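(* Let $\kappa>0$, $\gamma=1/2$, $s>5/2$, and $\alpha=1-\frac{5/2}{s}$. Assume that $\Theta_0\in H^s(\mathbb{T}^3)$ and $S\in L^2(0,\infty;H^{s-\gamma}(\mathbb{T}^3))$ have zero mean on $\mathbb{T}^3$. There exists a sufficiently small constant $\varepsilon>0$, depending on $\kappa$ (and not on $\Theta_0$, $S$), such that if $$\|\Theta_0\|_{L^2}^{\alpha}\|\Theta_0\|_{H^s}^{1-\alpha}+\|S\|_{L^\infty(0,\infty;H^{s-\gamma})}\le\varepsilon,$$ then the unique solution $\Theta\in L^\infty(0,T;H^s(\mathbb{T}^3))$ of the Cauchy problem $$\partial_t\Theta+U\cdot\nabla\Theta=S-\kappa(-\Delta)^{1/2}\Theta,\qquad \nabla\cdot U=0,\quad U=M[\Theta],\qquad \Theta(0,\cdot)=\Theta_0$$ is global in time (i.e. a unique solution exists on $(0,T)$ for every $T>0$).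
   Context: Setting (fractionally diffusive magneto-geostrophic equation). $\mathbb{T}^3=(\mathbb{R}/2\pi\mathbb{Z})^3$, and $\hat f(k)$, $k=(k_1,k_2,k_3)\in\mathbb{Z}^3$, denote Fourier coefficients. $\Omega,\beta,\eta,\kappa>0$ are fixed parameters. The velocity $U=M[\Theta]=(M_1\Theta,M_2\Theta,M_3\Theta)$ is given by Fourier multipliers: $\widehat{M_j\Theta}(k)=\hat M_j(k)\hat\Theta(k)$ where, for $k_3\neq0$, $$\hat M_1(k)=\frac{2\Omega k_2k_3|k|^2-(\beta^2/\eta)k_1k_2^2k_3}{4\Omega^2k_3^2|k|^2+(\beta^2/\eta)^2k_2^4},\quad \hat M_2(k)=\frac{-2\Omega k_1k_3|k|^2-(\beta^2/\eta)k_2^3k_3}{4\Omega^2k_3^2|k|^2+(\beta^2/\eta)^2k_2^4},\quad \hat M_3(k)=\frac{(\beta^2/\eta)k_2^2(k_1^2+k_2^2)}{4\Omega^2k_3^2|k|^2+(\beta^2/\eta)^2k_2^4},$$ and $\hat M_j(k)=0$ when $k_3=0$ (so $U$ has zero vertical mean). Then $\nabla\cdot U=0$ automatically. A solution on $(0,T)$ with initial data $\Theta_0$ is a function $\Theta\in L^\infty(0,T;H^s)\cap L^2(0,T;H^{s+\gamma})$ (here $\gamma=1/2$) such that for all smooth $\varphi$ on $\mathbb{T}^3$ and all $t\in(0,T)$, $$\int_{\mathbb{T}^3}(\Theta(t,\cdot)-\Theta_0)\varphi\,dx+\kappa\int_0^t\!\!\int_{\mathbb{T}^3}\Theta(-\Delta)^\gamma\varphi\,dx\,d\tau-\int_0^t\!\!\int_{\mathbb{T}^3}\Theta\,U\cdot\nabla\varphi\,dx\,d\tau=\int_0^t\!\!\int_{\mathbb{T}^3}S\varphi\,dx\,d\tau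 .$$ *)

theory Defs
  imports "HOL-Analysis.Analysis" "HOL-Probability.Essential_Supremum"
begin

text \<open>
  A real function on the torus (R/2piZ)^3 is a function on \<open>real^3\<close> that is \<open>2 * pi\<close>-periodic in
  every coordinate; integrals over the torus are integrals over one period cell.
\<close>

definition periodic :: "(real^3 \<Rightarrow> real) \<Rightarrow> bool" where
  "periodic f \<longleftrightarrow> (\<forall>x j. f (x + axis j (2 * pi)) = f x)"

definition torus :: "(real^3) measure" where
  "torus = lebesgue_on (cbox 0 (\<chi> j. 2 * pi))"

text \<open>Elements of L^2, and later of H^r, are functions and not classes modulo null sets.\<close>

definition L2_space :: "(real^3 \<Rightarrow> real) set" where
  "L2_space = {f. periodic f \<and> f \<in> borel_measurable torus \<and> integrable torus (\<lambda>x. (f x)\<^sup>2)}"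

definition L2_norm :: "(real^3 \<Rightarrow> real) \<Rightarrow> real" where
  "L2_norm f = sqrt (LINT x|torus. (f x)\<^sup>2)"

definition wavevec :: "int^3 \<Rightarrow> real^3" where
  "wavevec k = (\<chi> j. of_int (k $ j))"

definition fourier_coeff :: "(real^3 \<Rightarrow> real) \<Rightarrow> int^3 \<Rightarrow> complex" where
  "fourier_coeff f k =
     (LINT x|torus. complex_of_real (f x) * cis (- (wavevec k \<bullet> x))) / of_real ((2 * pi) ^ 3)"

text \<open>
  Inhomogeneous Sobolev spaces of order \<open>r \<ge> 0\<close>. The factor \<open>(2 * pi)^3\<close> makes the norm of order 0
  equal to the L^2 norm.
\<close>

definition Sobolev :: "real \<Rightarrow> (real^3 \<Rightarrow> real) set" where
  "Sobolev r = {f \<in> L2_space.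
     (\<lambda>k. (1 + (norm (wavevec k))\<^sup>2) powr r * (cmod (fourier_coeff f k))\<^sup>2) summable_on UNIV}"

definition Sobolev_norm :: "real \<Rightarrow> (real^3 \<Rightarrow> real) \<Rightarrow> real" where
  "Sobolev_norm r f = sqrt ((2 * pi) ^ 3 *
     (\<Sum>\<^sub>\<infinity>k. (1 + (norm (wavevec k))\<^sup>2) powr r * (cmod (fourier_coeff f k))\<^sup>2))"

definition zero_mean :: "(real^3 \<Rightarrow> real) \<Rightarrow> bool" where
  "zero_mean f \<longleftrightarrow> (LINT x|torus. f x) = 0"

text \<open>
  Bochner spaces of functions of time with values in H^r. \<open>Sobolev_norm\<close> is only meaningful on
  \<open>Sobolev\<close>; strong measurability contains the requirement that almost all values lie there.
\<close>

definition strongly_measurable :: "real \<Rightarrow> real set \<Rightarrow> (real \<Rightarrow> real^3 \<Rightarrow> real) \<Rightarrow> bool" where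
  "strongly_measurable r I f \<longleftrightarrow>
     (\<exists>F :: nat \<Rightarrow> real \<Rightarrow> real^3 \<Rightarrow> real.
        (\<forall>n. simple_function (lebesgue_on I) (F n) \<and> (\<forall>t\<in>I. F n t \<in> Sobolev r)) \<and>
        (AE t in lebesgue_on I. f t \<in> Sobolev r \<and>
           (\<lambda>n. Sobolev_norm r (\<lambda>x. F n t x - f t x)) \<longlonglongrightarrow> 0))"

definition Linf_norm :: "real \<Rightarrow> real set \<Rightarrow> (real \<Rightarrow> real^3 \<Rightarrow> real) \<Rightarrow> ereal" where
  "Linf_norm r I f = esssup (lebesgue_on I) (\<lambda>t. ereal (Sobolev_norm r (f t)))"

definition Linf_Sobolev :: "real \<Rightarrow> real set \<Rightarrow> (real \<Rightarrow> real^3 \<Rightarrow> real) set" where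
  "Linf_Sobolev r I = {f. strongly_measurable r I f \<and> Linf_norm r I f < \<infinity>}"

definition L2_Sobolev :: "real \<Rightarrow> real set \<Rightarrow> (real \<Rightarrow> real^3 \<Rightarrow> real) set" where
  "L2_Sobolev r I = {f. strongly_measurable r I f \<and>
     integrable (lebesgue_on I) (\<lambda>t. (Sobolev_norm r (f t))\<^sup>2)}"

definition grad :: "(real^3 \<Rightarrow> real) \<Rightarrow> real^3 \<Rightarrow> real^3" where
  "grad f x = (\<chi> j. frechet_derivative f (at x) (axis j 1))"

primrec C_diff :: "nat \<Rightarrow> (real^3 \<Rightarrow> real) \<Rightarrow> bool" where
  "C_diff 0 f \<longleftrightarrow> continuous_on UNIV f"
| "C_diff (Suc n) f \<longleftrightarrow> (\<forall>x. f differentiable (at x)) \<and> (\<forall>j. C_diff n (\<lambda>x. grad f x $ j))"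

definition test_functions :: "(real^3 \<Rightarrow> real) set" where
  "test_functions = {\<phi>. periodic \<phi> \<and> (\<forall>n. C_diff n \<phi>)}"

text \<open>
  The operator with Fourier symbol \<open>m\<close>. The result is determined up to a null set; it exists
  whenever \<open>m\<close> is even and \<open>m * fourier_coeff f\<close> is square summable. This covers the uses below:
  \<open>mg_symbol\<close> is even and grows at most linearly, and it is applied to functions in \<open>Sobolev s\<close> with
  \<open>s \<ge> 1\<close>, while the fractional Laplacian is applied to smooth functions.
\<close>

definition multiplier_op :: "(int^3 \<Rightarrow> real) \<Rightarrow> (real^3 \<Rightarrow> real) \<Rightarrow> real^3 \<Rightarrow> real" where
  "multiplier_op m f =
     (SOME g. g \<in> L2_space \<and> (\<forall>k. fourier_coeff g k = of_real (m k) * fourier_coeff f k))"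

text \<open>\<open>(- \<Delta>)^\<gamma>\<close>, for \<open>\<gamma> > 0\<close>\<close>

definition frac_laplacian :: "real \<Rightarrow> (real^3 \<Rightarrow> real) \<Rightarrow> real^3 \<Rightarrow> real" where
  "frac_laplacian \<gamma> = multiplier_op (\<lambda>k. norm (wavevec k) powr (2 * \<gamma>))"

definition mg_symbol :: "real \<Rightarrow> real \<Rightarrow> real \<Rightarrow> int^3 \<Rightarrow> real^3" where
  "mg_symbol \<Omega> \<beta> \<eta> k =
     (let k1 = wavevec k $ 1; k2 = wavevec k $ 2; k3 = wavevec k $ 3;
          K = (norm (wavevec k))\<^sup>2; b = \<beta>\<^sup>2 / \<eta>;
          D = 4 * \<Omega>\<^sup>2 * k3\<^sup>2 * K + b\<^sup>2 * k2 ^ 4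
      in if k3 = 0 then 0 else vector
           [(2 * \<Omega> * k2 * k3 * K - b * k1 * k2\<^sup>2 * k3) / D,
            (- 2 * \<Omega> * k1 * k3 * K - b * k2 ^ 3 * k3) / D,
            b * k2\<^sup>2 * (k1\<^sup>2 + k2\<^sup>2) / D])"

definition mg_velocity :: "real \<Rightarrow> real \<Rightarrow> real \<Rightarrow> (real^3 \<Rightarrow> real) \<Rightarrow> real^3 \<Rightarrow> real^3" where
  "mg_velocity \<Omega> \<beta> \<eta> f x = (\<chi> j. multiplier_op (\<lambda>k. mg_symbol \<Omega> \<beta> \<eta> k $ j) f x)"

definition div_free :: "(real^3 \<Rightarrow> real^3) \<Rightarrow> bool" where
  "div_free u \<longleftrightarrow> (\<forall>\<phi>\<in>test_functions. (LINT x|torus. u x \<bullet> grad \<phi> x) = 0)"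

text \<open>
  Weak solutions on \<open>(0,T)\<close>. The identity is imposed for every \<open>t\<close>, so \<open>\<Theta> t\<close> has to be a genuine
  element of L^2 for every \<open>t\<close> and not just for almost every one. The condition \<open>div_free\<close> is part
  of the Cauchy problem but holds automatically by the choice of the symbols.
\<close>

definition mg_solution ::
  "real \<Rightarrow> real \<Rightarrow> real \<Rightarrow> real \<Rightarrow> real \<Rightarrow> real \<Rightarrow> (real \<Rightarrow> real^3 \<Rightarrow> real) \<Rightarrow> (real^3 \<Rightarrow> real) \<Rightarrow> real \<Rightarrow>
   (real \<Rightarrow> real^3 \<Rightarrow> real) \<Rightarrow> bool" where
  "mg_solution \<Omega> \<beta> \<eta> \<kappa> \<gamma> s S \<Theta>\<^sub>0 T \<Theta> \<longleftrightarrow>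
     \<Theta> \<in> Linf_Sobolev s {0<..<T} \<and>
     \<Theta> \<in> L2_Sobolev (s + \<gamma>) {0<..<T} \<and>
     (\<forall>t\<in>{0<..<T}. \<Theta> t \<in> L2_space) \<and>
     (AE t in lebesgue_on {0<..<T}. div_free (mg_velocity \<Omega> \<beta> \<eta> (\<Theta> t))) \<and>
     (\<forall>\<phi>\<in>test_functions. \<forall>t\<in>{0<..<T}.
        (LINT x|torus. (\<Theta> t x - \<Theta>\<^sub>0 x) * \<phi> x)
        + \<kappa> * (LINT \<tau>|lebesgue_on {0<..<t}. LINT x|torus. \<Theta> \<tau> x * frac_laplacian \<gamma> \<phi> x)
        - (LINT \<tau>|lebesgue_on {0<..<t}. LINT x|torus.
             \<Theta> \<tau> x * (mg_velocity \<Omega> \<beta> \<eta> (\<Theta> \<tau>) x \<bullet> grad \<phi> x))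
        = (LINT \<tau>|lebesgue_on {0<..<t}. LINT x|torus. S \<tau> x * \<phi> x))"

end

theory Submission
  imports Defs
begin

text \<open>
  On the Fourier side the equation reads
  \<open>\<theta>\<^sub>k' + \<kappa> |k| \<theta>\<^sub>k = S\<^sub>k - B(\<theta>,\<theta>)\<^sub>k\<close>, where \<open>B\<close> is a convolution with the
  kernel \<open>k \<bullet> M(l)\<close>. Since \<open>l \<bullet> M(l) = 0\<close>, this kernel equals \<open>(k - l) \<bullet> M(l)\<close> and is bounded by
  \<open>C |l| |k - l|\<close>, so that \<open>B\<close> is bounded on the scaling-critical space with norm
  \<open>\<Sum>k. |k| |\<theta>\<^sub>k|\<close>. Integration against \<open>exp (- \<kappa> |k| t)\<close> gains exactly one derivative, and the Duhamel
  map is a contraction on a small ball in this norm, with the supremum over unit time windows taken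
  inside the sum; the decay by \<open>exp (- \<kappa>)\<close> from one window to the next makes the estimate global in
  time. The critical norm of \<open>\<Theta>\<^sub>0\<close> is controlled by interpolation between \<open>L\<^sup>2\<close> and \<open>H\<^sup>s\<close>. The weighted
  square sums belonging to \<open>H\<^sup>s\<close> and \<open>L\<^sup>2 H\<^sup>s\<^sup>+\<^sup>1\<^sup>/\<^sup>2\<close> stay bounded along the Picard iteration.

  Conversely, testing with trigonometric functions shows that the modes of every weak solution satisfy
  the Duhamel formula. The bound in \<open>H\<^sup>s\<close> makes their critical norm continuous in time, hence small on
  a short interval. There an \<open>L\<^sup>2\<close> estimate for the difference of two solutions gives uniqueness, and
  the smallness is passed on by continuation.
\<close>

section \<open>Characters and integration over the torus\<close>

text \<open>The symbol of \<open>M\<close> grows linearly, so the transport term loses two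
  derivatives in all, while the half Laplacian restores one. The cancellation in the kernel is
  therefore essential: it puts one lost derivative on each factor, and the critical weight
  \<open>|k|\<close> pays for exactly that, with nothing to spare. Taking the supremum in time for
  each mode separately reduces the smoothing estimate to the bound \<open>1 / (\<kappa> |k|)\<close>
  for one exponential integral. The threshold \<open>s > 5/2\<close> is the summability of
  \<open>|k|^(2 - 2 s)\<close> over the lattice, which embeds \<open>H^s\<close> into the critical
  space. A related sum with a cut at radius \<open>R\<close> is of order \<open>R^5\<close> and
  produces the exponent \<open>(5/2) / s\<close> of the smallness condition. The high norms enter
  linearly, with a small critical norm as coefficient, so their own size is irrelevant. The fixed
  point argument alone cannot give uniqueness: a competing solution is bounded in \<open>H^s\<close>
  but not known to lie in the small ball.\<close>

definition ek :: "int^3 \<Rightarrow> real^3 \<Rightarrow> complex" where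
  "ek k x = cis (wavevec k \<bullet> x)"

abbreviation per_vec :: "real^3" where "per_vec \<equiv> (\<chi> j. 2 * pi)"

lemma wavevec_nth [simp]: "wavevec k $ j = of_int (k $ j)"
  by (simp add: wavevec_def)

lemma wavevec_add: "wavevec (k + l) = wavevec k + wavevec l"
  and wavevec_diff: "wavevec (k - l) = wavevec k - wavevec l"
  and wavevec_minus: "wavevec (- k) = - wavevec k"
  and wavevec_0 [simp]: "wavevec 0 = 0"
  by (simp_all add: vec_eq_iff)

lemma norm_ek [simp]: "cmod (ek k x) = 1"
  by (simp add: ek_def)

lemma ek_add: "ek (k + l) x = ek k x * ek l x"
  and ek_minus: "ek (- k) x = cnj (ek k x)"
  and ek_0 [simp]: "ek 0 x = 1"
  by (simp_all add: ek_def wavevec_add wavevec_minus inner_add_left cis_mult cis_cnj)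

lemma ek_plus: "ek k (x + y) = ek k x * ek k y"
  by (simp add: ek_def inner_add_right cis_mult)

lemma ek_axis: "ek k (axis j h) = cis (of_int (k $ j) * h)"
  by (simp add: ek_def inner_axis)

lemma continuous_ek [continuous_intros]: "continuous_on A (ek k)"
  unfolding ek_def[abs_def] cis_conv_exp by (intro continuous_intros)

lemma ek_periodic: "ek k (x + axis j (2 * pi)) = ek k x"
proof -
  have "cis (of_int (k $ j) * (2 * pi)) = 1"
    by (metis cis_multiple_2pi Ints_of_int mult.commute)
  then show ?thesis by (simp add: ek_plus ek_axis)
qed

interpretation torus: finite_measure torus
proof
  have "emeasure torus (space torus) = emeasure lborel (cbox 0 per_vec)"
    by (simp add: torus_def emeasure_restrict_space)
  also have "\<dots> \<noteq> \<infinity>"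
    using emeasure_lborel_cbox_finite[of 0 per_vec] by (simp add: less_top)
  finally show "emeasure torus (space torus) \<noteq> \<infinity>" .
qed

lemma space_torus [simp]: "space torus = cbox 0 per_vec"
  by (simp add: torus_def)

lemma continuous_measurable_torus:
  fixes f :: "real^3 \<Rightarrow> 'b::euclidean_space"
  assumes "continuous_on UNIV f"
  shows "f \<in> borel_measurable torus"
proof -
  have "f \<in> borel_measurable borel" using assms by (rule borel_measurable_continuous_onI)
  then have "f \<in> borel_measurable lebesgue" by (simp add: measurable_completion)
  then show ?thesis unfolding torus_def by (rule measurable_restrict_space1)
qed

lemma ek_measurable [measurable]: "ek k \<in> borel_measurable torus"
  by (intro continuous_measurable_torus continuous_ek)

lemma integrable_torus_continuous:
  fixes f :: "real^3 \<Rightarrow> 'b::euclidean_space"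
  assumes "continuous_on UNIV f"
  shows "integrable torus f"
proof -
  have "compact (f ` cbox 0 per_vec)"
    by (intro compact_continuous_image continuous_on_subset[OF assms]) auto
  then obtain B where "\<forall>y\<in>f ` cbox 0 per_vec. norm y \<le> B"
    using compact_imp_bounded bounded_iff by blast
  then show ?thesis
    by (intro torus.integrable_const_bound[where B = B] AE_I2 continuous_measurable_torus[OF assms])
      auto
qed

lemma integral_torus_HK:
  fixes f :: "real^3 \<Rightarrow> 'b::euclidean_space"
  assumes "integrable torus f"
  shows "(LINT x|torus. f x) = integral (cbox 0 per_vec) f"
  using assms unfolding torus_def by (intro lebesgue_integral_eq_integral) auto

text \<open>Cutting the shifted cell at \<open>x_j = 2 * pi\<close> leaves one slab inside the
  original cell and one overhang, which periodicity moves back to the missing slab. The bounds on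
  \<open>h\<close> make a single cut enough.\<close>

lemma integral_torus_shift:
  fixes f :: "real^3 \<Rightarrow> 'b::euclidean_space"
  assumes c: "continuous_on UNIV f" and p: "\<And>x j. f (x + axis j (2 * pi)) = f x"
    and h: "0 \<le> h" "h \<le> 2 * pi"
  shows "(LINT x|torus. f (x + axis j h)) = (LINT x|torus. f x)"
proof -
  have int: "f integrable_on cbox a b" for a b
    by (intro integrable_continuous continuous_on_subset[OF c]) auto
  have c': "continuous_on UNIV (\<lambda>x. f (x + axis j h))"
    by (intro continuous_on_compose2[OF c] continuous_intros) auto
  let ?e = "axis j (1::real) :: real^3"
  have ax: "axis j r $ i = (if i = j then r else 0)" for r :: real and i by (simp add: axis_def)
  have eB: "?e \<in> Basis" by (simp add: axis_in_Basis_iff)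
  let ?S = "cbox 0 (\<chi> i. if i = j then h else 2 * pi) :: (real^3) set"
  let ?R = "cbox (\<chi> i. if i = j then h else 0) per_vec :: (real^3) set"
  let ?S' = "cbox (\<chi> i. if i = j then 2*pi else 0) (\<chi> i. if i = j then 2*pi + h else 2 * pi) :: (real^3) set"
  have "(LINT x|torus. f (x + axis j h)) = integral (cbox 0 per_vec) (\<lambda>x. f (x + axis j h))"
    by (intro integral_torus_HK integrable_torus_continuous c')
  also have "\<dots> = integral (cbox (0 + axis j h) (per_vec + axis j h)) f"
    using integral_shift_cbox_plus[of 0 per_vec f "axis j h"] by (simp add: o_def add.commute)
  also have "\<dots> = integral (cbox (0 + axis j h) (per_vec + axis j h) \<inter> {x. x \<bullet> ?e \<le> 2*pi}) f
                + integral (cbox (0 + axis j h) (per_vec + axis j h) \<inter> {x. x \<bullet> ?e \<ge> 2*pi}) f"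
    by (intro integral_split int eB)
  also have "cbox (0 + axis j h) (per_vec + axis j h) \<inter> {x. x \<bullet> ?e \<le> 2*pi} = ?R"
    using h by (simp add: set_eq_iff mem_box_cart inner_axis ax) (smt (verit))
  also have "cbox (0 + axis j h) (per_vec + axis j h) \<inter> {x. x \<bullet> ?e \<ge> 2*pi} = ?S'"
    using h by (simp add: set_eq_iff mem_box_cart inner_axis ax) (smt (verit))
  also have "integral ?S' f = integral ?S (\<lambda>x. f (x + axis j (2*pi)))"
  proof -
    have "?S' = cbox (0 + axis j (2*pi)) ((\<chi> i. if i = j then h else 2 * pi) + axis j (2*pi))"
      by (rule arg_cong2[where f = cbox]) (auto simp: vec_eq_iff axis_def)
    then show ?thesis
      using integral_shift_cbox_plus[of 0 "\<chi> i. if i = j then h else 2 * pi" f "axis j (2*pi)"]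
      by (simp add: o_def add.commute)
  qed
  also have "\<dots> = integral ?S f" by (simp add: p)
  also have "integral ?R f + integral ?S f
     = integral (cbox 0 per_vec \<inter> {x. x \<bullet> ?e \<le> h}) f + integral (cbox 0 per_vec \<inter> {x. x \<bullet> ?e \<ge> h}) f"
  proof -
    have "cbox 0 per_vec \<inter> {x. x \<bullet> ?e \<le> h} = ?S"
      using h by (simp add: set_eq_iff mem_box_cart inner_axis ax) (smt (verit))
    moreover have "cbox 0 per_vec \<inter> {x. x \<bullet> ?e \<ge> h} = ?R"
      using h by (simp add: set_eq_iff mem_box_cart inner_axis ax) (smt (verit))
    ultimately show ?thesis by (simp add: add.commute)
  qed
  also have "\<dots> = integral (cbox 0 per_vec) f"
    by (intro integral_split[symmetric] int eB)
  also have "\<dots> = (LINT x|torus. f x)"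
    by (intro integral_torus_HK[symmetric] integrable_torus_continuous c)
  finally show ?thesis .
qed

lemma measure_torus: "measure torus (space torus) = (2 * pi) ^ 3"
proof -
  have "measure torus (space torus) = measure lborel (cbox 0 per_vec)"
    by (simp add: torus_def measure_restrict_space measure_completion)
  also have "\<dots> = (\<Prod>i\<in>UNIV. per_vec $ i - 0 $ i)"
    by (subst content_cbox_cart) (auto simp: interval_eq_empty_cart not_less)
  finally show ?thesis by (simp add: prod_constant)
qed

text \<open>A shift by half a wavelength in a direction where \<open>k\<close> does not vanish turns
  \<open>ek k\<close> into its negative and keeps the integral, so the integral equals its own
  negative.\<close>

lemma integral_ek: "(LINT x|torus. ek k x) = (if k = 0 then of_real ((2 * pi) ^ 3) else 0)"
proof (cases "k = 0")
  case True
  then show ?thesis using measure_torus by (simp add: scaleR_conv_of_real)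
next
  case False
  then obtain j where j: "k $ j \<noteq> 0" by (auto simp: vec_eq_iff)
  let ?h = "pi / \<bar>of_int (k $ j)\<bar>"
  have ge1: "\<bar>real_of_int (k $ j)\<bar> \<ge> 1" using j by linarith
  have h: "0 \<le> ?h" "?h \<le> 2 * pi"
  proof -
    have "?h \<le> pi / 1" by (intro divide_left_mono) (use ge1 in auto)
    then show "?h \<le> 2 * pi" using pi_gt_zero by linarith
  qed auto
  have "real_of_int (k $ j) * ?h = pi \<or> real_of_int (k $ j) * ?h = - pi"
    using j by (cases "k $ j > 0") auto
  then have m1: "ek k (axis j ?h) = -1"
    by (auto simp: ek_axis simp flip: cis_cnj)
  have "(LINT x|torus. ek k x) = (LINT x|torus. ek k (x + axis j ?h))"
    by (intro integral_torus_shift[symmetric] continuous_ek ek_periodic h)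
  also have "\<dots> = - (LINT x|torus. ek k x)"
    by (simp add: ek_plus m1)
  finally show ?thesis using False by simp
qed

section \<open>Trigonometric polynomials\<close>

inductive trig_poly :: "(real^3 \<Rightarrow> complex) \<Rightarrow> bool" where
  tp_ek: "trig_poly (\<lambda>x. c * ek k x)"
| tp_add: "trig_poly f \<Longrightarrow> trig_poly g \<Longrightarrow> trig_poly (\<lambda>x. f x + g x)"

lemma trig_poly_const: "trig_poly (\<lambda>x. c)"
  using tp_ek[of c 0] by simp

lemma trig_poly_cmult: "trig_poly f \<Longrightarrow> trig_poly (\<lambda>x. c * f x)"
proof (induction rule: trig_poly.induct)
  case (tp_ek d k)
  then show ?case using trig_poly.tp_ek[of "c * d" k] by (simp add: mult.assoc)
qed (simp add: distrib_left trig_poly.tp_add)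

lemma trig_poly_mult_ek: "trig_poly f \<Longrightarrow> trig_poly (\<lambda>x. f x * (c * ek k x))"
proof (induction rule: trig_poly.induct)
  case (tp_ek d l)
  then show ?case using trig_poly.tp_ek[of "d * c" "l + k"] by (simp add: ek_add mult_ac)
qed (simp add: distrib_right trig_poly.tp_add)

lemma trig_poly_mult: "trig_poly g \<Longrightarrow> trig_poly f \<Longrightarrow> trig_poly (\<lambda>x. f x * g x)"
  by (induction rule: trig_poly.induct) (simp_all add: distrib_left trig_poly_mult_ek trig_poly.tp_add)

lemma trig_poly_sum: "finite A \<Longrightarrow> (\<And>a. a \<in> A \<Longrightarrow> trig_poly (f a)) \<Longrightarrow> trig_poly (\<lambda>x. \<Sum>a\<in>A. f a x)"
  by (induction A rule: finite_induct) (auto intro: trig_poly_const trig_poly.tp_add)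

lemma continuous_trig_poly: "trig_poly g \<Longrightarrow> continuous_on UNIV g"
  by (induction rule: trig_poly.induct) (auto intro!: continuous_intros)

text \<open>The torus embedded into \<open>complex^3\<close>, where the Stone--Weierstrass theorem applies.\<close>

definition circ :: "real^3 \<Rightarrow> complex^3" where
  "circ x = (\<chi> j. cis (x $ j))"

text \<open>The real coordinates of \<open>circ x\<close> are cosines and sines of the
  \<open>x_j\<close>, each a combination of two characters, and \<open>trig_poly\<close> is closed
  under sums and products. This links polynomial approximation to the characters.\<close>

lemma trig_poly_circ:
  assumes "real_polynomial_function p"
  shows "trig_poly (\<lambda>x. of_real (p (circ x)))"
  using assms
proof (induction p rule: real_polynomial_function.induct)
  case (linear l)
  have e: "cis (x $ j) = ek (axis j 1) x" for x :: "real^3" and j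
  proof -
    have "wavevec (axis j 1) = axis j 1" by (auto simp: vec_eq_iff axis_def)
    then show ?thesis by (simp add: ek_def inner_axis')
  qed
  have e': "cis (- (x $ j)) = ek (- axis j 1) x" for x :: "real^3" and j
    by (simp add: ek_minus e[symmetric] cis_cnj)
  have tp1: "trig_poly (\<lambda>x. of_real (cos (x $ j)))" for j
  proof -
    have "of_real (cos (x $ j)) = (1/2) * ek (axis j 1) x + (1/2) * ek (- axis j 1) x" for x
      by (simp add: e[symmetric] e'[symmetric] complex_eq_iff)
    then show ?thesis by (simp only:) (intro trig_poly.intros)
  qed
  have tp2: "trig_poly (\<lambda>x. of_real (sin (x $ j)))" for j
  proof -
    have "of_real (sin (x $ j)) = (-\<i>/2) * ek (axis j 1) x + (\<i>/2) * ek (- axis j 1) x" for x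
      by (simp add: e[symmetric] e'[symmetric] complex_eq_iff)
    then show ?thesis by (simp only:) (intro trig_poly.intros)
  qed
  have tpb: "trig_poly (\<lambda>x. of_real (circ x \<bullet> b))" if "b \<in> Basis" for b
  proof -
    from that obtain j u where b: "b = axis j u" "u \<in> Basis" by (auto simp: Basis_vec_def)
    then have "circ x \<bullet> b = cis (x $ j) \<bullet> u" for x by (simp add: inner_axis circ_def)
    then show ?thesis using b(2) tp1[of j] tp2[of j] by (auto simp: Basis_complex_def)
  qed
  interpret bounded_linear l by fact
  have "of_real (l (circ x)) = (\<Sum>b\<in>Basis. complex_of_real (l b) * of_real (circ x \<bullet> b))" for x
  proof -
    have "l (circ x) = l (\<Sum>b\<in>Basis. (circ x \<bullet> b) *\<^sub>R b)" by (simp add: euclidean_representation)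
    also have "\<dots> = (\<Sum>b\<in>Basis. l b * (circ x \<bullet> b))" by (simp add: sum scaleR mult.commute)
    finally show ?thesis by simp
  qed
  then show ?case by (simp only:) (intro trig_poly_sum trig_poly_cmult tpb finite_Basis)
next
  case (const c)
  then show ?case by (rule trig_poly_const)
qed (auto intro: trig_poly.intros trig_poly_mult)

section \<open>Sums over the lattice of wave vectors\<close>

abbreviation ecmod :: "complex \<Rightarrow> ennreal" where "ecmod z \<equiv> ennreal (cmod z)"

text \<open>Sums over modes are integrals against the counting measure, so that Tonelli, Fubini,
  Fatou and dominated convergence treat modes and time alike, and estimates in
  \<open>ennreal\<close> can precede any proof of summability.\<close>

abbreviation K :: "(int^3) measure" where "K \<equiv> count_space UNIV"

lemma countable_int3: "countable (UNIV :: (int^3) set)"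
proof -
  have "inj (\<lambda>k :: int^3. (k $ 1, k $ 2, k $ 3))"
    by (rule injI) (simp add: vec_eq_iff forall_3)
  then show ?thesis by (rule countableI'[OF inj_compose[OF inj_to_nat, unfolded o_def]])
qed

interpretation K: sigma_finite_measure K
  by (rule sigma_finite_measure_count_space_countable) (rule countable_int3)

lemma measurable_K_pair:
  assumes "\<And>k. f k \<in> measurable M N"
  shows "(\<lambda>(k, x). f k x) \<in> measurable (K \<Otimes>\<^sub>M M) N"
  by (rule measurable_pair_measure_countable1[OF countable_int3]) (simp add: assms)

lemma measurable_pair_K:
  assumes "\<And>k. f k \<in> measurable M N"
  shows "(\<lambda>(x, k). f k x) \<in> measurable (M \<Otimes>\<^sub>M K) N"
  using measurable_compose[OF measurable_pair_swap' measurable_K_pair[OF assms]]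
  by (simp add: split_beta')

lemma nn_integral_K_swap:
  assumes "sigma_finite_measure M" "\<And>k. f k \<in> borel_measurable M"
  shows "(\<integral>\<^sup>+x. \<integral>\<^sup>+k. f k x \<partial>K \<partial>M) = (\<integral>\<^sup>+k. \<integral>\<^sup>+x. f k x \<partial>M \<partial>K)"
proof -
  interpret pair_sigma_finite K M using assms(1) K.sigma_finite_measure_axioms by (simp add: pair_sigma_finite_def)
  show ?thesis by (rule Fubini') (rule measurable_K_pair[OF assms(2)])
qed

lemma
  fixes f :: "int^3 \<Rightarrow> 'a \<Rightarrow> 'b::{banach, second_countable_topology}"
  assumes M: "sigma_finite_measure M" and f: "\<And>k. f k \<in> borel_measurable M"
    and fin: "(\<integral>\<^sup>+k. \<integral>\<^sup>+x. ennreal (norm (f k x)) \<partial>M \<partial>K) < \<infinity>"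
  shows integrable_integral_K: "integrable M (\<lambda>x. LINT k|K. f k x)"
    and integral_K_swap: "(LINT x|M. LINT k|K. f k x) = (LINT k|K. LINT x|M. f k x)"
proof -
  interpret pair_sigma_finite K M using M K.sigma_finite_measure_axioms by (simp add: pair_sigma_finite_def)
  interpret M: sigma_finite_measure M by fact
  have m: "(\<lambda>(k, x). f k x) \<in> borel_measurable (K \<Otimes>\<^sub>M M)" by (rule measurable_K_pair[OF f])
  have int: "integrable (K \<Otimes>\<^sub>M M) (\<lambda>(k, x). f k x)"
  proof (rule integrableI_bounded[OF m])
    have "(\<integral>\<^sup>+z. ennreal (norm (case z of (k, x) \<Rightarrow> f k x)) \<partial>(K \<Otimes>\<^sub>M M))
        = (\<integral>\<^sup>+k. \<integral>\<^sup>+x. ennreal (norm (f k x)) \<partial>M \<partial>K)"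
      using m by (subst sigma_finite_measure.nn_integral_fst[OF M, symmetric]) auto
    then show "(\<integral>\<^sup>+z. ennreal (norm (case z of (k, x) \<Rightarrow> f k x)) \<partial>(K \<Otimes>\<^sub>M M)) < \<infinity>"
      using fin by simp
  qed
  show "(LINT x|M. LINT k|K. f k x) = (LINT k|K. LINT x|M. f k x)"
    by (rule Fubini_integral[OF int])
  show "integrable M (\<lambda>x. LINT k|K. f k x)"
    by (rule integrable_snd[OF int])
qed

lemma nn_integral_K_minus: "(\<integral>\<^sup>+k. f (- k) \<partial>K) = (\<integral>\<^sup>+k. f k \<partial>K)"
  by (rule nn_integral_bij_count_space) (auto intro!: bij_uminus)

lemma nn_integral_K_diff: "(\<integral>\<^sup>+k. f (k - l) \<partial>K) = (\<integral>\<^sup>+k. f k \<partial>K)"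
  by (rule nn_integral_bij_count_space) (auto intro!: bij_betw_byWitness[where f' = "\<lambda>k. k + l"])

lemma nn_integral_K_diff': "(\<integral>\<^sup>+l. f (k - l) \<partial>K) = (\<integral>\<^sup>+l. f l \<partial>K)"
  by (rule nn_integral_bij_count_space) (auto intro!: bij_betw_byWitness[where f' = "\<lambda>l. k - l"])

lemma integral_K_bij:
  fixes f :: "int^3 \<Rightarrow> 'b::{banach, second_countable_topology}"
  assumes "bij g" shows "(LINT k|K. f (g k)) = (LINT k|K. f k)"
proof -
  have "distr K K g = K" using assms by (rule distr_bij_count_space)
  then have "(LINT k|K. f k) = (LINT k|distr K K g. f k)" by simp
  also have "\<dots> = (LINT k|K. f (g k))" by (rule integral_distr) auto
  finally show ?thesis ..
qed

lemma integral_K_minus: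
  fixes f :: "int^3 \<Rightarrow> 'b::{banach, second_countable_topology}"
  shows "(LINT k|K. f (- k)) = (LINT k|K. f k)"
  by (rule integral_K_bij) (rule bij_uminus)

lemma integrable_K_iff:
  fixes f :: "int^3 \<Rightarrow> 'b::{banach, second_countable_topology}"
  shows "integrable K f \<longleftrightarrow> (\<integral>\<^sup>+k. ennreal (norm (f k)) \<partial>K) < \<infinity>"
  by (simp add: integrable_iff_bounded)

lemma norm_integral_le_nn:
  fixes f :: "'a \<Rightarrow> 'b::{banach, second_countable_topology}"
  shows "ennreal (norm (integral\<^sup>L M f)) \<le> (\<integral>\<^sup>+x. ennreal (norm (f x)) \<partial>M)"
proof (cases "integrable M f")
  case True
  then show ?thesis by (rule integral_norm_bound_ennreal)
qed (simp add: not_integrable_integral_eq)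

lemma nn_integral_K_member: "f k \<le> (\<integral>\<^sup>+k. f k \<partial>K)"
proof -
  have "f k = (\<integral>\<^sup>+l. f l * indicator {k} l \<partial>K)"
    by (subst nn_integral_count_space'[where A = "{k}"]) auto
  also have "\<dots> \<le> (\<integral>\<^sup>+k. f k \<partial>K)"
    by (intro nn_integral_mono) (auto simp: indicator_def)
  finally show ?thesis .
qed

lemma nn_integral_K_point:
  "(\<And>l. l \<noteq> k \<Longrightarrow> f l = 0) \<Longrightarrow> (\<integral>\<^sup>+l. f l \<partial>K) = f k"
  by (subst nn_integral_count_space'[where A = "{k}"]) auto

lemma integral_K_point:
  fixes f :: "int^3 \<Rightarrow> 'b::{banach, second_countable_topology}"
  assumes "\<And>l. l \<noteq> k \<Longrightarrow> f l = 0"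
  shows "(LINT l|K. f l) = f k"
proof -
  have "(LINT l|K. f l) = (\<Sum>l\<in>{k}. f l)"
  proof (subst lebesgue_integral_count_space_finite_support)
    have "{l. f l \<noteq> 0} \<subseteq> {k}" using assms by auto
    then show "finite {a \<in> UNIV. f a \<noteq> 0}" by (simp add: finite_subset)
    show "(\<Sum>a | a \<in> UNIV \<and> f a \<noteq> 0. f a) = sum f {k}"
      using \<open>{l. f l \<noteq> 0} \<subseteq> {k}\<close> by (intro sum.mono_neutral_left) auto
  qed
  then show ?thesis by simp
qed

text \<open>The bridge from the unordered sums in the definition of the Sobolev spaces to integrals
  over \<open>K\<close>.\<close>

lemma summable_on_iff_nn_integral_K:
  fixes f :: "int^3 \<Rightarrow> real"
  assumes "\<And>k. f k \<ge> 0"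
  shows "f summable_on UNIV \<longleftrightarrow> (\<integral>\<^sup>+k. ennreal (f k) \<partial>K) < \<infinity>"
    and "f summable_on UNIV \<Longrightarrow> (\<integral>\<^sup>+k. ennreal (f k) \<partial>K) = ennreal (\<Sum>\<^sub>\<infinity>k. f k)"
proof -
  have nf: "(\<lambda>k. norm (f k)) = f" using assms by auto
  have 1: "f summable_on UNIV \<longleftrightarrow> Infinite_Set_Sum.abs_summable_on f UNIV"
    using abs_summable_equivalent[of f UNIV] by (simp only: nf)
  then show "f summable_on UNIV \<longleftrightarrow> (\<integral>\<^sup>+k. ennreal (f k) \<partial>K) < \<infinity>"
    using assms by (simp add: Infinite_Set_Sum.abs_summable_on_def integrable_iff_bounded)
  assume "f summable_on UNIV"
  then show "(\<integral>\<^sup>+k. ennreal (f k) \<partial>K) = ennreal (\<Sum>\<^sub>\<infinity>k. f k)"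
    using nn_integral_conv_infsetsum[of f UNIV] 1 infsetsum_infsum[of f UNIV] assms by simp
qed

section \<open>Completeness of the characters\<close>

text \<open>\<open>circ\<close> identifies opposite faces of the closed cell. Off this null set it
  is injective, which is required for recovering sets in the cell from functions of
  \<open>circ x\<close>.\<close>

lemma AE_torus_interior: "AE x in torus. x \<in> box 0 per_vec"
proof -
  have "negligible (cbox 0 per_vec - box 0 per_vec)" by (rule negligible_frontier_interval)
  then have "cbox 0 per_vec - box 0 per_vec \<in> null_sets lebesgue" by (simp add: negligible_iff_null_sets)
  then have "AE x in lebesgue. x \<notin> cbox 0 per_vec - box 0 per_vec" by (rule AE_not_in)
  then show ?thesis unfolding torus_def by (subst AE_restrict_space_iff) auto
qed

lemma inj_circ: "inj_on circ (box 0 per_vec)"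
proof (rule inj_onI)
  fix x y :: "real^3" assume x: "x \<in> box 0 per_vec" and y: "y \<in> box 0 per_vec" and eq: "circ x = circ y"
  show "x = y" unfolding vec_eq_iff
  proof
    fix j
    have "cis (x $ j) = cis (y $ j)" using eq by (simp add: circ_def vec_eq_iff)
    then have "cis (x $ j - y $ j) = 1" by (simp add: cis_divide[symmetric])
    then have "cos (x $ j - y $ j) = 1" by (simp add: complex_eq_iff)
    then obtain n :: int where n: "x $ j - y $ j = of_int n * 2 * pi"
      unfolding cos_one_2pi_int by blast
    have "0 < x $ j" "x $ j < 2 * pi" "0 < y $ j" "y $ j < 2 * pi"
      using x y by (simp_all add: mem_box_cart)
    then have "\<bar>x $ j - y $ j\<bar> < 2 * pi" by linarith
    then have "\<bar>real_of_int n\<bar> < 1" by (simp add: n abs_mult)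
    then have "n = 0" by linarith
    then show "x $ j = y $ j" using n by simp
  qed
qed

lemma continuous_circ: "continuous_on A circ"
  unfolding circ_def[abs_def] cis_conv_exp by (intro continuous_intros)

lemma norm_circ_le: "norm (circ x) \<le> 3"
proof -
  have "norm (circ x) \<le> (\<Sum>i\<in>UNIV. norm (circ x $ i))" unfolding norm_vec_def by (rule L2_set_le_sum) simp
  then show ?thesis by (simp add: circ_def)
qed

text \<open>Orthogonality to the characters passes to trigonometric polynomials, by uniform
  approximation to continuous functions of \<open>circ x\<close>, by pointwise limits to indicators
  of compact sets in the open cell, and by inner regularity to the sets where \<open>f\<close> is
  positive or negative.\<close>

lemma fourier_complete:
  fixes f :: "real^3 \<Rightarrow> real"
  assumes f: "integrable torus f" and z: "\<And>k. (LINT x|torus. of_real (f x) * ek k x) = 0"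
  shows "AE x in torus. f x = 0"
proof -
  have f': "integrable torus (\<lambda>x. complex_of_real (f x))" using f by simp
  have fm [measurable]: "f \<in> borel_measurable torus" using f by simp
  have int: "integrable torus (\<lambda>x. of_real (f x) * g x)" if "continuous_on UNIV g" for g :: "real^3 \<Rightarrow> complex"
  proof -
    have "compact (g ` cbox 0 per_vec)"
      by (intro compact_continuous_image continuous_on_subset[OF that]) auto
    then obtain B where B: "\<forall>y\<in>g ` cbox 0 per_vec. norm y \<le> B"
      using compact_imp_bounded bounded_iff by blast
    have gm [measurable]: "g \<in> borel_measurable torus" by (rule continuous_measurable_torus[OF that])
    have "integrable torus (\<lambda>x. B * norm (f x))" using f by auto
    then show ?thesis
    proof (rule Bochner_Integration.integrable_bound)
      show "AE x in torus. norm (complex_of_real (f x) * g x) \<le> norm (B * norm (f x))"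
        using B by (intro AE_I2) (auto simp: norm_mult abs_mult mult.commute[of B] intro!: mult_left_mono
           intro: order_trans[OF _ abs_ge_self])
    qed measurable
  qed
  have tp: "(LINT x|torus. of_real (f x) * g x) = 0" if "trig_poly g" for g
    using that
  proof (induction rule: trig_poly.induct)
    case (tp_ek c k)
    have "(LINT x|torus. of_real (f x) * (c * ek k x)) = c * (LINT x|torus. of_real (f x) * ek k x)"
      by (subst integral_mult_right_zero[symmetric]) (simp add: mult_ac)
    then show ?case by (simp add: z)
  next
    case (tp_add g h)
    then show ?case
      by (simp add: distrib_left Bochner_Integration.integral_add int continuous_trig_poly)
  qed
  have cont: "(LINT x|torus. f x * G (circ x)) = 0" if G: "continuous_on UNIV G" for G :: "complex^3 \<Rightarrow> real"
  proof -
    have cG: "continuous_on UNIV (\<lambda>x. of_real (G (circ x)) :: complex)"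
      by (intro continuous_intros continuous_on_compose2[OF G] continuous_circ) auto
    have iG: "integrable torus (\<lambda>x. f x * G (circ x))"
      using integrable_Re[OF int[OF cG]] by simp
    have "\<bar>LINT x|torus. f x * G (circ x)\<bar> \<le> e * (LINT x|torus. \<bar>f x\<bar>)" if e: "e > 0" for e
    proof -
      \<comment> \<open>\<open>circ\<close> takes its values in the ball of radius 3, so
        approximation on this ball is uniform along it.\<close>
      obtain p where p: "real_polynomial_function p" "\<And>w. w \<in> cball 0 3 \<Longrightarrow> \<bar>G w - p w\<bar> < e"
        using Stone_Weierstrass_real_polynomial_function[OF compact_cball continuous_on_subset[OF G subset_UNIV] e]
        by blast
      have tpp: "trig_poly (\<lambda>x. of_real (p (circ x)))" by (rule trig_poly_circ[OF p(1)])
      have ip: "integrable torus (\<lambda>x. f x * p (circ x))"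
        using integrable_Re[OF int[OF continuous_trig_poly[OF tpp]]] by simp
      have "complex_of_real (LINT x|torus. f x * p (circ x)) = 0"
        using tp[OF tpp] by (simp flip: of_real_mult)
      then have "(LINT x|torus. f x * G (circ x)) = (LINT x|torus. f x * G (circ x) - f x * p (circ x))"
        using iG ip by simp
      also have "\<bar>\<dots>\<bar> \<le> (LINT x|torus. \<bar>f x * G (circ x) - f x * p (circ x)\<bar>)"
        by (rule integral_abs_bound)
      also have "\<dots> \<le> (LINT x|torus. e * \<bar>f x\<bar>)"
      proof (rule integral_mono)
        fix x
        have "\<bar>G (circ x) - p (circ x)\<bar> \<le> e" using p(2)[of "circ x"] norm_circ_le[of x] by auto
        then have "\<bar>f x\<bar> * \<bar>G (circ x) - p (circ x)\<bar> \<le> \<bar>f x\<bar> * e" by (rule mult_left_mono) auto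
        then show "\<bar>f x * G (circ x) - f x * p (circ x)\<bar> \<le> e * \<bar>f x\<bar>"
          by (simp only: right_diff_distrib[symmetric] abs_mult mult.commute)
      qed (use f iG ip in auto)
      finally show ?thesis by simp
    qed
    note small = this
    show ?thesis
    proof (rule ccontr)
      assume ne: "(LINT x|torus. f x * G (circ x)) \<noteq> 0"
      define I where "I = (LINT x|torus. \<bar>f x\<bar>)"
      have "I \<ge> 0" unfolding I_def by simp
      let ?J = "\<bar>LINT x|torus. f x * G (circ x)\<bar>"
      \<comment> \<open>The accuracy is \<open>?J / (2 * (I + 1))\<close>: the \<open>+ 1\<close>
        excludes a division by zero, and the resulting bound is strictly below
        \<open>?J\<close>.\<close>
      have "?J \<le> (?J / (2 * (I + 1))) * I"
        unfolding I_def by (rule small) (use ne \<open>I \<ge> 0\<close> in \<open>auto simp: I_def[symmetric]\<close>)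
      also have "\<dots> < ?J"
      proof -
        have "I / (2 * (I + 1)) < 1" using \<open>I \<ge> 0\<close> by (simp add: field_simps)
        then have "?J * (I / (2 * (I + 1))) < ?J * 1" using ne by (intro mult_strict_left_mono) auto
        then show ?thesis by simp
      qed
      finally show False by simp
    qed
  qed
  have cpt: "(LINT x|torus. indicator C x * f x) = 0" if C: "compact C" "C \<subseteq> box 0 per_vec" for C
  proof (cases "C = {}")
    case False
    let ?E = "circ ` C"
    have E: "closed ?E" "?E \<noteq> {}"
      using C False compact_continuous_image[OF continuous_circ] by (auto intro: compact_imp_closed)
    \<comment> \<open>Continuous tents over the compact image of \<open>C\<close> that shrink to its
      indicator; injectivity of \<open>circ\<close> keeps interior points outside \<open>C\<close>
      off that image.\<close>
    define G where "G n w = max 0 (1 - real n * infdist w ?E)" for n w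
    have cG: "continuous_on UNIV (G n)" for n
      unfolding G_def by (intro continuous_intros)
    have cGc: "continuous_on UNIV (\<lambda>x. G n (circ x))" for n
      by (intro continuous_on_compose2[OF cG] continuous_circ) auto
    have [measurable]: "(\<lambda>x. G n (circ x)) \<in> borel_measurable torus" for n
      by (rule continuous_measurable_torus[OF cGc])
    have Cm [measurable]: "C \<in> sets torus"
      unfolding torus_def using C box_subset_cbox[of 0 per_vec]
      by (subst sets_restrict_space_iff) (auto intro: lmeasurable_compact fmeasurableD)
    have "(\<lambda>n. LINT x|torus. f x * G n (circ x)) \<longlonglongrightarrow> (LINT x|torus. f x * indicator C x)"
    proof (rule integral_dominated_convergence[where w = "\<lambda>x. \<bar>f x\<bar>"])
      show "AE x in torus. (\<lambda>n. f x * G n (circ x)) \<longlonglongrightarrow> f x * indicator C x"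
        using AE_torus_interior
      proof eventually_elim
        case (elim x)
        have lim: "(\<lambda>n. G n (circ x)) \<longlonglongrightarrow> indicator C x"
        proof (cases "x \<in> C")
          case True
          then show ?thesis by (simp add: G_def)
        next
          case False
          have "circ x \<notin> ?E" using False C elim inj_circ by (auto simp: inj_on_def)
          then have d: "infdist (circ x) ?E > 0"
            using E by (metis in_closed_iff_infdist_zero infdist_nonneg less_eq_real_def)
          obtain N where N: "1 / infdist (circ x) ?E < real N" using reals_Archimedean2 by blast
          have "G n (circ x) = 0" if "n \<ge> N" for n
          proof -
            have "1 / infdist (circ x) ?E < real n" using N that by (meson of_nat_le_iff order_less_le_trans)
            then have "1 < real n * infdist (circ x) ?E" using d by (simp add: field_simps)
            then show ?thesis by (simp add: G_def)
          qed
          then have "eventually (\<lambda>n. G n (circ x) = indicator C x) sequentially"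
            using False by (auto simp: eventually_sequentially)
          then show ?thesis by (rule tendsto_eventually)
        qed
        then show ?case by (intro tendsto_mult_left)
      qed
      show "AE x in torus. norm (f x * G n (circ x)) \<le> \<bar>f x\<bar>" for n
        by (intro AE_I2) (auto simp: G_def abs_mult infdist_nonneg intro!: mult_left_le)
    qed (use f in auto)
    then have "(LINT x|torus. f x * indicator C x) = 0"
      by (simp add: cont[OF cG] LIMSEQ_const_iff)
    then show ?thesis by (simp add: mult.commute)
  qed simp
  \<comment> \<open>\<open>sg\<close> is 1 or -1, so one argument covers both signs. On a compact
    subset of the sign set a positive function has integral zero, hence the subset is null;
    approximation from inside makes the whole sign set null.\<close>
  have nullP: "AE x in torus. \<not> (x \<in> box 0 per_vec \<and> sg * f x > 0)" if sg: "\<bar>sg\<bar> = 1" for sg :: real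
  proof -
    let ?P = "{x \<in> box 0 per_vec. sg * f x > 0}"
    have "{x \<in> space torus. sg * f x > 0} \<in> sets torus" by measurable
    then have "{x \<in> space torus. sg * f x > 0} \<in> sets lebesgue"
      unfolding torus_def by (subst (asm) sets_restrict_space_iff) auto
    then have "{x \<in> space torus. sg * f x > 0} \<inter> box 0 per_vec \<in> sets lebesgue" by auto
    also have "{x \<in> space torus. sg * f x > 0} \<inter> box 0 per_vec = ?P"
      using box_subset_cbox[of 0 per_vec] by auto
    finally have P: "?P \<in> sets lebesgue" .
    have small: "emeasure lebesgue ?P \<le> ennreal e" if e: "e > 0" for e
    proof -
      obtain T where T: "closed T" "T \<subseteq> ?P" "emeasure lebesgue (?P - T) < ennreal e"
        by (rule sets_lebesgue_inner_closed[OF P e])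
      have Tb: "T \<subseteq> box 0 per_vec" using T by auto
      have Tc: "compact T" using T Tb bounded_subset[OF bounded_box] by (auto simp: compact_eq_bounded_closed)
      have Tm: "T \<in> sets torus"
        unfolding torus_def using Tc Tb box_subset_cbox[of 0 per_vec]
        by (subst sets_restrict_space_iff) (auto intro: lmeasurable_compact fmeasurableD)
      have "(LINT x|torus. indicator T x * (sg * f x)) = sg * (LINT x|torus. indicator T x * f x)"
        by (subst integral_mult_right_zero[symmetric]) (simp add: mult_ac)
      also have "\<dots> = 0" using cpt[OF Tc Tb] by simp
      finally have "(LINT x|torus. indicator T x * (sg * f x)) = 0" .
      moreover have "integrable torus (\<lambda>x. indicator T x * (sg * f x))"
        using integrable_mult_indicator[OF Tm integrable_mult_right[OF f, of sg]] by simp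
      ultimately have "AE x in torus. indicator T x * (sg * f x) = 0"
        using T(2) by (subst (asm) integral_nonneg_eq_0_iff_AE)
          (auto simp: indicator_def subset_iff intro!: AE_I2)
      then have "AE x in torus. x \<notin> T"
        by eventually_elim (use T(2) in \<open>auto simp: indicator_def split: if_splits\<close>)
      then have "AE x in lebesgue. x \<in> cbox 0 per_vec \<longrightarrow> x \<notin> T"
        unfolding torus_def by (subst (asm) AE_restrict_space_iff) auto
      then have "AE x in lebesgue. x \<notin> T"
        by eventually_elim (use Tb box_subset_cbox[of 0 per_vec] in auto)
      then have "T \<in> null_sets lebesgue" using Tc by (subst AE_iff_null_sets) (auto intro: lmeasurable_compact fmeasurableD)
      then have "emeasure lebesgue ?P = emeasure lebesgue (?P - T)"
        using P by (simp add: emeasure_Diff_null_set)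
      then show ?thesis using T(3) by simp
    qed
    have "emeasure lebesgue ?P \<le> 0"
      by (rule ennreal_le_epsilon) (use small in auto)
    then have "?P \<in> null_sets lebesgue" using P by auto
    then have "AE x in lebesgue. x \<notin> ?P" by (rule AE_not_in)
    then show ?thesis
      unfolding torus_def by (subst AE_restrict_space_iff) auto
  qed
  show ?thesis
    using AE_torus_interior nullP[of 1, simplified] nullP[of "-1", simplified]
    by eventually_elim (auto simp: not_less)
qed

section \<open>Absolutely convergent Fourier series\<close>

definition absum :: "(int^3 \<Rightarrow> complex) \<Rightarrow> bool" where
  "absum c \<longleftrightarrow> (\<integral>\<^sup>+k. ecmod (c k) \<partial>K) < \<infinity>"

definition herm :: "(int^3 \<Rightarrow> complex) \<Rightarrow> bool" where
  "herm c \<longleftrightarrow> (\<forall>k. c (- k) = cnj (c k))"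

text \<open>The real part gives a real function for arbitrary coefficients; for \<open>herm\<close>
  coefficients the sum is already real, see \<open>fser_complex\<close>.\<close>

definition fser :: "(int^3 \<Rightarrow> complex) \<Rightarrow> real^3 \<Rightarrow> real" where
  "fser c x = Re (LINT k|K. c k * ek k x)"

definition vol :: real where "vol = (2 * pi) ^ 3"

lemma vol_pos [simp]: "vol > 0" "vol \<noteq> 0"
  by (simp_all add: vol_def)

lemma fourier_coeff_ek:
  "fourier_coeff f k = (LINT x|torus. of_real (f x) * ek (- k) x) / of_real vol"
  by (simp add: fourier_coeff_def ek_def wavevec_minus vol_def)

lemma integral_f_ek: "(LINT x|torus. of_real (f x) * ek k x) = of_real vol * fourier_coeff f (- k)"
  by (simp add: fourier_coeff_ek)

lemma integrable_torus_mult_ek: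
  assumes "integrable torus f"
  shows "integrable torus (\<lambda>x. f x * ek k x)"
  by (rule Bochner_Integration.integrable_bound[OF assms])
    (use assms in \<open>auto simp: norm_mult\<close>)

lemma herm_fourier_coeff: "herm (fourier_coeff f)"
proof -
  have "cnj (LINT x|torus. of_real (f x) * ek (- k) x) = (LINT x|torus. of_real (f x) * ek k x)" for k
    by (subst Bochner_Integration.integral_cnj[symmetric]) (simp add: ek_minus)
  then have "fourier_coeff f (- k) = cnj (fourier_coeff f k)" for k
    by (simp add: fourier_coeff_ek)
  then show ?thesis by (simp add: herm_def)
qed

lemma fourier_coeff_diff:
  assumes "integrable torus f" "integrable torus g"
  shows "fourier_coeff (\<lambda>x. f x - g x) k = fourier_coeff f k - fourier_coeff g k"
proof -
  have "integrable torus (\<lambda>x. complex_of_real (f x))" "integrable torus (\<lambda>x. complex_of_real (g x))"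
    using assms by auto
  then show ?thesis
    by (simp add: fourier_coeff_ek left_diff_distrib diff_divide_distrib integrable_torus_mult_ek)
qed

lemma fourier_unique:
  assumes "integrable torus f" "integrable torus g" "\<And>k. fourier_coeff f k = fourier_coeff g k"
  shows "AE x in torus. f x = g x"
proof -
  have "AE x in torus. f x - g x = 0"
  proof (rule fourier_complete)
    show "(LINT x|torus. of_real (f x - g x) * ek k x) = 0" for k
      using assms by (subst integral_f_ek) (simp add: fourier_coeff_diff)
  qed (use assms in auto)
  then show ?thesis by simp
qed

lemma absum_integrable:
  "absum c \<Longrightarrow> integrable K c"
  "absum c \<Longrightarrow> integrable K (\<lambda>k. c k * ek k x)"
  by (simp_all add: absum_def integrable_K_iff norm_mult)

lemma fser_measurable [measurable]: "fser c \<in> borel_measurable torus"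
  unfolding fser_def[abs_def] by measurable

lemma fser_periodic: "periodic (fser c)"
  by (simp add: periodic_def fser_def ek_periodic)

lemma fser_bound: "\<bar>fser c x\<bar> \<le> enn2real (\<integral>\<^sup>+k. ecmod (c k) \<partial>K)" if "absum c"
proof -
  have "ennreal \<bar>fser c x\<bar> \<le> ecmod (LINT k|K. c k * ek k x)"
    unfolding fser_def by (intro ennreal_leI abs_Re_le_cmod)
  also have "\<dots> \<le> (\<integral>\<^sup>+k. ecmod (c k * ek k x) \<partial>K)" by (rule norm_integral_le_nn)
  also have "\<dots> = (\<integral>\<^sup>+k. ecmod (c k) \<partial>K)" by (simp add: norm_mult)
  also have "\<dots> = ennreal (enn2real (\<integral>\<^sup>+k. ecmod (c k) \<partial>K))"
    using that by (simp add: absum_def)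
  finally show ?thesis by (simp add: ennreal_le_iff)
qed

lemma fser_L2: "fser c \<in> L2_space" if "absum c"
proof -
  let ?B = "enn2real (\<integral>\<^sup>+k. ecmod (c k) \<partial>K)"
  have "integrable torus (\<lambda>x. (fser c x)\<^sup>2)"
    by (rule torus.integrable_const_bound[where B = "?B\<^sup>2"])
      (use fser_bound[OF that] in \<open>auto simp: power2_le_iff_abs_le intro!: AE_I2\<close>)
  then show ?thesis by (simp add: L2_space_def fser_periodic)
qed

lemma fser_complex:
  assumes "herm c"
  shows "of_real (fser c x) = (LINT k|K. c k * ek k x)"
proof -
  have "cnj (LINT k|K. c k * ek k x) = (LINT k|K. c (- k) * ek (- k) x)"
    using assms by (subst Bochner_Integration.integral_cnj[symmetric]) (simp add: herm_def ek_minus)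
  also have "\<dots> = (LINT k|K. c k * ek k x)" by (rule integral_K_minus)
  finally show ?thesis unfolding fser_def by (simp add: complex_eq_iff)
qed

lemma L2_integrable: "f \<in> L2_space \<Longrightarrow> integrable torus f"
  by (auto simp: L2_space_def intro: torus.square_integrable_imp_integrable)

lemma sigma_finite_torus: "sigma_finite_measure torus"
  by (rule torus.sigma_finite_measure_axioms)

lemma
  assumes f: "integrable torus f" and c: "absum c" "herm c"
  shows integrable_mult_fser: "integrable torus (\<lambda>x. f x * complex_of_real (fser c x))"
    and integral_mult_fser:
      "(LINT x|torus. f x * complex_of_real (fser c x)) = (LINT k|K. c k * (LINT x|torus. f x * ek k x))"
proof -
  have [measurable]: "f \<in> borel_measurable torus" using f by simp
  have eq: "f x * complex_of_real (fser c x) = (LINT k|K. c k * (f x * ek k x))" for x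
    unfolding fser_complex[OF c(2)]
    by (subst integral_mult_right_zero[symmetric]) (simp add: mult_ac)
  have "(\<integral>\<^sup>+x. ennreal (norm (f x)) \<partial>torus) < \<infinity>" using f by (simp add: integrable_iff_bounded)
  then have "(\<integral>\<^sup>+k. \<integral>\<^sup>+x. ennreal (norm (c k * (f x * ek k x))) \<partial>torus \<partial>K) < \<infinity>"
    using c(1) by (simp add: norm_mult ennreal_mult nn_integral_cmult nn_integral_multc absum_def
        ennreal_mult_less_top)
  note * = sigma_finite_torus _ this
  show "integrable torus (\<lambda>x. f x * complex_of_real (fser c x))"
    unfolding eq by (rule integrable_integral_K[OF *]) simp
  have "(LINT x|torus. f x * complex_of_real (fser c x)) = (LINT k|K. LINT x|torus. c k * (f x * ek k x))"
    unfolding eq by (rule integral_K_swap[OF *]) simp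
  then show "(LINT x|torus. f x * complex_of_real (fser c x)) = (LINT k|K. c k * (LINT x|torus. f x * ek k x))"
    by simp
qed

lemma fourier_coeff_fser:
  assumes "absum c" "herm c"
  shows "fourier_coeff (fser c) k = c k"
proof -
  have "(LINT x|torus. of_real (fser c x) * ek (- k) x) = (LINT x|torus. ek (- k) x * of_real (fser c x))"
    by (simp add: mult.commute)
  also have "\<dots> = (LINT l|K. c l * (LINT x|torus. ek (- k) x * ek l x))"
    by (intro integral_mult_fser integrable_torus_continuous continuous_ek assms)
  also have "\<dots> = (LINT l|K. c l * (if l = k then of_real vol else 0))"
  proof (rule Bochner_Integration.integral_cong[OF refl])
    fix l
    have "(LINT x|torus. ek (- k) x * ek l x) = (LINT x|torus. ek (l - k) x)"
      by (simp flip: ek_add)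
    then show "c l * (LINT x|torus. ek (- k) x * ek l x) = c l * (if l = k then of_real vol else 0)"
      by (simp add: integral_ek vol_def)
  qed
  also have "\<dots> = c k * of_real vol" by (subst integral_K_point[of k]) auto
  finally show ?thesis by (simp add: fourier_coeff_ek)
qed

lemma fser_fourier_coeff:
  assumes "integrable torus f" "absum (fourier_coeff f)"
  shows "AE x in torus. f x = fser (fourier_coeff f) x"
  by (intro fourier_unique L2_integrable[OF fser_L2] fourier_coeff_fser[symmetric] herm_fourier_coeff assms)

lemma
  assumes f: "integrable torus f" and g: "integrable torus g" "absum (fourier_coeff g)"
  shows integrable_mult_absum: "integrable torus (\<lambda>x. f x * complex_of_real (g x))"
    and integral_mult_absum:
      "(LINT x|torus. f x * complex_of_real (g x)) = (LINT k|K. fourier_coeff g k * (LINT x|torus. f x * ek k x))"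
proof -
  note h = herm_fourier_coeff[of g]
  have [measurable]: "f \<in> borel_measurable torus" "g \<in> borel_measurable torus" using f g by simp_all
  have ae: "AE x in torus. f x * complex_of_real (fser (fourier_coeff g) x) = f x * complex_of_real (g x)"
    using fser_fourier_coeff[OF g] by eventually_elim simp
  show "integrable torus (\<lambda>x. f x * complex_of_real (g x))"
    by (rule integrable_cong_AE_imp[OF integrable_mult_fser[OF f g(2) h] _ ae[THEN AE_mp]]) auto
  have "(LINT x|torus. f x * complex_of_real (g x)) = (LINT x|torus. f x * complex_of_real (fser (fourier_coeff g) x))"
    using ae by (intro integral_cong_AE) auto
  then show "(LINT x|torus. f x * complex_of_real (g x)) = (LINT k|K. fourier_coeff g k * (LINT x|torus. f x * ek k x))"
    by (simp add: integral_mult_fser[OF f g(2) h])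
qed

text \<open>Only \<open>g\<close> carries an absolutely convergent Fourier series, while
  \<open>f\<close> enters through its bounded coefficients. In the weak formulation \<open>g\<close>
  is a velocity component or comes from a test function.\<close>

lemma
  fixes f :: "real^3 \<Rightarrow> real"
  assumes f: "integrable torus f" and g: "integrable torus g" "absum (fourier_coeff g)"
  shows integrable_real_mult_absum: "integrable torus (\<lambda>x. f x * g x)"
    and integral_real_mult_absum:
      "complex_of_real (LINT x|torus. f x * g x) = vol * (LINT k|K. fourier_coeff g k * fourier_coeff f (- k))"
    and fourier_coeff_mult:
      "fourier_coeff (\<lambda>x. f x * g x) k = (LINT l|K. fourier_coeff g l * fourier_coeff f (k - l))"
proof -
  have f': "integrable torus (\<lambda>x. complex_of_real (f x))" using f by simp
  show "integrable torus (\<lambda>x. f x * g x)"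
    using integrable_Re[OF integrable_mult_absum[OF f' g]] by simp
  have "complex_of_real (LINT x|torus. f x * g x) = (LINT x|torus. complex_of_real (f x) * complex_of_real (g x))"
    by (simp flip: of_real_mult)
  also have "\<dots> = (LINT k|K. fourier_coeff g k * (of_real vol * fourier_coeff f (- k)))"
    by (simp add: integral_mult_absum[OF f' g] integral_f_ek)
  finally show "complex_of_real (LINT x|torus. f x * g x) = vol * (LINT k|K. fourier_coeff g k * fourier_coeff f (- k))"
    by (subst integral_mult_right_zero[symmetric]) (simp add: mult_ac)
  have "(LINT x|torus. complex_of_real (f x * g x) * ek (- k) x)
      = (LINT x|torus. (of_real (f x) * ek (- k) x) * complex_of_real (g x))"
    by (simp add: mult_ac)
  also have "\<dots> = (LINT l|K. fourier_coeff g l * (LINT x|torus. of_real (f x) * ek (- k) x * ek l x))"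
    by (rule integral_mult_absum[OF integrable_torus_mult_ek[OF f'] g])
  also have "\<dots> = (LINT l|K. fourier_coeff g l * (of_real vol * fourier_coeff f (k - l)))"
  proof (rule Bochner_Integration.integral_cong[OF refl])
    fix l
    have "(LINT x|torus. of_real (f x) * ek (- k) x * ek l x) = (LINT x|torus. of_real (f x) * ek (l - k) x)"
      by (simp add: mult.assoc flip: ek_add)
    then show "fourier_coeff g l * (LINT x|torus. of_real (f x) * ek (- k) x * ek l x)
        = fourier_coeff g l * (of_real vol * fourier_coeff f (k - l))"
      by (simp add: integral_f_ek)
  qed
  also have "\<dots> = of_real vol * (LINT l|K. fourier_coeff g l * fourier_coeff f (k - l))"
    by (subst integral_mult_right_zero[symmetric]) (simp add: mult_ac)
  finally show "fourier_coeff (\<lambda>x. f x * g x) k = (LINT l|K. fourier_coeff g l * fourier_coeff f (k - l))"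
    unfolding fourier_coeff_ek[of "\<lambda>x. f x * g x"] by simp
qed

section \<open>Convolutions and lattice sums\<close>

abbreviation kn :: "int^3 \<Rightarrow> real" where "kn k \<equiv> norm (wavevec k)"

lemma kn_ge_1: "k \<noteq> 0 \<Longrightarrow> kn k \<ge> 1"
proof -
  assume "k \<noteq> 0"
  then obtain j where "k $ j \<noteq> 0" by (auto simp: vec_eq_iff)
  then have "1 \<le> \<bar>wavevec k $ j\<bar>" by simp
  also have "\<dots> \<le> kn k" by (rule component_le_norm_cart)
  finally show ?thesis .
qed

lemma kn_eq_0 [simp]: "kn k = 0 \<longleftrightarrow> k = 0"
  using kn_ge_1[of k] by force

lemma wavevec_eq_0 [simp]: "wavevec k = 0 \<longleftrightarrow> k = 0"
  using kn_eq_0[of k] by simp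

lemma kn_minus [simp]: "kn (- k) = kn k"
  by (simp add: wavevec_minus)

lemma kn_triangle: "kn k \<le> kn l + kn (k - l)"
  using norm_triangle_ineq[of "wavevec l" "wavevec (k - l)"] by (simp add: wavevec_diff)

definition conv :: "(int^3 \<Rightarrow> ennreal) \<Rightarrow> (int^3 \<Rightarrow> ennreal) \<Rightarrow> int^3 \<Rightarrow> ennreal" where
  "conv f g k = (\<integral>\<^sup>+l. f l * g (k - l) \<partial>K)"

lemma conv_comm: "conv f g k = conv g f k"
proof -
  have "conv f g k = (\<integral>\<^sup>+l. f (k - l) * g (k - (k - l)) \<partial>K)"
    unfolding conv_def by (rule nn_integral_K_diff'[of "\<lambda>l. f l * g (k - l)" k, symmetric])
  then show ?thesis by (simp add: conv_def mult.commute)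
qed

lemma conv_mono: "(\<And>l. f l \<le> f' l) \<Longrightarrow> (\<And>l. g l \<le> g' l) \<Longrightarrow> conv f g k \<le> conv f' g' k"
  unfolding conv_def by (intro nn_integral_mono mult_mono) auto

lemma nn_integral_K_K_swap: "(\<integral>\<^sup>+k. \<integral>\<^sup>+l. f k l \<partial>K \<partial>K) = (\<integral>\<^sup>+l. \<integral>\<^sup>+k. f k l \<partial>K \<partial>K)"
  by (rule nn_integral_K_swap[OF K.sigma_finite_measure_axioms, of "\<lambda>l k. f k l"]) simp

lemma nn_integral_conv: "(\<integral>\<^sup>+k. conv f g k \<partial>K) = (\<integral>\<^sup>+k. f k \<partial>K) * (\<integral>\<^sup>+k. g k \<partial>K)"
proof -
  have "(\<integral>\<^sup>+k. conv f g k \<partial>K) = (\<integral>\<^sup>+l. \<integral>\<^sup>+k. f l * g (k - l) \<partial>K \<partial>K)"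
    unfolding conv_def by (rule nn_integral_K_K_swap)
  also have "\<dots> = (\<integral>\<^sup>+l. f l * (\<integral>\<^sup>+k. g k \<partial>K) \<partial>K)"
    by (simp add: nn_integral_cmult nn_integral_K_diff)
  finally show ?thesis by (simp add: nn_integral_multc)
qed

lemma conv_le: "conv f g k \<le> (\<integral>\<^sup>+k. f k \<partial>K) * (\<integral>\<^sup>+k. g k \<partial>K)"
  using nn_integral_K_member[of "conv f g" k] by (simp add: nn_integral_conv)

text \<open>Cauchy-Schwarz for the measure with density \<open>f\<close>. It yields both the Young
  inequality for convolutions and the Schur bound for the time kernel.\<close>

lemma ennreal_CS:
  assumes [measurable]: "f \<in> borel_measurable M" "g \<in> borel_measurable M"
  shows "(\<integral>\<^sup>+x. f x * g x \<partial>M)\<^sup>2 \<le> (\<integral>\<^sup>+x. f x \<partial>M) * (\<integral>\<^sup>+x. f x * (g x)\<^sup>2 \<partial>M)"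
proof (cases "AE x in M. f x < \<infinity>")
  case True
  define h where "h x = ennreal (sqrt (enn2real (f x)))" for x
  have [measurable]: "h \<in> borel_measurable M" unfolding h_def by measurable
  have h: "AE x in M. f x = (h x)\<^sup>2"
    using True
  proof eventually_elim
    case (elim x)
    then have "f x = ennreal (enn2real (f x))" by simp
    also have "enn2real (f x) = sqrt (enn2real (f x)) * sqrt (enn2real (f x))" by simp
    also have "ennreal \<dots> = (h x)\<^sup>2" unfolding h_def power2_eq_square by (simp only: ennreal_mult real_sqrt_ge_zero enn2real_nonneg)
    finally show ?case .
  qed
  have "(\<integral>\<^sup>+x. f x * g x \<partial>M) = (\<integral>\<^sup>+x. h x * (h x * g x) \<partial>M)"
    by (rule nn_integral_cong_AE) (use h in \<open>eventually_elim, simp add: power2_eq_square mult.assoc\<close>)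
  also have "\<dots>\<^sup>2 \<le> (\<integral>\<^sup>+x. (h x)\<^sup>2 \<partial>M) * (\<integral>\<^sup>+x. (h x * g x)\<^sup>2 \<partial>M)"
    by (rule Cauchy_Schwarz_nn_integral) measurable
  also have "(\<integral>\<^sup>+x. (h x)\<^sup>2 \<partial>M) = (\<integral>\<^sup>+x. f x \<partial>M)"
    by (rule nn_integral_cong_AE) (use h in \<open>eventually_elim, simp\<close>)
  also have "(\<integral>\<^sup>+x. (h x * g x)\<^sup>2 \<partial>M) = (\<integral>\<^sup>+x. f x * (g x)\<^sup>2 \<partial>M)"
    by (rule nn_integral_cong_AE) (use h in \<open>eventually_elim, simp add: power_mult_distrib\<close>)
  finally show ?thesis .
next
  case False
  \<comment> \<open>A weight that is infinite on a set of positive measure makes the right-hand side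
    infinite, unless \<open>f * g^2\<close> vanishes almost everywhere, and then the left-hand side
    vanishes too.\<close>
  have inf: "(\<integral>\<^sup>+x. f x \<partial>M) = \<infinity>"
  proof (rule ccontr)
    assume "(\<integral>\<^sup>+x. f x \<partial>M) \<noteq> \<infinity>"
    then have "AE x in M. f x \<noteq> \<infinity>" by (intro nn_integral_PInf_AE) auto
    then show False using False by (simp add: less_top)
  qed
  show ?thesis
  proof (cases "(\<integral>\<^sup>+x. f x * (g x)\<^sup>2 \<partial>M) = 0")
    case True
    then have "AE x in M. f x * (g x)\<^sup>2 = 0" by (subst (asm) nn_integral_0_iff_AE) auto
    then have "AE x in M. f x * g x = 0" by eventually_elim auto
    then have "(\<integral>\<^sup>+x. f x * g x \<partial>M) = 0" by (subst nn_integral_0_iff_AE) auto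
    then show ?thesis by simp
  next
    case False
    then show ?thesis by (simp add: inf ennreal_top_mult)
  qed
qed

text \<open>Cauchy-Schwarz with the translated \<open>g\<close> as weight, then summation over
  \<open>k\<close> by Tonelli: the sum of \<open>g\<close> appears once from each step.\<close>

lemma conv_Young: "(\<integral>\<^sup>+k. (conv f g k)\<^sup>2 \<partial>K) \<le> (\<integral>\<^sup>+k. g k \<partial>K)\<^sup>2 * (\<integral>\<^sup>+k. (f k)\<^sup>2 \<partial>K)"
proof -
  have "(conv f g k)\<^sup>2 \<le> (\<integral>\<^sup>+k. g k \<partial>K) * conv (\<lambda>l. (f l)\<^sup>2) g k" for k
  proof -
    have "(conv f g k)\<^sup>2 = (\<integral>\<^sup>+l. g (k - l) * f l \<partial>K)\<^sup>2" by (simp add: conv_def mult.commute)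
    also have "\<dots> \<le> (\<integral>\<^sup>+l. g (k - l) \<partial>K) * (\<integral>\<^sup>+l. g (k - l) * (f l)\<^sup>2 \<partial>K)"
      by (rule ennreal_CS) auto
    finally show ?thesis by (simp add: conv_def nn_integral_K_diff' mult.commute)
  qed
  then have "(\<integral>\<^sup>+k. (conv f g k)\<^sup>2 \<partial>K) \<le> (\<integral>\<^sup>+k. (\<integral>\<^sup>+k. g k \<partial>K) * conv (\<lambda>l. (f l)\<^sup>2) g k \<partial>K)"
    by (intro nn_integral_mono)
  also have "\<dots> = (\<integral>\<^sup>+k. g k \<partial>K)\<^sup>2 * (\<integral>\<^sup>+k. (f k)\<^sup>2 \<partial>K)"
    by (simp add: nn_integral_cmult nn_integral_conv power2_eq_square mult_ac)
  finally show ?thesis .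
qed

lemma powr_kn_le:
  assumes "p \<ge> 0"
  shows "kn k powr p \<le> 2 powr p * (kn l powr p + kn (k - l) powr p)"
proof -
  have "kn k \<le> 2 * max (kn l) (kn (k - l))" using kn_triangle[of k l] by auto
  then have "kn k powr p \<le> (2 * max (kn l) (kn (k - l))) powr p" by (intro powr_mono2 assms) auto
  also have "\<dots> = 2 powr p * (max (kn l) (kn (k - l)) powr p)" by (subst powr_mult) auto
  also have "\<dots> \<le> 2 powr p * (kn l powr p + kn (k - l) powr p)"
    by (intro mult_left_mono) (auto simp: max_def)
  finally show ?thesis .
qed

text \<open>A derivative of order \<open>p\<close> is distributed over the two factors, because the
  larger of \<open>|l|\<close> and \<open>|k - l|\<close> is at least
  \<open>|k| / 2\<close>.\<close>

lemma conv_weight: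
  assumes "p \<ge> 0"
  shows "ennreal (kn k powr p) * conv f g k
    \<le> ennreal (2 powr p) * (conv (\<lambda>l. ennreal (kn l powr p) * f l) g k + conv f (\<lambda>l. ennreal (kn l powr p) * g l) k)"
proof -
  have "ennreal (kn k powr p) * conv f g k = (\<integral>\<^sup>+l. ennreal (kn k powr p) * (f l * g (k - l)) \<partial>K)"
    by (simp add: conv_def nn_integral_cmult)
  also have "\<dots> \<le> (\<integral>\<^sup>+l. ennreal (2 powr p) * ((ennreal (kn l powr p) * f l) * g (k - l)
      + f l * (ennreal (kn (k - l) powr p) * g (k - l))) \<partial>K)"
  proof (rule nn_integral_mono)
    fix l
    have "ennreal (kn k powr p) \<le> ennreal (2 powr p * (kn l powr p + kn (k - l) powr p))"
      by (rule ennreal_leI[OF powr_kn_le[OF assms]])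
    also have "\<dots> = ennreal (2 powr p) * (ennreal (kn l powr p) + ennreal (kn (k - l) powr p))"
      by (simp add: ennreal_mult ennreal_plus)
    finally have "ennreal (kn k powr p) * (f l * g (k - l))
       \<le> ennreal (2 powr p) * (ennreal (kn l powr p) + ennreal (kn (k - l) powr p)) * (f l * g (k - l))"
      by (rule mult_right_mono) simp
    then show "ennreal (kn k powr p) * (f l * g (k - l)) \<le> ennreal (2 powr p) * ((ennreal (kn l powr p) * f l) * g (k - l)
      + f l * (ennreal (kn (k - l) powr p) * g (k - l)))"
      by (simp add: algebra_simps)
  qed
  also have "\<dots> = ennreal (2 powr p) * (conv (\<lambda>l. ennreal (kn l powr p) * f l) g k + conv f (\<lambda>l. ennreal (kn l powr p) * g l) k)"
    by (simp add: conv_def nn_integral_cmult nn_integral_add)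
  finally show ?thesis .
qed

lemma ennreal_le_suminf: "(g :: nat \<Rightarrow> ennreal) i \<le> (\<Sum>j. g j)"
  using sum_le_suminf[of g "{i}"] by (simp add: summableI)

text \<open>The ball lies in a cube with \<open>2 * n + 1\<close> integer points per edge, where
  \<open>n\<close> is the integer part of \<open>r\<close>, and this is at most \<open>3 * r\<close>
  because \<open>r >= 1\<close>.\<close>

lemma card_lattice_ball:
  assumes r: "r \<ge> 1"
  shows "finite {k. kn k \<le> r}" "real (card {k. kn k \<le> r}) \<le> 27 * r ^ 3"
proof -
  define n where "n = \<lfloor>r\<rfloor>"
  have n: "n \<ge> 1" "of_int n \<le> r" using r by (auto simp: n_def)
  let ?f = "\<lambda>k :: int^3. (k $ 1, k $ 2, k $ 3)"
  let ?B = "{-n..n} \<times> {-n..n} \<times> {-n..n}"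
  have inj: "inj_on ?f A" for A
    by (rule inj_onI) (simp add: vec_eq_iff forall_3)
  have sub: "?f ` {k. kn k \<le> r} \<subseteq> ?B"
  proof -
    have "k $ j \<in> {-n..n}" if "kn k \<le> r" for k j
    proof -
      have "\<bar>wavevec k $ j\<bar> \<le> r" using component_le_norm_cart[of "wavevec k" j] that by linarith
      then have "\<bar>k $ j\<bar> \<le> n" unfolding n_def by (simp add: le_floor_iff)
      then show ?thesis by auto
    qed
    then show ?thesis by auto
  qed
  have fB: "finite ?B" by simp
  show fin: "finite {k. kn k \<le> r}"
    by (rule finite_imageD[OF finite_subset[OF sub fB] inj])
  have "card {k. kn k \<le> r} = card (?f ` {k. kn k \<le> r})" by (simp add: card_image[OF inj])
  also have "\<dots> \<le> card ?B" by (rule card_mono[OF fB sub])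
  also have "card ?B = (nat (2 * n + 1)) ^ 3"
    by (simp add: card_cartesian_product power3_eq_cube algebra_simps)
  finally have "real (card {k. kn k \<le> r}) \<le> real ((nat (2 * n + 1)) ^ 3)" by (rule of_nat_mono)
  also have "\<dots> = (2 * of_int n + 1) ^ 3" using n by simp
  also have "\<dots> \<le> (3 * r) ^ 3" using n r by (intro power_mono) auto
  finally show "real (card {k. kn k \<le> r}) \<le> 27 * r ^ 3" by (simp add: power_mult_distrib)
qed

text \<open>The summand behaves like \<open>|k|^2\<close> up to \<open>|k| = R\<close> and like
  \<open>R^(2 s) |k|^(2 - 2 s)\<close> beyond. About \<open>R^3\<close> points of size
  \<open>R^2\<close> give \<open>R^5\<close>, and the rest is a geometric series over dyadic scales
  since \<open>2 s > 5\<close>.\<close>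

lemma lattice_sum:
  assumes s: "s > 5 / 2"
  shows "\<exists>C>0. \<forall>R\<ge>1.
    (\<integral>\<^sup>+k. ennreal ((kn k)\<^sup>2 / (1 + (kn k / R) powr (2 * s))) \<partial>K) \<le> ennreal (C * R ^ 5)"
proof -
  \<comment> \<open>From one dyadic scale to the next the denominator grows by \<open>X\<close>, the
    numerator by 4 and the number of points by 8. The ratio \<open>32 / X\<close> is below 1 exactly
    because \<open>2 s > 5\<close>.\<close>
  define X :: real where "X = 2 powr (2 * s)"
  define q :: real where "q = 32 / X"
  have "(2::real) powr 5 < 2 powr (2 * s)" using s by (intro powr_less_mono) auto
  then have X: "X > 32" unfolding X_def by simp
  then have q: "0 < q" "q < 1" by (auto simp: q_def)
  define C where "C = 27 * X * (1 / (1 - q))"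
  have C: "C > 0" using q X by (simp add: C_def)
  have "(\<integral>\<^sup>+k. ennreal ((kn k)\<^sup>2 / (1 + (kn k / R) powr (2 * s))) \<partial>K) \<le> ennreal (C * R ^ 5)" if R: "R \<ge> 1" for R
  proof -
  define c where "c j = 4 ^ j * R\<^sup>2 * X / X ^ j" for j :: nat
  have c0: "c j \<ge> 0" for j using X by (simp add: c_def)
  let ?f = "\<lambda>k. (kn k)\<^sup>2 / (1 + (kn k / R) powr (2 * s))"
  let ?B = "\<lambda>j :: nat. {k. kn k \<le> 2 ^ j * R}"
  have pt: "ennreal (?f k) \<le> (\<Sum>j. ennreal (c j) * indicator (?B j) k)" for k
  proof -
    obtain j0 where "kn k / R < 2 ^ j0" using real_arch_pow[of 2 "kn k / R"] by auto
    then have ex: "kn k \<le> 2 ^ j0 * R" using R by (simp add: field_simps)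
    define j where "j = (LEAST j. kn k \<le> 2 ^ j * R)"
    have j: "kn k \<le> 2 ^ j * R" unfolding j_def by (rule LeastI[of _ j0]) (rule ex)
    have jm: "\<not> kn k \<le> 2 ^ i * R" if "i < j" for i using that unfolding j_def by (rule not_less_Least)
    \<comment> \<open>Only the exclusion of \<open>k\<close> from ball \<open>j - 1\<close> is
      known, which costs one factor \<open>X\<close>; for \<open>j = 0\<close> the right-hand side
      is \<open>1 / X\<close>, below 1.\<close>
    have den: "1 + (kn k / R) powr (2 * s) \<ge> X ^ j / X"
    proof (cases j)
      case 0
      have "(kn k / R) powr (2 * s) \<ge> 0" by simp
      moreover have "X ^ j / X \<le> 1" using 0 X by simp
      ultimately show ?thesis by linarith
    next
      case (Suc i)
      have "kn k > 2 ^ i * R" using jm[of i] Suc by simp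
      then have "2 ^ i \<le> kn k / R" using R by (simp add: field_simps)
      then have "(2 ^ i) powr (2 * s) \<le> (kn k / R) powr (2 * s)" using s by (intro powr_mono2) auto
      moreover have "(2 ^ i :: real) powr (2 * s) = X ^ i"
        unfolding X_def by (simp add: powr_realpow[symmetric] powr_powr mult.commute)
      moreover have "X ^ j / X = X ^ i" using Suc X by simp
      ultimately show ?thesis by linarith
    qed
    have "?f k \<le> (2 ^ j * R)\<^sup>2 / (X ^ j / X)"
      using j den X by (intro frac_le power_mono) auto
    also have "(2 ^ j * R)\<^sup>2 = 4 ^ j * R\<^sup>2"
    proof -
      have "((2::real) ^ j) ^ 2 = (2 ^ 2) ^ j" by (simp only: power_mult[symmetric] mult.commute)
      then show ?thesis by (simp add: power_mult_distrib)
    qed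
    finally have "?f k \<le> c j" by (simp add: c_def)
    then have "ennreal (?f k) \<le> ennreal (c j) * indicator (?B j) k" using j by (simp add: ennreal_leI)
    also have "\<dots> \<le> (\<Sum>j. ennreal (c j) * indicator (?B j) k)"
      by (rule ennreal_le_suminf)
    finally show ?thesis .
  qed
  have cB: "(\<integral>\<^sup>+k. ennreal (c j) * indicator (?B j) k \<partial>K) \<le> ennreal (27 * X * R ^ 5 * q ^ j)" for j
  proof -
    have "1 * 1 \<le> 2 ^ j * R" using R by (intro mult_mono) auto
    then have r: "2 ^ j * R \<ge> 1" by simp
    note cb = card_lattice_ball[OF r]
    have "(\<integral>\<^sup>+k. ennreal (c j) * indicator (?B j) k \<partial>K) = ennreal (c j) * ennreal (card (?B j))"
      using cb(1) by (simp add: nn_integral_cmult_indicator ennreal_of_nat_eq_real_of_nat)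
    also have "\<dots> = ennreal (c j * card (?B j))" by (simp add: ennreal_mult c0)
    also have "\<dots> \<le> ennreal (c j * (27 * (2 ^ j * R) ^ 3))"
      by (intro ennreal_leI mult_left_mono cb(2) c0)
    also have "c j * (27 * (2 ^ j * R) ^ 3) = 27 * X * R ^ 5 * q ^ j"
    proof -
      have "(32::real) ^ j = (4 * 2 ^ 3) ^ j" by simp
      also have "\<dots> = 4 ^ j * (2 ^ 3) ^ j" by (rule power_mult_distrib)
      also have "((2::real) ^ 3) ^ j = (2 ^ j) ^ 3" by (simp only: power_mult[symmetric] mult.commute)
      finally have e: "(32::real) ^ j = 4 ^ j * (2 ^ j) ^ 3" .
      have "R ^ 5 = R ^ 2 * R ^ 3" by (simp only: power_add[symmetric]) simp
      then show ?thesis by (simp only: c_def q_def power_mult_distrib power_divide e) simp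
    qed
    finally show ?thesis .
  qed
  have "(\<integral>\<^sup>+k. ennreal (?f k) \<partial>K) \<le> (\<integral>\<^sup>+k. (\<Sum>j. ennreal (c j) * indicator (?B j) k) \<partial>K)"
    by (intro nn_integral_mono pt)
  also have "\<dots> = (\<Sum>j. \<integral>\<^sup>+k. ennreal (c j) * indicator (?B j) k \<partial>K)"
    by (rule nn_integral_suminf) simp
  also have "\<dots> \<le> (\<Sum>j. ennreal (27 * X * R ^ 5 * q ^ j))"
    by (intro suminf_le cB summableI)
  also have "\<dots> = ennreal (27 * X * R ^ 5 * (1 / (1 - q)))"
    using R q X by (intro suminf_ennreal_eq sums_mult geometric_sums) auto
  finally show "(\<integral>\<^sup>+k. ennreal (?f k) \<partial>K) \<le> ennreal (C * R ^ 5)" by (simp add: C_def mult_ac)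
  qed
  then show ?thesis using C by blast
qed

text \<open>The case \<open>R = 1\<close>, where \<open>|k| >= 1\<close> gives
  \<open>1 + |k|^(2 s) <= 2 |k|^(2 s)\<close>. The zero mode contributes nothing because
  \<open>0 powr x = 0\<close>.\<close>

lemma lattice_sum_powr:
  assumes s: "s > 5 / 2"
  shows "(\<integral>\<^sup>+k. ennreal (kn k powr (2 - 2 * s)) \<partial>K) < \<infinity>"
proof -
  obtain C where C: "C > 0" "\<And>R. R \<ge> 1 \<Longrightarrow>
    (\<integral>\<^sup>+k. ennreal ((kn k)\<^sup>2 / (1 + (kn k / R) powr (2 * s))) \<partial>K) \<le> ennreal (C * R ^ 5)"
    using lattice_sum[OF s] by blast
  have "(\<integral>\<^sup>+k. ennreal (kn k powr (2 - 2 * s)) \<partial>K)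
      \<le> (\<integral>\<^sup>+k. ennreal 2 * ennreal ((kn k)\<^sup>2 / (1 + (kn k / 1) powr (2 * s))) \<partial>K)"
  proof (rule nn_integral_mono)
    fix k
    have "kn k powr (2 - 2 * s) \<le> 2 * ((kn k)\<^sup>2 / (1 + (kn k / 1) powr (2 * s)))"
    proof (cases "k = 0")
      case False
      have k1: "kn k \<ge> 1" by (rule kn_ge_1[OF False])
      then have p1: "kn k powr (2 * s) \<ge> 1" using s by (intro ge_one_powr_ge_zero) auto
      have "kn k powr (2 - 2 * s) = (kn k)\<^sup>2 / kn k powr (2 * s)"
        using k1 False by (simp add: powr_diff powr_numeral)
      also have "\<dots> \<le> 2 * ((kn k)\<^sup>2 / (1 + (kn k / 1) powr (2 * s)))"
      proof -
        have "(kn k)\<^sup>2 * (1 + kn k powr (2 * s)) \<le> (kn k)\<^sup>2 * (2 * kn k powr (2 * s))"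
          using p1 by (intro mult_left_mono) auto
        then show ?thesis using p1 by (simp add: divide_simps add_pos_nonneg)
      qed
      finally show ?thesis .
    qed simp
    then have "ennreal (kn k powr (2 - 2 * s)) \<le> ennreal (2 * ((kn k)\<^sup>2 / (1 + (kn k / 1) powr (2 * s))))"
      by (rule ennreal_leI)
    also have "\<dots> = ennreal 2 * ennreal ((kn k)\<^sup>2 / (1 + (kn k / 1) powr (2 * s)))"
      by (rule ennreal_mult) (auto intro!: divide_nonneg_nonneg add_nonneg_nonneg)
    finally show "ennreal (kn k powr (2 - 2 * s)) \<le> ennreal 2 * ennreal ((kn k)\<^sup>2 / (1 + (kn k / 1) powr (2 * s)))" .
  qed
  also have "\<dots> = ennreal 2 * (\<integral>\<^sup>+k. ennreal ((kn k)\<^sup>2 / (1 + (kn k / 1) powr (2 * s))) \<partial>K)"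
    by (rule nn_integral_cmult) simp
  also have "\<dots> \<le> ennreal 2 * ennreal (C * 1 ^ 5)" by (intro mult_left_mono C(2)) auto
  also have "\<dots> < \<infinity>" by (simp add: ennreal_mult_less_top)
  finally show ?thesis .
qed

section \<open>The Duhamel formula for a single mode\<close>

text \<open>The solution of \<open>y' + \<mu> y = g\<close>. The decaying exponential is factored
  out so that the integrand does not depend on \<open>t\<close>; restarting at a later time and
  continuity then reduce to properties of an indefinite integral.\<close>

definition duhamel :: "real \<Rightarrow> complex \<Rightarrow> (real \<Rightarrow> complex) \<Rightarrow> real \<Rightarrow> complex" where
  "duhamel \<mu> y0 g t = exp (- (\<mu> * t)) *\<^sub>R (y0 + (LINT \<tau>:{0<..<t}|lborel. exp (\<mu> * \<tau>) *\<^sub>R g \<tau>))"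

text \<open>Majorant of the Duhamel integral started at time \<open>a\<close>, valued in
  \<open>ennreal\<close> so that it can be estimated before integrability is known.\<close>

definition dker :: "real \<Rightarrow> (real \<Rightarrow> ennreal) \<Rightarrow> real \<Rightarrow> real \<Rightarrow> ennreal" where
  "dker \<mu> g a t = (\<integral>\<^sup>+\<tau>. ennreal (exp (- (\<mu> * (t - \<tau>)))) * indicator {a<..<t} \<tau> * g \<tau> \<partial>lborel)"

lemma set_integrable_exp:
  fixes g :: "real \<Rightarrow> complex"
  assumes "set_integrable lborel {a<..<t} g" "\<mu> \<ge> 0"
  shows "set_integrable lborel {a<..<t} (\<lambda>\<tau>. exp (\<mu> * \<tau>) *\<^sub>R g \<tau>)"
  unfolding set_integrable_def
proof (rule Bochner_Integration.integrable_bound)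
  show "integrable lborel (\<lambda>\<tau>. exp (\<mu> * t) *\<^sub>R (indicator {a<..<t} \<tau> *\<^sub>R g \<tau>))"
    using assms(1) unfolding set_integrable_def by (intro integrable_scaleR_right) auto
  have "(\<lambda>x. indicator {a<..<t} x *\<^sub>R g x) \<in> borel_measurable lborel"
    using assms(1) unfolding set_integrable_def by auto
  then have "(\<lambda>x. exp (\<mu> * x) *\<^sub>R (indicator {a<..<t} x *\<^sub>R g x)) \<in> borel_measurable lborel"
    by (rule borel_measurable_scaleR[rotated]) measurable
  moreover have "(\<lambda>x. exp (\<mu> * x) *\<^sub>R (indicator {a<..<t} x *\<^sub>R g x)) = (\<lambda>x. indicator {a<..<t} x *\<^sub>R exp (\<mu> * x) *\<^sub>R g x)"
    by (simp add: fun_eq_iff mult.commute)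
  ultimately show "(\<lambda>x. indicator {a<..<t} x *\<^sub>R exp (\<mu> * x) *\<^sub>R g x) \<in> borel_measurable lborel"
    by simp
  show "AE x in lborel. norm (indicator {a<..<t} x *\<^sub>R exp (\<mu> * x) *\<^sub>R g x)
     \<le> norm (exp (\<mu> * t) *\<^sub>R (indicator {a<..<t} x *\<^sub>R g x))"
    using assms(2) by (intro AE_I2) (auto simp: indicator_def intro!: mult_right_mono mult_left_mono)
qed

lemma set_integrable_sub:
  fixes g :: "real \<Rightarrow> 'b::{banach, second_countable_topology}"
  assumes "set_integrable lborel {a<..<t} g" "a \<le> b" "u \<le> t"
  shows "set_integrable lborel {b<..<u} g"
  by (rule set_integrable_subset[OF assms(1)]) (use assms in auto)

lemma set_integral_split:
  fixes g :: "real \<Rightarrow> 'b::{banach, second_countable_topology}"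
  assumes "set_integrable lborel {a<..<t} g" "a \<le> b" "b \<le> t"
  shows "(LINT \<tau>:{a<..<t}|lborel. g \<tau>) = (LINT \<tau>:{a<..<b}|lborel. g \<tau>) + (LINT \<tau>:{b<..<t}|lborel. g \<tau>)"
proof -
  have i: "set_integrable lborel {a<..<b} g" "set_integrable lborel {b<..<t} g"
    using assms by (auto intro: set_integrable_sub)
  have m: "(\<lambda>x. indicator {a<..<t} x *\<^sub>R g x) \<in> borel_measurable lborel"
    using assms(1) unfolding set_integrable_def by auto
  have "(LINT \<tau>:{a<..<t}|lborel. g \<tau>) = (LINT \<tau>:{a<..<b} \<union> {b<..<t}|lborel. g \<tau>)"
    unfolding set_lebesgue_integral_def
  proof (rule integral_cong_AE[OF m])
    have "set_integrable lborel ({a<..<b} \<union> {b<..<t}) g"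
      using assms by (intro set_integrable_subset[OF assms(1)]) auto
    then show "(\<lambda>x. indicat_real ({a<..<b} \<union> {b<..<t}) x *\<^sub>R g x) \<in> borel_measurable lborel"
      unfolding set_integrable_def by auto
    have "AE x in lborel. x \<noteq> b" by (rule AE_lborel_singleton)
    then show "AE x in lborel. indicat_real {a<..<t} x *\<^sub>R g x = indicat_real ({a<..<b} \<union> {b<..<t}) x *\<^sub>R g x"
      by eventually_elim (use assms in \<open>auto simp: indicator_def\<close>)
  qed
  also have "\<dots> = (LINT \<tau>:{a<..<b}|lborel. g \<tau>) + (LINT \<tau>:{b<..<t}|lborel. g \<tau>)"
    by (rule set_integral_Un[OF _ i]) auto
  finally show ?thesis .
qed

lemma norm_set_integral_le:
  fixes g :: "real \<Rightarrow> complex"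
  shows "ennreal (norm (LINT \<tau>:A|lborel. g \<tau>)) \<le> (\<integral>\<^sup>+\<tau>. indicator A \<tau> * ennreal (norm (g \<tau>)) \<partial>lborel)"
proof (cases "set_integrable lborel A g")
  case True
  have "ennreal (norm (LINT \<tau>:A|lborel. g \<tau>)) \<le> (\<integral>\<^sup>+\<tau>. ennreal (norm (indicator A \<tau> *\<^sub>R g \<tau>)) \<partial>lborel)"
    using True unfolding set_integrable_def set_lebesgue_integral_def by (rule integral_norm_bound_ennreal)
  also have "\<dots> = (\<integral>\<^sup>+\<tau>. indicator A \<tau> * ennreal (norm (g \<tau>)) \<partial>lborel)"
    by (intro nn_integral_cong) (auto simp: indicator_def)
  finally show ?thesis .
qed (simp add: set_integrable_def set_lebesgue_integral_def not_integrable_integral_eq)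

lemma norm_exp_integral_le:
  fixes g :: "real \<Rightarrow> complex"
  assumes [measurable]: "g \<in> borel_measurable borel"
  shows "ennreal (norm (exp (- (\<mu> * t)) *\<^sub>R (LINT \<tau>:{a<..<t}|lborel. exp (\<mu> * \<tau>) *\<^sub>R g \<tau>)))
     \<le> dker \<mu> (\<lambda>\<tau>. ennreal (norm (g \<tau>))) a t"
proof -
  have "ennreal (norm (exp (- (\<mu> * t)) *\<^sub>R (LINT \<tau>:{a<..<t}|lborel. exp (\<mu> * \<tau>) *\<^sub>R g \<tau>)))
     = ennreal (exp (- (\<mu> * t))) * ennreal (norm (LINT \<tau>:{a<..<t}|lborel. exp (\<mu> * \<tau>) *\<^sub>R g \<tau>))"
    by (simp add: ennreal_mult)
  also have "\<dots> \<le> ennreal (exp (- (\<mu> * t))) * (\<integral>\<^sup>+\<tau>. indicator {a<..<t} \<tau> * ennreal (norm (exp (\<mu> * \<tau>) *\<^sub>R g \<tau>)) \<partial>lborel)"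
    by (intro mult_left_mono norm_set_integral_le) simp
  also have "\<dots> = (\<integral>\<^sup>+\<tau>. ennreal (exp (- (\<mu> * t))) * (indicator {a<..<t} \<tau> * ennreal (norm (exp (\<mu> * \<tau>) *\<^sub>R g \<tau>))) \<partial>lborel)"
    by (rule nn_integral_cmult[symmetric]) measurable
  also have "\<dots> = dker \<mu> (\<lambda>\<tau>. ennreal (norm (g \<tau>))) a t"
    unfolding dker_def
  proof (rule nn_integral_cong)
    fix \<tau>
    have "exp (- (\<mu> * (t - \<tau>))) = exp (- (\<mu> * t)) * exp (\<mu> * \<tau>)"
      by (simp add: exp_add[symmetric] algebra_simps)
    then show "ennreal (exp (- (\<mu> * t))) * (indicator {a<..<t} \<tau> * ennreal (norm (exp (\<mu> * \<tau>) *\<^sub>R g \<tau>)))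
      = ennreal (exp (- (\<mu> * (t - \<tau>)))) * indicator {a<..<t} \<tau> * ennreal (norm (g \<tau>))"
      by (auto simp: indicator_def ennreal_mult mult_ac)
  qed
  finally show ?thesis .
qed

lemma duhamel_restart:
  assumes "set_integrable lborel {0<..<t} g" "0 \<le> a" "a \<le> t" "\<mu> \<ge> 0"
  shows "duhamel \<mu> y0 g t = exp (- (\<mu> * (t - a))) *\<^sub>R duhamel \<mu> y0 g a
     + exp (- (\<mu> * t)) *\<^sub>R (LINT \<tau>:{a<..<t}|lborel. exp (\<mu> * \<tau>) *\<^sub>R g \<tau>)"
proof -
  have e: "exp (- (\<mu> * (t - a))) * exp (- (\<mu> * a)) = exp (- (\<mu> * t))"
    by (simp add: exp_add[symmetric] algebra_simps)
  show ?thesis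
    unfolding duhamel_def set_integral_split[OF set_integrable_exp[OF assms(1,4)] assms(2,3)]
    by (simp only: scaleR_scaleR e scaleR_add_right add.assoc)
qed

lemma duhamel_diff:
  assumes "set_integrable lborel {0<..<t} g" "set_integrable lborel {0<..<t} h" "\<mu> \<ge> 0"
  shows "duhamel \<mu> y g t - duhamel \<mu> z h t = duhamel \<mu> (y - z) (\<lambda>\<tau>. g \<tau> - h \<tau>) t"
proof -
  have "(LINT \<tau>:{0<..<t}|lborel. exp (\<mu> * \<tau>) *\<^sub>R (g \<tau> - h \<tau>))
      = (LINT \<tau>:{0<..<t}|lborel. exp (\<mu> * \<tau>) *\<^sub>R g \<tau>) - (LINT \<tau>:{0<..<t}|lborel. exp (\<mu> * \<tau>) *\<^sub>R h \<tau>)"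
    using set_integral_diff(2)[OF set_integrable_exp[OF assms(1,3)] set_integrable_exp[OF assms(2,3)]]
    by (simp only: scaleR_diff_right)
  then show ?thesis unfolding duhamel_def by (simp add: scaleR_diff_right scaleR_add_right)
qed

lemma duhamel_0 [simp]: "duhamel \<mu> y0 g 0 = y0"
  by (simp add: duhamel_def set_lebesgue_integral_def)

lemma duhamel_le:
  assumes "g \<in> borel_measurable borel" "set_integrable lborel {0<..<t} g" "0 \<le> a" "a \<le> t" "\<mu> \<ge> 0"
  shows "ennreal (norm (duhamel \<mu> y0 g t)) \<le> ennreal (exp (- (\<mu> * (t - a)))) * ennreal (norm (duhamel \<mu> y0 g a))
    + dker \<mu> (\<lambda>\<tau>. ennreal (norm (g \<tau>))) a t"
proof -
  have "ennreal (norm (duhamel \<mu> y0 g t)) \<le> ennreal (norm (exp (- (\<mu> * (t - a))) *\<^sub>R duhamel \<mu> y0 g a)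
     + norm (exp (- (\<mu> * t)) *\<^sub>R (LINT \<tau>:{a<..<t}|lborel. exp (\<mu> * \<tau>) *\<^sub>R g \<tau>)))"
    unfolding duhamel_restart[OF assms(2-5)] by (intro ennreal_leI norm_triangle_ineq)
  also have "\<dots> = ennreal (exp (- (\<mu> * (t - a)))) * ennreal (norm (duhamel \<mu> y0 g a))
     + ennreal (norm (exp (- (\<mu> * t)) *\<^sub>R (LINT \<tau>:{a<..<t}|lborel. exp (\<mu> * \<tau>) *\<^sub>R g \<tau>)))"
    by (simp add: ennreal_plus ennreal_mult)
  also have "\<dots> \<le> ennreal (exp (- (\<mu> * (t - a)))) * ennreal (norm (duhamel \<mu> y0 g a))
    + dker \<mu> (\<lambda>\<tau>. ennreal (norm (g \<tau>))) a t"
    by (intro add_left_mono norm_exp_integral_le assms)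
  finally show ?thesis .
qed

section \<open>Gain of derivatives by integration in time\<close>

lemma nn_integral_exp_past:
  assumes "\<mu> > 0"
  shows "(\<integral>\<^sup>+\<tau>. ennreal (exp (- (\<mu> * (t - \<tau>)))) * indicator {a<..<t} \<tau> \<partial>lborel) \<le> ennreal (1 / \<mu>)"
proof (cases "a \<le> t")
  case True
  have "(\<integral>\<^sup>+\<tau>. ennreal (exp (- (\<mu> * (t - \<tau>)))) * indicator {a<..<t} \<tau> \<partial>lborel)
      \<le> (\<integral>\<^sup>+\<tau>. ennreal (exp (- (\<mu> * (t - \<tau>)))) * indicator {a..t} \<tau> \<partial>lborel)"
    by (intro nn_integral_mono mult_left_mono) (auto simp: indicator_def)
  also have "\<dots> = ennreal (exp (- (\<mu> * (t - t))) / \<mu> - exp (- (\<mu> * (t - a))) / \<mu>)"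
    by (rule nn_integral_FTC_Icc)
      (use True assms in \<open>auto intro!: derivative_eq_intros simp: field_simps\<close>)
  also have "\<dots> \<le> ennreal (1 / \<mu>)" using assms by (intro ennreal_leI) simp
  finally show ?thesis .
qed (simp add: indicator_def)

lemma nn_integral_exp_future:
  assumes "\<mu> > 0"
  shows "(\<integral>\<^sup>+t. ennreal (exp (- (\<mu> * (t - \<tau>)))) * indicator {\<tau><..} t \<partial>lborel) \<le> ennreal (1 / \<mu>)"
proof -
  have "(\<integral>\<^sup>+t. ennreal (exp (- (\<mu> * (t - \<tau>)))) * indicator {\<tau><..} t \<partial>lborel)
      \<le> (\<integral>\<^sup>+t. ennreal (exp (- (\<mu> * (t - \<tau>)))) * indicator {\<tau>..} t \<partial>lborel)"
    by (intro nn_integral_mono mult_left_mono) (auto simp: indicator_def)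
  also have "\<dots> = ennreal (0 - (- exp (- (\<mu> * (\<tau> - \<tau>))) / \<mu>))"
  proof (rule nn_integral_FTC_atLeast[where F = "\<lambda>t. - exp (- (\<mu> * (t - \<tau>))) / \<mu>" and T = 0])
    have "((\<lambda>t. - exp (- (\<mu> * (t - \<tau>))) / \<mu>) \<longlongrightarrow> - 0 / \<mu>) at_top"
    proof (intro tendsto_intros)
      have "filterlim (\<lambda>t. \<mu> * (t - \<tau>)) at_top at_top"
      proof (rule filterlim_tendsto_pos_mult_at_top[OF tendsto_const assms])
        show "filterlim (\<lambda>t. t - \<tau>) at_top at_top"
          using filterlim_tendsto_add_at_top[OF tendsto_const[of "- \<tau>"] filterlim_ident] by simp
      qed
      then show "((\<lambda>t. exp (- (\<mu> * (t - \<tau>)))) \<longlongrightarrow> 0) at_top"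
        by (intro filterlim_compose[OF exp_at_bot]) (simp add: filterlim_uminus_at_top)
    qed (use assms in auto)
    then show "((\<lambda>t. - exp (- (\<mu> * (t - \<tau>))) / \<mu>) \<longlongrightarrow> 0) at_top" by simp
  qed (use assms in \<open>auto intro!: derivative_eq_intros simp: field_simps\<close>)
  finally show ?thesis by simp
qed

text \<open>With \<open>\<mu> = \<kappa> |k|\<close> this is the gain of a full derivative for
  sources bounded in time; it handles the quadratic term in the critical norm.\<close>

lemma dker_sup:
  assumes "\<mu> > 0" "\<And>\<tau>. a < \<tau> \<Longrightarrow> \<tau> < t \<Longrightarrow> g \<tau> \<le> G"
  shows "dker \<mu> g a t \<le> ennreal (1 / \<mu>) * G"
proof -
  have "dker \<mu> g a t \<le> (\<integral>\<^sup>+\<tau>. ennreal (exp (- (\<mu> * (t - \<tau>)))) * indicator {a<..<t} \<tau> * G \<partial>lborel)"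
    unfolding dker_def using assms(2) by (intro nn_integral_mono) (auto simp: indicator_def intro!: mult_left_mono)
  also have "\<dots> = (\<integral>\<^sup>+\<tau>. ennreal (exp (- (\<mu> * (t - \<tau>)))) * indicator {a<..<t} \<tau> \<partial>lborel) * G"
    by (rule nn_integral_multc) measurable
  also have "\<dots> \<le> ennreal (1 / \<mu>) * G" by (intro mult_right_mono nn_integral_exp_past assms) simp
  finally show ?thesis .
qed

text \<open>From square integrability in time to a bound at fixed time only half a derivative is
  gained, which is why the source is measured in \<open>H^(s - 1/2)\<close>.\<close>

lemma dker_L2:
  assumes "\<mu> > 0" and [measurable]: "g \<in> borel_measurable borel"
  shows "(dker \<mu> g a t)\<^sup>2 \<le> ennreal (1 / (2 * \<mu>)) * (\<integral>\<^sup>+\<tau>. indicator {a<..<t} \<tau> * (g \<tau>)\<^sup>2 \<partial>lborel)"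
proof -
  have "(dker \<mu> g a t)\<^sup>2 = (\<integral>\<^sup>+\<tau>. (ennreal (exp (- (\<mu> * (t - \<tau>)))) * indicator {a<..<t} \<tau>) * (indicator {a<..<t} \<tau> * g \<tau>) \<partial>lborel)\<^sup>2"
    unfolding dker_def by (intro arg_cong[where f = "\<lambda>x. x\<^sup>2"] nn_integral_cong) (auto simp: indicator_def)
  also have "\<dots> \<le> (\<integral>\<^sup>+\<tau>. (ennreal (exp (- (\<mu> * (t - \<tau>)))) * indicator {a<..<t} \<tau>)\<^sup>2 \<partial>lborel)
      * (\<integral>\<^sup>+\<tau>. (indicator {a<..<t} \<tau> * g \<tau>)\<^sup>2 \<partial>lborel)"
    by (rule Cauchy_Schwarz_nn_integral) measurable
  also have "(\<integral>\<^sup>+\<tau>. (ennreal (exp (- (\<mu> * (t - \<tau>)))) * indicator {a<..<t} \<tau>)\<^sup>2 \<partial>lborel)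
     = (\<integral>\<^sup>+\<tau>. ennreal (exp (- ((2 * \<mu>) * (t - \<tau>)))) * indicator {a<..<t} \<tau> \<partial>lborel)"
    by (intro nn_integral_cong) (auto simp: indicator_def power2_eq_square simp flip: ennreal_mult exp_add)
  also have "\<dots> * (\<integral>\<^sup>+\<tau>. (indicator {a<..<t} \<tau> * g \<tau>)\<^sup>2 \<partial>lborel)
    \<le> ennreal (1 / (2 * \<mu>)) * (\<integral>\<^sup>+\<tau>. (indicator {a<..<t} \<tau> * g \<tau>)\<^sup>2 \<partial>lborel)"
    by (intro mult_right_mono nn_integral_exp_past) (use assms in auto)
  also have "(\<integral>\<^sup>+\<tau>. (indicator {a<..<t} \<tau> * g \<tau>)\<^sup>2 \<partial>lborel) = (\<integral>\<^sup>+\<tau>. indicator {a<..<t} \<tau> * (g \<tau>)\<^sup>2 \<partial>lborel)"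
    by (intro nn_integral_cong) (auto simp: indicator_def)
  finally show ?thesis .
qed

text \<open>Schur's test: the kernel integrates to at most \<open>1 / \<mu>\<close> in either
  variable, so a full derivative is gained within \<open>L^2\<close> of time. The condition on
  \<open>I\<close> keeps the past of each of its times inside \<open>I\<close>.\<close>

lemma dker_L2_L2:
  assumes l: "\<mu> > 0" and [measurable]: "g \<in> borel_measurable borel" "I \<in> sets borel"
    and I: "\<And>t. t \<in> I \<Longrightarrow> {0<..<t} \<subseteq> I"
  shows "(\<integral>\<^sup>+t. indicator I t * (dker \<mu> g 0 t)\<^sup>2 \<partial>lborel) \<le> ennreal (1 / \<mu>\<^sup>2) * (\<integral>\<^sup>+\<tau>. indicator I \<tau> * (g \<tau>)\<^sup>2 \<partial>lborel)"
proof -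
  let ?k = "\<lambda>t \<tau>. ennreal (exp (- (\<mu> * (t - \<tau>)))) * indicator {0<..<t} \<tau>"
  have l2: "1 / \<mu>\<^sup>2 = (1 / \<mu>) * (1 / \<mu>)" by (simp add: power2_eq_square)
  have "(dker \<mu> g 0 t)\<^sup>2 \<le> ennreal (1 / \<mu>) * (\<integral>\<^sup>+\<tau>. ?k t \<tau> * (g \<tau>)\<^sup>2 \<partial>lborel)" for t
  proof -
    have "(dker \<mu> g 0 t)\<^sup>2 \<le> (\<integral>\<^sup>+\<tau>. ?k t \<tau> \<partial>lborel) * (\<integral>\<^sup>+\<tau>. ?k t \<tau> * (g \<tau>)\<^sup>2 \<partial>lborel)"
      unfolding dker_def by (rule ennreal_CS) measurable
    also have "\<dots> \<le> ennreal (1 / \<mu>) * (\<integral>\<^sup>+\<tau>. ?k t \<tau> * (g \<tau>)\<^sup>2 \<partial>lborel)"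
      by (intro mult_right_mono nn_integral_exp_past l) simp
    finally show ?thesis .
  qed
  then have "(\<integral>\<^sup>+t. indicator I t * (dker \<mu> g 0 t)\<^sup>2 \<partial>lborel)
     \<le> (\<integral>\<^sup>+t. indicator I t * (ennreal (1 / \<mu>) * (\<integral>\<^sup>+\<tau>. ?k t \<tau> * (g \<tau>)\<^sup>2 \<partial>lborel)) \<partial>lborel)"
    by (intro nn_integral_mono mult_left_mono) auto
  also have "\<dots> = (\<integral>\<^sup>+t. \<integral>\<^sup>+\<tau>. ennreal (1 / \<mu>) * (indicator I t * (?k t \<tau> * (g \<tau>)\<^sup>2)) \<partial>lborel \<partial>lborel)"
  proof (rule nn_integral_cong)
    fix t
    have "indicator I t * (ennreal (1 / \<mu>) * (\<integral>\<^sup>+\<tau>. ?k t \<tau> * (g \<tau>)\<^sup>2 \<partial>lborel))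
      = (ennreal (1 / \<mu>) * indicator I t) * (\<integral>\<^sup>+\<tau>. ?k t \<tau> * (g \<tau>)\<^sup>2 \<partial>lborel)" by (simp add: mult_ac)
    also have "\<dots> = (\<integral>\<^sup>+\<tau>. (ennreal (1 / \<mu>) * indicator I t) * (?k t \<tau> * (g \<tau>)\<^sup>2) \<partial>lborel)"
      by (rule nn_integral_cmult[symmetric]) measurable
    finally show "indicator I t * (ennreal (1 / \<mu>) * (\<integral>\<^sup>+\<tau>. ?k t \<tau> * (g \<tau>)\<^sup>2 \<partial>lborel))
      = (\<integral>\<^sup>+\<tau>. ennreal (1 / \<mu>) * (indicator I t * (?k t \<tau> * (g \<tau>)\<^sup>2)) \<partial>lborel)" by (simp add: mult.assoc)
  qed
  also have "\<dots> = (\<integral>\<^sup>+\<tau>. \<integral>\<^sup>+t. ennreal (1 / \<mu>) * (indicator I t * (?k t \<tau> * (g \<tau>)\<^sup>2)) \<partial>lborel \<partial>lborel)"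
  proof (rule lborel_pair.Fubini')
    let ?D = "{x \<in> space (lborel \<Otimes>\<^sub>M lborel). 0 < (fst x :: real) \<and> fst x < (snd x :: real)}"
    have D: "?D \<in> sets (lborel \<Otimes>\<^sub>M lborel)" by measurable
    have eq: "(\<lambda>x :: real \<times> real. indicator {0<..<snd x} (fst x) :: ennreal) = (indicator ?D :: real \<times> real \<Rightarrow> ennreal)"
      by (auto simp: fun_eq_iff indicator_def space_pair_measure)
    have [measurable]: "(\<lambda>x :: real \<times> real. indicator {0<..<snd x} (fst x) :: ennreal) \<in> borel_measurable (lborel \<Otimes>\<^sub>M lborel)"
      by (subst eq) (rule borel_measurable_indicator[OF D])
    show "(\<lambda>(\<tau>, t). ennreal (1 / \<mu>) * (indicator I t * (?k t \<tau> * (g \<tau>)\<^sup>2))) \<in> borel_measurable (lborel \<Otimes>\<^sub>M lborel)"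
      by (simp add: split_beta') measurable
  qed
  also have "\<dots> \<le> (\<integral>\<^sup>+\<tau>. ennreal (1 / \<mu>) * (ennreal (1 / \<mu>) * (indicator I \<tau> * (g \<tau>)\<^sup>2)) \<partial>lborel)"
  proof (rule nn_integral_mono)
    fix \<tau>
    have "(\<integral>\<^sup>+t. ennreal (1 / \<mu>) * (indicator I t * (?k t \<tau> * (g \<tau>)\<^sup>2)) \<partial>lborel)
       \<le> (\<integral>\<^sup>+t. (ennreal (1 / \<mu>) * (indicator I \<tau> * (g \<tau>)\<^sup>2)) * (ennreal (exp (- (\<mu> * (t - \<tau>)))) * indicator {\<tau><..} t) \<partial>lborel)"
    proof (rule nn_integral_mono)
      fix t
      show "ennreal (1 / \<mu>) * (indicator I t * (?k t \<tau> * (g \<tau>)\<^sup>2))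
         \<le> (ennreal (1 / \<mu>) * (indicator I \<tau> * (g \<tau>)\<^sup>2)) * (ennreal (exp (- (\<mu> * (t - \<tau>)))) * indicator {\<tau><..} t)"
      proof (cases "t \<in> I \<and> 0 < \<tau> \<and> \<tau> < t")
        case True
        then have "\<tau> \<in> I" using I[of t] by auto
        then show ?thesis using True by (simp add: mult_ac)
      qed (auto simp: indicator_def)
    qed
    also have "\<dots> = (ennreal (1 / \<mu>) * (indicator I \<tau> * (g \<tau>)\<^sup>2)) * (\<integral>\<^sup>+t. ennreal (exp (- (\<mu> * (t - \<tau>)))) * indicator {\<tau><..} t \<partial>lborel)"
      by (rule nn_integral_cmult) measurable
    also have "\<dots> \<le> (ennreal (1 / \<mu>) * (indicator I \<tau> * (g \<tau>)\<^sup>2)) * ennreal (1 / \<mu>)"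
      by (intro mult_left_mono nn_integral_exp_future l) simp
    finally show "(\<integral>\<^sup>+t. ennreal (1 / \<mu>) * (indicator I t * (?k t \<tau> * (g \<tau>)\<^sup>2)) \<partial>lborel)
       \<le> ennreal (1 / \<mu>) * (ennreal (1 / \<mu>) * (indicator I \<tau> * (g \<tau>)\<^sup>2))" by (simp add: mult_ac)
  qed
  also have "\<dots> = ennreal (1 / \<mu>\<^sup>2) * (\<integral>\<^sup>+\<tau>. indicator I \<tau> * (g \<tau>)\<^sup>2 \<partial>lborel)"
    using l by (simp only: l2 ennreal_mult zero_le_divide_1_iff less_imp_le mult.assoc)
      (simp add: nn_integral_cmult)
  finally show ?thesis .
qed

section \<open>The integrated differential equation of a mode\<close>

lemma continuous_indefinite_integral:
  fixes h :: "real \<Rightarrow> complex"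
  assumes h: "set_integrable lborel {0<..<T} h"
  shows "continuous_on {0..T} (\<lambda>t. LINT \<tau>:{0<..<t}|lborel. h \<tau>)"
  unfolding continuous_on_sequentially
proof (intro ballI allI impI)
  fix x u assume x: "x \<in> {0..T}" and u: "(\<forall>n. u n \<in> {0..T}) \<and> u \<longlonglongrightarrow> x"
  have "(\<lambda>n. LINT \<tau>|lborel. indicator {0<..<u n} \<tau> *\<^sub>R h \<tau>) \<longlonglongrightarrow> (LINT \<tau>|lborel. indicator {0<..<x} \<tau> *\<^sub>R h \<tau>)"
  proof (rule integral_dominated_convergence[where w = "\<lambda>\<tau>. norm (indicator {0<..<T} \<tau> *\<^sub>R h \<tau>)"])
    show "(\<lambda>\<tau>. indicator {0<..<x} \<tau> *\<^sub>R h \<tau>) \<in> borel_measurable lborel"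
      using set_integrable_sub[OF h, of 0 x] x unfolding set_integrable_def by auto
    show "(\<lambda>\<tau>. indicator {0<..<u n} \<tau> *\<^sub>R h \<tau>) \<in> borel_measurable lborel" for n
      using set_integrable_sub[OF h, of 0 "u n"] u unfolding set_integrable_def by auto
    show "integrable lborel (\<lambda>\<tau>. norm (indicator {0<..<T} \<tau> *\<^sub>R h \<tau>))"
      using h unfolding set_integrable_def by (rule integrable_norm)
    show "AE \<tau> in lborel. norm (indicator {0<..<u n} \<tau> *\<^sub>R h \<tau>) \<le> norm (indicator {0<..<T} \<tau> *\<^sub>R h \<tau>)" for n
    proof (rule AE_I2)
      fix \<tau>
      have "u n \<le> T" using u by auto
      then show "norm (indicator {0<..<u n} \<tau> *\<^sub>R h \<tau>) \<le> norm (indicator {0<..<T} \<tau> *\<^sub>R h \<tau>)"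
        by (auto simp: indicator_def)
    qed
    have "AE \<tau> in lborel. \<tau> \<noteq> x" by (rule AE_lborel_singleton)
    then show "AE \<tau> in lborel. (\<lambda>n. indicator {0<..<u n} \<tau> *\<^sub>R h \<tau>) \<longlonglongrightarrow> indicator {0<..<x} \<tau> *\<^sub>R h \<tau>"
    proof eventually_elim
      case (elim \<tau>)
      have "eventually (\<lambda>n. indicat_real {0<..<u n} \<tau> = indicator {0<..<x} \<tau>) sequentially"
      proof (cases "\<tau> < x")
        case True
        then have "eventually (\<lambda>n. \<tau> < u n) sequentially" using u order_tendstoD(1) by blast
        then show ?thesis by eventually_elim (use True in \<open>auto simp: indicator_def\<close>)
      next
        case False
        then have "x < \<tau>" using elim by auto
        then have "eventually (\<lambda>n. u n < \<tau>) sequentially" using u order_tendstoD(2) by blast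
        then show ?thesis by eventually_elim (use False in \<open>auto simp: indicator_def\<close>)
      qed
      then have "eventually (\<lambda>n. indicat_real {0<..<u n} \<tau> *\<^sub>R h \<tau> = indicator {0<..<x} \<tau> *\<^sub>R h \<tau>) sequentially"
        by eventually_elim simp
      then show ?case by (rule tendsto_eventually)
    qed
  qed
  then show "((\<lambda>t. LINT \<tau>:{0<..<t}|lborel. h \<tau>) \<circ> u) \<longlonglongrightarrow> (LINT \<tau>:{0<..<x}|lborel. h \<tau>)"
    by (simp add: set_lebesgue_integral_def o_def)
qed

lemma continuous_duhamel:
  assumes "set_integrable lborel {0<..<T} g" "\<mu> \<ge> 0"
  shows "continuous_on {0..T} (duhamel \<mu> y0 g)"
  unfolding duhamel_def[abs_def]
  by (intro continuous_intros continuous_indefinite_integral set_integrable_exp assms)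

lemma set_integral_exp:
  fixes a b \<mu> :: real
  assumes "a \<le> b"
  shows "set_integrable lborel {a<..<b} (\<lambda>\<sigma>. \<mu> * exp (- (\<mu> * \<sigma>)))"
    and "(LINT \<sigma>:{a<..<b}|lborel. \<mu> * exp (- (\<mu> * \<sigma>))) = exp (- (\<mu> * a)) - exp (- (\<mu> * b))"
proof -
  have "has_bochner_integral lborel (\<lambda>x. indicator {a..b} x *\<^sub>R (\<mu> * exp (- (\<mu> * x)))) (- exp (- (\<mu> * b)) - (- exp (- (\<mu> * a))))"
  proof (rule has_bochner_integral_FTC_Icc[OF assms])
    show "((\<lambda>x. - exp (- (\<mu> * x))) has_vector_derivative \<mu> * exp (- (\<mu> * x))) (at x within {a..b})" for x
      unfolding has_real_derivative_iff_has_vector_derivative[symmetric]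
      by (auto intro!: derivative_eq_intros)
  qed (intro continuous_intros)
  then have *: "has_bochner_integral lborel (\<lambda>x. indicator {a<..<b} x *\<^sub>R (\<mu> * exp (- (\<mu> * x)))) (exp (- (\<mu> * a)) - exp (- (\<mu> * b)))"
  proof (subst has_bochner_integral_cong_AE)
    have "AE x in lborel. x \<noteq> a" "AE x in lborel. x \<noteq> b" by (rule AE_lborel_singleton)+
    then show "AE x in lborel. indicat_real {a<..<b} x *\<^sub>R (\<mu> * exp (- (\<mu> * x))) = indicat_real {a..b} x *\<^sub>R (\<mu> * exp (- (\<mu> * x)))"
      by eventually_elim (auto simp: indicator_def)
  qed auto
  then show "set_integrable lborel {a<..<b} (\<lambda>\<sigma>. \<mu> * exp (- (\<mu> * \<sigma>)))"
    "(LINT \<sigma>:{a<..<b}|lborel. \<mu> * exp (- (\<mu> * \<sigma>))) = exp (- (\<mu> * a)) - exp (- (\<mu> * b))"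
    unfolding set_integrable_def set_lebesgue_integral_def by (auto simp: has_bochner_integral_iff)
qed

text \<open>Fubini over the triangle \<open>0 < \<tau> < \<sigma> < t\<close>; the inner integral
  over \<open>\<sigma>\<close> is an explicit difference of exponentials.\<close>

lemma integral_duhamel_exp:
  fixes g :: "real \<Rightarrow> complex"
  assumes [measurable]: "g \<in> borel_measurable borel" and g: "set_integrable lborel {0<..<t} g"
    and mu: "\<mu> \<ge> 0" and t: "t \<ge> 0"
  shows "(LINT \<sigma>:{0<..<t}|lborel. (\<mu> * exp (- (\<mu> * \<sigma>))) *\<^sub>R (LINT \<tau>:{0<..<\<sigma>}|lborel. exp (\<mu> * \<tau>) *\<^sub>R g \<tau>))
     = (LINT \<tau>:{0<..<t}|lborel. g \<tau> - exp (- (\<mu> * t)) *\<^sub>R (exp (\<mu> * \<tau>) *\<^sub>R g \<tau>))"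
proof -
  define f where "f \<sigma> \<tau> = (indicator {0<..<t} \<sigma> * indicator {0<..<\<sigma>} \<tau> * (\<mu> * exp (- (\<mu> * \<sigma>)))) *\<^sub>R (exp (\<mu> * \<tau>) *\<^sub>R g \<tau>)" for \<sigma> \<tau>
  let ?D = "{x \<in> space (lborel \<Otimes>\<^sub>M lborel). 0 < (snd x :: real) \<and> snd x < (fst x :: real)}"
  have D: "?D \<in> sets (lborel \<Otimes>\<^sub>M lborel)" by measurable
  have eq: "(\<lambda>x :: real \<times> real. indicator {0<..<fst x} (snd x) :: real) = indicator ?D"
    by (auto simp: fun_eq_iff indicator_def space_pair_measure)
  have [measurable]: "(\<lambda>x :: real \<times> real. indicator {0<..<fst x} (snd x) :: real) \<in> borel_measurable (lborel \<Otimes>\<^sub>M lborel)"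
    by (subst eq) (rule borel_measurable_indicator[OF D])
  have fm: "(\<lambda>(\<sigma>, \<tau>). f \<sigma> \<tau>) \<in> borel_measurable (lborel \<Otimes>\<^sub>M lborel)"
    unfolding f_def by (simp add: split_beta') measurable
  have int: "integrable (lborel \<Otimes>\<^sub>M lborel) (\<lambda>(\<sigma>, \<tau>). f \<sigma> \<tau>)"
  proof (rule integrableI_bounded[OF fm])
    have b: "ennreal (norm (f \<sigma> \<tau>)) \<le> (ennreal \<mu> * indicator {0<..<t} \<sigma>) * ennreal (norm (indicator {0<..<t} \<tau> *\<^sub>R g \<tau>))" for \<sigma> \<tau>
    proof (cases "0 < \<tau> \<and> \<tau> < \<sigma> \<and> \<sigma> < t")
      case True
      have "exp (- (\<mu> * \<sigma>)) * exp (\<mu> * \<tau>) = exp (- (\<mu> * (\<sigma> - \<tau>)))" by (simp add: exp_add[symmetric] algebra_simps)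
      also have "\<dots> \<le> 1" using mu True by simp
      finally have "\<mu> * (exp (- (\<mu> * \<sigma>)) * exp (\<mu> * \<tau>)) * norm (g \<tau>) \<le> \<mu> * 1 * norm (g \<tau>)"
        using mu by (intro mult_right_mono mult_left_mono) auto
      then have "norm (f \<sigma> \<tau>) \<le> \<mu> * norm (g \<tau>)" using True mu by (simp add: f_def abs_mult mult.assoc)
      then show ?thesis using True mu by (simp add: ennreal_mult[symmetric] ennreal_leI)
    qed (auto simp: f_def indicator_def)
    have "(\<integral>\<^sup>+z. ennreal (norm (case z of (\<sigma>, \<tau>) \<Rightarrow> f \<sigma> \<tau>)) \<partial>(lborel \<Otimes>\<^sub>M lborel))
        = (\<integral>\<^sup>+\<sigma>. \<integral>\<^sup>+\<tau>. ennreal (norm (f \<sigma> \<tau>)) \<partial>lborel \<partial>lborel)"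
      using fm by (subst lborel.nn_integral_fst[symmetric]) auto
    also have "\<dots> \<le> (\<integral>\<^sup>+\<sigma>. \<integral>\<^sup>+\<tau>. (ennreal \<mu> * indicator {0<..<t} \<sigma>) * ennreal (norm (indicator {0<..<t} \<tau> *\<^sub>R g \<tau>)) \<partial>lborel \<partial>lborel)"
      by (intro nn_integral_mono b)
    also have "\<dots> = (\<integral>\<^sup>+\<sigma>. (ennreal \<mu> * indicator {0<..<t} \<sigma>) * (\<integral>\<^sup>+\<tau>. ennreal (norm (indicator {0<..<t} \<tau> *\<^sub>R g \<tau>)) \<partial>lborel) \<partial>lborel)"
      by (intro nn_integral_cong nn_integral_cmult) measurable
    also have "\<dots> = (\<integral>\<^sup>+\<sigma>. ennreal \<mu> * indicator {0<..<t} \<sigma> \<partial>lborel) * (\<integral>\<^sup>+\<tau>. ennreal (norm (indicator {0<..<t} \<tau> *\<^sub>R g \<tau>)) \<partial>lborel)"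
      by (rule nn_integral_multc) measurable
    also have "\<dots> < \<infinity>"
    proof -
      have "(\<integral>\<^sup>+\<tau>. ennreal (norm (indicator {0<..<t} \<tau> *\<^sub>R g \<tau>)) \<partial>lborel) < \<infinity>"
        using g unfolding set_integrable_def integrable_iff_bounded by simp
      moreover have "(\<integral>\<^sup>+\<sigma>. ennreal \<mu> * indicator {0<..<t} \<sigma> \<partial>lborel) < \<infinity>"
        using t by (simp add: nn_integral_cmult_indicator ennreal_mult_less_top)
      ultimately show ?thesis by (simp add: ennreal_mult_less_top)
    qed
    finally show "(\<integral>\<^sup>+z. ennreal (norm (case z of (\<sigma>, \<tau>) \<Rightarrow> f \<sigma> \<tau>)) \<partial>(lborel \<Otimes>\<^sub>M lborel)) < \<infinity>" .
  qed
  have "(LINT \<sigma>|lborel. LINT \<tau>|lborel. f \<sigma> \<tau>) = (LINT \<tau>|lborel. LINT \<sigma>|lborel. f \<sigma> \<tau>)"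
    by (rule lborel_pair.Fubini_integral[OF int, symmetric])
  also have "(LINT \<sigma>|lborel. LINT \<tau>|lborel. f \<sigma> \<tau>)
     = (LINT \<sigma>:{0<..<t}|lborel. (\<mu> * exp (- (\<mu> * \<sigma>))) *\<^sub>R (LINT \<tau>:{0<..<\<sigma>}|lborel. exp (\<mu> * \<tau>) *\<^sub>R g \<tau>))"
    unfolding set_lebesgue_integral_def
  proof (rule Bochner_Integration.integral_cong[OF refl])
    fix \<sigma>
    have "f \<sigma> \<tau> = (indicator {0<..<t} \<sigma> * (\<mu> * exp (- (\<mu> * \<sigma>)))) *\<^sub>R (indicator {0<..<\<sigma>} \<tau> *\<^sub>R exp (\<mu> * \<tau>) *\<^sub>R g \<tau>)" for \<tau>
      by (simp add: f_def mult_ac)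
    then show "(LINT \<tau>|lborel. f \<sigma> \<tau>) = indicator {0<..<t} \<sigma> *\<^sub>R (\<mu> * exp (- (\<mu> * \<sigma>))) *\<^sub>R (LINT \<tau>|lborel. indicator {0<..<\<sigma>} \<tau> *\<^sub>R exp (\<mu> * \<tau>) *\<^sub>R g \<tau>)"
      by (simp only: integral_scaleR_right) simp
  qed
  also have "(LINT \<tau>|lborel. LINT \<sigma>|lborel. f \<sigma> \<tau>)
     = (LINT \<tau>:{0<..<t}|lborel. g \<tau> - exp (- (\<mu> * t)) *\<^sub>R (exp (\<mu> * \<tau>) *\<^sub>R g \<tau>))"
    unfolding set_lebesgue_integral_def
  proof (rule Bochner_Integration.integral_cong[OF refl])
    fix \<tau>
    show "(LINT \<sigma>|lborel. f \<sigma> \<tau>) = indicator {0<..<t} \<tau> *\<^sub>R (g \<tau> - exp (- (\<mu> * t)) *\<^sub>R (exp (\<mu> * \<tau>) *\<^sub>R g \<tau>))"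
    proof (cases "0 < \<tau> \<and> \<tau> < t")
      case True
      then have le: "\<tau> \<le> t" by simp
      have "f \<sigma> \<tau> = (indicator {\<tau><..<t} \<sigma> *\<^sub>R (\<mu> * exp (- (\<mu> * \<sigma>)))) *\<^sub>R (exp (\<mu> * \<tau>) *\<^sub>R g \<tau>)" for \<sigma>
        using True by (auto simp: f_def indicator_def)
      then have "(LINT \<sigma>|lborel. f \<sigma> \<tau>) = (LINT \<sigma>:{\<tau><..<t}|lborel. \<mu> * exp (- (\<mu> * \<sigma>))) *\<^sub>R (exp (\<mu> * \<tau>) *\<^sub>R g \<tau>)"
        using set_integral_exp(1)[OF le, of \<mu>] unfolding set_lebesgue_integral_def set_integrable_def
        by (simp only: integral_scaleR_left)
      also have "\<dots> = (exp (- (\<mu> * \<tau>)) - exp (- (\<mu> * t))) *\<^sub>R (exp (\<mu> * \<tau>) *\<^sub>R g \<tau>)"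
        by (simp only: set_integral_exp(2)[OF le])
      also have "\<dots> = g \<tau> - exp (- (\<mu> * t)) *\<^sub>R (exp (\<mu> * \<tau>) *\<^sub>R g \<tau>)"
        by (simp add: exp_minus left_diff_distrib scaleR_diff_left)
      finally show ?thesis using True by simp
    next
      case False
      then have "f \<sigma> \<tau> = 0" for \<sigma> by (auto simp: f_def indicator_def)
      then show ?thesis using False by auto
    qed
  qed
  finally show ?thesis .
qed

text \<open>This is the integrated form in which the weak formulation delivers the equation. As
  \<open>g\<close> is merely integrable, the Fubini identity \<open>integral_duhamel_exp\<close>
  takes the place of differentiation.\<close>

lemma duhamel_ode:
  assumes [measurable]: "g \<in> borel_measurable borel" and g: "set_integrable lborel {0<..<t} g"
    and mu: "\<mu> \<ge> 0" and t: "t \<ge> 0"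
  shows "duhamel \<mu> y0 g t = y0 + (LINT \<tau>:{0<..<t}|lborel. g \<tau> - \<mu> *\<^sub>R duhamel \<mu> y0 g \<tau>)"
proof -
  define F where "F \<sigma> = (LINT \<tau>:{0<..<\<sigma>}|lborel. exp (\<mu> * \<tau>) *\<^sub>R g \<tau>)" for \<sigma>
  have cF: "continuous_on {0..t} F"
    unfolding F_def[abs_def] by (intro continuous_indefinite_integral set_integrable_exp g mu)
  have eg: "set_integrable lborel {0<..<t} (\<lambda>\<tau>. exp (\<mu> * \<tau>) *\<^sub>R g \<tau>)" by (intro set_integrable_exp g mu)
  have cont: "set_integrable lborel {0<..<t} h" if "continuous_on {0..t} h" for h :: "real \<Rightarrow> complex"
    by (rule set_integrable_subset[OF borel_integrable_atLeastAtMost'[OF that]]) auto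
  have d: "\<mu> *\<^sub>R duhamel \<mu> y0 g \<sigma> = (\<mu> * exp (- (\<mu> * \<sigma>))) *\<^sub>R y0 + (\<mu> * exp (- (\<mu> * \<sigma>))) *\<^sub>R F \<sigma>" for \<sigma>
    by (simp add: duhamel_def F_def scaleR_add_right)
  have i1: "set_integrable lborel {0<..<t} (\<lambda>\<sigma>. (\<mu> * exp (- (\<mu> * \<sigma>))) *\<^sub>R y0)"
    and i2: "set_integrable lborel {0<..<t} (\<lambda>\<sigma>. (\<mu> * exp (- (\<mu> * \<sigma>))) *\<^sub>R F \<sigma>)"
    by (intro cont continuous_intros cF)+
  have "(LINT \<tau>:{0<..<t}|lborel. g \<tau> - \<mu> *\<^sub>R duhamel \<mu> y0 g \<tau>)
     = (LINT \<tau>:{0<..<t}|lborel. g \<tau>) - ((LINT \<tau>:{0<..<t}|lborel. (\<mu> * exp (- (\<mu> * \<tau>))) *\<^sub>R y0) +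
        (LINT \<sigma>:{0<..<t}|lborel. (\<mu> * exp (- (\<mu> * \<sigma>))) *\<^sub>R F \<sigma>))"
    unfolding d set_integral_add(2)[OF i1 i2, symmetric]
    by (rule set_integral_diff(2)[OF g set_integral_add(1)[OF i1 i2]])
  also have "(LINT \<tau>:{0<..<t}|lborel. (\<mu> * exp (- (\<mu> * \<tau>))) *\<^sub>R y0) = (1 - exp (- (\<mu> * t))) *\<^sub>R y0"
  proof -
    have "(LINT \<tau>:{0<..<t}|lborel. (\<mu> * exp (- (\<mu> * \<tau>))) *\<^sub>R y0) = (LINT \<tau>:{0<..<t}|lborel. \<mu> * exp (- (\<mu> * \<tau>))) *\<^sub>R y0"
    proof -
      have "indicat_real {0<..<t} x *\<^sub>R ((\<mu> * exp (- (\<mu> * x))) *\<^sub>R y0) = (indicat_real {0<..<t} x *\<^sub>R (\<mu> * exp (- (\<mu> * x)))) *\<^sub>R y0" for x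
        by simp
      then show ?thesis
        using set_integral_exp(1)[OF t, of \<mu>] unfolding set_lebesgue_integral_def set_integrable_def
        by (simp only: integral_scaleR_left)
    qed
    then show ?thesis by (simp only: set_integral_exp(2)[OF t]) simp
  qed
  also have "(LINT \<sigma>:{0<..<t}|lborel. (\<mu> * exp (- (\<mu> * \<sigma>))) *\<^sub>R F \<sigma>)
    = (LINT \<tau>:{0<..<t}|lborel. g \<tau>) - exp (- (\<mu> * t)) *\<^sub>R F t"
    unfolding F_def integral_duhamel_exp[OF assms]
    using set_integral_diff(2)[OF g set_integrable_scaleR_right[OF eg], of "exp (- (\<mu> * t))"]
    by (simp only: set_integral_scaleR_right)
  finally show ?thesis by (simp add: duhamel_def F_def scaleR_add_right scaleR_diff_left)
qed

lemma nn_integral_exp_L2: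
  assumes "\<mu> > 0"
  shows "(\<integral>\<^sup>+t. indicator {0<..} t * (ennreal (exp (- (\<mu> * t))) * ennreal (norm y))\<^sup>2 \<partial>lborel)
     \<le> ennreal (1 / (2 * \<mu>)) * (ennreal (norm y))\<^sup>2"
proof -
  have "(\<integral>\<^sup>+t. indicator {0<..} t * (ennreal (exp (- (\<mu> * t))) * ennreal (norm y))\<^sup>2 \<partial>lborel)
    = (\<integral>\<^sup>+t. ennreal (exp (- ((2 * \<mu>) * (t - 0)))) * indicator {0<..} t * (ennreal (norm y))\<^sup>2 \<partial>lborel)"
  proof (rule nn_integral_cong)
    fix t
    have "(ennreal (exp (- (\<mu> * t))))\<^sup>2 = ennreal (exp (- ((2 * \<mu>) * (t - 0))))"
      by (simp add: power2_eq_square ennreal_mult[symmetric] exp_add[symmetric])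
    then show "indicator {0<..} t * (ennreal (exp (- (\<mu> * t))) * ennreal (norm y))\<^sup>2
      = ennreal (exp (- ((2 * \<mu>) * (t - 0)))) * indicator {0<..} t * (ennreal (norm y))\<^sup>2"
      by (simp add: power_mult_distrib mult_ac)
  qed
  also have "\<dots> = (\<integral>\<^sup>+t. ennreal (exp (- ((2 * \<mu>) * (t - 0)))) * indicator {0<..} t \<partial>lborel) * (ennreal (norm y))\<^sup>2"
    by (rule nn_integral_multc) measurable
  also have "\<dots> \<le> ennreal (1 / (2 * \<mu>)) * (ennreal (norm y))\<^sup>2"
    by (intro mult_right_mono nn_integral_exp_future) (use assms in auto)
  finally show ?thesis .
qed

text \<open>The difference \<open>z\<close> to the Duhamel solution is \<open>- \<mu>\<close> times
  its own indefinite integral. In the supremum weighted by \<open>exp (- 2 \<mu> t)\<close> this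
  operator has norm at most \<open>1/2\<close>, which forces \<open>z = 0\<close>.\<close>

lemma duhamel_unique:
  assumes mu: "\<mu> \<ge> 0" and [measurable]: "g \<in> borel_measurable borel" and g: "set_integrable lborel {0<..<T} g"
    and y: "set_integrable lborel {0<..<T} y"
    and eq: "\<And>t. t \<in> {0<..<T} \<Longrightarrow> y t = y0 + (LINT \<tau>:{0<..<t}|lborel. g \<tau> - \<mu> *\<^sub>R y \<tau>)"
    and t0: "t0 \<in> {0<..<T}"
  shows "y t0 = duhamel \<mu> y0 g t0"
proof (cases "\<mu> = 0")
  case True
  then show ?thesis using eq[OF t0] by (simp add: duhamel_def)
next
  case False
  then have mp: "\<mu> > 0" using mu by simp
  define d where "d = duhamel \<mu> y0 g"
  have T: "T > 0" using t0 by auto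
  have cd: "continuous_on {0..T} d" unfolding d_def by (rule continuous_duhamel[OF g mu])
  have di: "set_integrable lborel {0<..<T} d"
    by (rule set_integrable_subset[OF borel_integrable_atLeastAtMost'[OF cd]]) auto
  define z where "z t = y t - d t" for t
  have zi: "set_integrable lborel {0<..<T} z" unfolding z_def by (rule set_integral_diff(1)[OF y di])
  have gy: "set_integrable lborel {0<..<T} (\<lambda>\<tau>. g \<tau> - \<mu> *\<^sub>R y \<tau>)"
    by (intro set_integral_diff(1) g set_integrable_scaleR_right) (use y in auto)
  have zeq: "z t = - (LINT \<tau>:{0<..<t}|lborel. \<mu> *\<^sub>R z \<tau>)" if t: "t \<in> {0<..<T}" for t
  proof -
    have sub: "set_integrable lborel {0<..<t} h" if "set_integrable lborel {0<..<T} h" for h :: "real \<Rightarrow> complex"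
      using set_integrable_sub[OF that, of 0 t] t by auto
    have i1: "set_integrable lborel {0<..<t} (\<lambda>\<tau>. g \<tau> - \<mu> *\<^sub>R y \<tau>)" using sub[OF gy] .
    have i2: "set_integrable lborel {0<..<t} (\<lambda>\<tau>. g \<tau> - \<mu> *\<^sub>R d \<tau>)"
      by (intro set_integral_diff(1) sub g set_integrable_scaleR_right) (use di in auto)
    have "z t = (LINT \<tau>:{0<..<t}|lborel. g \<tau> - \<mu> *\<^sub>R y \<tau>) - (LINT \<tau>:{0<..<t}|lborel. g \<tau> - \<mu> *\<^sub>R d \<tau>)"
      unfolding z_def eq[OF t] using duhamel_ode[OF _ sub[OF g] mu, of y0] t unfolding d_def by simp
    also have "\<dots> = (LINT \<tau>:{0<..<t}|lborel. - (\<mu> *\<^sub>R z \<tau>))"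
      unfolding set_integral_diff(2)[OF i1 i2, symmetric] by (simp add: z_def algebra_simps)
    also have "\<dots> = - (LINT \<tau>:{0<..<t}|lborel. \<mu> *\<^sub>R z \<tau>)"
      by (rule set_integral_uminus) (intro set_integrable_scaleR_right sub zi)
    finally show ?thesis .
  qed
  define m where "m = (SUP t\<in>{0<..<T}. ennreal (exp (- (2 * \<mu> * t)) * norm (z t)))"
  have mle: "ennreal (exp (- (2 * \<mu> * t)) * norm (z t)) \<le> m" if "t \<in> {0<..<T}" for t
    unfolding m_def by (rule SUP_upper[OF that])
  \<comment> \<open>\<open>z\<close> is only known to be integrable. Its own equation bounds it, so
    that \<open>m\<close> is finite and \<open>m <= m / 2\<close> becomes conclusive.\<close>
  have bnd: "norm (z t) \<le> \<mu> * (LINT \<tau>|lborel. norm (indicator {0<..<T} \<tau> *\<^sub>R z \<tau>))" if t: "t \<in> {0<..<T}" for t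
  proof -
    have zi': "set_integrable lborel {0<..<t} z" using set_integrable_sub[OF zi, of 0 t] t by auto
    have "norm (z t) = norm (LINT \<tau>:{0<..<t}|lborel. \<mu> *\<^sub>R z \<tau>)" by (subst zeq[OF t]) simp
    also have "\<dots> = \<mu> * norm (LINT \<tau>:{0<..<t}|lborel. z \<tau>)" using mu by simp
    also have "norm (LINT \<tau>:{0<..<t}|lborel. z \<tau>) \<le> (LINT \<tau>|lborel. norm (indicator {0<..<t} \<tau> *\<^sub>R z \<tau>))"
      unfolding set_lebesgue_integral_def by (rule integral_norm_bound)
    also have "\<dots> \<le> (LINT \<tau>|lborel. norm (indicator {0<..<T} \<tau> *\<^sub>R z \<tau>))"
    proof (rule integral_mono[OF integrable_norm[OF zi'[unfolded set_integrable_def]] integrable_norm[OF zi[unfolded set_integrable_def]]])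
      show "norm (indicator {0<..<t} \<tau> *\<^sub>R z \<tau>) \<le> norm (indicator {0<..<T} \<tau> *\<^sub>R z \<tau>)" for \<tau>
        using t by (auto simp: indicator_def)
    qed
    finally show ?thesis using mu by (simp add: mult_left_mono)
  qed
  have fin: "m < \<infinity>"
  proof -
    have "m \<le> ennreal (\<mu> * (LINT \<tau>|lborel. norm (indicator {0<..<T} \<tau> *\<^sub>R z \<tau>)))"
      unfolding m_def
    proof (rule SUP_least)
      fix t assume t: "t \<in> {0<..<T}"
      have "exp (- (2 * \<mu> * t)) * norm (z t) \<le> 1 * norm (z t)"
        using t mu by (intro mult_right_mono) auto
      then show "ennreal (exp (- (2 * \<mu> * t)) * norm (z t)) \<le> ennreal (\<mu> * (LINT \<tau>|lborel. norm (indicator {0<..<T} \<tau> *\<^sub>R z \<tau>)))"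
        using bnd[OF t] by (intro ennreal_leI) linarith
    qed
    then show ?thesis by (simp add: le_less_trans)
  qed
  have pt: "ennreal (exp (- (2 * \<mu> * t)) * norm (z t)) \<le> ennreal (1/2) * m" if t: "t \<in> {0<..<T}" for t
  proof -
    have "ennreal (exp (- (2 * \<mu> * t)) * norm (z t)) = ennreal (exp (- (2 * \<mu> * t))) * ennreal (norm (LINT \<tau>:{0<..<t}|lborel. \<mu> *\<^sub>R z \<tau>))"
      by (subst zeq[OF t]) (simp add: ennreal_mult)
    also have "\<dots> \<le> ennreal (exp (- (2 * \<mu> * t))) * (\<integral>\<^sup>+\<tau>. indicator {0<..<t} \<tau> * ennreal (norm (\<mu> *\<^sub>R z \<tau>)) \<partial>lborel)"
      by (intro mult_left_mono norm_set_integral_le) simp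
    also have "\<dots> \<le> ennreal (exp (- (2 * \<mu> * t))) * (\<integral>\<^sup>+\<tau>. indicator {0<..<t} \<tau> * (ennreal (\<mu> * exp (2 * \<mu> * \<tau>)) * m) \<partial>lborel)"
    proof (rule mult_left_mono[OF nn_integral_mono])
      fix \<tau>
      show "indicator {0<..<t} \<tau> * ennreal (norm (\<mu> *\<^sub>R z \<tau>)) \<le> indicator {0<..<t} \<tau> * (ennreal (\<mu> * exp (2 * \<mu> * \<tau>)) * m)"
      proof (cases "\<tau> \<in> {0<..<t}")
        case True
        then have tau: "\<tau> \<in> {0<..<T}" using t by auto
        have "norm (\<mu> *\<^sub>R z \<tau>) = (\<mu> * exp (2 * \<mu> * \<tau>)) * (exp (- (2 * \<mu> * \<tau>)) * norm (z \<tau>))"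
          using mu by (simp add: exp_minus)
        then have "ennreal (norm (\<mu> *\<^sub>R z \<tau>)) = ennreal (\<mu> * exp (2 * \<mu> * \<tau>)) * ennreal (exp (- (2 * \<mu> * \<tau>)) * norm (z \<tau>))"
          using mu by (simp only: ennreal_mult mult_nonneg_nonneg exp_ge_zero norm_ge_zero)
        also have "\<dots> \<le> ennreal (\<mu> * exp (2 * \<mu> * \<tau>)) * m" by (intro mult_left_mono mle[OF tau]) simp
        finally show ?thesis by (intro mult_left_mono) auto
      qed simp
    qed simp
    also have "\<dots> = (\<integral>\<^sup>+\<tau>. ennreal (exp (- (2 * \<mu> * t))) * (indicator {0<..<t} \<tau> * (ennreal (\<mu> * exp (2 * \<mu> * \<tau>)) * m)) \<partial>lborel)"
      by (rule nn_integral_cmult[symmetric]) measurable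
    also have "\<dots> = (\<integral>\<^sup>+\<tau>. (ennreal (exp (- (2 * \<mu> * (t - \<tau>)))) * indicator {0<..<t} \<tau>) * (ennreal \<mu> * m) \<partial>lborel)"
    proof (rule nn_integral_cong)
      fix \<tau>
      have "exp (- (2 * \<mu> * t)) * (\<mu> * exp (2 * \<mu> * \<tau>)) = exp (- (2 * \<mu> * (t - \<tau>))) * \<mu>"
        by (simp add: exp_add[symmetric] algebra_simps)
      then have "ennreal (exp (- (2 * \<mu> * t))) * ennreal (\<mu> * exp (2 * \<mu> * \<tau>)) = ennreal (exp (- (2 * \<mu> * (t - \<tau>)))) * ennreal \<mu>"
        using mu by (simp add: ennreal_mult[symmetric])
      then show "ennreal (exp (- (2 * \<mu> * t))) * (indicator {0<..<t} \<tau> * (ennreal (\<mu> * exp (2 * \<mu> * \<tau>)) * m))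
        = (ennreal (exp (- (2 * \<mu> * (t - \<tau>)))) * indicator {0<..<t} \<tau>) * (ennreal \<mu> * m)"
        by (simp add: mult_ac)
    qed
    also have "\<dots> = (\<integral>\<^sup>+\<tau>. ennreal (exp (- (2 * \<mu> * (t - \<tau>)))) * indicator {0<..<t} \<tau> \<partial>lborel) * (ennreal \<mu> * m)"
      by (rule nn_integral_multc) measurable
    also have "\<dots> \<le> ennreal (1 / (2 * \<mu>)) * (ennreal \<mu> * m)"
      by (intro mult_right_mono nn_integral_exp_past) (use mp in auto)
    also have "\<dots> = ennreal (1/2) * m"
      using mp by (simp add: mult.assoc[symmetric] ennreal_mult[symmetric])
    finally show ?thesis .
  qed
  have half: "m \<le> ennreal (1/2) * m"
    by (subst m_def) (rule SUP_least, rule pt)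
  have "m = 0"
  proof (cases m)
    case (real r)
    have "ennreal (1/2) * ennreal r = ennreal (1/2 * r)" using real by (intro ennreal_mult[symmetric]) auto
    then have "ennreal r \<le> ennreal (1/2 * r)" using half real by simp
    then have "r \<le> 1/2 * r" using real ennreal_le_iff[of "1/2 * r" r] by simp
    then show ?thesis using real by simp
  qed (use fin in auto)
  then have "z t0 = 0" using mle[OF t0] by simp
  then show ?thesis by (simp add: z_def d_def)
qed

section \<open>The bilinear term\<close>

definition aw :: "(int^3 \<Rightarrow> complex) \<Rightarrow> int^3 \<Rightarrow> ennreal" where
  "aw \<theta> k = ennreal (kn k * cmod (\<theta> k))"

text \<open>The scaling-critical norm. Its weight matches the bound on the kernel, so that the
  quadratic term is continuous from it into summable sequences. The zero mode has weight 0.\<close>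

definition AN :: "(int^3 \<Rightarrow> complex) \<Rightarrow> ennreal" where
  "AN \<theta> = (\<integral>\<^sup>+k. aw \<theta> k \<partial>K)"

lemma aw_0 [simp]: "aw \<theta> 0 = 0" "aw (\<lambda>k. 0) k = 0"
  by (simp_all add: aw_def)

lemma AN_0 [simp]: "AN (\<lambda>k. 0) = 0"
  by (simp add: AN_def)

lemma aw_le_AN: "aw \<theta> k \<le> AN \<theta>"
  unfolding AN_def by (rule nn_integral_K_member)

lemma aw_square: "(aw \<theta> k)\<^sup>2 = ennreal (kn k powr 2) * (ecmod (\<theta> k))\<^sup>2"
  by (simp add: aw_def power2_eq_square ennreal_mult[symmetric] powr_numeral mult_ac)

text \<open>What the analysis uses of the symbol; \<open>m k l\<close> stands for the inner product
  of \<open>wavevec k\<close> with the symbol at \<open>l\<close>. \<open>m_zero\<close> keeps the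
  mean out of the quadratic term, and \<open>m_minus\<close> keeps solutions real.\<close>

locale mg_fourier =
  fixes \<kappa> s C :: real and m :: "int^3 \<Rightarrow> int^3 \<Rightarrow> real"
  assumes kappa: "\<kappa> > 0" and s: "s > 5 / 2" and C: "C > 0"
    and m_bound: "\<bar>m k l\<bar> \<le> C * kn l * kn (k - l)"
    and m_zero: "m 0 l = 0"
    and m_minus: "m (- k) (- l) = - m k l"
begin

text \<open>Mode \<open>k\<close> of the divergence of velocity times scalar, that is of the
  transport term. The first argument generates the velocity, the second one is transported.\<close>

definition Bl :: "(int^3 \<Rightarrow> complex) \<Rightarrow> (int^3 \<Rightarrow> complex) \<Rightarrow> int^3 \<Rightarrow> complex" where
  "Bl \<theta> \<psi> k = (LINT l|K. \<i> * of_real (m k l) * \<theta> l * \<psi> (k - l))"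

lemma Bl_summand_le: "ecmod (\<i> * of_real (m k l) * \<theta> l * \<psi> (k - l)) \<le> ennreal C * (aw \<theta> l * aw \<psi> (k - l))"
proof -
  have "cmod (\<i> * of_real (m k l) * \<theta> l * \<psi> (k - l)) = \<bar>m k l\<bar> * (cmod (\<theta> l) * cmod (\<psi> (k - l)))"
    by (simp add: norm_mult)
  also have "\<dots> \<le> (C * kn l * kn (k - l)) * (cmod (\<theta> l) * cmod (\<psi> (k - l)))"
    by (intro mult_right_mono m_bound) auto
  finally have "ecmod (\<i> * of_real (m k l) * \<theta> l * \<psi> (k - l))
     \<le> ennreal (C * ((kn l * cmod (\<theta> l)) * (kn (k - l) * cmod (\<psi> (k - l)))))"
    by (intro ennreal_leI) (simp add: mult_ac)
  also have "\<dots> = ennreal C * (aw \<theta> l * aw \<psi> (k - l))"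
    using C by (simp add: aw_def ennreal_mult)
  finally show ?thesis .
qed

lemma nn_Bl_summand_le: "(\<integral>\<^sup>+l. ecmod (\<i> * of_real (m k l) * \<theta> l * \<psi> (k - l)) \<partial>K) \<le> ennreal C * conv (aw \<theta>) (aw \<psi>) k"
proof -
  have "(\<integral>\<^sup>+l. ecmod (\<i> * of_real (m k l) * \<theta> l * \<psi> (k - l)) \<partial>K) \<le> (\<integral>\<^sup>+l. ennreal C * (aw \<theta> l * aw \<psi> (k - l)) \<partial>K)"
    by (intro nn_integral_mono Bl_summand_le)
  then show ?thesis by (simp add: conv_def nn_integral_cmult)
qed

lemma Bl_le: "ecmod (Bl \<theta> \<psi> k) \<le> ennreal C * conv (aw \<theta>) (aw \<psi>) k"
  unfolding Bl_def by (rule order_trans[OF norm_integral_le_nn nn_Bl_summand_le])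

lemma Bl_le_AN: "ecmod (Bl \<theta> \<psi> k) \<le> ennreal C * (AN \<theta> * AN \<psi>)"
  unfolding AN_def by (rule order_trans[OF Bl_le mult_left_mono[OF conv_le]]) simp

lemma Bl_integrable:
  assumes "AN \<theta> < \<infinity>" "AN \<psi> < \<infinity>"
  shows "integrable K (\<lambda>l. \<i> * of_real (m k l) * \<theta> l * \<psi> (k - l))"
proof -
  have "conv (aw \<theta>) (aw \<psi>) k \<le> AN \<theta> * AN \<psi>" unfolding AN_def by (rule conv_le)
  also have "\<dots> < \<infinity>" using assms by (simp add: ennreal_mult_less_top)
  finally have "ennreal C * conv (aw \<theta>) (aw \<psi>) k < \<infinity>" by (simp add: ennreal_mult_less_top)
  then show ?thesis unfolding integrable_K_iff by (rule le_less_trans[OF nn_Bl_summand_le])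
qed

lemma AN_diff_fin: "AN \<theta> < \<infinity> \<Longrightarrow> AN \<psi> < \<infinity> \<Longrightarrow> AN (\<lambda>k. \<theta> k - \<psi> k) < \<infinity>"
proof -
  assume a: "AN \<theta> < \<infinity>" "AN \<psi> < \<infinity>"
  have "AN (\<lambda>k. \<theta> k - \<psi> k) \<le> (\<integral>\<^sup>+k. aw \<theta> k + aw \<psi> k \<partial>K)"
    unfolding AN_def
  proof (rule nn_integral_mono)
    fix k
    have "kn k * cmod (\<theta> k - \<psi> k) \<le> kn k * cmod (\<theta> k) + kn k * cmod (\<psi> k)"
      unfolding distrib_left[symmetric] by (intro mult_left_mono norm_triangle_ineq4) simp
    then have "aw (\<lambda>k. \<theta> k - \<psi> k) k \<le> ennreal (kn k * cmod (\<theta> k) + kn k * cmod (\<psi> k))"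
      unfolding aw_def by (rule ennreal_leI)
    also have "\<dots> = aw \<theta> k + aw \<psi> k" unfolding aw_def by (rule ennreal_plus) auto
    finally show "aw (\<lambda>k. \<theta> k - \<psi> k) k \<le> aw \<theta> k + aw \<psi> k" .
  qed
  also have "\<dots> = AN \<theta> + AN \<psi>" by (simp add: AN_def nn_integral_add)
  also have "\<dots> < \<infinity>" using a by simp
  finally show ?thesis .
qed

lemma Bl_diff:
  assumes "AN \<theta> < \<infinity>" "AN \<psi> < \<infinity>"
  shows "Bl \<theta> \<theta> k - Bl \<psi> \<psi> k = Bl (\<lambda>k. \<theta> k - \<psi> k) \<theta> k + Bl \<psi> (\<lambda>k. \<theta> k - \<psi> k) k"
proof -
  note d = AN_diff_fin[OF assms]
  have "Bl \<theta> \<theta> k - Bl \<psi> \<psi> k = (LINT l|K. \<i> * of_real (m k l) * \<theta> l * \<theta> (k - l) - \<i> * of_real (m k l) * \<psi> l * \<psi> (k - l))"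
    unfolding Bl_def by (rule Bochner_Integration.integral_diff[symmetric]) (intro Bl_integrable assms)+
  also have "\<dots> = (LINT l|K. \<i> * of_real (m k l) * (\<theta> l - \<psi> l) * \<theta> (k - l) + \<i> * of_real (m k l) * \<psi> l * (\<theta> (k - l) - \<psi> (k - l)))"
    by (simp add: algebra_simps)
  also have "\<dots> = Bl (\<lambda>k. \<theta> k - \<psi> k) \<theta> k + Bl \<psi> (\<lambda>k. \<theta> k - \<psi> k) k"
    unfolding Bl_def
    by (rule Bochner_Integration.integral_add) (intro Bl_integrable[where \<theta> = "\<lambda>k. \<theta> k - \<psi> k"] Bl_integrable[where \<psi> = "\<lambda>k. \<theta> k - \<psi> k"] d assms)+
  finally show ?thesis .
qed

lemma Bl_diff_le:
  assumes "AN \<theta> < \<infinity>" "AN \<psi> < \<infinity>"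
  shows "ecmod (Bl \<theta> \<theta> k - Bl \<psi> \<psi> k)
    \<le> ennreal C * (conv (aw (\<lambda>k. \<theta> k - \<psi> k)) (aw \<theta>) k + conv (aw \<psi>) (aw (\<lambda>k. \<theta> k - \<psi> k)) k)"
proof -
  have "ecmod (Bl \<theta> \<theta> k - Bl \<psi> \<psi> k) \<le> ennreal (cmod (Bl (\<lambda>k. \<theta> k - \<psi> k) \<theta> k) + cmod (Bl \<psi> (\<lambda>k. \<theta> k - \<psi> k) k))"
    unfolding Bl_diff[OF assms] by (intro ennreal_leI norm_triangle_ineq)
  also have "\<dots> = ecmod (Bl (\<lambda>k. \<theta> k - \<psi> k) \<theta> k) + ecmod (Bl \<psi> (\<lambda>k. \<theta> k - \<psi> k) k)"
    by (rule ennreal_plus) auto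
  also have "\<dots> \<le> ennreal C * conv (aw (\<lambda>k. \<theta> k - \<psi> k)) (aw \<theta>) k + ennreal C * conv (aw \<psi>) (aw (\<lambda>k. \<theta> k - \<psi> k)) k"
    by (intro add_mono Bl_le)
  finally show ?thesis by (simp add: distrib_left)
qed

lemma Bl_measurable [measurable]:
  assumes [measurable]: "\<And>k. (\<lambda>t. \<theta> t k) \<in> borel_measurable M" "\<And>k. (\<lambda>t. \<psi> t k) \<in> borel_measurable M"
  shows "(\<lambda>t. Bl (\<theta> t) (\<psi> t) k) \<in> borel_measurable M"
  unfolding Bl_def by measurable

lemma Bl_zero [simp]: "Bl \<theta> \<psi> 0 = 0"
  by (simp add: Bl_def m_zero)

lemma Bl_herm:
  assumes "herm \<theta>" "herm \<psi>"
  shows "herm (Bl \<theta> \<psi>)"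
  unfolding herm_def
proof
  fix k
  have "Bl \<theta> \<psi> (- k) = (LINT l|K. \<i> * of_real (m (- k) (- l)) * \<theta> (- l) * \<psi> (- k - (- l)))"
    unfolding Bl_def by (rule integral_K_minus[symmetric])
  also have "\<dots> = (LINT l|K. cnj (\<i> * of_real (m k l) * \<theta> l * \<psi> (k - l)))"
  proof (rule Bochner_Integration.integral_cong[OF refl])
    fix l
    have "- k - (- l) = - (k - l)" by simp
    then show "\<i> * of_real (m (- k) (- l)) * \<theta> (- l) * \<psi> (- k - (- l)) = cnj (\<i> * of_real (m k l) * \<theta> l * \<psi> (k - l))"
      using assms by (simp only: m_minus herm_def) simp
  qed
  also have "\<dots> = cnj (Bl \<theta> \<psi> k)" unfolding Bl_def by (rule Bochner_Integration.integral_cnj)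
  finally show "Bl \<theta> \<psi> (- k) = cnj (Bl \<theta> \<psi> k)" .
qed

text \<open>Young's inequality with either factor in the summable role: the difference of two
  solutions may occupy either slot, and the other slot is then measured in the critical
  norm.\<close>

lemma Bl_L2:
  "(\<integral>\<^sup>+k. (ecmod (Bl \<theta> \<psi> k))\<^sup>2 \<partial>K) \<le> (ennreal C)\<^sup>2 * ((AN \<psi>)\<^sup>2 * (\<integral>\<^sup>+k. (aw \<theta> k)\<^sup>2 \<partial>K))"
  "(\<integral>\<^sup>+k. (ecmod (Bl \<theta> \<psi> k))\<^sup>2 \<partial>K) \<le> (ennreal C)\<^sup>2 * ((AN \<theta>)\<^sup>2 * (\<integral>\<^sup>+k. (aw \<psi> k)\<^sup>2 \<partial>K))"
proof -
  have *: "(\<integral>\<^sup>+k. (ecmod (Bl \<theta> \<psi> k))\<^sup>2 \<partial>K) \<le> (ennreal C)\<^sup>2 * (\<integral>\<^sup>+k. (conv (aw \<theta>) (aw \<psi>) k)\<^sup>2 \<partial>K)"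
  proof -
    have "(\<integral>\<^sup>+k. (ecmod (Bl \<theta> \<psi> k))\<^sup>2 \<partial>K) \<le> (\<integral>\<^sup>+k. (ennreal C * conv (aw \<theta>) (aw \<psi>) k)\<^sup>2 \<partial>K)"
      by (intro nn_integral_mono power_mono Bl_le) simp
    then show ?thesis by (simp add: power_mult_distrib nn_integral_cmult)
  qed
  show "(\<integral>\<^sup>+k. (ecmod (Bl \<theta> \<psi> k))\<^sup>2 \<partial>K) \<le> (ennreal C)\<^sup>2 * ((AN \<psi>)\<^sup>2 * (\<integral>\<^sup>+k. (aw \<theta> k)\<^sup>2 \<partial>K))"
    unfolding AN_def by (rule order_trans[OF * mult_left_mono[OF conv_Young]]) simp
  show "(\<integral>\<^sup>+k. (ecmod (Bl \<theta> \<psi> k))\<^sup>2 \<partial>K) \<le> (ennreal C)\<^sup>2 * ((AN \<theta>)\<^sup>2 * (\<integral>\<^sup>+k. (aw \<psi> k)\<^sup>2 \<partial>K))"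
    unfolding AN_def
    by (rule order_trans[OF * mult_left_mono]) (use conv_Young[of "aw \<psi>" "aw \<theta>"] in \<open>simp_all add: conv_comm[of "aw \<theta>"]\<close>)
qed

definition CY :: real where "CY = (2 * C * 2 powr (s - 1/2))\<^sup>2"

text \<open>Both halves of the product rule coincide because the convolution is symmetric, hence the
  2 in \<open>CY\<close>. The weight \<open>|k|^(s - 1/2)\<close> times the \<open>|k|\<close>
  inside \<open>aw\<close> is the weight of \<open>H^(s + 1/2)\<close>: the bound is linear in the
  high norm with the critical norm as coefficient.\<close>

lemma Bl_weighted:
  "(\<integral>\<^sup>+k. ennreal (kn k powr (2 * s - 1)) * (ecmod (Bl \<theta> \<theta> k))\<^sup>2 \<partial>K)
    \<le> ennreal CY * ((AN \<theta>)\<^sup>2 * (\<integral>\<^sup>+k. ennreal (kn k powr (2 * s + 1)) * (ecmod (\<theta> k))\<^sup>2 \<partial>K))"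
proof -
  define p where "p = s - 1/2"
  have p: "p \<ge> 0" using s by (simp add: p_def)
  let ?f = "\<lambda>l. ennreal (kn l powr p) * aw \<theta> l"
  have pt: "ennreal (kn k powr (2 * s - 1)) * (ecmod (Bl \<theta> \<theta> k))\<^sup>2 \<le> ennreal CY * (conv ?f (aw \<theta>) k)\<^sup>2" for k
  proof -
    have "ennreal (kn k powr p) * ecmod (Bl \<theta> \<theta> k) \<le> ennreal C * (ennreal (kn k powr p) * conv (aw \<theta>) (aw \<theta>) k)"
      using mult_left_mono[OF Bl_le[of \<theta> \<theta> k], of "ennreal (kn k powr p)"] by (simp add: mult_ac)
    also have "\<dots> \<le> ennreal C * (ennreal (2 powr p) * (conv ?f (aw \<theta>) k + conv (aw \<theta>) ?f k))"
      by (intro mult_left_mono conv_weight p) simp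
    also have "conv (aw \<theta>) ?f k = conv ?f (aw \<theta>) k" by (rule conv_comm)
    also have "ennreal C * (ennreal (2 powr p) * (conv ?f (aw \<theta>) k + conv ?f (aw \<theta>) k)) = ennreal (2 * C * 2 powr p) * conv ?f (aw \<theta>) k"
      using C by (simp add: ennreal_mult mult_2[symmetric] mult_ac)
    finally have "(ennreal (kn k powr p) * ecmod (Bl \<theta> \<theta> k))\<^sup>2 \<le> (ennreal (2 * C * 2 powr p) * conv ?f (aw \<theta>) k)\<^sup>2"
      by (intro power_mono) auto
    moreover have "(ennreal (2 * C * 2 powr p))\<^sup>2 = ennreal CY"
      using C by (simp add: CY_def p_def ennreal_power)
    moreover have "(kn k powr p)\<^sup>2 = kn k powr (2 * s - 1)"
      by (simp only: power2_eq_square powr_add[symmetric]) (simp add: p_def)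
    then have "(ennreal (kn k powr p))\<^sup>2 = ennreal (kn k powr (2 * s - 1))"
      by (simp add: ennreal_power)
    ultimately show ?thesis by (simp add: power_mult_distrib)
  qed
  have f2: "(?f k)\<^sup>2 = ennreal (kn k powr (2 * s + 1)) * (ecmod (\<theta> k))\<^sup>2" for k
  proof -
    have "(?f k)\<^sup>2 = (ennreal (kn k powr p))\<^sup>2 * (ennreal (kn k powr 2) * (ecmod (\<theta> k))\<^sup>2)"
      by (simp add: power_mult_distrib aw_square)
    also have "(ennreal (kn k powr p))\<^sup>2 * (ennreal (kn k powr 2) * (ecmod (\<theta> k))\<^sup>2)
      = ennreal ((kn k powr p)\<^sup>2 * kn k powr 2) * (ecmod (\<theta> k))\<^sup>2"
      by (simp add: ennreal_mult ennreal_power mult.assoc)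
    also have "(kn k powr p)\<^sup>2 * kn k powr 2 = kn k powr (2 * s + 1)"
      by (simp only: power2_eq_square powr_add[symmetric]) (simp add: p_def add.commute)
    finally show ?thesis .
  qed
  have "(\<integral>\<^sup>+k. ennreal (kn k powr (2 * s - 1)) * (ecmod (Bl \<theta> \<theta> k))\<^sup>2 \<partial>K) \<le> (\<integral>\<^sup>+k. ennreal CY * (conv ?f (aw \<theta>) k)\<^sup>2 \<partial>K)"
    by (intro nn_integral_mono pt)
  also have "\<dots> = ennreal CY * (\<integral>\<^sup>+k. (conv ?f (aw \<theta>) k)\<^sup>2 \<partial>K)" by (simp add: nn_integral_cmult)
  also have "\<dots> \<le> ennreal CY * ((\<integral>\<^sup>+k. aw \<theta> k \<partial>K)\<^sup>2 * (\<integral>\<^sup>+k. (?f k)\<^sup>2 \<partial>K))"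
    by (intro mult_left_mono conv_Young) simp
  finally show ?thesis by (simp add: AN_def f2)
qed

end

lemma indicator_pair_measurable [measurable]:
  "(\<lambda>x :: real \<times> real. indicator {0<..<fst x} (snd x) :: real) \<in> borel_measurable (borel \<Otimes>\<^sub>M borel)"
proof -
  let ?D = "{x \<in> space (borel \<Otimes>\<^sub>M borel). 0 < (snd x :: real) \<and> snd x < (fst x :: real)}"
  have D: "?D \<in> sets (borel \<Otimes>\<^sub>M borel)" by measurable
  have eq: "(\<lambda>x :: real \<times> real. indicator {0<..<fst x} (snd x) :: real) = indicator ?D"
    by (auto simp: fun_eq_iff indicator_def space_pair_measure)
  show ?thesis by (subst eq) (rule borel_measurable_indicator[OF D])
qed

lemma duhamel_measurable [measurable]:
  assumes [measurable]: "g \<in> borel_measurable borel"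
  shows "duhamel \<mu> y0 g \<in> borel_measurable borel"
proof -
  have "(\<lambda>x :: real \<times> real. indicator {0<..<fst x} (snd x) *\<^sub>R (exp (\<mu> * snd x) *\<^sub>R g (snd x))) \<in> borel_measurable (borel \<Otimes>\<^sub>M lborel)"
  proof -
    have e: "sets (borel \<Otimes>\<^sub>M lborel) = sets (borel \<Otimes>\<^sub>M borel :: (real \<times> real) measure)"
      by (rule sets_pair_measure_cong) simp_all
    show ?thesis by (subst measurable_cong_sets[OF e refl]) measurable
  qed
  then have "(\<lambda>(t, \<tau>). indicator {0<..<t} \<tau> *\<^sub>R (exp (\<mu> * \<tau>) *\<^sub>R g \<tau>)) \<in> borel_measurable (borel \<Otimes>\<^sub>M lborel)"
    by (simp add: split_beta')
  then have [measurable]: "(\<lambda>t. LINT \<tau>|lborel. indicator {0<..<t} \<tau> *\<^sub>R (exp (\<mu> * \<tau>) *\<^sub>R g \<tau>)) \<in> borel_measurable borel"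
    by (rule lborel.borel_measurable_lebesgue_integral)
  show ?thesis unfolding duhamel_def[abs_def] set_lebesgue_integral_def by measurable
qed

section \<open>Global solution by Picard iteration\<close>

lemma ennreal_mult3: "a \<ge> 0 \<Longrightarrow> b \<ge> 0 \<Longrightarrow> c \<ge> 0 \<Longrightarrow> ennreal a * (ennreal b * ennreal c) = ennreal (a * (b * c))"
  by (metis ennreal_mult mult_nonneg_nonneg)

lemma ennreal_plus3: "a \<ge> 0 \<Longrightarrow> b \<ge> 0 \<Longrightarrow> c \<ge> 0 \<Longrightarrow> ennreal a + ennreal b + ennreal c = ennreal (a + b + c)"
  by (metis ennreal_plus add_nonneg_nonneg)

lemma dker_measurable_add:
  assumes [measurable]: "f1 \<in> borel_measurable borel" "f2 \<in> borel_measurable borel"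
    and le: "\<And>\<tau>. f \<tau> \<le> f1 \<tau> + f2 \<tau>"
  shows "dker \<mu> f a t \<le> dker \<mu> f1 a t + dker \<mu> f2 a t"
proof -
  have "dker \<mu> f a t \<le> (\<integral>\<^sup>+\<tau>. ennreal (exp (- (\<mu> * (t - \<tau>)))) * indicator {a<..<t} \<tau> * f1 \<tau>
     + ennreal (exp (- (\<mu> * (t - \<tau>)))) * indicator {a<..<t} \<tau> * f2 \<tau> \<partial>lborel)"
    unfolding dker_def distrib_left[symmetric] by (intro nn_integral_mono mult_left_mono le) simp
  also have "\<dots> = dker \<mu> f1 a t + dker \<mu> f2 a t"
    unfolding dker_def by (rule nn_integral_add) measurable
  finally show ?thesis .
qed

lemma kn_dker_sup:
  assumes k: "k \<noteq> 0" and "\<kappa> > 0" and le: "\<And>\<tau>. a < \<tau> \<Longrightarrow> \<tau> < t \<Longrightarrow> f \<tau> \<le> G"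
  shows "ennreal (kn k) * dker (\<kappa> * kn k) f a t \<le> ennreal (1 / \<kappa>) * G"
proof -
  have k1: "kn k > 0" using kn_ge_1[OF k] by linarith
  have "ennreal (kn k) * dker (\<kappa> * kn k) f a t \<le> ennreal (kn k) * (ennreal (1 / (\<kappa> * kn k)) * G)"
    by (intro mult_left_mono dker_sup le) (use k1 assms(2) in auto)
  also have "\<dots> = ennreal (kn k * (1 / (\<kappa> * kn k))) * G"
    using k1 assms(2) by (subst ennreal_mult) (auto simp: mult.assoc)
  also have "kn k * (1 / (\<kappa> * kn k)) = 1 / \<kappa>" using k1 by (simp add: field_simps)
  finally show ?thesis .
qed

lemma ennreal_AM:
  assumes "x * r \<le> a + c * r\<^sup>2" "x \<ge> 0" "a \<ge> 0" "c \<ge> 0" "r \<ge> 0"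
  shows "ennreal x * ennreal r \<le> ennreal a + ennreal c * (ennreal r)\<^sup>2"
proof -
  have "ennreal x * ennreal r = ennreal (x * r)" using assms by (simp add: ennreal_mult)
  also have "\<dots> \<le> ennreal (a + c * r\<^sup>2)" by (rule ennreal_leI[OF assms(1)])
  also have "\<dots> = ennreal a + ennreal (c * r\<^sup>2)" using assms by (intro ennreal_plus) auto
  also have "ennreal (c * r\<^sup>2) = ennreal c * (ennreal r)\<^sup>2" using assms by (simp add: ennreal_mult ennreal_power)
  finally show ?thesis .
qed

text \<open>Split \<open>|k|\<close> as \<open>|k|^(1 - s) |k|^s\<close> and apply the
  arithmetic-geometric mean inequality with parameter \<open>d\<close>. Summed over
  \<open>k\<close>, the first term converges because \<open>s > 5/2\<close> and the second is the
  source norm; if that norm is \<open>d\<close>, both are of order \<open>d\<close>.\<close>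

lemma kn_dker_L2:
  assumes k: "k \<noteq> 0" and kp: "\<kappa> > 0" and d: "d > 0" and [measurable]: "f \<in> borel_measurable borel"
  shows "ennreal (kn k) * dker (\<kappa> * kn k) f a t \<le> ennreal (d / 2) * ennreal (kn k powr (2 - 2 * s))
    + ennreal (1 / (4 * \<kappa> * d)) * (ennreal (kn k powr (2 * s - 1)) * (\<integral>\<^sup>+\<tau>. indicator {a<..<t} \<tau> * (f \<tau>)\<^sup>2 \<partial>lborel))"
proof -
  have k1: "kn k > 0" using kn_ge_1[OF k] by linarith
  define D where "D = dker (\<kappa> * kn k) f a t"
  define S where "S = (\<integral>\<^sup>+\<tau>. indicator {a<..<t} \<tau> * (f \<tau>)\<^sup>2 \<partial>lborel)"
  have DS: "D\<^sup>2 \<le> ennreal (1 / (2 * (\<kappa> * kn k))) * S"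
    unfolding D_def S_def by (rule dker_L2) (use k1 kp in auto)
  show ?thesis
  proof (cases D)
    case (real r)
    have am: "kn k * r \<le> (d / 2 * kn k powr (2 - 2 * s)) + (1 / (2 * d) * kn k powr (2 * s)) * r\<^sup>2"
    proof -
      define u v where "u = kn k powr (1 - s)" and "v = kn k powr s * r"
      have "u * v = kn k * r" using k1 by (simp add: u_def v_def powr_add[symmetric] mult.assoc[symmetric])
      moreover have "u\<^sup>2 = kn k powr (2 - 2 * s)"
        unfolding u_def power2_eq_square powr_add[symmetric] by (simp add: algebra_simps)
      moreover have "v\<^sup>2 = kn k powr (2 * s) * r\<^sup>2"
        unfolding v_def power_mult_distrib by (simp add: power2_eq_square powr_add[symmetric])
      moreover have "u * v \<le> d / 2 * u\<^sup>2 + 1 / (2 * d) * v\<^sup>2"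
      proof -
        have "0 \<le> (d * u - v)\<^sup>2 / (2 * d)" using d by simp
        also have "\<dots> = d / 2 * u\<^sup>2 + 1 / (2 * d) * v\<^sup>2 - u * v"
          using d by (simp add: power2_eq_square field_simps)
        finally show ?thesis by simp
      qed
      ultimately show ?thesis by (simp add: mult.assoc)
    qed
    have "ennreal (kn k) * D \<le> ennreal (d / 2 * kn k powr (2 - 2 * s)) + ennreal (1 / (2 * d) * kn k powr (2 * s)) * D\<^sup>2"
      unfolding real(2) by (rule ennreal_AM[OF am]) (use d real in auto)
    also have "\<dots> \<le> ennreal (d / 2 * kn k powr (2 - 2 * s)) + ennreal (1 / (2 * d) * kn k powr (2 * s)) * (ennreal (1 / (2 * (\<kappa> * kn k))) * S)"
      by (intro add_left_mono mult_left_mono DS) simp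
    also have "ennreal (1 / (2 * d) * kn k powr (2 * s)) * (ennreal (1 / (2 * (\<kappa> * kn k))) * S)
      = ennreal ((1 / (2 * d) * kn k powr (2 * s)) * (1 / (2 * (\<kappa> * kn k)))) * S"
      using d kp k1 by (subst ennreal_mult) (auto simp: mult.assoc)
    also have "(1 / (2 * d) * kn k powr (2 * s)) * (1 / (2 * (\<kappa> * kn k))) = 1 / (4 * \<kappa> * d) * kn k powr (2 * s - 1)"
      using k1 d kp by (simp add: powr_diff field_simps)
    also have "ennreal (1 / (4 * \<kappa> * d) * kn k powr (2 * s - 1)) = ennreal (1 / (4 * \<kappa> * d)) * ennreal (kn k powr (2 * s - 1))"
      using d kp by (intro ennreal_mult) auto
    also have "ennreal (d / 2 * kn k powr (2 - 2 * s)) = ennreal (d / 2) * ennreal (kn k powr (2 - 2 * s))"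
      using d by (intro ennreal_mult) auto
    finally show ?thesis by (simp add: D_def S_def mult.assoc)
  next
    case top
    \<comment> \<open>An infinite kernel integral forces an infinite right-hand side, as the
      coefficients of \<open>S\<close> do not vanish.\<close>
    then have "S = top" using DS by (auto simp: ennreal_mult_eq_top_iff top_unique)
    moreover have "ennreal (1 / (4 * \<kappa> * d)) \<noteq> 0" "ennreal (kn k powr (2 * s - 1)) \<noteq> 0"
      using k1 d kp by auto
    ultimately show ?thesis unfolding S_def[symmetric] by (simp add: ennreal_mult_eq_top_iff ennreal_mult_top)
  qed
qed

definition win :: "nat \<Rightarrow> (real \<Rightarrow> int^3 \<Rightarrow> complex) \<Rightarrow> int^3 \<Rightarrow> ennreal" where
  "win n \<theta> k = (SUP t\<in>{real n..real n + 1}. aw (\<theta> t) k)"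

text \<open>Taking the supremum over a time window of unit length before summing over the modes makes the
  quadratic term bounded without any loss, and the windows are coupled only by the decay of the
  linear evolution.\<close>

definition XN :: "nat \<Rightarrow> (real \<Rightarrow> int^3 \<Rightarrow> complex) \<Rightarrow> ennreal" where
  "XN n \<theta> = (\<integral>\<^sup>+k. win n \<theta> k \<partial>K)"

lemma win_upper: "real n \<le> t \<Longrightarrow> t \<le> real n + 1 \<Longrightarrow> aw (\<theta> t) k \<le> win n \<theta> k"
  unfolding win_def by (rule SUP_upper) simp

lemma AN_le_XN: "real n \<le> t \<Longrightarrow> t \<le> real n + 1 \<Longrightarrow> AN (\<theta> t) \<le> XN n \<theta>"
  unfolding AN_def XN_def by (intro nn_integral_mono win_upper)

lemma AN_le_of_XN:
  assumes "\<And>n. XN n \<theta> \<le> x" "t \<ge> 0"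
  shows "AN (\<theta> t) \<le> x"
proof -
  have "real (nat \<lfloor>t\<rfloor>) \<le> t" "t \<le> real (nat \<lfloor>t\<rfloor>) + 1" using assms(2) by linarith+
  then show ?thesis using AN_le_XN assms(1) order_trans by blast
qed

context mg_fourier
begin

text \<open>The geometric sum of the decay over all earlier windows, plus 1 for the forcing within
  the current one.\<close>

definition H :: real where "H = 1 + 1 / (1 - exp (- \<kappa>))"

lemma H_pos: "H > 0" "exp (- \<kappa>) < 1"
  using kappa by (auto simp: H_def add_pos_pos)

text \<open>A discrete Gronwall argument: at integer times the critical norm obeys
  \<open>A(n+1) <= exp (- \<kappa>) * A(n) + b\<close>, so it never exceeds
  \<open>a + b / (1 - exp (- \<kappa>))\<close>, and inside a window at most \<open>b\<close> is
  added.\<close>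

lemma window_recursion:
  assumes step: "\<And>n t k. real n \<le> t \<Longrightarrow> t \<le> real n + 1 \<Longrightarrow>
      aw (y t) k \<le> ennreal (exp (- (\<kappa> * (t - real n)))) * aw (y (real n)) k + \<beta> n k"
    and b: "\<And>n. (\<integral>\<^sup>+k. \<beta> n k \<partial>K) \<le> ennreal b" "b \<ge> 0"
    and a: "AN (y 0) \<le> ennreal a" "a \<ge> 0"
  shows "XN n y \<le> ennreal (a + H * b)"
proof -
  define e where "e = exp (- \<kappa>)"
  have e: "0 < e" "e < 1" using kappa by (auto simp: e_def)
  have AN: "AN (y (real n)) \<le> ennreal (a + b / (1 - e))" for n
  proof (induction n)
    case 0
    have le: "ennreal a \<le> ennreal (a + b / (1 - e))" using e b by (intro ennreal_leI) auto
    show ?case using order_trans[OF a(1) le] by simp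
  next
    case (Suc n)
    have "AN (y (real (Suc n))) \<le> (\<integral>\<^sup>+k. ennreal e * aw (y (real n)) k + \<beta> n k \<partial>K)"
      unfolding AN_def
    proof (rule nn_integral_mono)
      fix k
      show "aw (y (real (Suc n))) k \<le> ennreal e * aw (y (real n)) k + \<beta> n k"
        using step[of n "real (Suc n)" k] by (simp add: e_def algebra_simps)
    qed
    also have "\<dots> = ennreal e * AN (y (real n)) + (\<integral>\<^sup>+k. \<beta> n k \<partial>K)"
      by (simp add: nn_integral_add nn_integral_cmult AN_def)
    also have "\<dots> \<le> ennreal e * ennreal (a + b / (1 - e)) + ennreal b"
      by (intro add_mono mult_left_mono Suc b) simp
    also have "\<dots> = ennreal (e * (a + b / (1 - e)) + b)"
      using e a b by (subst ennreal_plus) (auto simp: ennreal_mult intro!: mult_nonneg_nonneg add_nonneg_nonneg divide_nonneg_nonneg)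
    also have "\<dots> \<le> ennreal (a + b / (1 - e))"
    proof (rule ennreal_leI)
      have "e * a \<le> a" using e a(2) by (simp add: mult_left_le_one_le)
      moreover have "e * (b / (1 - e)) + b = b / (1 - e)" using e by (simp add: field_simps)
      ultimately show "e * (a + b / (1 - e)) + b \<le> a + b / (1 - e)" by (simp add: distrib_left)
    qed
    finally show ?case .
  qed
  have "XN n y \<le> (\<integral>\<^sup>+k. aw (y (real n)) k + \<beta> n k \<partial>K)"
    unfolding XN_def
  proof (rule nn_integral_mono)
    fix k
    show "win n y k \<le> aw (y (real n)) k + \<beta> n k"
      unfolding win_def
    proof (rule SUP_least)
      fix t assume "t \<in> {real n..real n + 1}"
      then have t: "real n \<le> t" "t \<le> real n + 1" by auto
      have "ennreal (exp (- (\<kappa> * (t - real n)))) \<le> 1" using t kappa by (simp add: ennreal_le_1)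
      then have "ennreal (exp (- (\<kappa> * (t - real n)))) * aw (y (real n)) k \<le> 1 * aw (y (real n)) k"
        by (rule mult_right_mono) simp
      then show "aw (y t) k \<le> aw (y (real n)) k + \<beta> n k"
        using step[OF t, of k] by (auto intro: order_trans add_right_mono)
    qed
  qed
  also have "\<dots> = AN (y (real n)) + (\<integral>\<^sup>+k. \<beta> n k \<partial>K)" by (simp add: nn_integral_add AN_def)
  also have "\<dots> \<le> ennreal (a + b / (1 - e)) + ennreal b" by (intro add_mono AN b)
  also have "\<dots> = ennreal (a + b / (1 - e) + b)" using e a b by (intro ennreal_plus[symmetric]) auto
  also have "a + b / (1 - e) + b = a + H * b" by (simp add: H_def e_def algebra_simps)
  finally show ?thesis .
qed

text \<open>A nonzero mode has \<open>|k| >= 1\<close>, so it decays at least at the rate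
  \<open>\<kappa>\<close> common to all modes; the zero mode has weight 0.\<close>

lemma aw_duhamel_step:
  assumes "g \<in> borel_measurable borel" "set_integrable lborel {0<..<t} g" "0 \<le> a" "a \<le> t"
  shows "ennreal (kn k * cmod (duhamel (\<kappa> * kn k) z g t))
    \<le> ennreal (exp (- (\<kappa> * (t - a)))) * ennreal (kn k * cmod (duhamel (\<kappa> * kn k) z g a))
      + ennreal (kn k) * dker (\<kappa> * kn k) (\<lambda>\<tau>. ennreal (norm (g \<tau>))) a t"
proof (cases "k = 0")
  case False
  have k1: "kn k \<ge> 1" by (rule kn_ge_1[OF False])
  have "ennreal (kn k * cmod (duhamel (\<kappa> * kn k) z g t)) = ennreal (kn k) * ecmod (duhamel (\<kappa> * kn k) z g t)"
    by (rule ennreal_mult) auto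
  also have "\<dots> \<le> ennreal (kn k) * (ennreal (exp (- (\<kappa> * kn k * (t - a)))) * ecmod (duhamel (\<kappa> * kn k) z g a)
      + dker (\<kappa> * kn k) (\<lambda>\<tau>. ennreal (norm (g \<tau>))) a t)"
    by (intro mult_left_mono duhamel_le assms) (use kappa in auto)
  also have "\<dots> = ennreal (exp (- (\<kappa> * kn k * (t - a)))) * ennreal (kn k * cmod (duhamel (\<kappa> * kn k) z g a))
      + ennreal (kn k) * dker (\<kappa> * kn k) (\<lambda>\<tau>. ennreal (norm (g \<tau>))) a t"
    by (simp add: distrib_left ennreal_mult mult_ac)
  also have "\<dots> \<le> ennreal (exp (- (\<kappa> * (t - a)))) * ennreal (kn k * cmod (duhamel (\<kappa> * kn k) z g a))
      + ennreal (kn k) * dker (\<kappa> * kn k) (\<lambda>\<tau>. ennreal (norm (g \<tau>))) a t"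
  proof (intro add_right_mono mult_right_mono ennreal_leI)
    have "\<kappa> * (t - a) * 1 \<le> \<kappa> * (t - a) * kn k" using kappa assms k1 by (intro mult_left_mono) auto
    then show "exp (- (\<kappa> * kn k * (t - a))) \<le> exp (- (\<kappa> * (t - a)))" by (simp add: mult_ac)
  qed simp
  finally show ?thesis .
qed simp

definition Cz :: real where "Cz = enn2real (\<integral>\<^sup>+k. ennreal (kn k powr (2 - 2 * s)) \<partial>K)"

lemma Cz: "(\<integral>\<^sup>+k. ennreal (kn k powr (2 - 2 * s)) \<partial>K) = ennreal Cz" "Cz \<ge> 0"
  using lattice_sum_powr[OF s] by (simp_all add: Cz_def)

text \<open>The closed ball for the fixed point argument. Measurability in time is included so that
  the quadratic term of a member is again an admissible source.\<close>

definition ok :: "real \<Rightarrow> (real \<Rightarrow> int^3 \<Rightarrow> complex) \<Rightarrow> bool" where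
  "ok dl \<theta> \<longleftrightarrow> (\<forall>k. (\<lambda>t. \<theta> t k) \<in> borel_measurable borel) \<and> (\<forall>n. XN n \<theta> \<le> ennreal dl)"

lemma ok_measurable: "ok dl \<theta> \<Longrightarrow> (\<lambda>t. \<theta> t k) \<in> borel_measurable borel"
  and ok_XN: "ok dl \<theta> \<Longrightarrow> XN n \<theta> \<le> ennreal dl"
  and ok_AN: "ok dl \<theta> \<Longrightarrow> t \<ge> 0 \<Longrightarrow> AN (\<theta> t) \<le> ennreal dl"
  by (auto simp: ok_def intro: AN_le_of_XN)

lemma Bl_set_integrable:
  fixes T :: real
  assumes me: "\<And>k. (\<lambda>t. \<theta> t k) \<in> borel_measurable borel" and le: "\<And>t. 0 < t \<Longrightarrow> t < T \<Longrightarrow> AN (\<theta> t) \<le> ennreal dl"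
  shows "set_integrable lborel {0<..<T} (\<lambda>\<tau>. Bl (\<theta> \<tau>) (\<theta> \<tau>) k)"
proof -
  note [measurable] = me
  \<comment> \<open>\<open>dl\<close> may be negative, in which case \<open>ennreal dl = 0\<close>;
    \<open>max dl 0\<close> covers both signs.\<close>
  define B where "B = C * (max dl 0 * max dl 0)"
  have bd: "cmod (Bl (\<theta> \<tau>) (\<theta> \<tau>) k) \<le> B" if "0 < \<tau>" "\<tau> < T" for \<tau>
  proof -
    have l: "AN (\<theta> \<tau>) \<le> ennreal (max dl 0)" by (rule order_trans[OF le[OF that] ennreal_leI]) simp
    have "ecmod (Bl (\<theta> \<tau>) (\<theta> \<tau>) k) \<le> ennreal C * (AN (\<theta> \<tau>) * AN (\<theta> \<tau>))" by (rule Bl_le_AN)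
    also have "\<dots> \<le> ennreal C * (ennreal (max dl 0) * ennreal (max dl 0))" by (intro mult_left_mono mult_mono l) auto
    also have "\<dots> = ennreal B" unfolding B_def using C by (simp add: ennreal_mult)
    finally show ?thesis using C by (simp add: B_def ennreal_le_iff)
  qed
  show ?thesis
    unfolding set_integrable_def
  proof (rule integrableI_bounded_set_indicator[where B = B])
    show "AE x in lborel. x \<in> {0<..<T} \<longrightarrow> norm (Bl (\<theta> x) (\<theta> x) k) \<le> B"
      using bd by (intro AE_I2) auto
    show "emeasure lborel {0<..<T} < \<infinity>" by (cases "T \<ge> 0") auto
  qed auto
qed

end

lemma set_integrable_of_L2:
  fixes f :: "real \<Rightarrow> complex"
  assumes [measurable]: "f \<in> borel_measurable borel" and fin: "(\<integral>\<^sup>+\<tau>. indicator {a<..<T} \<tau> * (ecmod (f \<tau>))\<^sup>2 \<partial>lborel) < \<infinity>"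
  shows "set_integrable lborel {a<..<T} f"
  unfolding set_integrable_def
proof (rule integrableI_bounded)
  have "(\<integral>\<^sup>+\<tau>. ennreal (norm (indicator {a<..<T} \<tau> *\<^sub>R f \<tau>)) \<partial>lborel)
     \<le> (\<integral>\<^sup>+\<tau>. indicator {a<..<T} \<tau> + indicator {a<..<T} \<tau> * (ecmod (f \<tau>))\<^sup>2 \<partial>lborel)"
  proof (rule nn_integral_mono)
    fix \<tau>
    have "cmod (f \<tau>) \<le> 1 + (cmod (f \<tau>))\<^sup>2"
    proof -
      have "0 \<le> (cmod (f \<tau>) - 1/2)\<^sup>2" by simp
      then show ?thesis by (simp add: power2_eq_square algebra_simps)
    qed
    then have "ecmod (f \<tau>) \<le> ennreal (1 + (cmod (f \<tau>))\<^sup>2)" by (rule ennreal_leI)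
    also have "\<dots> = 1 + (ecmod (f \<tau>))\<^sup>2" by (simp add: ennreal_plus ennreal_power)
    finally show "ennreal (norm (indicator {a<..<T} \<tau> *\<^sub>R f \<tau>)) \<le> indicator {a<..<T} \<tau> + indicator {a<..<T} \<tau> * (ecmod (f \<tau>))\<^sup>2"
      by (simp add: indicator_def)
  qed
  also have "\<dots> = emeasure lborel {a<..<T} + (\<integral>\<^sup>+\<tau>. indicator {a<..<T} \<tau> * (ecmod (f \<tau>))\<^sup>2 \<partial>lborel)"
    by (subst nn_integral_add) auto
  also have "\<dots> < \<infinity>" using fin by (cases "a \<le> T") auto
  finally show "(\<integral>\<^sup>+\<tau>. ennreal (norm (indicator {a<..<T} \<tau> *\<^sub>R f \<tau>)) \<partial>lborel) < \<infinity>" .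
qed auto

text \<open>\<open>a0\<close> bounds the critical norm of the datum, \<open>d\<close> the source on
  each unit window, and \<open>dl\<close> is the radius of the ball. \<open>small1\<close> makes the
  quadratic part at most \<open>dl / 4\<close> and the map a contraction with factor
  \<open>1/2\<close>, \<open>small3\<close> leaves \<open>dl / 2\<close> for datum and source, and
  \<open>small2\<close> absorbs the quadratic term in the high norm.\<close>

locale mg_data = mg_fourier +
  fixes y0 :: "int^3 \<Rightarrow> complex" and sg :: "real \<Rightarrow> int^3 \<Rightarrow> complex" and d a0 dl :: real
  assumes sg_meas [measurable]: "\<And>k. (\<lambda>t. sg t k) \<in> borel_measurable borel"
    and sg_0: "\<And>t. sg t 0 = 0" and y0_0: "y0 0 = 0"
    and sg_tot: "(\<integral>\<^sup>+k. ennreal (kn k powr (2 * s - 1)) * (\<integral>\<^sup>+\<tau>. indicator {0<..} \<tau> * (ecmod (sg \<tau> k))\<^sup>2 \<partial>lborel) \<partial>K) < \<infinity>"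
    and sg_win: "\<And>j :: nat. (\<integral>\<^sup>+k. ennreal (kn k powr (2 * s - 1)) *
        (\<integral>\<^sup>+\<tau>. indicator {real j<..<real j + 1} \<tau> * (ecmod (sg \<tau> k))\<^sup>2 \<partial>lborel) \<partial>K) \<le> ennreal (d\<^sup>2)"
    and d: "d > 0" and a0: "a0 \<ge> 0" and dl: "dl > 0"
    and y0_AN: "AN y0 \<le> ennreal a0"
    and y0_Hs: "(\<integral>\<^sup>+k. ennreal (kn k powr (2 * s)) * (ecmod (y0 k))\<^sup>2 \<partial>K) < \<infinity>"
    and small1: "4 * (H * C * dl) / \<kappa> \<le> 1"
    and small2: "6 * CY * dl\<^sup>2 / \<kappa>\<^sup>2 \<le> 1"
    and small3: "a0 + H * (d / 2 * Cz + d / (4 * \<kappa>)) \<le> dl / 2"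
begin

section \<open>The Duhamel map on the small ball\<close>

definition src :: "(real \<Rightarrow> int^3 \<Rightarrow> complex) \<Rightarrow> int^3 \<Rightarrow> real \<Rightarrow> complex" where
  "src \<theta> k \<tau> = sg \<tau> k - Bl (\<theta> \<tau>) (\<theta> \<tau>) k"

definition Phi :: "(real \<Rightarrow> int^3 \<Rightarrow> complex) \<Rightarrow> real \<Rightarrow> int^3 \<Rightarrow> complex" where
  "Phi \<theta> t k = duhamel (\<kappa> * kn k) (y0 k) (src \<theta> k) t"

lemma sg_L2: "(\<integral>\<^sup>+\<tau>. indicator {0<..} \<tau> * (ecmod (sg \<tau> k))\<^sup>2 \<partial>lborel) < \<infinity>"
proof (cases "k = 0")
  case False
  have "ennreal (kn k powr (2 * s - 1)) * (\<integral>\<^sup>+\<tau>. indicator {0<..} \<tau> * (ecmod (sg \<tau> k))\<^sup>2 \<partial>lborel) < \<infinity>"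
    by (rule le_less_trans[OF nn_integral_K_member[where k = k] sg_tot])
  moreover have "ennreal (kn k powr (2 * s - 1)) \<noteq> 0" using kn_ge_1[OF False] by auto
  ultimately show ?thesis by (auto simp: ennreal_mult_less_top)
qed (simp add: sg_0)

lemma sg_set_integrable: "set_integrable lborel {0<..<T} (\<lambda>\<tau>. sg \<tau> k)"
proof (rule set_integrable_of_L2)
  have "(\<integral>\<^sup>+\<tau>. indicator {0<..<T} \<tau> * (ecmod (sg \<tau> k))\<^sup>2 \<partial>lborel) \<le> (\<integral>\<^sup>+\<tau>. indicator {0<..} \<tau> * (ecmod (sg \<tau> k))\<^sup>2 \<partial>lborel)"
    by (intro nn_integral_mono mult_right_mono) (auto simp: indicator_def)
  then show "(\<integral>\<^sup>+\<tau>. indicator {0<..<T} \<tau> * (ecmod (sg \<tau> k))\<^sup>2 \<partial>lborel) < \<infinity>"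
    using sg_L2 by (rule le_less_trans)
qed measurable

lemma src_set_integrable:
  assumes "ok dl \<theta>"
  shows "set_integrable lborel {0<..<T} (src \<theta> k)" "set_integrable lborel {0<..<T} (\<lambda>\<tau>. Bl (\<theta> \<tau>) (\<theta> \<tau>) k)"
    "src \<theta> k \<in> borel_measurable borel"
proof -
  note [measurable] = ok_measurable[OF assms]
  show "set_integrable lborel {0<..<T} (\<lambda>\<tau>. Bl (\<theta> \<tau>) (\<theta> \<tau>) k)"
    by (intro Bl_set_integrable[where dl = dl] ok_measurable[OF assms] ok_AN[OF assms]) auto
  then show "set_integrable lborel {0<..<T} (src \<theta> k)"
    unfolding src_def[abs_def] by (intro set_integral_diff(1) sg_set_integrable)
  show "src \<theta> k \<in> borel_measurable borel" unfolding src_def[abs_def] by measurable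
qed

lemma Phi_0: "Phi \<theta> t 0 = 0"
  by (simp add: Phi_def duhamel_def src_def y0_0 sg_0 set_lebesgue_integral_def)

lemma Phi_ok:
  assumes ok: "ok dl \<theta>"
  shows "ok dl (Phi \<theta>)"
proof -
  note [measurable] = ok_measurable[OF ok] src_set_integrable(3)[OF ok]
  have me: "(\<lambda>t. Phi \<theta> t k) \<in> borel_measurable borel" for k
    unfolding Phi_def using duhamel_measurable[OF src_set_integrable(3)[OF ok]] by (simp cong: measurable_cong)
  define S where "S n k = (\<integral>\<^sup>+\<tau>. indicator {real n<..<real n + 1} \<tau> * (ecmod (sg \<tau> k))\<^sup>2 \<partial>lborel)" for n k
  \<comment> \<open>The forcing on window \<open>n\<close>: the source through its square integral
    over the window, and the quadratic term through the convolution of window suprema, which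
    dominates it at every time of the window.\<close>
  define \<beta> where "\<beta> n k = (ennreal (d / 2) * ennreal (kn k powr (2 - 2 * s))
    + ennreal (1 / (4 * \<kappa> * d)) * (ennreal (kn k powr (2 * s - 1)) * S n k))
    + ennreal (1 / \<kappa>) * (ennreal C * conv (win n \<theta>) (win n \<theta>) k)" for n k
  define b where "b = d / 2 * Cz + 1 / (4 * \<kappa> * d) * d\<^sup>2 + 1 / \<kappa> * (C * (dl * dl))"
  have step: "aw (Phi \<theta> t) k \<le> ennreal (exp (- (\<kappa> * (t - real n)))) * aw (Phi \<theta> (real n)) k + \<beta> n k"
    if t: "real n \<le> t" "t \<le> real n + 1" for n t k
  proof (cases "k = 0")
    case False
    have "aw (Phi \<theta> t) k \<le> ennreal (exp (- (\<kappa> * (t - real n)))) * aw (Phi \<theta> (real n)) k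
       + ennreal (kn k) * dker (\<kappa> * kn k) (\<lambda>\<tau>. ennreal (norm (src \<theta> k \<tau>))) (real n) t"
      unfolding aw_def Phi_def
      by (rule aw_duhamel_step[OF src_set_integrable(3,1)[OF ok]]) (use t in auto)
    also have "ennreal (kn k) * dker (\<kappa> * kn k) (\<lambda>\<tau>. ennreal (norm (src \<theta> k \<tau>))) (real n) t
      \<le> ennreal (kn k) * (dker (\<kappa> * kn k) (\<lambda>\<tau>. ecmod (sg \<tau> k)) (real n) t
         + dker (\<kappa> * kn k) (\<lambda>\<tau>. ecmod (Bl (\<theta> \<tau>) (\<theta> \<tau>) k)) (real n) t)"
    proof (intro mult_left_mono dker_measurable_add)
      fix \<tau>
      have "ecmod (src \<theta> k \<tau>) \<le> ennreal (cmod (sg \<tau> k) + cmod (Bl (\<theta> \<tau>) (\<theta> \<tau>) k))"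
        unfolding src_def by (intro ennreal_leI norm_triangle_ineq4)
      also have "\<dots> = ecmod (sg \<tau> k) + ecmod (Bl (\<theta> \<tau>) (\<theta> \<tau>) k)" by (rule ennreal_plus) auto
      finally show "ecmod (src \<theta> k \<tau>) \<le> ecmod (sg \<tau> k) + ecmod (Bl (\<theta> \<tau>) (\<theta> \<tau>) k)" .
    qed auto
    also have "\<dots> \<le> \<beta> n k"
      unfolding \<beta>_def distrib_left
    proof (intro add_mono)
      have "ennreal (kn k) * dker (\<kappa> * kn k) (\<lambda>\<tau>. ecmod (sg \<tau> k)) (real n) t
        \<le> ennreal (d / 2) * ennreal (kn k powr (2 - 2 * s))
          + ennreal (1 / (4 * \<kappa> * d)) * (ennreal (kn k powr (2 * s - 1)) *
            (\<integral>\<^sup>+\<tau>. indicator {real n<..<t} \<tau> * (ecmod (sg \<tau> k))\<^sup>2 \<partial>lborel))"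
        by (rule kn_dker_L2) (use False kappa d in auto)
      also have "\<dots> \<le> ennreal (d / 2) * ennreal (kn k powr (2 - 2 * s))
          + ennreal (1 / (4 * \<kappa> * d)) * (ennreal (kn k powr (2 * s - 1)) * S n k)"
        unfolding S_def
        by (intro add_left_mono mult_left_mono nn_integral_mono mult_right_mono) (use t in \<open>auto simp: indicator_def\<close>)
      finally show "ennreal (kn k) * dker (\<kappa> * kn k) (\<lambda>\<tau>. ecmod (sg \<tau> k)) (real n) t
        \<le> ennreal (d / 2) * ennreal (kn k powr (2 - 2 * s))
          + ennreal (1 / (4 * \<kappa> * d)) * (ennreal (kn k powr (2 * s - 1)) * S n k)" .
      show "ennreal (kn k) * dker (\<kappa> * kn k) (\<lambda>\<tau>. ecmod (Bl (\<theta> \<tau>) (\<theta> \<tau>) k)) (real n) t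
        \<le> ennreal (1 / \<kappa>) * (ennreal C * conv (win n \<theta>) (win n \<theta>) k)"
      proof (rule kn_dker_sup[OF False kappa])
        fix \<tau> assume "real n < \<tau>" "\<tau> < t"
        then have \<tau>: "real n \<le> \<tau>" "\<tau> \<le> real n + 1" using t by auto
        have "ecmod (Bl (\<theta> \<tau>) (\<theta> \<tau>) k) \<le> ennreal C * conv (aw (\<theta> \<tau>)) (aw (\<theta> \<tau>)) k" by (rule Bl_le)
        also have "\<dots> \<le> ennreal C * conv (win n \<theta>) (win n \<theta>) k"
          by (intro mult_left_mono conv_mono win_upper \<tau>) simp
        finally show "ecmod (Bl (\<theta> \<tau>) (\<theta> \<tau>) k) \<le> ennreal C * conv (win n \<theta>) (win n \<theta>) k" .
      qed
    qed
    finally show ?thesis by (simp add: add_left_mono)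
  qed simp
  have b: "(\<integral>\<^sup>+k. \<beta> n k \<partial>K) \<le> ennreal b" for n
  proof -
    have "(\<integral>\<^sup>+k. \<beta> n k \<partial>K) = (ennreal (d / 2) * ennreal Cz + ennreal (1 / (4 * \<kappa> * d)) * (\<integral>\<^sup>+k. ennreal (kn k powr (2 * s - 1)) * S n k \<partial>K))
       + ennreal (1 / \<kappa>) * (ennreal C * (XN n \<theta> * XN n \<theta>))"
      unfolding \<beta>_def by (simp add: nn_integral_add nn_integral_cmult nn_integral_conv XN_def Cz(1))
    also have "\<dots> \<le> (ennreal (d / 2) * ennreal Cz + ennreal (1 / (4 * \<kappa> * d)) * ennreal (d\<^sup>2))
       + ennreal (1 / \<kappa>) * (ennreal C * (ennreal dl * ennreal dl))"
      unfolding S_def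
      by (intro add_mono order_refl mult_left_mono mult_mono sg_win ok_XN[OF ok]) simp_all
    also have "ennreal (d / 2) * ennreal Cz = ennreal (d / 2 * Cz)"
      using d Cz(2) by (intro ennreal_mult[symmetric]) auto
    also have "ennreal (1 / (4 * \<kappa> * d)) * ennreal (d\<^sup>2) = ennreal (1 / (4 * \<kappa> * d) * d\<^sup>2)"
      using d kappa by (intro ennreal_mult[symmetric]) auto
    also have "ennreal C * (ennreal dl * ennreal dl) = ennreal (C * (dl * dl))"
      using C dl by (intro ennreal_mult3) auto
    also have "ennreal (1 / \<kappa>) * ennreal (C * (dl * dl)) = ennreal (1 / \<kappa> * (C * (dl * dl)))"
      using C dl kappa by (intro ennreal_mult[symmetric]) auto
    also have "ennreal (d / 2 * Cz) + ennreal (1 / (4 * \<kappa> * d) * d\<^sup>2) + ennreal (1 / \<kappa> * (C * (dl * dl))) = ennreal b"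
      unfolding b_def using d kappa C dl Cz(2)
      by (intro ennreal_plus3) auto
    finally show ?thesis .
  qed
  have b0: "b \<ge> 0" unfolding b_def using d kappa C dl Cz(2) by (auto intro!: add_nonneg_nonneg mult_nonneg_nonneg)
  have "Phi \<theta> 0 = y0" by (simp add: Phi_def fun_eq_iff)
  then have y: "AN (Phi \<theta> 0) \<le> ennreal a0" using y0_AN by simp
  have "a0 + H * b \<le> dl"
  proof -
    have "1 / (4 * \<kappa> * d) * d\<^sup>2 = d / (4 * \<kappa>)" using d kappa by (simp add: power2_eq_square field_simps)
    then have "b = (d / 2 * Cz + d / (4 * \<kappa>)) + (C * dl / \<kappa>) * dl" unfolding b_def by simp
    then have "a0 + H * b = (a0 + H * (d / 2 * Cz + d / (4 * \<kappa>))) + H * ((C * dl / \<kappa>) * dl)"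
      by (simp only: distrib_left add.assoc)
    also have "H * ((C * dl / \<kappa>) * dl) = (4 * (H * C * dl) / \<kappa>) * (dl / 4)" by simp
    also have "(a0 + H * (d / 2 * Cz + d / (4 * \<kappa>))) + (4 * (H * C * dl) / \<kappa>) * (dl / 4) \<le> dl / 2 + 1 * (dl / 4)"
      by (intro add_mono small3 mult_right_mono small1) (use dl in auto)
    finally show ?thesis using dl by simp
  qed
  then have "XN n (Phi \<theta>) \<le> ennreal dl" for n
    using order_trans[OF window_recursion[OF step b b0 y a0] ennreal_leI] by blast
  then show ?thesis using me by (simp add: ok_def)
qed

text \<open>Both images share the datum, so their difference is a Duhamel integral with zero initial
  value. Bilinearity gives two terms, each with one factor in the ball; these two terms and the
  target factor \<open>1/2\<close> account for the 4 in \<open>small1\<close>.\<close>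

lemma Phi_contract:
  assumes o1: "ok dl \<theta>" and o2: "ok dl \<psi>"
    and x: "\<And>n. XN n (\<lambda>t k. \<theta> t k - \<psi> t k) \<le> ennreal x" "x \<ge> 0"
  shows "XN n (\<lambda>t k. Phi \<theta> t k - Phi \<psi> t k) \<le> ennreal (x / 2)"
proof -
  note [measurable] = ok_measurable[OF o1] ok_measurable[OF o2]
  let ?w = "\<lambda>t k. \<theta> t k - \<psi> t k"
  define g where "g k \<tau> = src \<theta> k \<tau> - src \<psi> k \<tau>" for k \<tau>
  define y where "y t k = duhamel (\<kappa> * kn k) 0 (g k) t" for t k
  have gi: "set_integrable lborel {0<..<T} (g k)" for T k
    unfolding g_def[abs_def] by (intro set_integral_diff(1) src_set_integrable o1 o2)
  have gm [measurable]: "g k \<in> borel_measurable borel" for k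
    unfolding g_def[abs_def] using src_set_integrable(3)[OF o1] src_set_integrable(3)[OF o2] by simp
  have eq: "Phi \<theta> t k - Phi \<psi> t k = y t k" for t k
    unfolding Phi_def y_def g_def[abs_def]
    using duhamel_diff[OF src_set_integrable(1)[OF o1] src_set_integrable(1)[OF o2], of "\<kappa> * kn k"] kappa by simp
  define \<beta> where "\<beta> n k = ennreal (1 / \<kappa>) * (ennreal C * (conv (win n ?w) (win n \<theta>) k + conv (win n \<psi>) (win n ?w) k))" for n k
  have step: "aw (y t) k \<le> ennreal (exp (- (\<kappa> * (t - real n)))) * aw (y (real n)) k + \<beta> n k"
    if t: "real n \<le> t" "t \<le> real n + 1" for n t k
  proof (cases "k = 0")
    case False
    have "aw (y t) k \<le> ennreal (exp (- (\<kappa> * (t - real n)))) * aw (y (real n)) k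
       + ennreal (kn k) * dker (\<kappa> * kn k) (\<lambda>\<tau>. ennreal (norm (g k \<tau>))) (real n) t"
      unfolding aw_def y_def
      by (rule aw_duhamel_step[OF gm gi]) (use t in auto)
    also have "ennreal (kn k) * dker (\<kappa> * kn k) (\<lambda>\<tau>. ennreal (norm (g k \<tau>))) (real n) t \<le> \<beta> n k"
      unfolding \<beta>_def
    proof (rule kn_dker_sup[OF False kappa])
      fix \<tau> assume "real n < \<tau>" "\<tau> < t"
      then have \<tau>: "real n \<le> \<tau>" "\<tau> \<le> real n + 1" "0 \<le> \<tau>" using t by auto
      have A: "AN (\<theta> \<tau>) < \<infinity>" "AN (\<psi> \<tau>) < \<infinity>"
        using ok_AN[OF o1 \<tau>(3)] ok_AN[OF o2 \<tau>(3)] by (auto intro: le_less_trans)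
      have "ennreal (norm (g k \<tau>)) = ecmod (Bl (\<theta> \<tau>) (\<theta> \<tau>) k - Bl (\<psi> \<tau>) (\<psi> \<tau>) k)"
        by (simp add: g_def src_def norm_minus_commute)
      also have "\<dots> \<le> ennreal C * (conv (aw (?w \<tau>)) (aw (\<theta> \<tau>)) k + conv (aw (\<psi> \<tau>)) (aw (?w \<tau>)) k)"
        by (rule Bl_diff_le[OF A])
      also have "\<dots> \<le> ennreal C * (conv (win n ?w) (win n \<theta>) k + conv (win n \<psi>) (win n ?w) k)"
        by (intro mult_left_mono add_mono conv_mono win_upper[where \<theta> = ?w] win_upper \<tau>(1,2)) simp
      finally show "ennreal (norm (g k \<tau>)) \<le> ennreal C * (conv (win n ?w) (win n \<theta>) k + conv (win n \<psi>) (win n ?w) k)" .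
    qed
    finally show ?thesis by (simp add: add_left_mono)
  qed simp
  define b where "b = 1 / \<kappa> * (C * (x * dl + dl * x))"
  have b: "(\<integral>\<^sup>+k. \<beta> n k \<partial>K) \<le> ennreal b" for n
  proof -
    have "(\<integral>\<^sup>+k. \<beta> n k \<partial>K) = ennreal (1 / \<kappa>) * (ennreal C * (XN n ?w * XN n \<theta> + XN n \<psi> * XN n ?w))"
      unfolding \<beta>_def by (simp add: nn_integral_add nn_integral_cmult nn_integral_conv XN_def)
    also have "\<dots> \<le> ennreal (1 / \<kappa>) * (ennreal C * (ennreal x * ennreal dl + ennreal dl * ennreal x))"
      by (intro add_mono mult_left_mono mult_mono x(1) ok_XN[OF o1] ok_XN[OF o2]) simp_all
    also have "\<dots> = ennreal b"
    proof -
      have "ennreal x * ennreal dl + ennreal dl * ennreal x = ennreal (x * dl + dl * x)"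
        using x dl by (subst ennreal_plus) (auto simp: ennreal_mult)
      then show ?thesis unfolding b_def using x dl C kappa
        by (simp only:) (rule ennreal_mult3, auto)
    qed
    finally show ?thesis .
  qed
  have b0: "b \<ge> 0" unfolding b_def using x dl C kappa by auto
  have "y 0 = (\<lambda>k. 0)" by (simp add: y_def fun_eq_iff)
  then have y0: "AN (y 0) \<le> ennreal 0" by simp
  have "0 + H * b = (4 * (H * C * dl) / \<kappa>) * (x / 2)" unfolding b_def using kappa by (simp add: field_simps)
  also have "\<dots> \<le> 1 * (x / 2)" by (intro mult_right_mono small1) (use x in auto)
  finally have "ennreal (0 + H * b) \<le> ennreal (x / 2)" by (intro ennreal_leI) simp
  then have "XN n y \<le> ennreal (x / 2)"
    using order_trans[OF window_recursion[OF step b b0 y0 order_refl]] by blast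
  then show ?thesis by (simp add: eq)
qed

end

lemma ennreal_sq3: "(a + b + c)\<^sup>2 \<le> ennreal 3 * (a\<^sup>2 + b\<^sup>2 + c\<^sup>2)" for a b c :: ennreal
proof (cases "a = top \<or> b = top \<or> c = top")
  case True
  then have *: "a\<^sup>2 + b\<^sup>2 + c\<^sup>2 = top" by (auto simp: power2_eq_square ennreal_mult_top)
  then show ?thesis unfolding * by (simp add: ennreal_mult_top)
next
  case False
  then obtain x y z where e: "a = ennreal x" "b = ennreal y" "c = ennreal z" and n: "x \<ge> 0" "y \<ge> 0" "z \<ge> 0"
    by (metis ennreal_cases)
  have "0 \<le> (x - y)\<^sup>2 + (y - z)\<^sup>2 + (x - z)\<^sup>2" by simp
  then have r: "(x + y + z)\<^sup>2 \<le> 3 * (x\<^sup>2 + y\<^sup>2 + z\<^sup>2)" by (simp add: power2_eq_square algebra_simps)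
  have p: "(ennreal u)\<^sup>2 = ennreal (u\<^sup>2)" if "u \<ge> 0" for u using that by (rule ennreal_power)
  have "(a + b + c)\<^sup>2 = (ennreal (x + y + z))\<^sup>2"
    using n by (simp only: e ennreal_plus3)
  also have "\<dots> = ennreal ((x + y + z)\<^sup>2)" using n by (intro p) auto
  also have "\<dots> \<le> ennreal (3 * (x\<^sup>2 + y\<^sup>2 + z\<^sup>2))" by (rule ennreal_leI[OF r])
  also have "\<dots> = ennreal 3 * ennreal (x\<^sup>2 + y\<^sup>2 + z\<^sup>2)" by (rule ennreal_mult) auto
  also have "ennreal (x\<^sup>2 + y\<^sup>2 + z\<^sup>2) = a\<^sup>2 + b\<^sup>2 + c\<^sup>2"
    using n by (simp only: e p) (rule ennreal_plus3[symmetric], auto)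
  finally show ?thesis .
qed

lemma dker_measurable [measurable]:
  assumes [measurable]: "g \<in> borel_measurable borel"
  shows "dker \<mu> g 0 \<in> borel_measurable borel"
proof -
  have e: "sets (borel \<Otimes>\<^sub>M lborel) = sets (borel \<Otimes>\<^sub>M borel :: (real \<times> real) measure)"
    by (rule sets_pair_measure_cong) simp_all
  let ?D = "{x \<in> space (borel \<Otimes>\<^sub>M borel). 0 < (snd x :: real) \<and> snd x < (fst x :: real)}"
  have D: "?D \<in> sets (borel \<Otimes>\<^sub>M borel)" by measurable
  have eq: "(\<lambda>x :: real \<times> real. indicator {0<..<fst x} (snd x) :: ennreal) = indicator ?D"
    by (auto simp: fun_eq_iff indicator_def space_pair_measure)
  have [measurable]: "(\<lambda>x :: real \<times> real. indicator {0<..<fst x} (snd x) :: ennreal) \<in> borel_measurable (borel \<Otimes>\<^sub>M borel)"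
    by (subst eq) (rule borel_measurable_indicator[OF D])
  have "(\<lambda>x :: real \<times> real. ennreal (exp (- (\<mu> * (fst x - snd x)))) * indicator {0<..<fst x} (snd x) * g (snd x)) \<in> borel_measurable (borel \<Otimes>\<^sub>M lborel)"
    by (subst measurable_cong_sets[OF e refl]) measurable
  then have "(\<lambda>(t, \<tau>). ennreal (exp (- (\<mu> * (t - \<tau>)))) * indicator {0<..<t} \<tau> * g \<tau>) \<in> borel_measurable (borel \<Otimes>\<^sub>M lborel)"
    by (simp add: split_beta')
  then show ?thesis unfolding dker_def[abs_def] by (rule lborel.borel_measurable_nn_integral)
qed

lemma tendsto_aw:
  assumes "(\<lambda>p. f p k) \<longlonglongrightarrow> g k"
  shows "(\<lambda>p. aw (f p) k) \<longlonglongrightarrow> aw g k"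
  unfolding aw_def by (intro tendsto_ennrealI tendsto_intros assms)

text \<open>Fatou's lemma as a closedness statement: bounds that hold along the iteration pass to
  modewise limits.\<close>

lemma nn_integral_liminf_le:
  assumes "\<And>p. (\<integral>\<^sup>+x. f p x \<partial>M) \<le> c" "\<And>p. f p \<in> borel_measurable M" "\<And>x. g x \<le> liminf (\<lambda>p. f p x)"
  shows "(\<integral>\<^sup>+x. g x \<partial>M) \<le> (c :: ennreal)"
proof -
  have "(\<integral>\<^sup>+x. g x \<partial>M) \<le> (\<integral>\<^sup>+x. liminf (\<lambda>p. f p x) \<partial>M)" by (intro nn_integral_mono assms)
  also have "\<dots> \<le> liminf (\<lambda>p. \<integral>\<^sup>+x. f p x \<partial>M)" by (rule nn_integral_liminf) (rule assms)
  also have "\<dots> \<le> liminf (\<lambda>p. c)" by (intro Liminf_mono always_eventually allI assms)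
  finally show ?thesis by (simp add: Liminf_const)
qed

text \<open>The squared homogeneous norm of \<open>L^2\<close> in time with values in
  \<open>H^(s + 1/2)\<close>, with the time integral inside the sum so that the modes can be
  estimated one by one.\<close>

definition Y1 :: "real \<Rightarrow> (real \<Rightarrow> int^3 \<Rightarrow> complex) \<Rightarrow> ennreal" where
  "Y1 s \<theta> = (\<integral>\<^sup>+k. ennreal (kn k powr (2 * s + 1)) * (\<integral>\<^sup>+t. indicator {0<..} t * (ecmod (\<theta> t k))\<^sup>2 \<partial>lborel) \<partial>K)"

lemma duhamel_cnj: "duhamel \<mu> (cnj y) (\<lambda>\<tau>. cnj (g \<tau>)) t = cnj (duhamel \<mu> y g t)"
proof -
  have "(LINT \<tau>:{0<..<t}|lborel. exp (\<mu> * \<tau>) *\<^sub>R cnj (g \<tau>)) = (LINT \<tau>|lborel. cnj (indicator {0<..<t} \<tau> *\<^sub>R exp (\<mu> * \<tau>) *\<^sub>R g \<tau>))"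
    unfolding set_lebesgue_integral_def by (simp add: scaleR_conv_of_real)
  also have "\<dots> = cnj (LINT \<tau>:{0<..<t}|lborel. exp (\<mu> * \<tau>) *\<^sub>R g \<tau>)"
    unfolding set_lebesgue_integral_def by (rule Bochner_Integration.integral_cnj)
  finally show ?thesis unfolding duhamel_def by (simp add: scaleR_conv_of_real)
qed

section \<open>Picard iterates and their limit\<close>

context mg_data
begin

definition it :: "nat \<Rightarrow> real \<Rightarrow> int^3 \<Rightarrow> complex" where
  "it i = (Phi ^^ i) (\<lambda>t k. 0)"

lemma it_0: "it 0 t k = 0" and it_Suc: "it (Suc i) = Phi (it i)"
  by (simp_all add: it_def)

lemma it_ok: "ok dl (it i)"
proof (induction i)
  case 0
  have "XN n (it 0) = 0" for n by (simp add: XN_def win_def it_def)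
  moreover have "(\<lambda>t. it 0 t k) \<in> borel_measurable borel" for k by (simp add: it_0)
  ultimately show ?case unfolding ok_def by auto
qed (simp add: it_Suc Phi_ok)

text \<open>All later iterates are compared with iterate \<open>i\<close> at once:
  \<open>it p\<close> lies in the ball around \<open>it 0 = 0\<close>, and each application of
  \<open>Phi\<close> halves the distance. The Cauchy property is then immediate.\<close>

lemma it_diff: "XN n (\<lambda>t k. it (i + p) t k - it i t k) \<le> ennreal (dl / 2 ^ i)"
proof (induction i arbitrary: n)
  case 0
  show ?case using ok_XN[OF it_ok[of p]] by (simp add: it_0)
next
  case (Suc i)
  have "XN n (\<lambda>t k. Phi (it (i + p)) t k - Phi (it i) t k) \<le> ennreal (dl / 2 ^ i / 2)"
    by (rule Phi_contract[OF it_ok it_ok Suc]) (use dl in auto)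
  then show ?case by (simp add: it_Suc mult.commute)
qed

lemma it_AN: "t \<ge> 0 \<Longrightarrow> AN (\<lambda>k. it (i + p) t k - it i t k) \<le> ennreal (dl / 2 ^ i)"
  using AN_le_of_XN[of "\<lambda>t k. it (i + p) t k - it i t k", OF it_diff] by simp

lemma it_zero_mode: "it i t 0 = 0"
  by (cases i) (simp_all add: it_0 it_Suc Phi_0)

lemma it_dist:
  assumes "t \<ge> 0"
  shows "cmod (it (i + p) t k - it i t k) \<le> dl / 2 ^ i"
proof (cases "k = 0")
  case True
  then show ?thesis using dl by (simp add: it_zero_mode)
next
  case False
  have "ennreal (kn k * cmod (it (i + p) t k - it i t k)) \<le> ennreal (dl / 2 ^ i)"
    using order_trans[OF aw_le_AN it_AN[OF assms]] by (simp add: aw_def)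
  then have 1: "kn k * cmod (it (i + p) t k - it i t k) \<le> dl / 2 ^ i" using dl by (simp add: ennreal_le_iff)
  have "1 * cmod (it (i + p) t k - it i t k) \<le> kn k * cmod (it (i + p) t k - it i t k)"
    by (intro mult_right_mono kn_ge_1 False) simp
  then show ?thesis using 1 by linarith
qed

lemma it_convergent:
  assumes t: "t \<ge> 0"
  shows "convergent (\<lambda>i. it i t k)"
proof (rule Cauchy_convergent, rule CauchyI')
  fix e :: real assume e: "e > 0"
  obtain M where M: "dl / e < 2 ^ M" using real_arch_pow[of 2 "dl / e"] by auto
  show "\<exists>M. \<forall>i\<ge>M. \<forall>j>i. dist (it i t k) (it j t k) < e"
  proof (intro exI allI impI)
    fix i j assume ij: "M \<le> i" "i < j"
    have "dist (it i t k) (it j t k) = cmod (it (i + (j - i)) t k - it i t k)"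
      using ij by (simp add: dist_norm norm_minus_commute)
    also have "\<dots> \<le> dl / 2 ^ i" by (rule it_dist[OF t])
    also have "\<dots> \<le> dl / 2 ^ M" using dl ij by (intro divide_left_mono power_increasing) auto
    also have "\<dots> < e" using M e by (simp add: field_simps)
    finally show "dist (it i t k) (it j t k) < e" .
  qed
qed

definition th :: "real \<Rightarrow> int^3 \<Rightarrow> complex" where
  "th t k = lim (\<lambda>i. it i t k)"

lemma th_lim: "t \<ge> 0 \<Longrightarrow> (\<lambda>i. it i t k) \<longlonglongrightarrow> th t k"
  unfolding th_def using it_convergent convergent_LIMSEQ_iff by blast

lemma th_measurable [measurable]: "(\<lambda>t. th t k) \<in> borel_measurable borel"
  unfolding th_def by (rule borel_measurable_lim_metric) (rule ok_measurable[OF it_ok])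

lemma th_ok: "ok dl th"
proof -
  have "XN n th \<le> ennreal dl" for n
    unfolding XN_def
  proof (rule nn_integral_liminf_le[where f = "\<lambda>i. win n (it i)"])
    show "(\<integral>\<^sup>+k. win n (it i) k \<partial>K) \<le> ennreal dl" for i
      using ok_XN[OF it_ok] by (simp add: XN_def)
    fix k
    show "win n th k \<le> liminf (\<lambda>i. win n (it i) k)"
      unfolding win_def[of n th]
    proof (rule SUP_least)
      fix t assume t: "t \<in> {real n..real n + 1}"
      then have "t \<ge> 0" by auto
      then have "(\<lambda>i. aw (it i t) k) \<longlonglongrightarrow> aw (th t) k" by (intro tendsto_aw th_lim)
      then have "aw (th t) k = liminf (\<lambda>i. aw (it i t) k)" by (simp add: lim_imp_Liminf)
      also have "\<dots> \<le> liminf (\<lambda>i. win n (it i) k)"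
        using t by (intro Liminf_mono always_eventually allI win_upper) auto
      finally show "aw (th t) k \<le> liminf (\<lambda>i. win n (it i) k)" .
    qed
  qed simp
  then show ?thesis by (simp add: ok_def)
qed

lemma th_it_AN:
  assumes "t \<ge> 0"
  shows "AN (\<lambda>k. th t k - it i t k) \<le> ennreal (dl / 2 ^ i)"
  unfolding AN_def
proof (rule nn_integral_liminf_le[where f = "\<lambda>p. aw (\<lambda>k. it (i + p) t k - it i t k)"])
  show "(\<integral>\<^sup>+k. aw (\<lambda>k. it (i + p) t k - it i t k) k \<partial>K) \<le> ennreal (dl / 2 ^ i)" for p
    using it_AN[OF assms] by (simp add: AN_def)
  fix k
  have "(\<lambda>p. it (p + i) t k) \<longlonglongrightarrow> th t k" using th_lim[OF assms] by (rule LIMSEQ_ignore_initial_segment)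
  then have "(\<lambda>p. it (i + p) t k - it i t k) \<longlonglongrightarrow> th t k - it i t k"
    by (intro tendsto_diff tendsto_const) (simp add: add.commute)
  then have "(\<lambda>p. aw (\<lambda>k. it (i + p) t k - it i t k) k) \<longlonglongrightarrow> aw (\<lambda>k. th t k - it i t k) k"
    by (rule tendsto_aw[where f = "\<lambda>p k. it (i + p) t k - it i t k"])
  then show "aw (\<lambda>k. th t k - it i t k) k \<le> liminf (\<lambda>p. aw (\<lambda>k. it (i + p) t k - it i t k) k)"
    by (simp add: lim_imp_Liminf)
qed simp

text \<open>\<open>Phi th\<close> is compared with \<open>Phi (it i)\<close>, which is iterate
  \<open>i + 1\<close>. The critical distance of \<open>th\<close> and \<open>it i\<close> is at
  most \<open>dl / 2 ^ i\<close> at each time, and the Duhamel estimate hands this down to every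
  mode.\<close>

lemma th_fixed:
  assumes t: "t \<ge> 0"
  shows "th t k = Phi th t k"
proof (cases "k = 0")
  case True
  have "(\<lambda>i. it i t 0) \<longlonglongrightarrow> 0" by (simp add: it_zero_mode)
  then show ?thesis using th_lim[OF t, of 0] LIMSEQ_unique True by (auto simp: Phi_0)
next
  case False
  have k1: "kn k \<ge> 1" by (rule kn_ge_1[OF False])
  have bd: "cmod (Phi th t k - it (Suc i) t k) \<le> (1 / \<kappa> * (2 * C * dl * dl)) / 2 ^ i" for i
  proof -
    define g where "g \<tau> = src th k \<tau> - src (it i) k \<tau>" for \<tau>
    have gi: "set_integrable lborel {0<..<t} g"
      unfolding g_def[abs_def] by (intro set_integral_diff(1) src_set_integrable th_ok it_ok)
    have gm [measurable]: "g \<in> borel_measurable borel"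
      unfolding g_def[abs_def] using src_set_integrable(3)[OF th_ok] src_set_integrable(3)[OF it_ok] by simp
    have eq: "Phi th t k - it (Suc i) t k = duhamel (\<kappa> * kn k) 0 g t"
      unfolding Phi_def it_Suc g_def[abs_def]
      using duhamel_diff[OF src_set_integrable(1)[OF th_ok] src_set_integrable(1)[OF it_ok], of "\<kappa> * kn k"] kappa by simp
    have "ennreal (kn k * cmod (duhamel (\<kappa> * kn k) 0 g t))
       \<le> ennreal (exp (- (\<kappa> * (t - 0)))) * ennreal (kn k * cmod (duhamel (\<kappa> * kn k) 0 g 0))
        + ennreal (kn k) * dker (\<kappa> * kn k) (\<lambda>\<tau>. ennreal (norm (g \<tau>))) 0 t"
      by (rule aw_duhamel_step[OF gm gi]) (use t in auto)
    also have "\<dots> = ennreal (kn k) * dker (\<kappa> * kn k) (\<lambda>\<tau>. ennreal (norm (g \<tau>))) 0 t" by simp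
    also have "\<dots> \<le> ennreal (1 / \<kappa>) * (ennreal C * (ennreal (2 * dl) * ennreal (dl / 2 ^ i)))"
    proof (rule kn_dker_sup[OF False kappa])
      fix \<tau> assume "0 < \<tau>" "\<tau> < t"
      then have \<tau>: "\<tau> \<ge> 0" by simp
      have A: "AN (th \<tau>) < \<infinity>" "AN (it i \<tau>) < \<infinity>"
        using ok_AN[OF th_ok \<tau>] ok_AN[OF it_ok[of i] \<tau>] by (auto intro: le_less_trans)
      let ?w = "\<lambda>k. th \<tau> k - it i \<tau> k"
      have "ennreal (norm (g \<tau>)) = ecmod (Bl (th \<tau>) (th \<tau>) k - Bl (it i \<tau>) (it i \<tau>) k)"
        by (simp add: g_def src_def norm_minus_commute)
      also have "\<dots> \<le> ennreal C * (conv (aw ?w) (aw (th \<tau>)) k + conv (aw (it i \<tau>)) (aw ?w) k)"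
        by (rule Bl_diff_le[OF A])
      also have "\<dots> \<le> ennreal C * (AN ?w * AN (th \<tau>) + AN (it i \<tau>) * AN ?w)"
        unfolding AN_def by (intro mult_left_mono add_mono conv_le) simp
      also have "\<dots> \<le> ennreal C * (ennreal (dl / 2 ^ i) * ennreal dl + ennreal dl * ennreal (dl / 2 ^ i))"
        by (intro mult_left_mono add_mono mult_mono th_it_AN ok_AN[OF th_ok] ok_AN[OF it_ok] \<tau>) auto
      also have "ennreal (dl / 2 ^ i) * ennreal dl + ennreal dl * ennreal (dl / 2 ^ i) = ennreal (2 * dl) * ennreal (dl / 2 ^ i)"
        using dl by (simp add: ennreal_mult[symmetric] ennreal_plus[symmetric] del: ennreal_plus)
      finally show "ennreal (norm (g \<tau>)) \<le> ennreal C * (ennreal (2 * dl) * ennreal (dl / 2 ^ i))" .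
    qed
    also have "\<dots> = ennreal (1 / \<kappa> * (C * (2 * dl * (dl / 2 ^ i))))"
    proof -
      have "ennreal C * (ennreal (2 * dl) * ennreal (dl / 2 ^ i)) = ennreal (C * (2 * dl * (dl / 2 ^ i)))"
        using C dl by (intro ennreal_mult3) auto
      moreover have "ennreal (1 / \<kappa>) * ennreal (C * (2 * dl * (dl / 2 ^ i))) = ennreal (1 / \<kappa> * (C * (2 * dl * (dl / 2 ^ i))))"
        using kappa C dl by (intro ennreal_mult[symmetric]) auto
      ultimately show ?thesis by (simp only:)
    qed
    finally have "kn k * cmod (duhamel (\<kappa> * kn k) 0 g t) \<le> 1 / \<kappa> * (C * (2 * dl * (dl / 2 ^ i)))"
      using kappa C dl by (subst (asm) ennreal_le_iff) auto
    moreover have "1 * cmod (duhamel (\<kappa> * kn k) 0 g t) \<le> kn k * cmod (duhamel (\<kappa> * kn k) 0 g t)"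
      by (intro mult_right_mono k1) simp
    moreover have "1 / \<kappa> * (C * (2 * dl * (dl / 2 ^ i))) = (1 / \<kappa> * (2 * C * dl * dl)) / 2 ^ i" by simp
    ultimately show ?thesis unfolding eq by linarith
  qed
  have "(\<lambda>i. (1 / \<kappa> * (2 * C * dl * dl)) / 2 ^ i) \<longlonglongrightarrow> 0"
    by (rule LIMSEQ_divide_realpow_zero) simp
  then have "(\<lambda>i. Phi th t k - it (Suc i) t k) \<longlonglongrightarrow> 0"
    by (rule Lim_null_comparison[OF always_eventually[OF allI[OF bd]]])
  then have "(\<lambda>i. Phi th t k - (Phi th t k - it (Suc i) t k)) \<longlonglongrightarrow> Phi th t k - 0"
    by (intro tendsto_diff tendsto_const)
  then have "(\<lambda>i. it (Suc i) t k) \<longlonglongrightarrow> Phi th t k" by simp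
  moreover have "(\<lambda>i. it (Suc i) t k) \<longlonglongrightarrow> th t k" using th_lim[OF t] by (rule LIMSEQ_Suc)
  ultimately show ?thesis by (metis LIMSEQ_unique)
qed

lemma Phi_le:
  assumes ok: "ok dl \<theta>" and t: "t \<ge> 0"
  shows "ecmod (Phi \<theta> t k) \<le> ennreal (exp (- (\<kappa> * kn k * t))) * ecmod (y0 k)
    + dker (\<kappa> * kn k) (\<lambda>\<tau>. ecmod (sg \<tau> k)) 0 t + dker (\<kappa> * kn k) (\<lambda>\<tau>. ecmod (Bl (\<theta> \<tau>) (\<theta> \<tau>) k)) 0 t"
proof -
  note [measurable] = ok_measurable[OF ok]
  have "ennreal (norm (duhamel (\<kappa> * kn k) (y0 k) (src \<theta> k) t)) \<le> ennreal (exp (- (\<kappa> * kn k * (t - 0)))) * ennreal (norm (duhamel (\<kappa> * kn k) (y0 k) (src \<theta> k) 0))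
    + dker (\<kappa> * kn k) (\<lambda>\<tau>. ennreal (norm (src \<theta> k \<tau>))) 0 t"
    by (rule duhamel_le[OF src_set_integrable(3,1)[OF ok]]) (use t kappa in auto)
  also have "dker (\<kappa> * kn k) (\<lambda>\<tau>. ennreal (norm (src \<theta> k \<tau>))) 0 t
     \<le> dker (\<kappa> * kn k) (\<lambda>\<tau>. ecmod (sg \<tau> k)) 0 t + dker (\<kappa> * kn k) (\<lambda>\<tau>. ecmod (Bl (\<theta> \<tau>) (\<theta> \<tau>) k)) 0 t"
  proof (intro dker_measurable_add)
    fix \<tau>
    have "ecmod (src \<theta> k \<tau>) \<le> ennreal (cmod (sg \<tau> k) + cmod (Bl (\<theta> \<tau>) (\<theta> \<tau>) k))"
      unfolding src_def by (intro ennreal_leI norm_triangle_ineq4)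
    also have "\<dots> = ecmod (sg \<tau> k) + ecmod (Bl (\<theta> \<tau>) (\<theta> \<tau>) k)" by (rule ennreal_plus) auto
    finally show "ecmod (src \<theta> k \<tau>) \<le> ecmod (sg \<tau> k) + ecmod (Bl (\<theta> \<tau>) (\<theta> \<tau>) k)" .
  qed auto
  finally show ?thesis by (simp add: Phi_def add.assoc add_left_mono)
qed

section \<open>Bounds in the high norms\<close>

definition H0 :: ennreal where
  "H0 = (\<integral>\<^sup>+k. ennreal (kn k powr (2 * s)) * (ecmod (y0 k))\<^sup>2 \<partial>K)"

definition SG :: ennreal where
  "SG = (\<integral>\<^sup>+k. ennreal (kn k powr (2 * s - 1)) * (\<integral>\<^sup>+\<tau>. indicator {0<..} \<tau> * (ecmod (sg \<tau> k))\<^sup>2 \<partial>lborel) \<partial>K)"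

definition NB :: "(real \<Rightarrow> int^3 \<Rightarrow> complex) \<Rightarrow> int^3 \<Rightarrow> ennreal" where
  "NB \<theta> k = (\<integral>\<^sup>+\<tau>. indicator {0<..} \<tau> * (ecmod (Bl (\<theta> \<tau>) (\<theta> \<tau>) k))\<^sup>2 \<partial>lborel)"

text \<open>\<open>Bl_weighted\<close> holds at a fixed time; exchanging time and modes before and
  after it turns it into a bound for time integrals. The critical norm enters as the small factor
  \<open>dl^2\<close>.\<close>

lemma NB_le:
  assumes ok: "ok dl \<theta>"
  shows "(\<integral>\<^sup>+k. ennreal (kn k powr (2 * s - 1)) * NB \<theta> k \<partial>K) \<le> ennreal (CY * dl\<^sup>2) * Y1 s \<theta>"
proof -
  note [measurable] = ok_measurable[OF ok]
  have CYdl: "ennreal (CY * dl\<^sup>2) = ennreal CY * (ennreal dl)\<^sup>2"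
    using dl by (simp add: CY_def ennreal_mult ennreal_power)
  have "(\<integral>\<^sup>+k. ennreal (kn k powr (2 * s - 1)) * NB \<theta> k \<partial>K)
     = (\<integral>\<^sup>+k. \<integral>\<^sup>+\<tau>. ennreal (kn k powr (2 * s - 1)) * (indicator {0<..} \<tau> * (ecmod (Bl (\<theta> \<tau>) (\<theta> \<tau>) k))\<^sup>2) \<partial>lborel \<partial>K)"
    unfolding NB_def by (intro nn_integral_cong nn_integral_cmult[symmetric]) measurable
  also have "\<dots> = (\<integral>\<^sup>+\<tau>. \<integral>\<^sup>+k. ennreal (kn k powr (2 * s - 1)) * (indicator {0<..} \<tau> * (ecmod (Bl (\<theta> \<tau>) (\<theta> \<tau>) k))\<^sup>2) \<partial>K \<partial>lborel)"
    by (rule nn_integral_K_swap[OF lborel.sigma_finite_measure_axioms, symmetric]) measurable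
  also have "\<dots> \<le> (\<integral>\<^sup>+\<tau>. \<integral>\<^sup>+k. ennreal (CY * dl\<^sup>2) * (ennreal (kn k powr (2 * s + 1)) * (indicator {0<..} \<tau> * (ecmod (\<theta> \<tau> k))\<^sup>2)) \<partial>K \<partial>lborel)"
  proof (rule nn_integral_mono)
    fix \<tau> :: real
    show "(\<integral>\<^sup>+k. ennreal (kn k powr (2 * s - 1)) * (indicator {0<..} \<tau> * (ecmod (Bl (\<theta> \<tau>) (\<theta> \<tau>) k))\<^sup>2) \<partial>K)
      \<le> (\<integral>\<^sup>+k. ennreal (CY * dl\<^sup>2) * (ennreal (kn k powr (2 * s + 1)) * (indicator {0<..} \<tau> * (ecmod (\<theta> \<tau> k))\<^sup>2)) \<partial>K)"
    proof (cases "\<tau> > 0")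
      case True
      have "(\<integral>\<^sup>+k. ennreal (kn k powr (2 * s - 1)) * (ecmod (Bl (\<theta> \<tau>) (\<theta> \<tau>) k))\<^sup>2 \<partial>K)
        \<le> ennreal CY * ((AN (\<theta> \<tau>))\<^sup>2 * (\<integral>\<^sup>+k. ennreal (kn k powr (2 * s + 1)) * (ecmod (\<theta> \<tau> k))\<^sup>2 \<partial>K))"
        by (rule Bl_weighted)
      also have "\<dots> \<le> ennreal CY * ((ennreal dl)\<^sup>2 * (\<integral>\<^sup>+k. ennreal (kn k powr (2 * s + 1)) * (ecmod (\<theta> \<tau> k))\<^sup>2 \<partial>K))"
        using True by (intro mult_left_mono mult_right_mono power_mono ok_AN[OF ok]) auto
      also have "\<dots> = (\<integral>\<^sup>+k. ennreal (CY * dl\<^sup>2) * (ennreal (kn k powr (2 * s + 1)) * (ecmod (\<theta> \<tau> k))\<^sup>2) \<partial>K)"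
        by (simp add: CYdl nn_integral_cmult mult.assoc)
      finally show ?thesis using True by simp
    qed simp
  qed
  also have "\<dots> = (\<integral>\<^sup>+k. \<integral>\<^sup>+\<tau>. ennreal (CY * dl\<^sup>2) * (ennreal (kn k powr (2 * s + 1)) * (indicator {0<..} \<tau> * (ecmod (\<theta> \<tau> k))\<^sup>2)) \<partial>lborel \<partial>K)"
    by (rule nn_integral_K_swap[OF lborel.sigma_finite_measure_axioms]) measurable
  also have "\<dots> = ennreal (CY * dl\<^sup>2) * Y1 s \<theta>"
    unfolding Y1_def by (simp add: nn_integral_cmult)
  finally show ?thesis .
qed

text \<open>In \<open>L^2\<close> of time the datum gains half a derivative, while source and
  quadratic term gain a full one, which brings all three parts of the Duhamel formula to the order
  \<open>s + 1/2\<close>. The 3 is the price of squaring a sum of three terms.\<close>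

lemma Y1_Phi:
  assumes ok: "ok dl \<theta>"
  shows "Y1 s (Phi \<theta>) \<le> ennreal 3 * (ennreal (1 / (2 * \<kappa>)) * H0 + ennreal (1 / \<kappa>\<^sup>2) * SG + ennreal (1 / \<kappa>\<^sup>2) * (ennreal (CY * dl\<^sup>2) * Y1 s \<theta>))"
proof -
  note [measurable] = ok_measurable[OF ok]
  let ?S = "\<lambda>k. \<integral>\<^sup>+\<tau>. indicator {0<..} \<tau> * (ecmod (sg \<tau> k))\<^sup>2 \<partial>lborel"
  have pt: "ennreal (kn k powr (2 * s + 1)) * (\<integral>\<^sup>+t. indicator {0<..} t * (ecmod (Phi \<theta> t k))\<^sup>2 \<partial>lborel)
     \<le> ennreal 3 * (ennreal (1 / (2 * \<kappa>)) * (ennreal (kn k powr (2 * s)) * (ecmod (y0 k))\<^sup>2)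
        + ennreal (1 / \<kappa>\<^sup>2) * (ennreal (kn k powr (2 * s - 1)) * ?S k) + ennreal (1 / \<kappa>\<^sup>2) * (ennreal (kn k powr (2 * s - 1)) * NB \<theta> k))" for k
  proof (cases "k = 0")
    case False
    have k1: "kn k > 0" using kn_ge_1[OF False] by linarith
    define \<mu> where "\<mu> = \<kappa> * kn k"
    have mu: "\<mu> > 0" using k1 kappa by (simp add: \<mu>_def)
    let ?a = "\<lambda>t. ennreal (exp (- (\<mu> * t))) * ecmod (y0 k)"
    let ?b = "dker \<mu> (\<lambda>\<tau>. ecmod (sg \<tau> k)) 0"
    let ?c = "dker \<mu> (\<lambda>\<tau>. ecmod (Bl (\<theta> \<tau>) (\<theta> \<tau>) k)) 0"
    have "(\<integral>\<^sup>+t. indicator {0<..} t * (ecmod (Phi \<theta> t k))\<^sup>2 \<partial>lborel)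
      \<le> (\<integral>\<^sup>+t. ennreal 3 * (indicator {0<..} t * (?a t)\<^sup>2 + indicator {0<..} t * (?b t)\<^sup>2 + indicator {0<..} t * (?c t)\<^sup>2) \<partial>lborel)"
    proof (rule nn_integral_mono)
      fix t :: real
      show "indicator {0<..} t * (ecmod (Phi \<theta> t k))\<^sup>2
        \<le> ennreal 3 * (indicator {0<..} t * (?a t)\<^sup>2 + indicator {0<..} t * (?b t)\<^sup>2 + indicator {0<..} t * (?c t)\<^sup>2)"
      proof (cases "t > 0")
        case True
        have "(ecmod (Phi \<theta> t k))\<^sup>2 \<le> (?a t + ?b t + ?c t)\<^sup>2"
          using Phi_le[OF ok, of t k] True unfolding \<mu>_def by (intro power_mono) auto
        also have "\<dots> \<le> ennreal 3 * ((?a t)\<^sup>2 + (?b t)\<^sup>2 + (?c t)\<^sup>2)" by (rule ennreal_sq3)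
        finally show ?thesis using True by simp
      qed simp
    qed
    also have "\<dots> = ennreal 3 * ((\<integral>\<^sup>+t. indicator {0<..} t * (?a t)\<^sup>2 \<partial>lborel) + (\<integral>\<^sup>+t. indicator {0<..} t * (?b t)\<^sup>2 \<partial>lborel) + (\<integral>\<^sup>+t. indicator {0<..} t * (?c t)\<^sup>2 \<partial>lborel))"
    proof -
      have [measurable]: "?b \<in> borel_measurable borel" "?c \<in> borel_measurable borel"
        by (rule dker_measurable, measurable)+
      have "(\<integral>\<^sup>+t. indicator {0<..} t * (?a t)\<^sup>2 + indicator {0<..} t * (?b t)\<^sup>2 \<partial>lborel)
         = (\<integral>\<^sup>+t. indicator {0<..} t * (?a t)\<^sup>2 \<partial>lborel) + (\<integral>\<^sup>+t. indicator {0<..} t * (?b t)\<^sup>2 \<partial>lborel)"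
        by (rule nn_integral_add) measurable
      moreover have "(\<integral>\<^sup>+t. (indicator {0<..} t * (?a t)\<^sup>2 + indicator {0<..} t * (?b t)\<^sup>2) + indicator {0<..} t * (?c t)\<^sup>2 \<partial>lborel)
         = (\<integral>\<^sup>+t. indicator {0<..} t * (?a t)\<^sup>2 + indicator {0<..} t * (?b t)\<^sup>2 \<partial>lborel) + (\<integral>\<^sup>+t. indicator {0<..} t * (?c t)\<^sup>2 \<partial>lborel)"
        by (rule nn_integral_add) measurable
      moreover have "(\<integral>\<^sup>+t. ennreal 3 * (indicator {0<..} t * (?a t)\<^sup>2 + indicator {0<..} t * (?b t)\<^sup>2 + indicator {0<..} t * (?c t)\<^sup>2) \<partial>lborel)
         = ennreal 3 * (\<integral>\<^sup>+t. indicator {0<..} t * (?a t)\<^sup>2 + indicator {0<..} t * (?b t)\<^sup>2 + indicator {0<..} t * (?c t)\<^sup>2 \<partial>lborel)"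
        by (rule nn_integral_cmult) measurable
      ultimately show ?thesis by (simp only:)
    qed
    also have "\<dots> \<le> ennreal 3 * (ennreal (1 / (2 * \<mu>)) * (ecmod (y0 k))\<^sup>2 + ennreal (1 / \<mu>\<^sup>2) * ?S k + ennreal (1 / \<mu>\<^sup>2) * NB \<theta> k)"
    proof (intro mult_left_mono add_mono)
      show "(\<integral>\<^sup>+t. indicator {0<..} t * (?a t)\<^sup>2 \<partial>lborel) \<le> ennreal (1 / (2 * \<mu>)) * (ecmod (y0 k))\<^sup>2"
        by (rule nn_integral_exp_L2[OF mu])
      show "(\<integral>\<^sup>+t. indicator {0<..} t * (?b t)\<^sup>2 \<partial>lborel) \<le> ennreal (1 / \<mu>\<^sup>2) * ?S k"
        by (rule dker_L2_L2[OF mu]) auto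
      show "(\<integral>\<^sup>+t. indicator {0<..} t * (?c t)\<^sup>2 \<partial>lborel) \<le> ennreal (1 / \<mu>\<^sup>2) * NB \<theta> k"
        unfolding NB_def by (rule dker_L2_L2[OF mu]) auto
    qed simp
    finally have "ennreal (kn k powr (2 * s + 1)) * (\<integral>\<^sup>+t. indicator {0<..} t * (ecmod (Phi \<theta> t k))\<^sup>2 \<partial>lborel)
      \<le> ennreal (kn k powr (2 * s + 1)) * (ennreal 3 * (ennreal (1 / (2 * \<mu>)) * (ecmod (y0 k))\<^sup>2 + ennreal (1 / \<mu>\<^sup>2) * ?S k + ennreal (1 / \<mu>\<^sup>2) * NB \<theta> k))"
      by (rule mult_left_mono) simp
    also have "\<dots> = ennreal 3 * ((ennreal (kn k powr (2 * s + 1)) * ennreal (1 / (2 * \<mu>))) * (ecmod (y0 k))\<^sup>2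
        + (ennreal (kn k powr (2 * s + 1)) * ennreal (1 / \<mu>\<^sup>2)) * ?S k + (ennreal (kn k powr (2 * s + 1)) * ennreal (1 / \<mu>\<^sup>2)) * NB \<theta> k)"
      by (simp add: distrib_left mult_ac)
    also have "ennreal (kn k powr (2 * s + 1)) * ennreal (1 / (2 * \<mu>)) = ennreal (1 / (2 * \<kappa>)) * ennreal (kn k powr (2 * s))"
    proof -
      have "kn k powr (2 * s + 1) * (1 / (2 * \<mu>)) = 1 / (2 * \<kappa>) * kn k powr (2 * s)"
        using k1 kappa by (simp add: \<mu>_def powr_add field_simps)
      then show ?thesis using mu kappa by (simp add: ennreal_mult[symmetric])
    qed
    also have "ennreal (kn k powr (2 * s + 1)) * ennreal (1 / \<mu>\<^sup>2) = ennreal (1 / \<kappa>\<^sup>2) * ennreal (kn k powr (2 * s - 1))"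
    proof -
      have "kn k powr (2 * s + 1) = kn k powr (2 * s - 1) * (kn k)\<^sup>2"
        using k1 powr_add[of "kn k" "2 * s - 1" 2] by (simp add: powr_numeral add.commute)
      then have "kn k powr (2 * s + 1) * (1 / \<mu>\<^sup>2) = 1 / \<kappa>\<^sup>2 * kn k powr (2 * s - 1)"
        using k1 kappa by (simp add: \<mu>_def power_mult_distrib)
      then show ?thesis by (simp add: ennreal_mult[symmetric])
    qed
    finally show ?thesis by (simp add: mult.assoc)
  qed simp
  have "Y1 s (Phi \<theta>) \<le> (\<integral>\<^sup>+k. ennreal 3 * (ennreal (1 / (2 * \<kappa>)) * (ennreal (kn k powr (2 * s)) * (ecmod (y0 k))\<^sup>2)
        + ennreal (1 / \<kappa>\<^sup>2) * (ennreal (kn k powr (2 * s - 1)) * ?S k) + ennreal (1 / \<kappa>\<^sup>2) * (ennreal (kn k powr (2 * s - 1)) * NB \<theta> k)) \<partial>K)"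
    unfolding Y1_def by (rule nn_integral_mono) (rule pt)
  also have "\<dots> = ennreal 3 * (ennreal (1 / (2 * \<kappa>)) * H0 + ennreal (1 / \<kappa>\<^sup>2) * SG + ennreal (1 / \<kappa>\<^sup>2) * (\<integral>\<^sup>+k. ennreal (kn k powr (2 * s - 1)) * NB \<theta> k \<partial>K))"
    unfolding H0_def SG_def by (simp only: nn_integral_add nn_integral_cmult borel_measurable_count_space)
  also have "\<dots> \<le> ennreal 3 * (ennreal (1 / (2 * \<kappa>)) * H0 + ennreal (1 / \<kappa>\<^sup>2) * SG + ennreal (1 / \<kappa>\<^sup>2) * (ennreal (CY * dl\<^sup>2) * Y1 s \<theta>))"
    by (intro mult_left_mono add_left_mono NB_le ok) auto
  finally show ?thesis .
qed

definition Ylin :: ennreal where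
  "Ylin = ennreal 3 * (ennreal (1 / (2 * \<kappa>)) * H0 + ennreal (1 / \<kappa>\<^sup>2) * SG)"

lemma Ylin_fin: "Ylin < \<infinity>"
  using y0_Hs sg_tot by (simp add: Ylin_def H0_def SG_def ennreal_mult_less_top)

text \<open>The recursion is linear in the high norm with a coefficient of at most
  \<open>1/2\<close> by \<open>small2\<close>, so the bound \<open>2 * Ylin\<close> reproduces
  itself whatever the size of \<open>Ylin\<close>.\<close>

lemma Y1_it: "Y1 s (it i) \<le> ennreal 2 * Ylin"
proof (induction i)
  case 0
  show ?case by (simp add: Y1_def it_0)
next
  case (Suc i)
  have "Y1 s (it (Suc i)) \<le> ennreal 3 * (ennreal (1 / (2 * \<kappa>)) * H0 + ennreal (1 / \<kappa>\<^sup>2) * SG + ennreal (1 / \<kappa>\<^sup>2) * (ennreal (CY * dl\<^sup>2) * Y1 s (it i)))"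
    unfolding it_Suc by (rule Y1_Phi[OF it_ok])
  also have "\<dots> = Ylin + (ennreal 3 * (ennreal (1 / \<kappa>\<^sup>2) * ennreal (CY * dl\<^sup>2))) * Y1 s (it i)"
    by (simp add: Ylin_def distrib_left mult.assoc)
  also have "ennreal 3 * (ennreal (1 / \<kappa>\<^sup>2) * ennreal (CY * dl\<^sup>2)) = ennreal (3 * (1 / \<kappa>\<^sup>2 * (CY * dl\<^sup>2)))"
    by (rule ennreal_mult3) (auto simp: CY_def)
  also have "ennreal (3 * (1 / \<kappa>\<^sup>2 * (CY * dl\<^sup>2))) \<le> ennreal (1 / 2)"
    using small2 by (intro ennreal_leI) simp
  also have "Ylin + ennreal (1 / 2) * Y1 s (it i) \<le> Ylin + ennreal (1 / 2) * (ennreal 2 * Ylin)"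
    by (intro add_left_mono mult_left_mono Suc) simp
  also have "\<dots> = ennreal 2 * Ylin"
  proof -
    have "ennreal (1 / 2) * (ennreal 2 * Ylin) = Ylin"
      by (simp only: mult.assoc[symmetric] ennreal_mult[symmetric, of "1/2" 2]) simp
    then show ?thesis by (simp add: mult_2)
  qed
  finally show ?case by (simp add: add_left_mono mult_right_mono)
qed

text \<open>Fatou's lemma in time, applied inside Fatou's lemma over the modes.\<close>

lemma Y1_th: "Y1 s th < \<infinity>"
proof -
  have [measurable]: "(\<lambda>t. it i t k) \<in> borel_measurable borel" for i k by (rule ok_measurable[OF it_ok])
  have Y: "Y1 s \<theta> = (\<integral>\<^sup>+k. \<integral>\<^sup>+t. ennreal (kn k powr (2 * s + 1)) * (indicator {0<..} t * (ecmod (\<theta> t k))\<^sup>2) \<partial>lborel \<partial>K)"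
    if [measurable]: "\<And>k. (\<lambda>t. \<theta> t k) \<in> borel_measurable borel" for \<theta>
    unfolding Y1_def by (intro nn_integral_cong nn_integral_cmult[symmetric]) measurable
  have "Y1 s th \<le> ennreal 2 * Ylin"
    unfolding Y[OF th_measurable]
  proof (rule nn_integral_liminf_le[where f = "\<lambda>i k. \<integral>\<^sup>+t. ennreal (kn k powr (2 * s + 1)) * (indicator {0<..} t * (ecmod (it i t k))\<^sup>2) \<partial>lborel"])
    show "(\<integral>\<^sup>+k. \<integral>\<^sup>+t. ennreal (kn k powr (2 * s + 1)) * (indicator {0<..} t * (ecmod (it i t k))\<^sup>2) \<partial>lborel \<partial>K) \<le> ennreal 2 * Ylin" for i
      using Y1_it[of i] by (simp add: Y)
    fix k
    have "(\<integral>\<^sup>+t. ennreal (kn k powr (2 * s + 1)) * (indicator {0<..} t * (ecmod (th t k))\<^sup>2) \<partial>lborel)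
      \<le> (\<integral>\<^sup>+t. liminf (\<lambda>i. ennreal (kn k powr (2 * s + 1)) * (indicator {0<..} t * (ecmod (it i t k))\<^sup>2)) \<partial>lborel)"
    proof (rule nn_integral_mono)
      fix t :: real
      show "ennreal (kn k powr (2 * s + 1)) * (indicator {0<..} t * (ecmod (th t k))\<^sup>2)
         \<le> liminf (\<lambda>i. ennreal (kn k powr (2 * s + 1)) * (indicator {0<..} t * (ecmod (it i t k))\<^sup>2))"
      proof (cases "t > 0")
        case True
        then have "(\<lambda>i. ennreal (kn k powr (2 * s + 1) * (cmod (it i t k))\<^sup>2)) \<longlonglongrightarrow> ennreal (kn k powr (2 * s + 1) * (cmod (th t k))\<^sup>2)"
          by (intro tendsto_ennrealI tendsto_intros th_lim) auto
        then have "ennreal (kn k powr (2 * s + 1) * (cmod (th t k))\<^sup>2) = liminf (\<lambda>i. ennreal (kn k powr (2 * s + 1) * (cmod (it i t k))\<^sup>2))"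
          by (rule lim_imp_Liminf[OF sequentially_bot, symmetric])
        then show ?thesis using True by (simp add: ennreal_mult ennreal_power)
      qed simp
    qed
    also have "\<dots> \<le> liminf (\<lambda>i. \<integral>\<^sup>+t. ennreal (kn k powr (2 * s + 1)) * (indicator {0<..} t * (ecmod (it i t k))\<^sup>2) \<partial>lborel)"
      by (rule nn_integral_liminf) measurable
    finally show "(\<integral>\<^sup>+t. ennreal (kn k powr (2 * s + 1)) * (indicator {0<..} t * (ecmod (th t k))\<^sup>2) \<partial>lborel)
      \<le> liminf (\<lambda>i. \<integral>\<^sup>+t. ennreal (kn k powr (2 * s + 1)) * (indicator {0<..} t * (ecmod (it i t k))\<^sup>2) \<partial>lborel)" .
  qed simp
  also have "\<dots> < \<infinity>" using Ylin_fin by (simp add: ennreal_mult_less_top)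
  finally show ?thesis .
qed

text \<open>Bounds at fixed times come from the fixed point equation: \<open>dker_L2\<close> gains
  half a derivative for terms that are square integrable in time, and the quadratic term is such a
  term because \<open>Y1 s th\<close> is finite.\<close>

lemma th_Hs:
  obtains M where "\<And>t. t \<ge> 0 \<Longrightarrow> (\<integral>\<^sup>+k. ennreal (kn k powr (2 * s)) * (ecmod (th t k))\<^sup>2 \<partial>K) \<le> M" "M < \<infinity>"
proof
  note [measurable] = th_measurable
  let ?S = "\<lambda>k. \<integral>\<^sup>+\<tau>. indicator {0<..} \<tau> * (ecmod (sg \<tau> k))\<^sup>2 \<partial>lborel"
  define M where "M = ennreal 3 * (H0 + ennreal (1 / (2 * \<kappa>)) * SG + ennreal (1 / (2 * \<kappa>)) * (ennreal (CY * dl\<^sup>2) * Y1 s th))"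
  show "M < \<infinity>"
    using y0_Hs sg_tot Y1_th by (simp add: M_def H0_def SG_def ennreal_mult_less_top)
  fix t :: real assume t: "t \<ge> 0"
  have pt: "ennreal (kn k powr (2 * s)) * (ecmod (th t k))\<^sup>2
     \<le> ennreal 3 * (ennreal (kn k powr (2 * s)) * (ecmod (y0 k))\<^sup>2
        + ennreal (1 / (2 * \<kappa>)) * (ennreal (kn k powr (2 * s - 1)) * ?S k) + ennreal (1 / (2 * \<kappa>)) * (ennreal (kn k powr (2 * s - 1)) * NB th k))" for k
  proof (cases "k = 0")
    case False
    have k1: "kn k > 0" using kn_ge_1[OF False] by linarith
    define \<mu> where "\<mu> = \<kappa> * kn k"
    have mu: "\<mu> > 0" using k1 kappa by (simp add: \<mu>_def)
    let ?a = "ennreal (exp (- (\<mu> * t))) * ecmod (y0 k)"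
    let ?b = "dker \<mu> (\<lambda>\<tau>. ecmod (sg \<tau> k)) 0 t"
    let ?c = "dker \<mu> (\<lambda>\<tau>. ecmod (Bl (th \<tau>) (th \<tau>) k)) 0 t"
    have "(ecmod (th t k))\<^sup>2 \<le> (?a + ?b + ?c)\<^sup>2"
      unfolding th_fixed[OF t] using Phi_le[OF th_ok t, of k] unfolding \<mu>_def by (intro power_mono) auto
    also have "\<dots> \<le> ennreal 3 * (?a\<^sup>2 + ?b\<^sup>2 + ?c\<^sup>2)" by (rule ennreal_sq3)
    also have "\<dots> \<le> ennreal 3 * ((ecmod (y0 k))\<^sup>2 + ennreal (1 / (2 * \<mu>)) * ?S k + ennreal (1 / (2 * \<mu>)) * NB th k)"
    proof (rule mult_left_mono[OF add_mono[OF add_mono]])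
      have "ennreal (exp (- (\<mu> * t))) \<le> 1" using mu t by (simp add: ennreal_le_1)
      then have "?a \<le> 1 * ecmod (y0 k)" by (rule mult_right_mono) simp
      then show "?a\<^sup>2 \<le> (ecmod (y0 k))\<^sup>2" by (intro power_mono) auto
      have "?b\<^sup>2 \<le> ennreal (1 / (2 * \<mu>)) * (\<integral>\<^sup>+\<tau>. indicator {0<..<t} \<tau> * (ecmod (sg \<tau> k))\<^sup>2 \<partial>lborel)"
        by (rule dker_L2[OF mu]) measurable
      also have "\<dots> \<le> ennreal (1 / (2 * \<mu>)) * ?S k"
        by (intro mult_left_mono nn_integral_mono mult_right_mono) (auto simp: indicator_def)
      finally show "?b\<^sup>2 \<le> ennreal (1 / (2 * \<mu>)) * ?S k" .
      have "?c\<^sup>2 \<le> ennreal (1 / (2 * \<mu>)) * (\<integral>\<^sup>+\<tau>. indicator {0<..<t} \<tau> * (ecmod (Bl (th \<tau>) (th \<tau>) k))\<^sup>2 \<partial>lborel)"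
        by (rule dker_L2[OF mu]) measurable
      also have "\<dots> \<le> ennreal (1 / (2 * \<mu>)) * NB th k"
        unfolding NB_def by (intro mult_left_mono nn_integral_mono mult_right_mono) (auto simp: indicator_def)
      finally show "?c\<^sup>2 \<le> ennreal (1 / (2 * \<mu>)) * NB th k" .
    qed simp
    finally have "ennreal (kn k powr (2 * s)) * (ecmod (th t k))\<^sup>2
      \<le> ennreal (kn k powr (2 * s)) * (ennreal 3 * ((ecmod (y0 k))\<^sup>2 + ennreal (1 / (2 * \<mu>)) * ?S k + ennreal (1 / (2 * \<mu>)) * NB th k))"
      by (rule mult_left_mono) simp
    also have "\<dots> = ennreal 3 * (ennreal (kn k powr (2 * s)) * (ecmod (y0 k))\<^sup>2
        + (ennreal (kn k powr (2 * s)) * ennreal (1 / (2 * \<mu>))) * ?S k + (ennreal (kn k powr (2 * s)) * ennreal (1 / (2 * \<mu>))) * NB th k)"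
      by (simp add: distrib_left mult_ac)
    also have "ennreal (kn k powr (2 * s)) * ennreal (1 / (2 * \<mu>)) = ennreal (1 / (2 * \<kappa>)) * ennreal (kn k powr (2 * s - 1))"
    proof -
      have "kn k powr (2 * s) * (1 / (2 * \<mu>)) = 1 / (2 * \<kappa>) * kn k powr (2 * s - 1)"
        using k1 kappa by (simp add: \<mu>_def powr_diff field_simps)
      then show ?thesis using mu kappa by (simp add: ennreal_mult[symmetric])
    qed
    finally show ?thesis by (simp add: mult.assoc)
  qed simp
  have "(\<integral>\<^sup>+k. ennreal (kn k powr (2 * s)) * (ecmod (th t k))\<^sup>2 \<partial>K)
    \<le> (\<integral>\<^sup>+k. ennreal 3 * (ennreal (kn k powr (2 * s)) * (ecmod (y0 k))\<^sup>2
        + ennreal (1 / (2 * \<kappa>)) * (ennreal (kn k powr (2 * s - 1)) * ?S k) + ennreal (1 / (2 * \<kappa>)) * (ennreal (kn k powr (2 * s - 1)) * NB th k)) \<partial>K)"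
    by (rule nn_integral_mono) (rule pt)
  also have "\<dots> = ennreal 3 * (H0 + ennreal (1 / (2 * \<kappa>)) * SG + ennreal (1 / (2 * \<kappa>)) * (\<integral>\<^sup>+k. ennreal (kn k powr (2 * s - 1)) * NB th k \<partial>K))"
    unfolding H0_def SG_def by (simp only: nn_integral_add nn_integral_cmult borel_measurable_count_space)
  also have "\<dots> \<le> M"
    unfolding M_def by (intro mult_left_mono add_left_mono NB_le th_ok) auto
  finally show "(\<integral>\<^sup>+k. ennreal (kn k powr (2 * s)) * (ecmod (th t k))\<^sup>2 \<partial>K) \<le> M" .
qed

text \<open>Reality survives each application of \<open>Phi\<close>, by \<open>Bl_herm\<close>, and
  the modewise limit.\<close>

lemma th_herm:
  assumes "herm y0" "\<And>t. herm (sg t)" and t: "t \<ge> 0"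
  shows "herm (th t)"
proof -
  have it: "herm (it i t)" for i t
  proof (induction i arbitrary: t)
    case 0
    show ?case by (simp add: herm_def it_0)
  next
    case (Suc i)
    show ?case
      unfolding herm_def
    proof
      fix k
      have "src (it i) (- k) \<tau> = cnj (src (it i) k \<tau>)" for \<tau>
        using assms(2)[of \<tau>] Bl_herm[OF Suc[of \<tau>] Suc[of \<tau>]] by (simp add: src_def herm_def)
      then have "src (it i) (- k) = (\<lambda>\<tau>. cnj (src (it i) k \<tau>))" by (simp add: fun_eq_iff)
      then show "it (Suc i) t (- k) = cnj (it (Suc i) t k)"
        using assms(1) by (simp add: it_Suc Phi_def duhamel_cnj herm_def)
    qed
  qed
  show ?thesis
    unfolding herm_def
  proof
    fix k
    have "(\<lambda>i. cnj (it i t k)) \<longlonglongrightarrow> cnj (th t k)" by (intro tendsto_cnj th_lim t)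
    moreover have "(\<lambda>i. cnj (it i t k)) \<longlonglongrightarrow> th t (- k)" using th_lim[OF t, of "- k"] it by (simp add: herm_def)
    ultimately show "th t (- k) = cnj (th t k)" by (metis LIMSEQ_unique)
  qed
qed

end

section \<open>Uniqueness on the Fourier side\<close>

definition HsN :: "real \<Rightarrow> (int^3 \<Rightarrow> complex) \<Rightarrow> ennreal" where
  "HsN s v = (\<integral>\<^sup>+k. ennreal (kn k powr (2 * s)) * (ecmod (v k))\<^sup>2 \<partial>K)"

lemma ennreal_sq2: "(a + b)\<^sup>2 \<le> ennreal 2 * (a\<^sup>2 + b\<^sup>2)" for a b :: ennreal
proof (cases "a = top \<or> b = top")
  case True
  then have *: "a\<^sup>2 + b\<^sup>2 = top" by (auto simp: power2_eq_square ennreal_mult_top)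
  then show ?thesis unfolding * by (simp add: ennreal_mult_top)
next
  case False
  then obtain x y where e: "a = ennreal x" "b = ennreal y" and n: "x \<ge> 0" "y \<ge> 0"
    by (metis ennreal_cases)
  have "0 \<le> (x - y)\<^sup>2" by simp
  then have r: "(x + y)\<^sup>2 \<le> 2 * (x\<^sup>2 + y\<^sup>2)" by (simp add: power2_eq_square algebra_simps)
  have p: "(ennreal u)\<^sup>2 = ennreal (u\<^sup>2)" if "u \<ge> 0" for u using that by (rule ennreal_power)
  have "(a + b)\<^sup>2 = (ennreal (x + y))\<^sup>2" using n by (simp only: e ennreal_plus)
  also have "\<dots> = ennreal ((x + y)\<^sup>2)" using n by (intro p) auto
  also have "\<dots> \<le> ennreal (2 * (x\<^sup>2 + y\<^sup>2))" by (rule ennreal_leI[OF r])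
  also have "\<dots> = ennreal 2 * ennreal (x\<^sup>2 + y\<^sup>2)" by (rule ennreal_mult) auto
  also have "ennreal (x\<^sup>2 + y\<^sup>2) = a\<^sup>2 + b\<^sup>2"
    using n by (simp only: e p) (rule ennreal_plus, auto)
  finally show ?thesis .
qed

lemma cmod_diff_sq: "(ecmod (u - v))\<^sup>2 \<le> ennreal 2 * ((ecmod u)\<^sup>2 + (ecmod v)\<^sup>2)"
proof -
  have "ecmod (u - v) \<le> ennreal (cmod u + cmod v)" by (intro ennreal_leI norm_triangle_ineq4)
  also have "\<dots> = ecmod u + ecmod v" by (rule ennreal_plus) auto
  finally have "(ecmod (u - v))\<^sup>2 \<le> (ecmod u + ecmod v)\<^sup>2" by (intro power_mono) auto
  also have "\<dots> \<le> ennreal 2 * ((ecmod u)\<^sup>2 + (ecmod v)\<^sup>2)" by (rule ennreal_sq2)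
  finally show ?thesis .
qed

lemma HsN_diff: "HsN s (\<lambda>k. u k - v k) \<le> ennreal 2 * (HsN s u + HsN s v)"
proof -
  have "HsN s (\<lambda>k. u k - v k) \<le> (\<integral>\<^sup>+k. ennreal (kn k powr (2 * s)) * (ennreal 2 * ((ecmod (u k))\<^sup>2 + (ecmod (v k))\<^sup>2)) \<partial>K)"
    unfolding HsN_def by (intro nn_integral_mono mult_left_mono cmod_diff_sq) simp
  also have "\<dots> = (\<integral>\<^sup>+k. ennreal 2 * (ennreal (kn k powr (2 * s)) * (ecmod (u k))\<^sup>2 + ennreal (kn k powr (2 * s)) * (ecmod (v k))\<^sup>2) \<partial>K)"
    by (simp add: distrib_left mult.left_commute)
  also have "\<dots> = ennreal 2 * (HsN s u + HsN s v)"
    unfolding HsN_def by (simp only: nn_integral_add nn_integral_cmult borel_measurable_count_space)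
  finally show ?thesis .
qed

text \<open>The free parameter \<open>x\<close> weighs the lattice sum against the
  \<open>H^s\<close> norm. It is 1 for plain boundedness, and in \<open>AN_tendsto\<close> it is
  adapted to the \<open>H^s\<close> bound, with only a small tail of the lattice sum left to pay for
  it.\<close>

lemma aw_AM:
  assumes x: "x > 0"
  shows "aw v k \<le> ennreal (x / 2) * ennreal (kn k powr (2 - 2 * s)) + ennreal (1 / (2 * x)) * (ennreal (kn k powr (2 * s)) * (ecmod (v k))\<^sup>2)"
proof (cases "k = 0")
  case False
  have k1: "kn k > 0" using kn_ge_1[OF False] by linarith
  define r where "r = cmod (v k)"
  have am: "kn k * r \<le> (x / 2 * kn k powr (2 - 2 * s)) + (1 / (2 * x) * kn k powr (2 * s)) * r\<^sup>2"
  proof -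
    define a b where "a = kn k powr (1 - s)" and "b = kn k powr s * r"
    have "a * b = kn k * r" using k1 by (simp add: a_def b_def powr_add[symmetric] mult.assoc[symmetric])
    moreover have "a\<^sup>2 = kn k powr (2 - 2 * s)"
      unfolding a_def power2_eq_square powr_add[symmetric] by (simp add: algebra_simps)
    moreover have "b\<^sup>2 = kn k powr (2 * s) * r\<^sup>2"
      unfolding b_def power_mult_distrib by (simp add: power2_eq_square powr_add[symmetric])
    moreover have "a * b \<le> x / 2 * a\<^sup>2 + 1 / (2 * x) * b\<^sup>2"
    proof -
      have "0 \<le> (x * a - b)\<^sup>2 / (2 * x)" using x by simp
      also have "\<dots> = x / 2 * a\<^sup>2 + 1 / (2 * x) * b\<^sup>2 - a * b"
        using x by (simp add: power2_eq_square field_simps)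
      finally show ?thesis by simp
    qed
    ultimately show ?thesis by (simp add: mult.assoc)
  qed
  have "aw v k = ennreal (kn k) * ennreal r" by (simp add: aw_def r_def ennreal_mult)
  also have "\<dots> \<le> ennreal (x / 2 * kn k powr (2 - 2 * s)) + ennreal (1 / (2 * x) * kn k powr (2 * s)) * (ennreal r)\<^sup>2"
    by (rule ennreal_AM[OF am]) (use x in \<open>auto simp: r_def\<close>)
  also have "ennreal (x / 2 * kn k powr (2 - 2 * s)) = ennreal (x / 2) * ennreal (kn k powr (2 - 2 * s))"
    using x by (intro ennreal_mult) auto
  also have "ennreal (1 / (2 * x) * kn k powr (2 * s)) = ennreal (1 / (2 * x)) * ennreal (kn k powr (2 * s))"
    using x by (intro ennreal_mult) auto
  finally show ?thesis by (simp add: r_def mult.assoc)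
qed simp

lemma AN_triangle: "AN u \<le> AN v + AN (\<lambda>k. u k - v k)"
proof -
  have "aw u k \<le> aw v k + aw (\<lambda>k. u k - v k) k" for k
  proof -
    have "cmod (u k) \<le> cmod (v k) + cmod (u k - v k)" using norm_triangle_sub[of "u k" "v k"] by simp
    then have "kn k * cmod (u k) \<le> kn k * cmod (v k) + kn k * cmod (u k - v k)"
      unfolding distrib_left[symmetric] by (intro mult_left_mono) auto
    then have "aw u k \<le> ennreal (kn k * cmod (v k) + kn k * cmod (u k - v k))"
      unfolding aw_def by (rule ennreal_leI)
    also have "\<dots> = aw v k + aw (\<lambda>k. u k - v k) k" unfolding aw_def by (rule ennreal_plus) auto
    finally show ?thesis .
  qed
  then have "AN u \<le> (\<integral>\<^sup>+k. aw v k + aw (\<lambda>k. u k - v k) k \<partial>K)" unfolding AN_def by (rule nn_integral_mono)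
  also have "\<dots> = AN v + AN (\<lambda>k. u k - v k)" by (simp add: nn_integral_add AN_def)
  finally show ?thesis .
qed

lemma (in mg_fourier) AN_le_HsN: "AN v \<le> ennreal (1 / 2) * (ennreal Cz + HsN s v)"
proof -
  have "AN v \<le> (\<integral>\<^sup>+k. ennreal (1 / 2) * ennreal (kn k powr (2 - 2 * s)) + ennreal (1 / (2 * 1)) * (ennreal (kn k powr (2 * s)) * (ecmod (v k))\<^sup>2) \<partial>K)"
    unfolding AN_def by (intro nn_integral_mono aw_AM) simp
  also have "\<dots> = ennreal (1 / 2) * ennreal Cz + ennreal (1 / (2 * 1)) * HsN s v"
    unfolding HsN_def by (simp only: nn_integral_add nn_integral_cmult borel_measurable_count_space Cz(1))
  finally show ?thesis by (simp add: distrib_left)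
qed

context mg_fourier
begin

lemma lattice_tail:
  assumes e: "e > 0"
  obtains N :: nat where "(\<integral>\<^sup>+k. indicator {k. kn k > real N} k * ennreal (kn k powr (2 - 2 * s)) \<partial>K) < ennreal e"
proof -
  have "(\<lambda>N. \<integral>\<^sup>+k. indicator {k. kn k > real N} k * ennreal (kn k powr (2 - 2 * s)) \<partial>K) \<longlonglongrightarrow> (\<integral>\<^sup>+k. 0 \<partial>K)"
  proof (rule nn_integral_dominated_convergence[where w = "\<lambda>k. ennreal (kn k powr (2 - 2 * s))"])
    show "(\<integral>\<^sup>+k. ennreal (kn k powr (2 - 2 * s)) \<partial>K) < \<infinity>" by (simp add: Cz)
    show "AE k in K. (\<lambda>N. indicator {k. kn k > real N} k * ennreal (kn k powr (2 - 2 * s))) \<longlonglongrightarrow> 0"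
    proof (rule AE_I2)
      fix k
      obtain N0 where N0: "kn k \<le> real N0" using real_arch_simple by blast
      have "eventually (\<lambda>N. indicator {k. kn k > real N} k * ennreal (kn k powr (2 - 2 * s)) = 0) sequentially"
        unfolding eventually_sequentially
      proof (intro exI allI impI)
        fix N assume "N0 \<le> N"
        then have "\<not> kn k > real N" using N0 by (simp add: not_less order_trans[OF N0])
        then show "indicator {k. kn k > real N} k * ennreal (kn k powr (2 - 2 * s)) = 0" by simp
      qed
      then show "(\<lambda>N. indicator {k. kn k > real N} k * ennreal (kn k powr (2 - 2 * s))) \<longlonglongrightarrow> 0"
        by (rule tendsto_eventually)
    qed
  qed (auto simp: indicator_def intro!: AE_I2)
  then have "eventually (\<lambda>N. (\<integral>\<^sup>+k. indicator {k. kn k > real N} k * ennreal (kn k powr (2 - 2 * s)) \<partial>K) < ennreal e) sequentially"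
    using e by (intro order_tendstoD(2)[where y = 0]) auto
  then show ?thesis using that by (auto simp: eventually_sequentially)
qed

text \<open>On bounded sets of \<open>H^s\<close> the tails of the critical norm are uniformly
  small, so modewise convergence of the finitely many remaining modes is enough.\<close>

lemma AN_tendsto:
  assumes lim: "\<And>k. ((\<lambda>t. f t k) \<longlongrightarrow> z k) F"
    and bd: "eventually (\<lambda>t. HsN s (\<lambda>k. f t k - z k) \<le> ennreal M) F" and M: "M > 0"
    and e: "e > 0"
  shows "eventually (\<lambda>t. AN (\<lambda>k. f t k - z k) \<le> ennreal e) F"
proof -
  \<comment> \<open>This choice makes the \<open>H^s\<close> part \<open>M / (2 * x)\<close> equal
    to \<open>e / 4\<close>. The tail of the lattice sum below \<open>e / (2 * x)\<close>
    contributes another \<open>e / 4\<close> and the low modes \<open>e / 2\<close>.\<close>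
  define x where "x = 2 * M / e"
  have x: "x > 0" using M e by (simp add: x_def)
  obtain N :: nat where N: "(\<integral>\<^sup>+k. indicator {k. kn k > real N} k * ennreal (kn k powr (2 - 2 * s)) \<partial>K) < ennreal (e / (2 * x))"
    using lattice_tail[of "e / (2 * x)"] e x by auto
  \<comment> \<open>\<open>Suc N\<close> because the count of lattice points asks for a radius of at
    least 1; modes outside \<open>B\<close> still lie beyond \<open>N\<close>.\<close>
  define B where "B = {k. kn k \<le> real (Suc N)}"
  have fB: "finite B" unfolding B_def by (rule card_lattice_ball(1)) simp
  have "((\<lambda>t. \<Sum>k\<in>B. kn k * cmod (f t k - z k)) \<longlongrightarrow> (\<Sum>k\<in>B. kn k * cmod (z k - z k))) F"
    by (intro tendsto_intros lim)
  then have "eventually (\<lambda>t. (\<Sum>k\<in>B. kn k * cmod (f t k - z k)) < e / 2) F"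
    using e by (intro order_tendstoD(2)) auto
  then show ?thesis using bd
  proof eventually_elim
    case (elim t)
    let ?v = "\<lambda>k. f t k - z k"
    have pt: "aw ?v k \<le> indicator B k * aw ?v k + (ennreal (x / 2) * (indicator {k. kn k > real N} k * ennreal (kn k powr (2 - 2 * s)))
       + ennreal (1 / (2 * x)) * (ennreal (kn k powr (2 * s)) * (ecmod (?v k))\<^sup>2))" for k
    proof (cases "k \<in> B")
      case False
      then have "kn k > real N" by (auto simp: B_def)
      then show ?thesis using aw_AM[OF x, of ?v k s] False by simp
    qed simp
    have "AN ?v \<le> (\<integral>\<^sup>+k. indicator B k * aw ?v k \<partial>K) + (ennreal (x / 2) * (\<integral>\<^sup>+k. indicator {k. kn k > real N} k * ennreal (kn k powr (2 - 2 * s)) \<partial>K)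
       + ennreal (1 / (2 * x)) * HsN s ?v)"
    proof -
      have "AN ?v \<le> (\<integral>\<^sup>+k. indicator B k * aw ?v k + (ennreal (x / 2) * (indicator {k. kn k > real N} k * ennreal (kn k powr (2 - 2 * s)))
       + ennreal (1 / (2 * x)) * (ennreal (kn k powr (2 * s)) * (ecmod (?v k))\<^sup>2)) \<partial>K)"
        unfolding AN_def by (rule nn_integral_mono) (rule pt)
      then show ?thesis
        unfolding HsN_def by (simp only: nn_integral_add nn_integral_cmult borel_measurable_count_space)
    qed
    also have "\<dots> \<le> ennreal (e / 2) + (ennreal (x / 2) * ennreal (e / (2 * x)) + ennreal (1 / (2 * x)) * ennreal M)"
    proof (intro add_mono mult_left_mono less_imp_le[OF N] elim(2))
      have "(\<integral>\<^sup>+k. indicator B k * aw ?v k \<partial>K) = (\<Sum>k\<in>B. aw ?v k)"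
        using fB by (subst nn_integral_count_space'[where A = B]) auto
      also have "\<dots> = ennreal (\<Sum>k\<in>B. kn k * cmod (?v k))" unfolding aw_def by (rule sum_ennreal) auto
      also have "\<dots> \<le> ennreal (e / 2)" using elim(1) by (intro ennreal_leI) simp
      finally show "(\<integral>\<^sup>+k. indicator B k * aw ?v k \<partial>K) \<le> ennreal (e / 2)" .
    qed auto
    also have "ennreal (x / 2) * ennreal (e / (2 * x)) = ennreal (e / 4)"
      using x e by (subst ennreal_mult[symmetric]) auto
    also have "ennreal (1 / (2 * x)) * ennreal M = ennreal (e / 4)"
      using x e M by (subst ennreal_mult[symmetric]) (auto simp: x_def)
    also have "ennreal (e / 2) + (ennreal (e / 4) + ennreal (e / 4)) = ennreal e"
      using e ennreal_plus3[of "e/2" "e/4" "e/4"] by (simp add: add.assoc)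
    finally show ?case .
  qed
qed

text \<open>In each of the two terms of the bilinear splitting the difference sits in the
  square-summable slot and a solution in the critical norm.\<close>

lemma Bl_diff_L2:
  assumes "AN \<theta> \<le> ennreal a" "AN \<psi> \<le> ennreal b" "a \<ge> 0" "b \<ge> 0"
  shows "(\<integral>\<^sup>+k. (ecmod (Bl \<theta> \<theta> k - Bl \<psi> \<psi> k))\<^sup>2 \<partial>K)
     \<le> ennreal (2 * C\<^sup>2 * (a\<^sup>2 + b\<^sup>2)) * (\<integral>\<^sup>+k. (aw (\<lambda>k. \<theta> k - \<psi> k) k)\<^sup>2 \<partial>K)"
proof -
  let ?w = "\<lambda>k. \<theta> k - \<psi> k"
  let ?W = "\<integral>\<^sup>+k. (aw ?w k)\<^sup>2 \<partial>K"
  have fin: "AN \<theta> < \<infinity>" "AN \<psi> < \<infinity>" using assms by (auto intro: le_less_trans)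
  have p: "(ennreal u)\<^sup>2 = ennreal (u\<^sup>2)" if "u \<ge> 0" for u using that by (rule ennreal_power)
  have "(\<integral>\<^sup>+k. (ecmod (Bl \<theta> \<theta> k - Bl \<psi> \<psi> k))\<^sup>2 \<partial>K)
    \<le> (\<integral>\<^sup>+k. ennreal 2 * ((ecmod (Bl ?w \<theta> k))\<^sup>2 + (ecmod (Bl \<psi> ?w k))\<^sup>2) \<partial>K)"
  proof (rule nn_integral_mono)
    fix k
    have "(ecmod (Bl ?w \<theta> k - (- Bl \<psi> ?w k)))\<^sup>2 \<le> ennreal 2 * ((ecmod (Bl ?w \<theta> k))\<^sup>2 + (ecmod (- Bl \<psi> ?w k))\<^sup>2)"
      by (rule cmod_diff_sq)
    then show "(ecmod (Bl \<theta> \<theta> k - Bl \<psi> \<psi> k))\<^sup>2 \<le> ennreal 2 * ((ecmod (Bl ?w \<theta> k))\<^sup>2 + (ecmod (Bl \<psi> ?w k))\<^sup>2)"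
      by (simp add: Bl_diff[OF fin])
  qed
  also have "\<dots> = ennreal 2 * ((\<integral>\<^sup>+k. (ecmod (Bl ?w \<theta> k))\<^sup>2 \<partial>K) + (\<integral>\<^sup>+k. (ecmod (Bl \<psi> ?w k))\<^sup>2 \<partial>K))"
    by (simp only: nn_integral_add nn_integral_cmult borel_measurable_count_space)
  also have "\<dots> \<le> ennreal 2 * ((ennreal C)\<^sup>2 * ((AN \<theta>)\<^sup>2 * ?W) + (ennreal C)\<^sup>2 * ((AN \<psi>)\<^sup>2 * ?W))"
    by (intro mult_left_mono add_mono Bl_L2) simp
  also have "\<dots> \<le> ennreal 2 * ((ennreal C)\<^sup>2 * ((ennreal a)\<^sup>2 * ?W) + (ennreal C)\<^sup>2 * ((ennreal b)\<^sup>2 * ?W))"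
    by (intro mult_left_mono add_mono mult_right_mono power_mono assms) auto
  also have "\<dots> = (ennreal 2 * ((ennreal C)\<^sup>2 * ((ennreal a)\<^sup>2 + (ennreal b)\<^sup>2))) * ?W"
    by (simp add: distrib_left distrib_right mult.assoc)
  also have "(ennreal a)\<^sup>2 + (ennreal b)\<^sup>2 = ennreal (a\<^sup>2 + b\<^sup>2)"
    using assms by (simp only: p) (rule ennreal_plus[symmetric], auto)
  also have "ennreal 2 * ((ennreal C)\<^sup>2 * ennreal (a\<^sup>2 + b\<^sup>2)) = ennreal (2 * (C\<^sup>2 * (a\<^sup>2 + b\<^sup>2)))"
    using C by (simp only: p less_imp_le) (rule ennreal_mult3, auto)
  finally show ?thesis by (simp add: mult.assoc)
qed

end

text \<open>\<open>\<theta>\<close> is the constructed solution, small in the critical norm; of the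
  competitor \<open>\<psi>\<close> only an \<open>H^s\<close> bound is known. \<open>small\<close>
  reads \<open>2 C^2 ((2 dl)^2 + dl^2) < \<kappa>^2\<close>, which still closes the estimate if the
  competitor is bounded by \<open>2 * dl\<close>.\<close>

locale mg_pair = mg_fourier +
  fixes T dl M :: real and y0 :: "int^3 \<Rightarrow> complex" and sg \<theta> \<psi> :: "real \<Rightarrow> int^3 \<Rightarrow> complex"
  assumes T: "T > 0" and dl: "dl > 0" and M: "M > 0"
    and sg_meas [measurable]: "\<And>k. (\<lambda>t. sg t k) \<in> borel_measurable borel"
    and sg_int: "\<And>k. set_integrable lborel {0<..<T} (\<lambda>t. sg t k)"
    and theta_meas [measurable]: "\<And>k. (\<lambda>t. \<theta> t k) \<in> borel_measurable borel"
    and psi_meas [measurable]: "\<And>k. (\<lambda>t. \<psi> t k) \<in> borel_measurable borel"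
    and theta_eq: "\<And>t k. t \<in> {0<..<T} \<Longrightarrow> \<theta> t k = duhamel (\<kappa> * kn k) (y0 k) (\<lambda>\<tau>. sg \<tau> k - Bl (\<theta> \<tau>) (\<theta> \<tau>) k) t"
    and psi_eq: "\<And>t k. t \<in> {0<..<T} \<Longrightarrow> \<psi> t k = duhamel (\<kappa> * kn k) (y0 k) (\<lambda>\<tau>. sg \<tau> k - Bl (\<psi> \<tau>) (\<psi> \<tau>) k) t"
    and theta_AN: "\<And>t. t \<in> {0<..<T} \<Longrightarrow> AN (\<theta> t) \<le> ennreal dl"
    and y0_AN: "AN y0 \<le> ennreal dl"
    and theta_Hs: "\<And>t. t \<in> {0<..<T} \<Longrightarrow> HsN s (\<theta> t) \<le> ennreal M"
    and psi_Hs: "\<And>t. t \<in> {0<..<T} \<Longrightarrow> HsN s (\<psi> t) \<le> ennreal M"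
    and y0_Hs: "HsN s y0 \<le> ennreal M"
    and small: "10 * C\<^sup>2 * dl\<^sup>2 < \<kappa>\<^sup>2"
begin

lemma Hs_diff_le:
  assumes "HsN s u \<le> ennreal M" "HsN s v \<le> ennreal M"
  shows "HsN s (\<lambda>k. u k - v k) \<le> ennreal (4 * M)"
proof -
  have "HsN s (\<lambda>k. u k - v k) \<le> ennreal 2 * (HsN s u + HsN s v)" by (rule HsN_diff)
  also have "\<dots> \<le> ennreal 2 * (ennreal M + ennreal M)" by (intro mult_left_mono add_mono assms) simp
  also have "ennreal M + ennreal M = ennreal (2 * M)" using M by (simp add: ennreal_plus[symmetric] del: ennreal_plus)
  also have "ennreal 2 * ennreal (2 * M) = ennreal (4 * M)" using M by (subst ennreal_mult[symmetric]) auto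
  finally show ?thesis .
qed

lemma psi_AN: "t \<in> {0<..<T} \<Longrightarrow> AN (\<psi> t) \<le> ennreal (1 / 2 * (Cz + M))"
proof -
  assume t: "t \<in> {0<..<T}"
  have "AN (\<psi> t) \<le> ennreal (1 / 2) * (ennreal Cz + HsN s (\<psi> t))" by (rule AN_le_HsN)
  also have "\<dots> \<le> ennreal (1 / 2) * (ennreal Cz + ennreal M)" by (intro mult_left_mono add_left_mono psi_Hs t) simp
  also have "ennreal Cz + ennreal M = ennreal (Cz + M)" using M Cz(2) by (intro ennreal_plus[symmetric]) auto
  also have "ennreal (1 / 2) * ennreal (Cz + M) = ennreal (1 / 2 * (Cz + M))" using M Cz(2) by (intro ennreal_mult[symmetric]) auto
  finally show ?thesis .
qed

lemma src_int:
  "set_integrable lborel {0<..<T} (\<lambda>\<tau>. sg \<tau> k - Bl (\<theta> \<tau>) (\<theta> \<tau>) k)"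
  "set_integrable lborel {0<..<T} (\<lambda>\<tau>. sg \<tau> k - Bl (\<psi> \<tau>) (\<psi> \<tau>) k)"
  by (intro set_integral_diff(1) sg_int Bl_set_integrable[OF theta_meas] Bl_set_integrable[OF psi_meas];
      rule theta_AN psi_AN; simp)+

lemma psi_cont: "continuous_on {0..T} (duhamel (\<kappa> * kn k) (y0 k) (\<lambda>\<tau>. sg \<tau> k - Bl (\<psi> \<tau>) (\<psi> \<tau>) k))"
  by (rule continuous_duhamel[OF src_int(2)]) (use kappa in simp)

lemma diff_le_dker:
  assumes t: "t \<in> {0<..<T}"
  shows "ecmod (\<psi> t k - \<theta> t k) \<le> dker (\<kappa> * kn k) (\<lambda>\<tau>. ecmod (Bl (\<psi> \<tau>) (\<psi> \<tau>) k - Bl (\<theta> \<tau>) (\<theta> \<tau>) k)) 0 t"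
proof -
  define g where "g \<tau> = (sg \<tau> k - Bl (\<psi> \<tau>) (\<psi> \<tau>) k) - (sg \<tau> k - Bl (\<theta> \<tau>) (\<theta> \<tau>) k)" for \<tau>
  have i: "set_integrable lborel {0<..<t} (\<lambda>\<tau>. sg \<tau> k - Bl (\<psi> \<tau>) (\<psi> \<tau>) k)"
    "set_integrable lborel {0<..<t} (\<lambda>\<tau>. sg \<tau> k - Bl (\<theta> \<tau>) (\<theta> \<tau>) k)"
    using set_integrable_sub[OF src_int(2), of 0 t] set_integrable_sub[OF src_int(1), of 0 t] t by auto
  have gi: "set_integrable lborel {0<..<t} g" unfolding g_def by (rule set_integral_diff(1)[OF i])
  have [measurable]: "g \<in> borel_measurable borel" unfolding g_def[abs_def] by measurable
  have mu: "\<kappa> * kn k \<ge> 0" using kappa by simp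
  have "\<psi> t k - \<theta> t k = duhamel (\<kappa> * kn k) (y0 k - y0 k) g t"
    unfolding psi_eq[OF t] theta_eq[OF t] g_def[abs_def] by (rule duhamel_diff[OF i mu])
  then have "ecmod (\<psi> t k - \<theta> t k) \<le> ennreal (exp (- (\<kappa> * kn k * (t - 0)))) * ennreal (norm (duhamel (\<kappa> * kn k) (y0 k - y0 k) g 0))
    + dker (\<kappa> * kn k) (\<lambda>\<tau>. ennreal (norm (g \<tau>))) 0 t"
    using duhamel_le[of g t 0 "\<kappa> * kn k" "y0 k - y0 k"] gi t mu by simp
  also have "\<dots> = dker (\<kappa> * kn k) (\<lambda>\<tau>. ennreal (norm (g \<tau>))) 0 t" by simp
  also have "(\<lambda>\<tau>. ennreal (norm (g \<tau>))) = (\<lambda>\<tau>. ecmod (Bl (\<psi> \<tau>) (\<psi> \<tau>) k - Bl (\<theta> \<tau>) (\<theta> \<tau>) k))"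
    by (simp add: g_def fun_eq_iff norm_minus_commute)
  finally show ?thesis .
qed

text \<open>In \<open>L^2\<close> of time and modes the Duhamel formula gives
  \<open>W <= NN / \<kappa>^2\<close>, and bilinearity gives \<open>NN <= q * W\<close> with
  \<open>q < \<kappa>^2\<close>. The conclusion includes the end point \<open>T'\<close> when it
  lies before \<open>T\<close>; the continuation argument relies on this.\<close>

lemma local_unique:
  assumes T': "0 < T'" "T' \<le> T" and AN: "\<And>t. t \<in> {0<..<T'} \<Longrightarrow> AN (\<psi> t) \<le> ennreal (2 * dl)"
    and t: "0 < t" "t \<le> T'" "t < T" and k: "k \<noteq> 0"
  shows "\<psi> t k = \<theta> t k"
proof -
  let ?w = "\<lambda>t k. \<psi> t k - \<theta> t k"
  let ?N = "\<lambda>k \<tau>. ecmod (Bl (\<psi> \<tau>) (\<psi> \<tau>) k - Bl (\<theta> \<tau>) (\<theta> \<tau>) k)"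
  define I where "I = {0<..<T'}"
  have Im [measurable]: "I \<in> sets borel" by (simp add: I_def)
  define W where "W = (\<integral>\<^sup>+k. \<integral>\<^sup>+t. indicator I t * (aw (?w t) k)\<^sup>2 \<partial>lborel \<partial>K)"
  define NN where "NN = (\<integral>\<^sup>+k. \<integral>\<^sup>+t. indicator I t * (?N k t)\<^sup>2 \<partial>lborel \<partial>K)"
  have awm [measurable]: "(\<lambda>t. aw (?w t) k) \<in> borel_measurable borel" for k
    unfolding aw_def by measurable
  have inT: "t \<in> {0<..<T}" if "t \<in> I" for t using that T' by (auto simp: I_def)
  define q where "q = 2 * C\<^sup>2 * ((2 * dl)\<^sup>2 + dl\<^sup>2)"
  have q0: "q \<ge> 0" by (simp add: q_def)
  have NW: "NN \<le> ennreal q * W"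
  proof -
    have "NN = (\<integral>\<^sup>+t. \<integral>\<^sup>+k. indicator I t * (?N k t)\<^sup>2 \<partial>K \<partial>lborel)"
      unfolding NN_def by (rule nn_integral_K_swap[OF lborel.sigma_finite_measure_axioms, symmetric]) measurable
    also have "\<dots> \<le> (\<integral>\<^sup>+t. \<integral>\<^sup>+k. ennreal q * (indicator I t * (aw (?w t) k)\<^sup>2) \<partial>K \<partial>lborel)"
    proof (rule nn_integral_mono)
      fix t :: real
      show "(\<integral>\<^sup>+k. indicator I t * (?N k t)\<^sup>2 \<partial>K) \<le> (\<integral>\<^sup>+k. ennreal q * (indicator I t * (aw (?w t) k)\<^sup>2) \<partial>K)"
      proof (cases "t \<in> I")
        case True
        have "(\<integral>\<^sup>+k. (?N k t)\<^sup>2 \<partial>K) \<le> ennreal q * (\<integral>\<^sup>+k. (aw (?w t) k)\<^sup>2 \<partial>K)"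
          unfolding q_def by (rule Bl_diff_L2) (use AN theta_AN[OF inT[OF True]] True dl in \<open>auto simp: I_def\<close>)
        then show ?thesis using True by (simp add: nn_integral_cmult)
      qed simp
    qed
    also have "\<dots> = (\<integral>\<^sup>+k. \<integral>\<^sup>+t. ennreal q * (indicator I t * (aw (?w t) k)\<^sup>2) \<partial>lborel \<partial>K)"
      by (rule nn_integral_K_swap[OF lborel.sigma_finite_measure_axioms]) measurable
    also have "\<dots> = ennreal q * W" unfolding W_def by (simp add: nn_integral_cmult)
    finally show ?thesis .
  qed
  have WN: "W \<le> ennreal (1 / \<kappa>\<^sup>2) * NN"
  proof -
    have "(\<integral>\<^sup>+t. indicator I t * (aw (?w t) k)\<^sup>2 \<partial>lborel) \<le> ennreal (1 / \<kappa>\<^sup>2) * (\<integral>\<^sup>+t. indicator I t * (?N k t)\<^sup>2 \<partial>lborel)" for k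
    proof (cases "k = 0")
      case False
      have k1: "kn k > 0" using kn_ge_1[OF False] by linarith
      define \<mu> where "\<mu> = \<kappa> * kn k"
      have mu: "\<mu> > 0" using k1 kappa by (simp add: \<mu>_def)
      have [measurable]: "dker \<mu> (?N k) 0 \<in> borel_measurable borel" by (rule dker_measurable) measurable
      have "(\<integral>\<^sup>+t. indicator I t * (aw (?w t) k)\<^sup>2 \<partial>lborel) \<le> (\<integral>\<^sup>+t. (ennreal (kn k))\<^sup>2 * (indicator I t * (dker \<mu> (?N k) 0 t)\<^sup>2) \<partial>lborel)"
      proof (rule nn_integral_mono)
        fix t :: real
        show "indicator I t * (aw (?w t) k)\<^sup>2 \<le> (ennreal (kn k))\<^sup>2 * (indicator I t * (dker \<mu> (?N k) 0 t)\<^sup>2)"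
        proof (cases "t \<in> I")
          case True
          have "aw (?w t) k = ennreal (kn k) * ecmod (?w t k)" by (simp add: aw_def ennreal_mult)
          also have "\<dots> \<le> ennreal (kn k) * dker \<mu> (?N k) 0 t"
            unfolding \<mu>_def by (intro mult_left_mono diff_le_dker inT True) simp
          finally have "(aw (?w t) k)\<^sup>2 \<le> (ennreal (kn k) * dker \<mu> (?N k) 0 t)\<^sup>2" by (intro power_mono) auto
          then show ?thesis using True by (simp add: power_mult_distrib)
        qed simp
      qed
      also have "\<dots> = (ennreal (kn k))\<^sup>2 * (\<integral>\<^sup>+t. indicator I t * (dker \<mu> (?N k) 0 t)\<^sup>2 \<partial>lborel)"
        by (rule nn_integral_cmult) measurable
      also have "\<dots> \<le> (ennreal (kn k))\<^sup>2 * (ennreal (1 / \<mu>\<^sup>2) * (\<integral>\<^sup>+t. indicator I t * (?N k t)\<^sup>2 \<partial>lborel))"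
        by (intro mult_left_mono dker_L2_L2 mu) (auto simp: I_def)
      also have "\<dots> = ((ennreal (kn k))\<^sup>2 * ennreal (1 / \<mu>\<^sup>2)) * (\<integral>\<^sup>+t. indicator I t * (?N k t)\<^sup>2 \<partial>lborel)"
        by (simp add: mult.assoc)
      also have "(ennreal (kn k))\<^sup>2 * ennreal (1 / \<mu>\<^sup>2) = ennreal (1 / \<kappa>\<^sup>2)"
      proof -
        have "(kn k)\<^sup>2 * (1 / \<mu>\<^sup>2) = 1 / \<kappa>\<^sup>2" using k1 kappa by (simp add: \<mu>_def power_mult_distrib)
        then show ?thesis by (simp add: ennreal_power ennreal_mult[symmetric])
      qed
      finally show ?thesis .
    qed simp
    then have "W \<le> (\<integral>\<^sup>+k. ennreal (1 / \<kappa>\<^sup>2) * (\<integral>\<^sup>+t. indicator I t * (?N k t)\<^sup>2 \<partial>lborel) \<partial>K)"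
      unfolding W_def by (rule nn_integral_mono)
    then show ?thesis by (simp add: nn_integral_cmult NN_def)
  qed
  \<comment> \<open>Without finiteness the inequality \<open>W <= c * W\<close> with
    \<open>c < 1\<close> says nothing. It follows from the \<open>H^s\<close> bounds by
    \<open>|k|^2 <= |k|^(2 s)\<close> on a bounded interval.\<close>
  have Wfin: "W < \<infinity>"
  proof -
    have "W = (\<integral>\<^sup>+t. \<integral>\<^sup>+k. indicator I t * (aw (?w t) k)\<^sup>2 \<partial>K \<partial>lborel)"
      unfolding W_def by (rule nn_integral_K_swap[OF lborel.sigma_finite_measure_axioms, symmetric]) measurable
    also have "\<dots> \<le> (\<integral>\<^sup>+t. ennreal (4 * M) * indicator I t \<partial>lborel)"
    proof (rule nn_integral_mono)
      fix t :: real
      show "(\<integral>\<^sup>+k. indicator I t * (aw (?w t) k)\<^sup>2 \<partial>K) \<le> ennreal (4 * M) * indicator I t"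
      proof (cases "t \<in> I")
        case True
        have "(\<integral>\<^sup>+k. (aw (?w t) k)\<^sup>2 \<partial>K) \<le> HsN s (?w t)"
          unfolding HsN_def
        proof (rule nn_integral_mono)
          fix k
          have "kn k powr 2 \<le> kn k powr (2 * s)"
          proof (cases "k = 0")
            case False
            then show ?thesis using kn_ge_1[OF False] s by (intro powr_mono) auto
          qed simp
          then show "(aw (?w t) k)\<^sup>2 \<le> ennreal (kn k powr (2 * s)) * (ecmod (?w t k))\<^sup>2"
            unfolding aw_square by (intro mult_right_mono ennreal_leI) auto
        qed
        also have "\<dots> \<le> ennreal (4 * M)" by (intro Hs_diff_le psi_Hs theta_Hs inT True)
        finally show ?thesis using True by simp
      qed simp
    qed
    also have "\<dots> < \<infinity>" using T' by (simp add: I_def nn_integral_cmult_indicator ennreal_mult_less_top)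
    finally show ?thesis .
  qed
  have "W = 0"
  proof (cases W)
    case (real r)
    have "W \<le> ennreal (1 / \<kappa>\<^sup>2) * (ennreal q * W)" by (rule order_trans[OF WN mult_left_mono[OF NW]]) simp
    also have "\<dots> = ennreal (1 / \<kappa>\<^sup>2 * (q * r))" unfolding real(2) using q0 real by (intro ennreal_mult3) auto
    finally have "r \<le> 1 / \<kappa>\<^sup>2 * (q * r)" unfolding real(2) using q0 real(1) by (subst (asm) ennreal_le_iff) auto
    then have le: "\<kappa>\<^sup>2 * r \<le> q * r" using kappa by (simp add: field_simps)
    have "q < \<kappa>\<^sup>2" using small by (simp add: q_def power_mult_distrib algebra_simps)
    then have "r = 0" using le real(1) mult_right_less_imp_less by (metis less_le_not_le mult_strict_right_mono order_le_less)
    then show ?thesis using real by simp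
  qed (use Wfin in auto)
  then have NN0: "NN = 0" using NW by simp
  have k1: "kn k > 0" using kn_ge_1[OF k] by linarith
  \<comment> \<open>At a fixed time the difference depends on the earlier quadratic terms alone, and
    their differences vanish almost everywhere because \<open>NN = 0\<close>. This gives equality at
    every \<open>t\<close> and not just at almost every one.\<close>
  have "(\<integral>\<^sup>+\<tau>. indicator {0<..<t} \<tau> * (?N k \<tau>)\<^sup>2 \<partial>lborel) \<le> (\<integral>\<^sup>+\<tau>. indicator I \<tau> * (?N k \<tau>)\<^sup>2 \<partial>lborel)"
    using t by (intro nn_integral_mono mult_right_mono) (auto simp: indicator_def I_def)
  also have "\<dots> \<le> NN" unfolding NN_def by (rule nn_integral_K_member)
  finally have z: "(\<integral>\<^sup>+\<tau>. indicator {0<..<t} \<tau> * (?N k \<tau>)\<^sup>2 \<partial>lborel) = 0" using NN0 by simp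
  have "(dker (\<kappa> * kn k) (?N k) 0 t)\<^sup>2 \<le> ennreal (1 / (2 * (\<kappa> * kn k))) * (\<integral>\<^sup>+\<tau>. indicator {0<..<t} \<tau> * (?N k \<tau>)\<^sup>2 \<partial>lborel)"
    by (rule dker_L2) (use k1 kappa in auto)
  then have "dker (\<kappa> * kn k) (?N k) 0 t = 0" by (simp add: z)
  then have "ecmod (\<psi> t k - \<theta> t k) \<le> 0" using diff_le_dker[of t k] t by simp
  then show ?thesis by simp
qed

text \<open>\<open>\<psi>\<close> satisfies its equation on the open interval, so the value at
  \<open>t\<close> is read off the Duhamel formula, which gives the datum at \<open>t = 0\<close>.
  The \<open>H^s\<close> bound upgrades modewise continuity to the critical norm, which can
  therefore at most double for a short while.\<close>

lemma extend:
  assumes t: "0 \<le> t" "t < T" and AN: "AN (\<lambda>k. duhamel (\<kappa> * kn k) (y0 k) (\<lambda>\<tau>. sg \<tau> k - Bl (\<psi> \<tau>) (\<psi> \<tau>) k) t) \<le> ennreal dl"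
    and Hs: "HsN s (\<lambda>k. duhamel (\<kappa> * kn k) (y0 k) (\<lambda>\<tau>. sg \<tau> k - Bl (\<psi> \<tau>) (\<psi> \<tau>) k) t) \<le> ennreal M"
  shows "\<exists>b>t. b \<le> T \<and> (\<forall>r. t < r \<and> r < b \<longrightarrow> AN (\<psi> r) \<le> ennreal (2 * dl))"
proof -
  let ?z = "\<lambda>k. duhamel (\<kappa> * kn k) (y0 k) (\<lambda>\<tau>. sg \<tau> k - Bl (\<psi> \<tau>) (\<psi> \<tau>) k) t"
  have ev: "eventually (\<lambda>r. r \<in> {0<..<T} \<and> t < r) (at_right t)"
    unfolding eventually_at_right_field using t by (intro exI[of _ T]) auto
  have "eventually (\<lambda>r. AN (\<lambda>k. \<psi> r k - ?z k) \<le> ennreal dl) (at_right t)"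
  proof (rule AN_tendsto[where M = "4 * M"])
    fix k
    let ?d = "duhamel (\<kappa> * kn k) (y0 k) (\<lambda>\<tau>. sg \<tau> k - Bl (\<psi> \<tau>) (\<psi> \<tau>) k)"
    have "(?d \<longlongrightarrow> ?d t) (at t within {0..T})"
      using psi_cont[of k] t by (auto simp: continuous_on_def)
    then have "(?d \<longlongrightarrow> ?d t) (at t within {t<..<T})"
      by (rule tendsto_within_subset) (use t in auto)
    moreover have "at t within {t<..<T} = at_right t" using t by (intro at_within_nhd[of t "{t - 1<..<T}"]) auto
    ultimately have "(?d \<longlongrightarrow> ?d t) (at_right t)" by simp
    moreover have "eventually (\<lambda>r. ?d r = \<psi> r k) (at_right t)"
      using ev by eventually_elim (simp add: psi_eq)
    ultimately show "((\<lambda>r. \<psi> r k) \<longlongrightarrow> ?z k) (at_right t)" by (rule Lim_transform_eventually)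
  next
    show "eventually (\<lambda>r. HsN s (\<lambda>k. \<psi> r k - ?z k) \<le> ennreal (4 * M)) (at_right t)"
      using ev by eventually_elim (intro Hs_diff_le psi_Hs Hs, auto)
  qed (use M dl in auto)
  then have "eventually (\<lambda>r. AN (\<psi> r) \<le> ennreal (2 * dl)) (at_right t)"
  proof eventually_elim
    case (elim r)
    have "AN (\<psi> r) \<le> AN ?z + AN (\<lambda>k. \<psi> r k - ?z k)" by (rule AN_triangle)
    also have "\<dots> \<le> ennreal dl + ennreal dl" by (intro add_mono AN elim)
    also have "\<dots> = ennreal (2 * dl)" using dl by (simp add: ennreal_plus[symmetric] del: ennreal_plus)
    finally show ?case .
  qed
  then obtain b where b: "b > t" "\<And>r. t < r \<Longrightarrow> r < b \<Longrightarrow> AN (\<psi> r) \<le> ennreal (2 * dl)"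
    unfolding eventually_at_right_field by auto
  then show ?thesis using t by (intro exI[of _ "min b T"]) auto
qed

text \<open>At the supremum \<open>c\<close> of the good times both solutions agree up to the zero
  mode, so the critical norm of \<open>\<psi> c\<close> is back below \<open>dl\<close>, half of the
  bound, and \<open>extend\<close> leads beyond \<open>c\<close>.\<close>

lemma psi_AN_small:
  assumes "t \<in> {0<..<T}"
  shows "AN (\<psi> t) \<le> ennreal (2 * dl)"
proof -
  define G where "G = {b. 0 < b \<and> b \<le> T \<and> (\<forall>r. 0 < r \<and> r < b \<longrightarrow> AN (\<psi> r) \<le> ennreal (2 * dl))}"
  obtain b0 where b0: "b0 > 0" "b0 \<le> T" "\<forall>r. 0 < r \<and> r < b0 \<longrightarrow> AN (\<psi> r) \<le> ennreal (2 * dl)"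
    using extend[of 0] T y0_AN y0_Hs by auto
  then have b0G: "b0 \<in> G" by (simp add: G_def)
  have bdd: "bdd_above G" by (rule bdd_aboveI[of _ T]) (auto simp: G_def)
  define c where "c = Sup G"
  have cT: "c \<le> T" unfolding c_def using b0G by (intro cSup_least) (auto simp: G_def)
  have c0: "0 < c" using cSup_upper[OF b0G bdd] b0 by (simp add: c_def)
  have cG: "AN (\<psi> r) \<le> ennreal (2 * dl)" if r: "0 < r" "r < c" for r
  proof -
    obtain b where "b \<in> G" "r < b" using less_cSup_iff[of G r] b0G bdd r(2) by (auto simp: c_def)
    then show ?thesis using r by (auto simp: G_def)
  qed
  have "c = T"
  proof (rule ccontr)
    assume "c \<noteq> T"
    then have cT': "c < T" using cT by simp
    then have cin: "c \<in> {0<..<T}" using c0 by simp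
    have eq: "\<psi> c k = \<theta> c k" if "k \<noteq> 0" for k
      by (rule local_unique[OF c0 cT _ c0 order_refl cT' that]) (use cG in auto)
    have z: "(\<lambda>k. duhamel (\<kappa> * kn k) (y0 k) (\<lambda>\<tau>. sg \<tau> k - Bl (\<psi> \<tau>) (\<psi> \<tau>) k) c) = \<psi> c"
      using psi_eq[OF cin] by (simp add: fun_eq_iff)
    have "aw (\<psi> c) k = aw (\<theta> c) k" for k using eq by (cases "k = 0") (auto simp: aw_def)
    then have "AN (\<psi> c) = AN (\<theta> c)" by (simp add: AN_def)
    then have "AN (\<psi> c) \<le> ennreal dl" using theta_AN[OF cin] by simp
    then obtain b where b: "b > c" "b \<le> T" "\<forall>r. c < r \<and> r < b \<longrightarrow> AN (\<psi> r) \<le> ennreal (2 * dl)"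
      using extend[of c] c0 cT' psi_Hs[OF cin] unfolding z by auto
    have "AN (\<psi> c) \<le> ennreal (2 * dl)"
      using \<open>AN (\<psi> c) \<le> ennreal dl\<close> dl by (intro order_trans[OF _ ennreal_leI[of dl "2 * dl"]]) auto
    then have "\<forall>r. 0 < r \<and> r < b \<longrightarrow> AN (\<psi> r) \<le> ennreal (2 * dl)"
      using cG b(3) by (metis linorder_neqE_linordered_idom)
    then have "b \<in> G" using b c0 by (simp add: G_def)
    then have "b \<le> c" unfolding c_def by (rule cSup_upper[OF _ bdd])
    then show False using b by simp
  qed
  then show ?thesis using assms cG by simp
qed

lemma fourier_uniqueness: "t \<in> {0<..<T} \<Longrightarrow> k \<noteq> 0 \<Longrightarrow> \<psi> t k = \<theta> t k"
  using local_unique[OF T order_refl psi_AN_small] by auto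

end

section \<open>Sobolev spaces on the Fourier side\<close>

text \<open>Inhomogeneous counterpart of \<open>HsN\<close>. When finite, it is the squared Sobolev
  norm up to the factor \<open>vol\<close>.\<close>

definition SN :: "real \<Rightarrow> (int^3 \<Rightarrow> complex) \<Rightarrow> ennreal" where
  "SN r c = (\<integral>\<^sup>+k. ennreal ((1 + (kn k)\<^sup>2) powr r) * (ecmod (c k))\<^sup>2 \<partial>K)"

lemma ennreal_weight: "0 \<le> w \<Longrightarrow> ennreal (w * (cmod z)\<^sup>2) = ennreal w * (ecmod z)\<^sup>2"
  by (simp add: ennreal_mult ennreal_power)

lemma Sobolev_iff: "f \<in> Sobolev r \<longleftrightarrow> f \<in> L2_space \<and> SN r (fourier_coeff f) < \<infinity>"
  unfolding Sobolev_def SN_def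
  by (simp add: summable_on_iff_nn_integral_K(1) ennreal_weight)

lemma Sobolev_norm_nonneg: "0 \<le> Sobolev_norm r f"
  unfolding Sobolev_norm_def by (intro real_sqrt_ge_zero mult_nonneg_nonneg infsum_nonneg) auto

lemma Sobolev_norm_SN:
  assumes "SN r (fourier_coeff f) < \<infinity>"
  shows "ennreal ((Sobolev_norm r f)\<^sup>2) = ennreal vol * SN r (fourier_coeff f)"
proof -
  let ?f = "\<lambda>k. (1 + (norm (wavevec k))\<^sup>2) powr r * (cmod (fourier_coeff f k))\<^sup>2"
  have s: "?f summable_on UNIV"
    using assms unfolding SN_def by (subst summable_on_iff_nn_integral_K(1)) (auto simp: ennreal_weight)
  have "(Sobolev_norm r f)\<^sup>2 = vol * (\<Sum>\<^sub>\<infinity>k. ?f k)"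
    unfolding Sobolev_norm_def vol_def by (intro real_sqrt_pow2 mult_nonneg_nonneg infsum_nonneg) auto
  then have "ennreal ((Sobolev_norm r f)\<^sup>2) = ennreal vol * ennreal (\<Sum>\<^sub>\<infinity>k. ?f k)"
    by (simp add: ennreal_mult infsum_nonneg less_imp_le)
  also have "ennreal (\<Sum>\<^sub>\<infinity>k. ?f k) = SN r (fourier_coeff f)"
    unfolding SN_def using summable_on_iff_nn_integral_K(2)[OF _ s] by (simp add: ennreal_weight)
  finally show ?thesis .
qed

lemma SN_eq: "SN r (fourier_coeff f) = ennreal ((Sobolev_norm r f)\<^sup>2 / vol)" if "f \<in> Sobolev r"
proof -
  have fin: "SN r (fourier_coeff f) < \<infinity>" using that by (simp add: Sobolev_iff)
  then obtain x where x: "SN r (fourier_coeff f) = ennreal x" "x \<ge> 0" by (cases "SN r (fourier_coeff f)") auto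
  have "ennreal ((Sobolev_norm r f)\<^sup>2) = ennreal (vol * x)"
    using Sobolev_norm_SN[OF fin] x by (simp add: ennreal_mult less_imp_le)
  then have "(Sobolev_norm r f)\<^sup>2 = vol * x" using x by (simp add: less_imp_le)
  then show ?thesis using x by simp
qed

lemma weight_le: "r \<ge> 0 \<Longrightarrow> kn k powr (2 * r) \<le> (1 + (kn k)\<^sup>2) powr r"
proof -
  assume r: "r \<ge> 0"
  have "kn k powr (2 * r) = ((kn k)\<^sup>2) powr r"
    by (cases "k = 0") (simp_all add: powr_powr[symmetric] powr_numeral)
  also have "\<dots> \<le> (1 + (kn k)\<^sup>2) powr r" using r by (intro powr_mono2) auto
  finally show ?thesis .
qed

lemma HsN_le_SN: "r \<ge> 0 \<Longrightarrow> HsN r c \<le> SN r c"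
  unfolding HsN_def SN_def by (intro nn_integral_mono mult_right_mono ennreal_leI weight_le) auto

text \<open>Away from the zero mode \<open>1 + |k|^2 <= 2 |k|^2\<close>.\<close>

lemma SN_le_HsN:
  assumes "r \<ge> 0" "c 0 = 0"
  shows "SN r c \<le> ennreal (2 powr r) * HsN r c"
proof -
  have "SN r c \<le> (\<integral>\<^sup>+k. ennreal (2 powr r) * (ennreal (kn k powr (2 * r)) * (ecmod (c k))\<^sup>2) \<partial>K)"
    unfolding SN_def
  proof (rule nn_integral_mono)
    fix k
    show "ennreal ((1 + (kn k)\<^sup>2) powr r) * (ecmod (c k))\<^sup>2 \<le> ennreal (2 powr r) * (ennreal (kn k powr (2 * r)) * (ecmod (c k))\<^sup>2)"
    proof (cases "k = 0")
      case False
      have k1: "kn k \<ge> 1" by (rule kn_ge_1[OF False])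
      have "1 + (kn k)\<^sup>2 \<le> 2 * (kn k)\<^sup>2" using one_le_power[OF k1, of 2] by simp
      then have "(1 + (kn k)\<^sup>2) powr r \<le> (2 * (kn k)\<^sup>2) powr r" using assms by (intro powr_mono2) (auto simp: add_nonneg_nonneg)
      also have "\<dots> = 2 powr r * kn k powr (2 * r)"
        using k1 False by (simp add: powr_mult powr_powr[symmetric] powr_numeral)
      finally have "ennreal ((1 + (kn k)\<^sup>2) powr r) \<le> ennreal (2 powr r) * ennreal (kn k powr (2 * r))"
        by (simp add: ennreal_mult[symmetric] ennreal_leI)
      then show ?thesis unfolding mult.assoc[symmetric] by (rule mult_right_mono) simp
    qed (simp add: assms)
  qed
  then show ?thesis by (simp add: HsN_def nn_integral_cmult)
qed

lemma SN_mono: "r \<le> r' \<Longrightarrow> SN r c \<le> SN r' c"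
  unfolding SN_def by (intro nn_integral_mono mult_right_mono ennreal_leI powr_mono) auto

lemma SN_diff: "SN r (\<lambda>k. u k - v k) \<le> ennreal 2 * (SN r u + SN r v)"
proof -
  have "SN r (\<lambda>k. u k - v k) \<le> (\<integral>\<^sup>+k. ennreal ((1 + (kn k)\<^sup>2) powr r) * (ennreal 2 * ((ecmod (u k))\<^sup>2 + (ecmod (v k))\<^sup>2)) \<partial>K)"
    unfolding SN_def by (intro nn_integral_mono mult_left_mono cmod_diff_sq) simp
  also have "\<dots> = (\<integral>\<^sup>+k. ennreal 2 * (ennreal ((1 + (kn k)\<^sup>2) powr r) * (ecmod (u k))\<^sup>2 + ennreal ((1 + (kn k)\<^sup>2) powr r) * (ecmod (v k))\<^sup>2) \<partial>K)"
    by (simp add: distrib_left mult.left_commute)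
  also have "\<dots> = ennreal 2 * (SN r u + SN r v)"
    unfolding SN_def by (simp only: nn_integral_add nn_integral_cmult borel_measurable_count_space)
  finally show ?thesis .
qed

lemma SN_ge: "r \<ge> 0 \<Longrightarrow> (ecmod (c k))\<^sup>2 \<le> SN r c"
proof -
  assume r: "r \<ge> 0"
  have "1 \<le> (1 + (kn k)\<^sup>2) powr r" using r by (intro ge_one_powr_ge_zero) auto
  then have "1 * (ecmod (c k))\<^sup>2 \<le> ennreal ((1 + (kn k)\<^sup>2) powr r) * (ecmod (c k))\<^sup>2"
    by (intro mult_right_mono) auto
  also have "\<dots> \<le> SN r c" unfolding SN_def by (rule nn_integral_K_member)
  finally show ?thesis by simp
qed

lemma cmod_le_Sobolev_norm:
  assumes "SN r (fourier_coeff f) < \<infinity>" "r \<ge> 0"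
  shows "cmod (fourier_coeff f k) \<le> Sobolev_norm r f / sqrt vol"
proof -
  have "ennreal vol * (ecmod (fourier_coeff f k))\<^sup>2 \<le> ennreal ((Sobolev_norm r f)\<^sup>2)"
    unfolding Sobolev_norm_SN[OF assms(1)] by (intro mult_left_mono SN_ge assms) simp
  then have "ennreal (vol * (cmod (fourier_coeff f k))\<^sup>2) \<le> ennreal ((Sobolev_norm r f)\<^sup>2)"
    by (simp add: ennreal_weight less_imp_le)
  then have "vol * (cmod (fourier_coeff f k))\<^sup>2 \<le> (Sobolev_norm r f)\<^sup>2" by (simp add: ennreal_le_iff)
  then have "(sqrt vol * cmod (fourier_coeff f k))\<^sup>2 \<le> (Sobolev_norm r f)\<^sup>2"
    by (simp add: power_mult_distrib less_imp_le)
  then have "sqrt vol * cmod (fourier_coeff f k) \<le> Sobolev_norm r f"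
    by (rule power2_le_imp_le) (rule Sobolev_norm_nonneg)
  then show ?thesis by (simp add: field_simps)
qed

lemma L2_space_diff:
  assumes "f \<in> L2_space" "g \<in> L2_space"
  shows "(\<lambda>x. f x - g x) \<in> L2_space"
proof -
  have [measurable]: "f \<in> borel_measurable torus" "g \<in> borel_measurable torus" using assms by (auto simp: L2_space_def)
  have i: "integrable torus (\<lambda>x. 2 * (f x)\<^sup>2 + 2 * (g x)\<^sup>2)" using assms by (auto simp: L2_space_def)
  have "integrable torus (\<lambda>x. (f x - g x)\<^sup>2)"
  proof (rule Bochner_Integration.integrable_bound[OF i])
    show "AE x in torus. norm ((f x - g x)\<^sup>2) \<le> norm (2 * (f x)\<^sup>2 + 2 * (g x)\<^sup>2)"
    proof (rule AE_I2)
      fix x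
      have "0 \<le> (f x + g x)\<^sup>2" by simp
      then have "(f x - g x)\<^sup>2 \<le> 2 * (f x)\<^sup>2 + 2 * (g x)\<^sup>2" by (simp add: power2_eq_square algebra_simps)
      then show "norm ((f x - g x)\<^sup>2) \<le> norm (2 * (f x)\<^sup>2 + 2 * (g x)\<^sup>2)" by simp
    qed
  qed measurable
  then show ?thesis using assms by (simp add: L2_space_def periodic_def)
qed

lemma Sobolev_diff:
  assumes "f \<in> Sobolev r" "g \<in> Sobolev r"
  shows "(\<lambda>x. f x - g x) \<in> Sobolev r"
    and "fourier_coeff (\<lambda>x. f x - g x) = (\<lambda>k. fourier_coeff f k - fourier_coeff g k)"
proof -
  have L: "f \<in> L2_space" "g \<in> L2_space" using assms by (auto simp: Sobolev_iff)
  show eq: "fourier_coeff (\<lambda>x. f x - g x) = (\<lambda>k. fourier_coeff f k - fourier_coeff g k)"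
    using L by (intro ext fourier_coeff_diff L2_integrable)
  have "SN r (\<lambda>k. fourier_coeff f k - fourier_coeff g k) \<le> ennreal 2 * (SN r (fourier_coeff f) + SN r (fourier_coeff g))"
    by (rule SN_diff)
  also have "\<dots> < \<infinity>" using assms by (simp add: Sobolev_iff ennreal_mult_less_top)
  finally show "(\<lambda>x. f x - g x) \<in> Sobolev r" using L by (simp add: Sobolev_iff eq L2_space_diff)
qed

section \<open>Absolute convergence, multipliers and interpolation\<close>

lemma absum_AN: "AN c < \<infinity> \<Longrightarrow> absum c"
proof -
  assume a: "AN c < \<infinity>"
  have "(\<integral>\<^sup>+k. ecmod (c k) \<partial>K) \<le> (\<integral>\<^sup>+k. ecmod (c 0) * indicator {0} k + aw c k \<partial>K)"
  proof (rule nn_integral_mono)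
    fix k
    show "ecmod (c k) \<le> ecmod (c 0) * indicator {0} k + aw c k"
    proof (cases "k = 0")
      case False
      have "1 * cmod (c k) \<le> kn k * cmod (c k)" by (intro mult_right_mono kn_ge_1 False) simp
      then show ?thesis using False by (simp add: aw_def ennreal_leI)
    qed simp
  qed
  also have "\<dots> = ecmod (c 0) + AN c" by (simp add: nn_integral_add AN_def)
  also have "\<dots> < \<infinity>" using a by simp
  finally show ?thesis by (simp add: absum_def)
qed

lemma absum_cmult_AN: "AN c < \<infinity> \<Longrightarrow> (\<And>k. \<bar>w k\<bar> \<le> B * kn k) \<Longrightarrow> absum (\<lambda>k. of_real (w k) * c k)"
proof -
  assume a: "AN c < \<infinity>" and w: "\<And>k. \<bar>w k\<bar> \<le> B * kn k"
  have "(\<integral>\<^sup>+k. ecmod (of_real (w k) * c k) \<partial>K) \<le> (\<integral>\<^sup>+k. ennreal (max B 0) * aw c k \<partial>K)"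
  proof (rule nn_integral_mono)
    fix k
    have "\<bar>w k\<bar> \<le> max B 0 * kn k" by (rule order_trans[OF w mult_right_mono]) auto
    then have "\<bar>w k\<bar> * cmod (c k) \<le> max B 0 * kn k * cmod (c k)" by (rule mult_right_mono) simp
    then have "ecmod (of_real (w k) * c k) \<le> ennreal (max B 0 * (kn k * cmod (c k)))"
      by (intro ennreal_leI) (simp add: norm_mult mult.assoc)
    also have "\<dots> = ennreal (max B 0) * aw c k" unfolding aw_def by (rule ennreal_mult) auto
    finally show "ecmod (of_real (w k) * c k) \<le> ennreal (max B 0) * aw c k" .
  qed
  also have "\<dots> = ennreal (max B 0) * AN c" by (simp add: AN_def nn_integral_cmult)
  also have "\<dots> < \<infinity>" using a by (simp add: ennreal_mult_less_top)
  finally show ?thesis by (simp add: absum_def)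
qed

lemma (in mg_fourier) AN_Sobolev: "f \<in> Sobolev s \<Longrightarrow> AN (fourier_coeff f) < \<infinity>"
proof -
  assume f: "f \<in> Sobolev s"
  have "HsN s (fourier_coeff f) < \<infinity>"
    using f s by (intro le_less_trans[OF HsN_le_SN]) (auto simp: Sobolev_iff)
  then obtain x where x: "ennreal Cz + HsN s (fourier_coeff f) = ennreal x" "x \<ge> 0"
    by (cases "ennreal Cz + HsN s (fourier_coeff f)") auto
  have "AN (fourier_coeff f) \<le> ennreal (1 / 2) * ennreal x" using AN_le_HsN[of "fourier_coeff f"] by (simp only: x)
  also have "\<dots> = ennreal (1 / 2 * x)" using x by (intro ennreal_mult[symmetric]) auto
  finally show ?thesis by (rule le_less_trans) simp
qed

lemma multiplier_op_exists:
  assumes "absum (\<lambda>k. of_real (w k) * fourier_coeff f k)" "\<And>k. w (- k) = w k"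
  shows "multiplier_op w f \<in> L2_space" "fourier_coeff (multiplier_op w f) k = of_real (w k) * fourier_coeff f k"
proof -
  have h: "herm (\<lambda>k. of_real (w k) * fourier_coeff f k)"
    using herm_fourier_coeff[of f] by (simp add: herm_def assms(2))
  have ex: "\<exists>g. g \<in> L2_space \<and> (\<forall>k. fourier_coeff g k = of_real (w k) * fourier_coeff f k)"
    using fser_L2[OF assms(1)] fourier_coeff_fser[OF assms(1) h] by blast
  show "multiplier_op w f \<in> L2_space" "fourier_coeff (multiplier_op w f) k = of_real (w k) * fourier_coeff f k"
    using someI_ex[OF ex] unfolding multiplier_op_def by auto
qed

lemma Parseval:
  assumes f: "f \<in> L2_space" "absum (fourier_coeff f)"
  shows "(\<integral>\<^sup>+k. (ecmod (fourier_coeff f k))\<^sup>2 \<partial>K) = ennreal ((L2_norm f)\<^sup>2 / vol)"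
proof -
  let ?c = "fourier_coeff f"
  have fi: "integrable torus f" by (rule L2_integrable[OF f(1)])
  obtain B where B: "(\<integral>\<^sup>+k. ecmod (?c k) \<partial>K) = ennreal B" "B \<ge> 0"
    using f(2) unfolding absum_def by (cases "(\<integral>\<^sup>+k. ecmod (?c k) \<partial>K)") auto
  have cB: "cmod (?c k) \<le> B" for k
    using nn_integral_K_member[of "\<lambda>k. ecmod (?c k)" k] B by (simp add: ennreal_le_iff)
  have i2: "integrable K (\<lambda>k. (cmod (?c k))\<^sup>2)"
  proof (rule Bochner_Integration.integrable_bound[where f = "\<lambda>k. B * cmod (?c k)"])
    show "integrable K (\<lambda>k. B * cmod (?c k))"
      using f(2) by (intro integrable_mult_right) (simp add: integrable_K_iff absum_def)
    show "AE k in K. norm ((cmod (?c k))\<^sup>2) \<le> norm (B * cmod (?c k))"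
      using cB B(2) by (intro AE_I2) (simp add: power2_eq_square mult_right_mono)
  qed simp
  have "complex_of_real (LINT x|torus. f x * f x) = vol * (LINT k|K. ?c k * ?c (- k))"
    by (rule integral_real_mult_absum[OF fi fi f(2)])
  also have "(\<lambda>k. ?c k * ?c (- k)) = (\<lambda>k. complex_of_real ((cmod (?c k))\<^sup>2))"
    using herm_fourier_coeff[of f] by (auto simp: herm_def complex_norm_square[symmetric])
  also have "complex_of_real vol * (LINT k|K. complex_of_real ((cmod (?c k))\<^sup>2)) = complex_of_real (vol * (LINT k|K. (cmod (?c k))\<^sup>2))"
    by (simp only: integral_complex_of_real of_real_mult)
  finally have eq: "(LINT x|torus. f x * f x) = vol * (LINT k|K. (cmod (?c k))\<^sup>2)" by (simp only: of_real_eq_iff)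
  have "(L2_norm f)\<^sup>2 = (LINT x|torus. f x * f x)" unfolding L2_norm_def by (simp add: power2_eq_square)
  then have "(L2_norm f)\<^sup>2 / vol = (LINT k|K. (cmod (?c k))\<^sup>2)" by (simp add: eq)
  then have "ennreal ((L2_norm f)\<^sup>2 / vol) = (\<integral>\<^sup>+k. ennreal ((cmod (?c k))\<^sup>2) \<partial>K)"
    using nn_integral_eq_integral[OF i2] by simp
  then show ?thesis by (simp add: ennreal_power)
qed

text \<open>The smallness condition controls the scaling-critical norm: the low modes are estimated by the
  \<open>L\<^sup>2\<close> norm, the high ones by the \<open>H\<^sup>s\<close> norm, and the cut is made where the two bounds agree.\<close>

lemma (in mg_fourier) interpolation:
  obtains C1 where "C1 > 0" "\<And>f. f \<in> Sobolev s \<Longrightarrow>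
    AN (fourier_coeff f) \<le> ennreal (C1 * (L2_norm f powr (1 - (5/2) / s) * Sobolev_norm s f powr ((5/2) / s)))"
proof -
  obtain C0 where C0: "C0 > 0" "\<And>R. R \<ge> 1 \<Longrightarrow>
    (\<integral>\<^sup>+k. ennreal ((kn k)\<^sup>2 / (1 + (kn k / R) powr (2 * s))) \<partial>K) \<le> ennreal (C0 * R ^ 5)"
    using lattice_sum[OF s] by blast
  define C1 where "C1 = sqrt (C0 * 2 / vol)"
  have C1: "C1 > 0" using C0 by (simp add: C1_def)
  have "AN (fourier_coeff f) \<le> ennreal (C1 * (L2_norm f powr (1 - (5/2) / s) * Sobolev_norm s f powr ((5/2) / s)))"
    if f: "f \<in> Sobolev s" for f
  proof -
    let ?c = "fourier_coeff f"
    define L where "L = L2_norm f"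
    define Hn where "Hn = Sobolev_norm s f"
    have L0: "L \<ge> 0" by (simp add: L_def L2_norm_def)
    have H0: "Hn \<ge> 0" unfolding Hn_def by (rule Sobolev_norm_nonneg)
    have fL: "f \<in> L2_space" using f by (simp add: Sobolev_iff)
    have ab: "absum ?c" by (rule absum_AN[OF AN_Sobolev[OF f]])
    have l2: "(\<integral>\<^sup>+k. (ecmod (?c k))\<^sup>2 \<partial>K) = ennreal (L\<^sup>2 / vol)"
      unfolding L_def by (rule Parseval[OF fL ab])
    have h2: "HsN s ?c \<le> ennreal (Hn\<^sup>2 / vol)"
      using HsN_le_SN[of s ?c] s SN_eq[OF f] by (simp add: Hn_def)
    have "(\<integral>\<^sup>+k. (ecmod (?c k))\<^sup>2 \<partial>K) = SN 0 ?c"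
    proof -
      have "1 + (kn k)\<^sup>2 \<noteq> 0" for k using zero_le_power2[of "kn k"] by linarith
      then show ?thesis by (simp add: SN_def)
    qed
    also have "\<dots> \<le> ennreal (Hn\<^sup>2 / vol)" unfolding Hn_def SN_eq[OF f, symmetric] using s by (intro SN_mono) simp
    finally have "L\<^sup>2 / vol \<le> Hn\<^sup>2 / vol" unfolding l2 by (simp add: ennreal_le_iff less_imp_le)
    then have "L\<^sup>2 \<le> Hn\<^sup>2" by (simp add: divide_le_cancel)
    then have LH: "L \<le> Hn" using H0 by (rule power2_le_imp_le)
    show ?thesis
    proof (cases "L = 0")
      \<comment> \<open>The cut radius is defined by a division by \<open>L\<close>; for
        \<open>L = 0\<close> all coefficients vanish.\<close>
      case True
      then have "(\<integral>\<^sup>+k. (ecmod (?c k))\<^sup>2 \<partial>K) = 0" using l2 by simp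
      then have "(ecmod (?c k))\<^sup>2 = 0" for k
        using nn_integral_K_member[of "\<lambda>k. (ecmod (?c k))\<^sup>2" k] by simp
      then have "AN ?c = 0" by (simp add: AN_def aw_def)
      then show ?thesis by simp
    next
      case False
      then have Lp: "L > 0" using L0 by simp
      then have Hp: "Hn > 0" using LH by simp
      define R where "R = (Hn / L) powr (1 / s)"
      have HL: "Hn / L \<ge> 1" using LH Lp by simp
      then have R1: "R \<ge> 1" unfolding R_def using s by (intro ge_one_powr_ge_zero) auto
      have R2s: "R powr (2 * s) = (Hn / L)\<^sup>2"
        unfolding R_def using s HL by (simp add: powr_powr powr_numeral)
      define w where "w k = 1 + (kn k / R) powr (2 * s)" for k
      have w1: "w k \<ge> 1" for k by (simp add: w_def)
      have w0: "w k > 0" for k using w1[of k] by linarith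
      \<comment> \<open>The weight consists of 1 and \<open>(|k| / R)^(2 s)\<close>. Since
        \<open>R^(2 s) = (Hn / L)^2\<close>, each part contributes at most \<open>L^2 / vol\<close>
        to the weighted square sum.\<close>
      have wW: "(\<integral>\<^sup>+k. ennreal (w k) * (ecmod (?c k))\<^sup>2 \<partial>K) \<le> ennreal (2 * L\<^sup>2 / vol)"
      proof -
        have we: "ennreal (w k) = 1 + ennreal ((L / Hn)\<^sup>2) * ennreal (kn k powr (2 * s))" for k
        proof -
          have "(kn k / R) powr (2 * s) = (L / Hn)\<^sup>2 * kn k powr (2 * s)"
            using R1 by (subst powr_divide) (auto simp: R2s power_divide)
          then have "w k = 1 + (L / Hn)\<^sup>2 * kn k powr (2 * s)" by (simp add: w_def)
          then have "ennreal (w k) = ennreal 1 + ennreal ((L / Hn)\<^sup>2 * kn k powr (2 * s))"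
            by (simp only:) (rule ennreal_plus, auto)
          also have "ennreal ((L / Hn)\<^sup>2 * kn k powr (2 * s)) = ennreal ((L / Hn)\<^sup>2) * ennreal (kn k powr (2 * s))"
            by (rule ennreal_mult) auto
          finally show ?thesis by simp
        qed
        have "(\<integral>\<^sup>+k. ennreal (w k) * (ecmod (?c k))\<^sup>2 \<partial>K)
          = (\<integral>\<^sup>+k. (ecmod (?c k))\<^sup>2 + ennreal ((L / Hn)\<^sup>2) * (ennreal (kn k powr (2 * s)) * (ecmod (?c k))\<^sup>2) \<partial>K)"
          unfolding we by (simp add: distrib_right mult.assoc)
        also have "\<dots> = ennreal (L\<^sup>2 / vol) + ennreal ((L / Hn)\<^sup>2) * HsN s ?c"
          unfolding HsN_def by (simp only: nn_integral_add nn_integral_cmult borel_measurable_count_space l2)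
        also have "\<dots> \<le> ennreal (L\<^sup>2 / vol) + ennreal ((L / Hn)\<^sup>2) * ennreal (Hn\<^sup>2 / vol)"
          by (intro add_left_mono mult_left_mono h2) simp
        also have "ennreal ((L / Hn)\<^sup>2) * ennreal (Hn\<^sup>2 / vol) = ennreal ((L / Hn)\<^sup>2 * (Hn\<^sup>2 / vol))"
          by (rule ennreal_mult[symmetric]) (auto simp: less_imp_le)
        also have "(L / Hn)\<^sup>2 * (Hn\<^sup>2 / vol) = L\<^sup>2 / vol" using Hp by (simp add: power_divide)
        also have "ennreal (L\<^sup>2 / vol) + ennreal (L\<^sup>2 / vol) = ennreal (L\<^sup>2 / vol + L\<^sup>2 / vol)"
          by (rule ennreal_plus[symmetric]) (auto simp: less_imp_le)
        finally show ?thesis by simp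
      qed
      have "(AN ?c)\<^sup>2 = (\<integral>\<^sup>+k. ennreal (kn k / sqrt (w k)) * ennreal (sqrt (w k) * cmod (?c k)) \<partial>K)\<^sup>2"
      proof -
        have "aw ?c k = ennreal (kn k / sqrt (w k)) * ennreal (sqrt (w k) * cmod (?c k))" for k
          unfolding aw_def using w0[of k] by (subst ennreal_mult[symmetric]) (auto simp: less_imp_le)
        then show ?thesis by (simp add: AN_def)
      qed
      also have "\<dots> \<le> (\<integral>\<^sup>+k. (ennreal (kn k / sqrt (w k)))\<^sup>2 \<partial>K) * (\<integral>\<^sup>+k. (ennreal (sqrt (w k) * cmod (?c k)))\<^sup>2 \<partial>K)"
        by (rule Cauchy_Schwarz_nn_integral) auto
      also have "(\<lambda>k. (ennreal (kn k / sqrt (w k)))\<^sup>2) = (\<lambda>k. ennreal ((kn k)\<^sup>2 / w k))"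
        using w0 by (auto simp: ennreal_power power_divide less_imp_le fun_eq_iff)
      also have "(\<lambda>k. (ennreal (sqrt (w k) * cmod (?c k)))\<^sup>2) = (\<lambda>k. ennreal (w k) * (ecmod (?c k))\<^sup>2)"
        using w0 by (auto simp: ennreal_power power_mult_distrib less_imp_le fun_eq_iff ennreal_mult)
      also have "(\<integral>\<^sup>+k. ennreal ((kn k)\<^sup>2 / w k) \<partial>K) * (\<integral>\<^sup>+k. ennreal (w k) * (ecmod (?c k))\<^sup>2 \<partial>K)
         \<le> ennreal (C0 * R ^ 5) * ennreal (2 * L\<^sup>2 / vol)"
        unfolding w_def by (intro mult_mono C0(2) R1 wW[unfolded w_def]) auto
      also have "\<dots> = ennreal (C0 * R ^ 5 * (2 * L\<^sup>2 / vol))"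
        using C0 R1 by (intro ennreal_mult[symmetric]) (auto simp: less_imp_le)
      finally have sq: "(AN ?c)\<^sup>2 \<le> ennreal (C0 * R ^ 5 * (2 * L\<^sup>2 / vol))" .
      define Q where "Q = C1 * (L powr (1 - (5/2) / s) * Hn powr ((5/2) / s))"
      have Q0: "Q \<ge> 0" using C1 by (simp add: Q_def)
      \<comment> \<open>The square root of \<open>R^5\<close> is
        \<open>R^(5/2) = (Hn / L)^((5/2) / s)\<close>; this is the origin of the exponents in the
        smallness condition.\<close>
      have "R powr (5/2) * L = L powr (1 - (5/2) / s) * Hn powr ((5/2) / s)"
      proof -
        have "R powr (5/2) = (Hn / L) powr ((5/2) / s)" unfolding R_def by (simp add: powr_powr mult.commute)
        also have "\<dots> = Hn powr ((5/2) / s) / L powr ((5/2) / s)" using Lp Hp by (subst powr_divide) auto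
        finally show ?thesis using Lp by (simp add: powr_diff)
      qed
      then have "Q = C1 * (R powr (5/2) * L)" by (simp add: Q_def)
      then have "Q\<^sup>2 = C1\<^sup>2 * ((R powr (5/2))\<^sup>2 * L\<^sup>2)" by (simp add: power_mult_distrib)
      also have "(R powr (5/2))\<^sup>2 = R ^ 5"
      proof -
        have "(R powr (5/2))\<^sup>2 = R powr (5/2 + 5/2)" unfolding power2_eq_square by (rule powr_add[symmetric])
        also have "\<dots> = R ^ 5" using R1 by (simp add: powr_numeral)
        finally show ?thesis .
      qed
      also have "C1\<^sup>2 = C0 * 2 / vol" unfolding C1_def using C0 by (intro real_sqrt_pow2) (auto simp: less_imp_le)
      finally have "Q\<^sup>2 = C0 * R ^ 5 * (2 * L\<^sup>2 / vol)" by simp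
      then have "(AN ?c)\<^sup>2 \<le> ennreal (Q\<^sup>2)" using sq by simp
      then have "AN ?c \<le> ennreal Q"
      proof (cases "AN ?c")
        case (real x)
        assume "(AN ?c)\<^sup>2 \<le> ennreal (Q\<^sup>2)"
        then have "ennreal (x\<^sup>2) \<le> ennreal (Q\<^sup>2)" using real by (simp add: ennreal_power)
        then have "x\<^sup>2 \<le> Q\<^sup>2" by (simp add: ennreal_le_iff)
        then have "x \<le> Q" using Q0 by (rule power2_le_imp_le)
        then show ?thesis using real by (simp add: ennreal_leI)
      next
        case top
        assume "(AN ?c)\<^sup>2 \<le> ennreal (Q\<^sup>2)"
        then show ?thesis using top by (simp add: power2_eq_square ennreal_top_mult top_unique)
      qed
      then show ?thesis unfolding Q_def L_def Hn_def .
    qed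
  qed
  then show ?thesis using that C1 by blast
qed

section \<open>Measurability of the modes in time\<close>

lemma complete_lebesgue_on:
  assumes "S \<in> sets lebesgue"
  shows "complete_measure (lebesgue_on S)"
proof
  fix A B assume AB: "A \<subseteq> B" "B \<in> null_sets (lebesgue_on S)"
  then have "B \<in> null_sets lebesgue" "B \<subseteq> S" using assms by (auto simp: null_sets_restrict_space)
  then have "A \<in> sets lebesgue" "A \<subseteq> S" using AB completion.complete by blast+
  then show "A \<in> sets (lebesgue_on S)" using assms by (simp add: sets_restrict_space_iff)
qed

text \<open>Completeness of \<open>lebesgue_on S\<close> makes measurability insensitive to null
  sets; the data are controlled only at almost every time.\<close>

lemma measurable_lebesgue_on_AE:
  assumes S: "S \<in> sets lebesgue" and g: "g \<in> borel_measurable (lebesgue_on S)" and ae: "AE t in lebesgue_on S. f t = g t"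
  shows "f \<in> borel_measurable (lebesgue_on S)"
proof (rule borel_measurableI)
  interpret complete_measure "lebesgue_on S" by (rule complete_lebesgue_on[OF S])
  fix U :: "'b set" assume U: "open U"
  show "f -` U \<inter> space (lebesgue_on S) \<in> sets (lebesgue_on S)"
  proof (rule in_sets_AE)
    show "g -` U \<inter> space (lebesgue_on S) \<in> sets (lebesgue_on S)" using U by (intro measurable_sets[OF g]) auto
    show "AE x in lebesgue_on S. x \<in> g -` U \<inter> space (lebesgue_on S) \<longleftrightarrow> x \<in> f -` U \<inter> space (lebesgue_on S)"
      using ae by eventually_elim auto
  qed auto
qed

text \<open>The modes are estimated with respect to \<open>lborel\<close>, while the data live on
  \<open>lebesgue_on\<close>; Borel versions mediate between the two.\<close>

lemma borel_version:
  fixes f :: "real \<Rightarrow> complex"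
  assumes f: "f \<in> borel_measurable (lebesgue_on S)" and S: "S \<in> sets lebesgue"
  obtains g where "g \<in> borel_measurable borel" "AE t in lebesgue_on S. f t = g t"
proof -
  have "(\<lambda>t. if t \<in> S then f t else 0) \<in> borel_measurable lebesgue"
    using f S by (simp add: borel_measurable_if)
  then have "(\<lambda>t. Re (if t \<in> S then f t else 0)) \<in> borel_measurable lebesgue" "(\<lambda>t. Im (if t \<in> S then f t else 0)) \<in> borel_measurable lebesgue"
    by measurable
  then have "\<exists>u\<in>borel_measurable lborel. AE t in lborel. Re (if t \<in> S then f t else 0) = u t"
    "\<exists>v\<in>borel_measurable lborel. AE t in lborel. Im (if t \<in> S then f t else 0) = v t"
    by (simp_all only: completion_ex_borel_measurable_real)
  then obtain u v where u: "u \<in> borel_measurable lborel" "AE t in lborel. Re (if t \<in> S then f t else 0) = u t"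
    and v: "v \<in> borel_measurable lborel" "AE t in lborel. Im (if t \<in> S then f t else 0) = v t"
    by blast
  have "(\<lambda>t. Complex (u t) (v t)) \<in> borel_measurable borel"
  proof -
    have [measurable]: "u \<in> borel_measurable borel" "v \<in> borel_measurable borel" using u v by simp_all
    have "(\<lambda>t. complex_of_real (u t) + \<i> * complex_of_real (v t)) \<in> borel_measurable borel" by measurable
    then show ?thesis by (simp add: Complex_eq)
  qed
  moreover have "AE t in lebesgue_on S. f t = Complex (u t) (v t)"
  proof -
    have "AE t in lborel. t \<in> S \<longrightarrow> f t = Complex (u t) (v t)"
      using u(2) v(2) by eventually_elim (auto simp: complex_eq_iff)
    then have "AE t in lebesgue. t \<in> S \<longrightarrow> f t = Complex (u t) (v t)" by (rule AE_completion)
    then show ?thesis using S by (subst AE_restrict_space_iff) auto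
  qed
  ultimately show ?thesis using that by blast
qed

text \<open>A Fourier coefficient is continuous in the Sobolev norm, so the coefficients of the
  approximating simple functions converge at almost every time.\<close>

lemma fourier_coeff_strongly_measurable:
  assumes f: "strongly_measurable r S f" and S: "S \<in> sets lebesgue" and r: "r \<ge> 0"
  shows "(\<lambda>t. fourier_coeff (f t) k) \<in> borel_measurable (lebesgue_on S)" "AE t in lebesgue_on S. f t \<in> Sobolev r"
proof -
  obtain F where F: "\<And>n. simple_function (lebesgue_on S) (F n)" "\<And>n t. t \<in> S \<Longrightarrow> F n t \<in> Sobolev r"
    and ae: "AE t in lebesgue_on S. f t \<in> Sobolev r \<and> (\<lambda>n. Sobolev_norm r (\<lambda>x. F n t x - f t x)) \<longlonglongrightarrow> 0"
    using f unfolding strongly_measurable_def by blast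
  show "AE t in lebesgue_on S. f t \<in> Sobolev r" using ae by eventually_elim simp
  have [measurable]: "(\<lambda>t. fourier_coeff (F n t) k) \<in> borel_measurable (lebesgue_on S)" for n
    by (intro borel_measurable_simple_function simple_function_compose1[OF F(1)])
  define g where "g t = lim (\<lambda>n. fourier_coeff (F n t) k)" for t
  have g: "g \<in> borel_measurable (lebesgue_on S)" unfolding g_def[abs_def] by (rule borel_measurable_lim_metric) measurable
  have "AE t in lebesgue_on S. fourier_coeff (f t) k = g t"
    using ae AE_space
  proof eventually_elim
    case (elim t)
    then have t: "t \<in> S" using S by simp
    have "(\<lambda>n. fourier_coeff (F n t) k - fourier_coeff (f t) k) \<longlonglongrightarrow> 0"
    proof (rule Lim_null_comparison)
      show "eventually (\<lambda>n. norm (fourier_coeff (F n t) k - fourier_coeff (f t) k) \<le> Sobolev_norm r (\<lambda>x. F n t x - f t x) / sqrt vol) sequentially"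
      proof (intro always_eventually allI)
        fix n
        note d = Sobolev_diff[OF F(2)[OF t, of n] conjunct1[OF elim(1)]]
        show "norm (fourier_coeff (F n t) k - fourier_coeff (f t) k) \<le> Sobolev_norm r (\<lambda>x. F n t x - f t x) / sqrt vol"
          using cmod_le_Sobolev_norm[of r "\<lambda>x. F n t x - f t x" k] d r by (simp add: Sobolev_iff)
      qed
      have "(\<lambda>n. Sobolev_norm r (\<lambda>x. F n t x - f t x) / sqrt vol) \<longlonglongrightarrow> 0 / sqrt vol"
        using elim by (intro tendsto_intros) (auto simp: vol_def)
      then show "(\<lambda>n. Sobolev_norm r (\<lambda>x. F n t x - f t x) / sqrt vol) \<longlonglongrightarrow> 0" by simp
    qed
    then have "(\<lambda>n. fourier_coeff (F n t) k) \<longlonglongrightarrow> fourier_coeff (f t) k" by (simp add: LIM_zero_iff)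
    then show ?case by (simp add: g_def limI)
  qed
  then show "(\<lambda>t. fourier_coeff (f t) k) \<in> borel_measurable (lebesgue_on S)"
    by (rule measurable_lebesgue_on_AE[OF S g])
qed

section \<open>Test functions and the weak formulation\<close>

lemma C_diff_continuous: "C_diff n f \<Longrightarrow> continuous_on UNIV f"
proof (cases n)
  case (Suc m)
  assume "C_diff n f"
  then have "f differentiable_on UNIV" by (auto simp: Suc differentiable_on_def intro: differentiable_at_withinI)
  then show ?thesis by (rule differentiable_imp_continuous_on)
qed simp

lemma axis_zero [simp]: "axis j (0 :: real) = 0"
  by (simp add: axis_eq_0_iff)

lemma axis_add: "axis j (a + b) = axis j a + (axis j b :: real^3)" for a b :: real
  by (simp add: vec_eq_iff axis_def)

lemma has_derivative_axis:
  fixes f :: "real^3 \<Rightarrow> real"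
  assumes "f differentiable (at x)"
  shows "((\<lambda>h. f (x + axis j h)) has_real_derivative grad f x $ j) (at 0)"
proof -
  let ?D = "frechet_derivative f (at x)"
  have D: "(f has_derivative ?D) (at (x + axis j 0))"
    using frechet_derivative_works[THEN iffD1, OF assms] by simp
  have "((\<lambda>h. x + axis j h) has_derivative (\<lambda>h. axis j h)) (at 0)"
  proof -
    define a where "a = (axis j 1 :: real^3)"
    have e: "axis j h = h *\<^sub>R a" for h by (simp add: vec_eq_iff axis_def a_def)
    show ?thesis unfolding e
      by (rule has_derivative_eq_rhs[OF has_derivative_add[OF has_derivative_const has_derivative_scaleR_left[OF has_derivative_ident]]]) simp
  qed
  then have "((\<lambda>h. f (x + axis j h)) has_derivative (\<lambda>h. ?D (axis j h))) (at 0)"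
    using has_derivative_compose[where f = "\<lambda>h. x + axis j h" and x = 0 and g = f, OF _ D] by simp
  moreover have "(\<lambda>h. ?D (axis j h)) = (*) (grad f x $ j)"
  proof
    fix h
    have "axis j h = h *\<^sub>R (axis j 1 :: real^3)" by (simp add: vec_eq_iff axis_def)
    moreover have "linear ?D" by (rule linear_frechet_derivative[OF assms])
    ultimately show "?D (axis j h) = grad f x $ j * h" by (simp add: grad_def linear_scale mult.commute)
  qed
  ultimately show ?thesis by (simp add: has_field_derivative_def)
qed

text \<open>A partial derivative is a derivative along a line, and the restrictions of
  \<open>f\<close> to two lines that differ by a period coincide.\<close>

lemma grad_periodic:
  assumes p: "periodic f" and d: "\<And>x. f differentiable (at x)"
  shows "periodic (\<lambda>x. grad f x $ j)"
  unfolding periodic_def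
proof (intro allI)
  fix x :: "real^3" and i
  let ?a = "axis i (2 * pi) :: real^3"
  have "(\<lambda>h. f (x + ?a + axis j h)) = (\<lambda>h. f (x + axis j h))"
  proof
    fix h
    have "x + ?a + axis j h = (x + axis j h) + ?a" by (simp only: add_ac)
    then show "f (x + ?a + axis j h) = f (x + axis j h)" using p by (simp only: periodic_def)
  qed
  then have "((\<lambda>h. f (x + axis j h)) has_real_derivative grad f (x + ?a) $ j) (at 0)"
    using has_derivative_axis[OF d[of "x + ?a"], of j] by simp
  then show "grad f (x + ?a) $ j = grad f x $ j"
    using has_derivative_axis[OF d[of x], of j] by (rule DERIV_unique)
qed

lemma bounded_periodic:
  assumes p: "periodic f" and c: "continuous_on UNIV f"
  shows "\<exists>B. \<forall>x. \<bar>f x\<bar> \<le> B"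
proof -
  have pi: "f (x + axis j (of_int n * (2 * pi))) = f x" for x j and n :: int
  proof -
    have nat: "f (x + axis j (of_nat n * (2 * pi))) = f x" for n x
    proof (induction n arbitrary: x)
      case (Suc n)
      have "axis j (of_nat (Suc n) * (2 * pi)) = axis j (of_nat n * (2 * pi)) + (axis j (2 * pi) :: real^3)"
        by (simp add: vec_eq_iff axis_def algebra_simps)
      then have "f (x + axis j (of_nat (Suc n) * (2 * pi))) = f ((x + axis j (of_nat n * (2 * pi))) + axis j (2 * pi))"
        by (simp only: add.assoc)
      also have "\<dots> = f (x + axis j (of_nat n * (2 * pi)))" using p by (simp only: periodic_def)
      finally show ?case by (simp add: Suc)
    qed simp
    show ?thesis
    proof (cases "n \<ge> 0")
      case True
      then show ?thesis using nat[of x "nat n"] by simp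
    next
      case False
      have e: "x + axis j (of_int n * (2 * pi)) + axis j (of_nat (nat (- n)) * (2 * pi)) = x"
        using False by (simp add: vec_eq_iff axis_def)
      show ?thesis using nat[of "x + axis j (of_int n * (2 * pi))" "nat (- n)"] unfolding e by (rule sym)
    qed
  qed
  have "compact (f ` cbox 0 per_vec)"
    by (intro compact_continuous_image continuous_on_subset[OF c]) auto
  then obtain B where B: "\<forall>y\<in>f ` cbox 0 per_vec. norm y \<le> B"
    using compact_imp_bounded bounded_iff by blast
  have "\<bar>f x\<bar> \<le> B" for x
  proof -
    define n where "n j = \<lfloor>x $ j / (2 * pi)\<rfloor>" for j
    define y where "y = x + axis 1 (of_int (- n 1) * (2 * pi)) + axis 2 (of_int (- n 2) * (2 * pi)) + axis 3 (of_int (- n 3) * (2 * pi))"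
    have fy: "f y = f x" unfolding y_def by (simp only: pi)
    have yj: "y $ j = x $ j - of_int (n j) * (2 * pi)" for j
      using exhaust_3[of j] by (auto simp: y_def axis_def)
    have "0 \<le> y $ j \<and> y $ j \<le> 2 * pi" for j
    proof -
      have "of_int (n j) \<le> x $ j / (2 * pi)" "x $ j / (2 * pi) < of_int (n j) + 1" unfolding n_def by linarith+
      then have "of_int (n j) * (2 * pi) \<le> x $ j" "x $ j < (of_int (n j) + 1) * (2 * pi)"
        by (simp_all add: field_simps)
      then show ?thesis unfolding yj by (simp add: algebra_simps)
    qed
    then have "y \<in> cbox 0 per_vec" by (simp add: mem_box_cart)
    then show ?thesis using B fy by force
  qed
  then show ?thesis by blast
qed

text \<open>Difference quotients have integral zero by translation invariance, the mean value
  theorem bounds them by \<open>B\<close>, and dominated convergence passes to the derivative.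
  Applied to products, this is integration by parts on the torus.\<close>

lemma integral_deriv_zero:
  fixes F F' :: "real^3 \<Rightarrow> real"
  assumes c: "continuous_on UNIV F" and p: "\<And>x j. F (x + axis j (2 * pi)) = F x"
    and d: "\<And>x. ((\<lambda>h. F (x + axis j h)) has_real_derivative F' x) (at 0)"
    and B: "\<And>x. \<bar>F' x\<bar> \<le> B" and m: "F' \<in> borel_measurable torus"
  shows "(LINT x|torus. F' x) = 0"
proof -
  define u where "u n = 1 / real (Suc n)" for n
  have u: "u n > 0" "u n \<le> 1" for n by (auto simp: u_def)
  have u0: "u \<longlonglongrightarrow> 0" unfolding u_def by (rule LIMSEQ_Suc[OF lim_1_over_n])
  have pi1: "1 \<le> 2 * pi" using pi_gt3 by linarith
  have dh: "((\<lambda>h. F (x + axis j h)) has_real_derivative F' (x + axis j h0)) (at h0)" for x h0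
    using d[of "x + axis j h0"] DERIV_shift[of "\<lambda>h. F (x + axis j h)" "F' (x + axis j h0)" 0 h0]
    by (simp add: axis_add add_ac)
  have q: "\<bar>(F (x + axis j (u n)) - F x) / u n\<bar> \<le> B" for n x
  proof -
    obtain z where "F (x + axis j (u n)) - F (x + axis j 0) = (u n - 0) * F' (x + axis j z)"
      using MVT2[OF u(1)[of n] dh] by blast
    then have "(F (x + axis j (u n)) - F x) / u n = F' (x + axis j z)" using u(1)[of n] by simp
    then show ?thesis using B by simp
  qed
  have "(\<lambda>n. LINT x|torus. (F (x + axis j (u n)) - F x) / u n) \<longlonglongrightarrow> (LINT x|torus. F' x)"
  proof (rule integral_dominated_convergence[where w = "\<lambda>_. B"])
    show "AE x in torus. (\<lambda>n. (F (x + axis j (u n)) - F x) / u n) \<longlonglongrightarrow> F' x"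
    proof (rule AE_I2)
      fix x
      have "(\<lambda>h. (F (x + axis j (0 + h)) - F (x + axis j 0)) / h) \<midarrow>0\<rightarrow> F' x"
        using d[of x] by (simp add: DERIV_def)
      moreover have "filterlim u (at 0) sequentially"
        using u0 u(1) by (intro filterlim_atI) (auto simp: less_imp_neq[THEN not_sym])
      ultimately have "(\<lambda>n. (F (x + axis j (0 + u n)) - F (x + axis j 0)) / u n) \<longlonglongrightarrow> F' x"
        by (rule filterlim_compose)
      then show "(\<lambda>n. (F (x + axis j (u n)) - F x) / u n) \<longlonglongrightarrow> F' x" by simp
    qed
    show "(\<lambda>x. (F (x + axis j (u n)) - F x) / u n) \<in> borel_measurable torus" for n
    proof (rule continuous_measurable_torus)
      have "continuous_on UNIV (\<lambda>x. F (x + axis j (u n)))"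
        by (intro continuous_on_compose2[OF c] continuous_intros) auto
      then show "continuous_on UNIV (\<lambda>x. (F (x + axis j (u n)) - F x) / u n)"
        using u(1)[of n] by (intro continuous_intros c) auto
    qed
    show "AE x in torus. norm ((F (x + axis j (u n)) - F x) / u n) \<le> B" for n
      using q by (intro AE_I2) simp
  qed (use m in auto)
  moreover have z: "(LINT x|torus. (F (x + axis j (u n)) - F x) / u n) = 0" for n
  proof -
    have c': "continuous_on UNIV (\<lambda>x. F (x + axis j (u n)))"
      by (intro continuous_on_compose2[OF c] continuous_intros) auto
    have "(LINT x|torus. F (x + axis j (u n)) - F x) = (LINT x|torus. F (x + axis j (u n))) - (LINT x|torus. F x)"
      by (intro Bochner_Integration.integral_diff integrable_torus_continuous c c')
    also have "(LINT x|torus. F (x + axis j (u n))) = (LINT x|torus. F x)"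
      using u[of n] pi1 by (intro integral_torus_shift c p) auto
    finally show ?thesis by simp
  qed
  ultimately show ?thesis by (simp only: z LIMSEQ_const_iff)
qed

text \<open>Integration by parts against \<open>ek (- k)\<close>: the product with \<open>f\<close>
  is periodic, so the integral of its derivative vanishes, separately for real and imaginary
  part.\<close>

lemma fourier_coeff_grad:
  assumes p: "periodic f" and C: "C_diff (Suc n) f"
  shows "fourier_coeff (\<lambda>x. grad f x $ j) k = \<i> * of_int (k $ j) * fourier_coeff f k"
proof -
  let ?g = "\<lambda>x. grad f x $ j"
  have d: "f differentiable (at x)" for x using C by simp
  have cf: "continuous_on UNIV f" by (rule C_diff_continuous[OF C])
  have cg: "continuous_on UNIV ?g" using C by (intro C_diff_continuous[of n]) simp
  obtain Bf where Bf: "\<And>x. \<bar>f x\<bar> \<le> Bf" using bounded_periodic[OF p cf] by blast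
  obtain Bg where Bg: "\<And>x. \<bar>?g x\<bar> \<le> Bg" using bounded_periodic[OF grad_periodic[OF p d] cg] by blast
  define F where "F x = complex_of_real (f x) * ek (- k) x" for x
  define F' where "F' x = complex_of_real (?g x) * ek (- k) x + complex_of_real (f x) * (- \<i> * of_int (k $ j) * ek (- k) x)" for x
  have cF': "continuous_on UNIV F'" unfolding F'_def by (intro continuous_intros cf cg)
  have i: "integrable torus (\<lambda>x. complex_of_real (?g x) * ek (- k) x)" "integrable torus (\<lambda>x. complex_of_real (f x) * ek (- k) x)"
    by (intro integrable_torus_continuous continuous_intros cf cg)+
  define Bd where "Bd = Bg + Bf * \<bar>of_int (k $ j)\<bar>"
  have bd: "norm (F' x) \<le> Bd" for x
  proof -
    have "norm (F' x) \<le> norm (complex_of_real (?g x) * ek (- k) x) + norm (complex_of_real (f x) * (- \<i> * of_int (k $ j) * ek (- k) x))"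
      unfolding F'_def by (rule norm_triangle_ineq)
    also have "\<dots> = \<bar>?g x\<bar> + \<bar>f x\<bar> * \<bar>of_int (k $ j)\<bar>" by (simp add: norm_mult)
    also have "\<dots> \<le> Bd" unfolding Bd_def by (intro add_mono mult_right_mono Bf Bg) simp
    finally show ?thesis .
  qed
  have cF: "continuous_on UNIV F" unfolding F_def by (intro continuous_intros cf)
  have pF: "F (x + axis j (2 * pi)) = F x" for x j using p by (simp add: F_def ek_periodic periodic_def)
  have mF: "F' \<in> borel_measurable torus" by (rule continuous_measurable_torus[OF cF'])
  have dF: "((\<lambda>h. F (x + axis j h)) has_vector_derivative F' x) (at 0)" for x
  proof -
    have 1: "((\<lambda>h. complex_of_real (f (x + axis j h))) has_vector_derivative complex_of_real (?g x)) (at 0)"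
      using has_derivative_axis[OF d[of x], of j]
      by (intro has_vector_derivative_of_real) (simp add: has_real_derivative_iff_has_vector_derivative)
    have "((\<lambda>h. ek (- k) (x + axis j h)) has_vector_derivative - \<i> * of_int (k $ j) * ek (- k) x) (at 0)"
    proof -
      have e: "ek (- k) (x + axis j h) = ek (- k) x * exp (\<i> * of_real (- of_int (k $ j) * h))" for h
        by (simp add: ek_plus ek_axis cis_conv_exp)
      have "((\<lambda>z. ek (- k) x * exp (\<i> * (- of_int (k $ j) * z))) has_field_derivative - \<i> * of_int (k $ j) * ek (- k) x) (at (of_real 0))"
        by (auto intro!: derivative_eq_intros)
      from has_vector_derivative_real_field[OF this] show ?thesis by (simp add: e)
    qed
    from has_vector_derivative_mult[OF 1 this] show ?thesis
      by (simp add: F_def F'_def add.commute)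
  qed
  have "(LINT x|torus. Re (F' x)) = 0"
  proof (rule integral_deriv_zero[where F = "\<lambda>x. Re (F x)" and j = j and B = Bd])
    show "((\<lambda>h. Re (F (x + axis j h))) has_real_derivative Re (F' x)) (at 0)" for x
      using bounded_linear.has_vector_derivative[OF bounded_linear_Re dF] by (simp add: has_real_derivative_iff_has_vector_derivative)
    show "\<bar>Re (F' x)\<bar> \<le> Bd" for x using abs_Re_le_cmod[of "F' x"] bd[of x] by linarith
    show "(\<lambda>x. Re (F' x)) \<in> borel_measurable torus" using mF by measurable
  qed (use cF pF in \<open>auto intro: continuous_intros\<close>)
  moreover have "(LINT x|torus. Im (F' x)) = 0"
  proof (rule integral_deriv_zero[where F = "\<lambda>x. Im (F x)" and j = j and B = Bd])
    show "((\<lambda>h. Im (F (x + axis j h))) has_real_derivative Im (F' x)) (at 0)" for x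
      using bounded_linear.has_vector_derivative[OF bounded_linear_Im dF] by (simp add: has_real_derivative_iff_has_vector_derivative)
    show "\<bar>Im (F' x)\<bar> \<le> Bd" for x using abs_Im_le_cmod[of "F' x"] bd[of x] by linarith
    show "(\<lambda>x. Im (F' x)) \<in> borel_measurable torus" using mF by measurable
  qed (use cF pF in \<open>auto intro: continuous_intros\<close>)
  moreover have "integrable torus F'" by (rule integrable_torus_continuous[OF cF'])
  ultimately have "(LINT x|torus. F' x) = 0" by (simp add: complex_eq_iff)
  moreover have "F' = (\<lambda>x. complex_of_real (?g x) * ek (- k) x + (- \<i> * of_int (k $ j)) * (complex_of_real (f x) * ek (- k) x))"
    by (simp add: F'_def fun_eq_iff)
  ultimately have "(LINT x|torus. complex_of_real (?g x) * ek (- k) x) + (- \<i> * of_int (k $ j)) * (LINT x|torus. complex_of_real (f x) * ek (- k) x) = 0"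
    using Bochner_Integration.integral_add[OF i(1) integrable_mult_right[OF i(2)], of "- \<i> * of_int (k $ j)"]
    by (simp only: integral_mult_right_zero)
  then have "(LINT x|torus. complex_of_real (?g x) * ek (- k) x) = \<i> * of_int (k $ j) * (LINT x|torus. complex_of_real (f x) * ek (- k) x)"
    by (simp add: add_eq_0_iff)
  then show ?thesis by (simp add: fourier_coeff_ek)
qed

lemma test_functions_grad: "\<phi> \<in> test_functions \<Longrightarrow> (\<lambda>x. grad \<phi> x $ j) \<in> test_functions"
proof -
  assume a: "\<phi> \<in> test_functions"
  then have C: "C_diff (Suc n) \<phi>" for n by (simp only: test_functions_def mem_Collect_eq)
  have d: "\<phi> differentiable (at x)" for x using C[of 0] by simp
  have "periodic (\<lambda>x. grad \<phi> x $ j)" using a by (intro grad_periodic d) (simp add: test_functions_def)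
  moreover have "C_diff n (\<lambda>x. grad \<phi> x $ j)" for n using C[of n] by simp
  ultimately show ?thesis by (simp add: test_functions_def)
qed

lemma test_functions_coeff_grad: "\<phi> \<in> test_functions \<Longrightarrow> fourier_coeff (\<lambda>x. grad \<phi> x $ j) k = \<i> * of_int (k $ j) * fourier_coeff \<phi> k"
  by (rule fourier_coeff_grad[of _ 0]) (simp_all only: test_functions_def mem_Collect_eq)

lemma test_functions_continuous: "\<phi> \<in> test_functions \<Longrightarrow> continuous_on UNIV \<phi>"
  by (rule C_diff_continuous[of 0]) (simp only: test_functions_def mem_Collect_eq)

lemma test_functions_integrable: "\<phi> \<in> test_functions \<Longrightarrow> integrable torus \<phi>"
  by (intro integrable_torus_continuous test_functions_continuous)

lemma test_functions_decay_axis: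
  assumes "\<phi> \<in> test_functions"
  shows "\<exists>B\<ge>0. \<forall>k. \<bar>real_of_int (k $ j)\<bar> ^ n * cmod (fourier_coeff \<phi> k) \<le> B"
  using assms
proof (induction n arbitrary: \<phi>)
  case 0
  have i: "integrable torus (\<lambda>x. \<bar>\<phi> x\<bar>)" using test_functions_integrable[OF 0] by simp
  have "cmod (fourier_coeff \<phi> k) \<le> (LINT x|torus. \<bar>\<phi> x\<bar>) / vol" for k
  proof -
    have "cmod (LINT x|torus. of_real (\<phi> x) * ek (- k) x) \<le> (LINT x|torus. norm (of_real (\<phi> x) * ek (- k) x))"
      by (rule integral_norm_bound)
    also have "\<dots> = (LINT x|torus. \<bar>\<phi> x\<bar>)" by (simp add: norm_mult)
    finally show ?thesis by (simp add: fourier_coeff_ek norm_divide divide_right_mono less_imp_le)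
  qed
  then show ?case by (intro exI[of _ "(LINT x|torus. \<bar>\<phi> x\<bar>) / vol"]) (simp add: less_imp_le)
next
  case (Suc n)
  obtain B where B: "B \<ge> 0" "\<And>k. \<bar>real_of_int (k $ j)\<bar> ^ n * cmod (fourier_coeff (\<lambda>x. grad \<phi> x $ j) k) \<le> B"
    using Suc.IH[OF test_functions_grad[OF Suc.prems]] by blast
  have "\<bar>real_of_int (k $ j)\<bar> ^ Suc n * cmod (fourier_coeff \<phi> k) \<le> B" for k
    using B(2)[of k] by (simp add: test_functions_coeff_grad[OF Suc.prems] norm_mult mult_ac)
  then show ?case using B(1) by blast
qed

lemma kn_le_sum: "kn k \<le> \<bar>real_of_int (k $ 1)\<bar> + \<bar>real_of_int (k $ 2)\<bar> + \<bar>real_of_int (k $ 3)\<bar>"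
  using norm_le_l1_cart[of "wavevec k"] by (simp add: sum_3)

text \<open>Five derivatives bound coefficient \<open>k\<close> by \<open>A |k|^(-5)\<close>. With
  the weight \<open>|k|\<close> this leaves \<open>|k|^(-4)\<close>, which is the summable
  \<open>|k|^(2 - 2 s)\<close> for \<open>s = 3\<close>. The factor 243 is \<open>3^5\<close>, from
  bounding \<open>|k|\<close> by three times its largest component.\<close>

lemma test_functions_AN:
  assumes "\<phi> \<in> test_functions"
  shows "AN (fourier_coeff \<phi>) < \<infinity>"
proof -
  let ?c = "fourier_coeff \<phi>"
  obtain B where B: "\<And>j. B j \<ge> 0" "\<And>j k. \<bar>real_of_int (k $ j)\<bar> ^ 5 * cmod (?c k) \<le> B j"
    using test_functions_decay_axis[OF assms, of _ 5] by metis
  define A where "A = 243 * (B 1 + B 2 + B 3)"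
  have A0: "A \<ge> 0" using B(1)[of 1] B(1)[of 2] B(1)[of 3] by (simp add: A_def)
  have bd: "kn k ^ 5 * cmod (?c k) \<le> A" for k
  proof -
    let ?a = "\<bar>real_of_int (k $ 1)\<bar>" and ?b = "\<bar>real_of_int (k $ 2)\<bar>" and ?d = "\<bar>real_of_int (k $ 3)\<bar>"
    define x where "x = max ?a (max ?b ?d)"
    have "kn k \<le> 3 * x" using kn_le_sum[of k] by (auto simp: x_def)
    then have "kn k ^ 5 \<le> (3 * x) ^ 5" by (intro power_mono) auto
    also have "(3 * x) ^ 5 = 243 * x ^ 5" by (simp add: power_mult_distrib)
    also have "x ^ 5 \<le> ?a ^ 5 + ?b ^ 5 + ?d ^ 5" by (auto simp: x_def max_def)
    finally have "kn k ^ 5 * cmod (?c k) \<le> (243 * (?a ^ 5 + ?b ^ 5 + ?d ^ 5)) * cmod (?c k)" by (intro mult_right_mono) auto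
    also have "\<dots> = 243 * (?a ^ 5 * cmod (?c k) + ?b ^ 5 * cmod (?c k) + ?d ^ 5 * cmod (?c k))" by (simp add: algebra_simps)
    also have "\<dots> \<le> A" unfolding A_def by (intro mult_left_mono add_mono B(2)) simp
    finally show ?thesis .
  qed
  have "AN ?c \<le> (\<integral>\<^sup>+k. ennreal A * ennreal (kn k powr (2 - 2 * 3)) \<partial>K)"
    unfolding AN_def
  proof (rule nn_integral_mono)
    fix k
    show "aw ?c k \<le> ennreal A * ennreal (kn k powr (2 - 2 * 3))"
    proof (cases "k = 0")
      case False
      then have k1: "kn k > 0" using kn_ge_1[of k] by linarith
      have "kn k powr (2 - 2 * 3) = 1 / kn k ^ 4" using k1 by (simp add: powr_minus powr_numeral divide_inverse)
      moreover have "kn k * cmod (?c k) \<le> A * (1 / kn k ^ 4)"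
      proof -
        have "kn k * cmod (?c k) = (kn k ^ 5 * cmod (?c k)) * (1 / kn k ^ 4)" using k1 by (simp add: field_simps eval_nat_numeral)
        also have "\<dots> \<le> A * (1 / kn k ^ 4)" by (intro mult_right_mono bd) simp
        finally show ?thesis .
      qed
      ultimately show ?thesis unfolding aw_def using A0 by (subst ennreal_mult[symmetric]) (auto intro: ennreal_leI)
    qed simp
  qed
  also have "\<dots> = ennreal A * (\<integral>\<^sup>+k. ennreal (kn k powr (2 - 2 * 3)) \<partial>K)" by (rule nn_integral_cmult) simp
  also have "\<dots> < \<infinity>" using lattice_sum_powr[of 3] by (simp add: ennreal_mult_less_top)
  finally show ?thesis .
qed

lemma test_functions_absum: "\<phi> \<in> test_functions \<Longrightarrow> absum (fourier_coeff \<phi>)"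
  by (intro absum_AN test_functions_AN)

text \<open>The real test functions that isolate the pair of modes \<open>k\<close> and
  \<open>- k\<close>. The family is closed under partial derivatives, which reduces smoothness to an
  induction.\<close>

definition trig :: "int^3 \<Rightarrow> real \<Rightarrow> real \<Rightarrow> real^3 \<Rightarrow> real" where
  "trig k a b x = a * cos (wavevec k \<bullet> x) + b * sin (wavevec k \<bullet> x)"

lemma trig_has_derivative:
  "(trig k a b has_derivative (\<lambda>h. (wavevec k \<bullet> h) * (b * cos (wavevec k \<bullet> x) - a * sin (wavevec k \<bullet> x)))) (at x)"
  unfolding trig_def[abs_def] by (auto intro!: derivative_eq_intros simp: algebra_simps)

lemma grad_trig: "grad (trig k a b) x $ j = trig k (of_int (k $ j) * b) (- (of_int (k $ j) * a)) x"
proof -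
  have "frechet_derivative (trig k a b) (at x) = (\<lambda>h. (wavevec k \<bullet> h) * (b * cos (wavevec k \<bullet> x) - a * sin (wavevec k \<bullet> x)))"
    by (rule frechet_derivative_at[OF trig_has_derivative, symmetric])
  then show ?thesis by (simp add: grad_def trig_def inner_axis algebra_simps)
qed

lemma trig_test_function: "trig k a b \<in> test_functions"
proof -
  have "C_diff n (trig k a b)" for n
  proof (induction n arbitrary: a b)
    case 0
    have "continuous_on UNIV (trig k a b)" unfolding trig_def[abs_def] by (intro continuous_intros)
    then show ?case by simp
  next
    case (Suc n)
    have "trig k a b differentiable (at x)" for x using trig_has_derivative unfolding differentiable_def by blast
    then show ?case using Suc by (simp add: grad_trig)
  qed
  moreover have "periodic (trig k a b)"
  proof -
    have "trig k a b x = a * Re (ek k x) + b * Im (ek k x)" for x by (simp add: trig_def ek_def)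
    then show ?thesis by (simp add: periodic_def ek_periodic)
  qed
  ultimately show ?thesis by (simp add: test_functions_def)
qed

lemma pairing:
  fixes f g :: "real^3 \<Rightarrow> real"
  assumes "integrable torus f" "integrable torus g" "absum (fourier_coeff g)"
  shows "complex_of_real (LINT x|torus. f x * g x) = of_real vol * (LINT k|K. fourier_coeff g (- k) * fourier_coeff f k)"
  using integral_real_mult_absum[OF assms] integral_K_minus[of "\<lambda>k. fourier_coeff g (- k) * fourier_coeff f k"] by simp

lemma frac_laplacian_test:
  assumes "\<phi> \<in> test_functions"
  shows "frac_laplacian (1/2) \<phi> \<in> L2_space" "fourier_coeff (frac_laplacian (1/2) \<phi>) k = of_real (kn k) * fourier_coeff \<phi> k"
    "absum (fourier_coeff (frac_laplacian (1/2) \<phi>))"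
proof -
  have w: "(\<lambda>k. norm (wavevec k) powr (2 * (1/2))) = kn" by (simp add: fun_eq_iff)
  have ab: "absum (\<lambda>k. of_real (kn k) * fourier_coeff \<phi> k)"
    by (rule absum_cmult_AN[OF test_functions_AN[OF assms], where B = 1]) simp
  show *: "frac_laplacian (1/2) \<phi> \<in> L2_space" "fourier_coeff (frac_laplacian (1/2) \<phi>) k = of_real (kn k) * fourier_coeff \<phi> k" for k
    unfolding frac_laplacian_def w using ab by (auto intro!: multiplier_op_exists)
  then have "fourier_coeff (frac_laplacian (1/2) \<phi>) = (\<lambda>k. of_real (kn k) * fourier_coeff \<phi> k)" by auto
  then show "absum (fourier_coeff (frac_laplacian (1/2) \<phi>))" using ab by simp
qed

lemma norm_wavevec_sq: "(kn k)\<^sup>2 = (of_int (k $ 1))\<^sup>2 + (of_int (k $ 2))\<^sup>2 + (of_int (k $ 3))\<^sup>2"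
  by (simp add: power2_norm_eq_inner inner_vec_def sum_3) (simp add: power2_eq_square)

lemma absum_mult_bounded:
  assumes "absum c" "\<And>k. cmod (b k) \<le> B"
  shows "absum (\<lambda>k. c k * b k)"
proof -
  have "(\<integral>\<^sup>+k. ecmod (c k * b k) \<partial>K) \<le> (\<integral>\<^sup>+k. ennreal (max B 0) * ecmod (c k) \<partial>K)"
  proof (rule nn_integral_mono)
    fix k
    have "cmod (c k * b k) \<le> max B 0 * cmod (c k)"
      unfolding norm_mult mult.commute[of "cmod (c k)"] using assms(2)[of k] by (intro mult_right_mono) auto
    then have "ecmod (c k * b k) \<le> ennreal (max B 0 * cmod (c k))" by (rule ennreal_leI)
    also have "\<dots> = ennreal (max B 0) * ecmod (c k)" by (rule ennreal_mult) auto
    finally show "ecmod (c k * b k) \<le> ennreal (max B 0) * ecmod (c k)" .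
  qed
  also have "\<dots> < \<infinity>" using assms(1) by (simp add: nn_integral_cmult absum_def ennreal_mult_less_top)
  finally show ?thesis by (simp add: absum_def)
qed

lemma absum_bounded: "absum c \<Longrightarrow> \<exists>B. \<forall>k. cmod (c k) \<le> B"
proof -
  assume "absum c"
  then obtain B where B: "(\<integral>\<^sup>+k. ecmod (c k) \<partial>K) = ennreal B" "B \<ge> 0"
    unfolding absum_def by (cases "(\<integral>\<^sup>+k. ecmod (c k) \<partial>K)") auto
  have "cmod (c k) \<le> B" for k
    using nn_integral_K_member[of "\<lambda>k. ecmod (c k)" k] B by (simp add: ennreal_le_iff)
  then show ?thesis by blast
qed

lemma absum_reflect: "absum c \<Longrightarrow> absum (\<lambda>k. c (- k))"
  unfolding absum_def using nn_integral_K_minus[of "\<lambda>k. ecmod (c k)"] by simp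

lemma absum_grad: "\<phi> \<in> test_functions \<Longrightarrow> absum (\<lambda>k. fourier_coeff (\<lambda>x. grad \<phi> x $ j) (- k))"
  by (intro absum_reflect test_functions_absum test_functions_grad)

section \<open>The magneto-geostrophic symbol\<close>

context
  fixes \<Omega> \<beta> \<eta> :: real
  assumes Om: "\<Omega> > 0" and be: "\<beta> > 0" and et: "\<eta> > 0"
begin

abbreviation "mgs \<equiv> mg_symbol \<Omega> \<beta> \<eta>"

lemma symbol_even: "mgs (- k) = mgs k"
  by (simp add: mg_symbol_def Let_def)

lemma symbol_orth: "wavevec k \<bullet> mgs k = 0"
proof (cases "k $ 3 = 0")
  case False
  define k1 k2 k3 where "k1 = real_of_int (k $ 1)" and "k2 = real_of_int (k $ 2)" and "k3 = real_of_int (k $ 3)"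
  define Q b where "Q = (kn k)\<^sup>2" and "b = \<beta>\<^sup>2 / \<eta>"
  define D where "D = 4 * \<Omega>\<^sup>2 * k3\<^sup>2 * Q + b\<^sup>2 * k2 ^ 4"
  have M: "mgs k = vector [(2 * \<Omega> * k2 * k3 * Q - b * k1 * k2\<^sup>2 * k3) / D,
            (- 2 * \<Omega> * k1 * k3 * Q - b * k2 ^ 3 * k3) / D, b * k2\<^sup>2 * (k1\<^sup>2 + k2\<^sup>2) / D]"
    using False by (simp add: mg_symbol_def Let_def k1_def k2_def k3_def Q_def b_def D_def)
  have "wavevec k \<bullet> mgs k = (k1 * (2 * \<Omega> * k2 * k3 * Q - b * k1 * k2\<^sup>2 * k3) + k2 * (- 2 * \<Omega> * k1 * k3 * Q - b * k2 ^ 3 * k3)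
      + k3 * (b * k2\<^sup>2 * (k1\<^sup>2 + k2\<^sup>2))) / D"
    unfolding M by (simp add: inner_vec_def sum_3 vector_3 k1_def k2_def k3_def add_divide_distrib)
  also have "k1 * (2 * \<Omega> * k2 * k3 * Q - b * k1 * k2\<^sup>2 * k3) + k2 * (- 2 * \<Omega> * k1 * k3 * Q - b * k2 ^ 3 * k3)
      + k3 * (b * k2\<^sup>2 * (k1\<^sup>2 + k2\<^sup>2)) = 0"
    by (simp add: algebra_simps power2_eq_square power3_eq_cube)
  finally show ?thesis by simp
qed (simp add: mg_symbol_def)

text \<open>With \<open>A = 2 \<Omega> |k_3| |k|\<close> and
  \<open>Bq = (\<beta>^2 / \<eta>) k_2^2\<close> the denominator is \<open>A^2 + Bq^2\<close>, which
  dominates both \<open>A^2\<close> and \<open>2 A Bq\<close>. Together with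
  \<open>|k_3| >= 1\<close>, as \<open>k_3\<close> is a nonzero integer, this gives linear growth
  with a constant free of \<open>\<beta>\<close> and \<open>\<eta>\<close>.\<close>

lemma symbol_bound: "\<bar>mgs k $ j\<bar> \<le> (1 / \<Omega>) * kn k"
proof (cases "k $ 3 = 0")
  case False
  define k1 k2 k3 where "k1 = real_of_int (k $ 1)" and "k2 = real_of_int (k $ 2)" and "k3 = real_of_int (k $ 3)"
  define N b where "N = kn k" and "b = \<beta>\<^sup>2 / \<eta>"
  define D where "D = 4 * \<Omega>\<^sup>2 * k3\<^sup>2 * N\<^sup>2 + b\<^sup>2 * k2 ^ 4"
  have M: "mgs k = vector [(2 * \<Omega> * k2 * k3 * N\<^sup>2 - b * k1 * k2\<^sup>2 * k3) / D,
            (- 2 * \<Omega> * k1 * k3 * N\<^sup>2 - b * k2 ^ 3 * k3) / D, b * k2\<^sup>2 * (k1\<^sup>2 + k2\<^sup>2) / D]"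
    using False by (simp add: mg_symbol_def Let_def k1_def k2_def k3_def N_def b_def D_def)
  have k3: "\<bar>k3\<bar> \<ge> 1" using False unfolding k3_def by linarith
  have kN: "\<bar>k1\<bar> \<le> N" "\<bar>k2\<bar> \<le> N" "\<bar>k3\<bar> \<le> N"
    using component_le_norm_cart[of "wavevec k" 1] component_le_norm_cart[of "wavevec k" 2] component_le_norm_cart[of "wavevec k" 3]
    by (simp_all add: k1_def k2_def k3_def N_def)
  have N1: "N \<ge> 1" using k3 kN by linarith
  have b0: "b > 0" using be et by (simp add: b_def)
  define A Bq where "A = 2 * \<Omega> * \<bar>k3\<bar> * N" and "Bq = b * k2\<^sup>2"
  have A0: "A > 0" using Om k3 N1 by (simp add: A_def)
  have Bq0: "Bq \<ge> 0" using b0 by (simp add: Bq_def)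
  have D: "D = A\<^sup>2 + Bq\<^sup>2" by (simp add: D_def A_def Bq_def power_mult_distrib power4_eq_xxxx power2_eq_square)
  have Dp: "D > 0" unfolding D using A0 by (intro add_pos_nonneg) auto
  have AB: "2 * A * Bq \<le> D" unfolding D using sum_squares_bound[of A Bq] by simp
  have F2: "N * \<bar>k3\<bar> * Bq \<le> D / (4 * \<Omega>)"
  proof -
    have "N * \<bar>k3\<bar> * Bq = (2 * A * Bq) / (4 * \<Omega>)" using Om by (simp add: A_def)
    also have "\<dots> \<le> D / (4 * \<Omega>)" using AB Om by (intro divide_right_mono) auto
    finally show ?thesis .
  qed
  have F1: "2 * \<Omega> * \<bar>k3\<bar> * N\<^sup>2 \<le> D / (2 * \<Omega>)"
  proof -
    have "2 * \<Omega> * \<bar>k3\<bar> * N\<^sup>2 * 1 \<le> 2 * \<Omega> * \<bar>k3\<bar> * N\<^sup>2 * \<bar>k3\<bar>" using Om k3 by (intro mult_left_mono) auto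
    also have "\<dots> = A\<^sup>2 / (2 * \<Omega>)" using Om by (simp add: A_def power2_eq_square)
    also have "\<dots> \<le> D / (2 * \<Omega>)" unfolding D using Om by (intro divide_right_mono) auto
    finally show ?thesis by simp
  qed
  have F3: "\<bar>k3\<bar> * Bq \<le> D / (4 * \<Omega>)"
  proof -
    have "1 * (\<bar>k3\<bar> * Bq) \<le> N * (\<bar>k3\<bar> * Bq)" using N1 Bq0 by (intro mult_right_mono) auto
    then show ?thesis using F2 by (simp add: mult.assoc)
  qed
  have sum: "2 * \<Omega> * \<bar>k3\<bar> * N\<^sup>2 + \<bar>k3\<bar> * Bq \<le> D / \<Omega>"
  proof -
    have "D / (2 * \<Omega>) + D / (4 * \<Omega>) \<le> D / \<Omega>" using Om Dp by (simp add: field_simps)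
    then show ?thesis using F1 F3 by linarith
  qed
  \<comment> \<open>The first two components have the same shape up to the sign \<open>s\<close>;
    \<open>x\<close> and \<open>y\<close> stand for components of the wave vector.\<close>
  have gen: "\<bar>(s * (2 * \<Omega> * x * k3 * N\<^sup>2) - b * y * k2\<^sup>2 * k3) / D\<bar> \<le> (1 / \<Omega>) * N"
    if "\<bar>x\<bar> \<le> N" "\<bar>y\<bar> \<le> N" "\<bar>s\<bar> = 1" for x y s
  proof -
    have "\<bar>s * (2 * \<Omega> * x * k3 * N\<^sup>2) - b * y * k2\<^sup>2 * k3\<bar> \<le> \<bar>s * (2 * \<Omega> * x * k3 * N\<^sup>2)\<bar> + \<bar>b * y * k2\<^sup>2 * k3\<bar>" by (rule abs_triangle_ineq4)
    also have "\<dots> = \<bar>x\<bar> * (2 * \<Omega> * \<bar>k3\<bar> * N\<^sup>2) + \<bar>y\<bar> * (\<bar>k3\<bar> * Bq)"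
      using Om b0 that(3) by (simp add: abs_mult Bq_def)
    also have "\<dots> \<le> N * (2 * \<Omega> * \<bar>k3\<bar> * N\<^sup>2) + N * (\<bar>k3\<bar> * Bq)"
      using Om Bq0 that by (intro add_mono mult_right_mono) auto
    also have "\<dots> \<le> N * (D / \<Omega>)" unfolding distrib_left[symmetric] using N1 by (intro mult_left_mono sum) auto
    finally show ?thesis using Dp Om by (simp add: field_simps)
  qed
  have m3: "\<bar>b * k2\<^sup>2 * (k1\<^sup>2 + k2\<^sup>2) / D\<bar> \<le> (1 / \<Omega>) * N"
  proof -
    have "k1\<^sup>2 + k2\<^sup>2 \<le> N\<^sup>2" unfolding N_def norm_wavevec_sq k1_def k2_def by simp
    then have "Bq * (k1\<^sup>2 + k2\<^sup>2) \<le> Bq * N\<^sup>2" using Bq0 by (intro mult_left_mono) auto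
    also have "\<dots> = N * (N * 1 * Bq)" by (simp add: power2_eq_square)
    also have "\<dots> \<le> N * (N * \<bar>k3\<bar> * Bq)" using N1 k3 Bq0 by (intro mult_left_mono mult_right_mono) auto
    also have "\<dots> \<le> N * (D / (4 * \<Omega>))" using N1 by (intro mult_left_mono F2) auto
    also have "\<dots> \<le> N * (D / \<Omega>)" using N1 Om Dp by (intro mult_left_mono divide_left_mono) auto
    finally have "\<bar>Bq * (k1\<^sup>2 + k2\<^sup>2)\<bar> \<le> N * (D / \<Omega>)" using Bq0 by simp
    then show ?thesis using Dp Om by (simp add: Bq_def field_simps)
  qed
  have k23: "b * k2 ^ 3 * k3 = b * k2 * k2\<^sup>2 * k3" by (simp add: power3_eq_cube power2_eq_square)
  consider "j = 1" | "j = 2" | "j = 3" using exhaust_3 by blast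
  then show ?thesis
  proof cases
    case 1
    then show ?thesis unfolding M N_def[symmetric] using gen[of k2 k1 1] kN by (simp add: vector_3)
  next
    case 2
    then show ?thesis unfolding M N_def[symmetric] k23 using gen[of k1 k2 "-1"] kN by (simp add: vector_3)
  next
    case 3
    then show ?thesis unfolding M N_def[symmetric] using m3 by (simp add: vector_3)
  qed
qed (use Om in \<open>simp add: mg_symbol_def\<close>)

definition msym :: "int^3 \<Rightarrow> int^3 \<Rightarrow> real" where
  "msym k l = wavevec k \<bullet> mgs l"

text \<open>By \<open>symbol_orth\<close> the vector \<open>k\<close> may be replaced by
  \<open>k - l\<close>, so the two lost derivatives fall on different factors. The 3 comes from
  bounding a Euclidean norm by the sum of three components.\<close>

lemma mg_fourier_msym:
  assumes "\<kappa> > 0" "s > 5 / 2"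
  shows "mg_fourier \<kappa> s (3 / \<Omega>) msym"
proof
  show "\<bar>msym k l\<bar> \<le> 3 / \<Omega> * kn l * kn (k - l)" for k l
  proof -
    have "msym k l = wavevec (k - l) \<bullet> mgs l"
      by (simp add: msym_def wavevec_diff inner_diff_left symbol_orth)
    then have 1: "\<bar>msym k l\<bar> \<le> kn (k - l) * norm (mgs l)" by (simp add: Cauchy_Schwarz_ineq2)
    have "norm (mgs l) \<le> \<bar>mgs l $ 1\<bar> + \<bar>mgs l $ 2\<bar> + \<bar>mgs l $ 3\<bar>" using norm_le_l1_cart[of "mgs l"] by (simp add: sum_3)
    also have "\<dots> \<le> (1 / \<Omega>) * kn l + (1 / \<Omega>) * kn l + (1 / \<Omega>) * kn l" by (intro add_mono symbol_bound)
    finally have "norm (mgs l) \<le> 3 / \<Omega> * kn l" by simp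
    then have "kn (k - l) * norm (mgs l) \<le> kn (k - l) * (3 / \<Omega> * kn l)" by (rule mult_left_mono) simp
    then show ?thesis using 1 by (simp add: mult_ac)
  qed
qed (use assms Om in \<open>simp_all add: msym_def symbol_even wavevec_minus\<close>)

lemma velocity:
  assumes "AN (fourier_coeff f) < \<infinity>"
  defines "u j \<equiv> multiplier_op (\<lambda>k. mgs k $ j) f"
  shows "u j \<in> L2_space" "fourier_coeff (u j) = (\<lambda>k. of_real (mgs k $ j) * fourier_coeff f k)" "absum (fourier_coeff (u j))"
    "mg_velocity \<Omega> \<beta> \<eta> f x $ j = u j x"
proof -
  have ab: "absum (\<lambda>k. of_real (mgs k $ j) * fourier_coeff f k)"
    by (rule absum_cmult_AN[OF assms(1) symbol_bound])
  show "u j \<in> L2_space" and 1: "fourier_coeff (u j) = (\<lambda>k. of_real (mgs k $ j) * fourier_coeff f k)"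
    unfolding u_def using ab by (auto intro!: multiplier_op_exists simp: symbol_even fun_eq_iff)
  show "absum (fourier_coeff (u j))" unfolding 1 by (rule ab)
  show "mg_velocity \<Omega> \<beta> \<eta> f x $ j = u j x" by (simp add: mg_velocity_def u_def)
qed

lemma integrable_L2_mult:
  assumes "integrable torus f" "u \<in> L2_space" "absum (fourier_coeff u)" "\<phi> \<in> test_functions"
  shows "integrable torus (\<lambda>x. f x * u x * \<phi> x)"
  by (intro integrable_real_mult_absum[OF integrable_real_mult_absum] assms L2_integrable test_functions_integrable test_functions_absum)

text \<open>Expanding \<open>f * u_j\<close> as a convolution and summing over \<open>j\<close>
  combines the factor \<open>k_j\<close> of the gradient with the symbol of the velocity into
  \<open>msym k l\<close>. The minus sign is that of the gradient coefficient at
  \<open>- k\<close>.\<close>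

lemma weak_nonlinear:
  assumes f: "f \<in> L2_space" "AN (fourier_coeff f) < \<infinity>" and \<phi>: "\<phi> \<in> test_functions"
  shows "complex_of_real (LINT x|torus. f x * (mg_velocity \<Omega> \<beta> \<eta> f x \<bullet> grad \<phi> x))
    = - (of_real vol * (LINT k|K. fourier_coeff \<phi> (- k) * (LINT l|K. \<i> * of_real (msym k l) * fourier_coeff f l * fourier_coeff f (k - l))))"
proof -
  let ?c = "fourier_coeff f"
  define u where "u j = multiplier_op (\<lambda>k. mgs k $ j) f" for j
  note vel = velocity[OF f(2), folded u_def]
  have fi: "integrable torus f" by (rule L2_integrable[OF f(1)])
  have ab: "absum ?c" by (rule absum_AN[OF f(2)])
  obtain B where B: "\<And>k. cmod (?c k) \<le> B" using absum_bounded[OF ab] by blast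
  define P where "P j k = (LINT l|K. fourier_coeff (u j) l * ?c (k - l))" for j k
  have Pc: "fourier_coeff (\<lambda>x. f x * u j x) k = P j k" for j k
    unfolding P_def by (rule fourier_coeff_mult[OF fi L2_integrable[OF vel(1)] vel(3)])
  have uf: "integrable torus (\<lambda>x. f x * u j x)" for j
    by (rule integrable_real_mult_absum[OF fi L2_integrable[OF vel(1)] vel(3)])
  have iu: "integrable K (\<lambda>l. fourier_coeff (u j) l * ?c (k - l))" for j k
    by (rule absum_integrable(1)[OF absum_mult_bounded[OF vel(3) B]])
  \<comment> \<open>Bounded coefficients of \<open>f * u_j\<close> against absolutely summable ones
    of the gradient justify exchanging the sums over \<open>j\<close> and over the modes.\<close>
  have Pb: "\<exists>B. \<forall>k. cmod (P j k) \<le> B" for j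
  proof -
    obtain Q where Q: "(\<integral>\<^sup>+l. ecmod (fourier_coeff (u j) l) \<partial>K) = ennreal Q" "Q \<ge> 0"
      using vel(3)[of j] unfolding absum_def by (cases "(\<integral>\<^sup>+l. ecmod (fourier_coeff (u j) l) \<partial>K)") auto
    have "cmod (P j k) \<le> Q * max B 0" for k
    proof -
      have "ecmod (P j k) \<le> (\<integral>\<^sup>+l. ecmod (fourier_coeff (u j) l * ?c (k - l)) \<partial>K)"
        unfolding P_def by (rule norm_integral_le_nn)
      also have "\<dots> \<le> (\<integral>\<^sup>+l. ecmod (fourier_coeff (u j) l) * ennreal (max B 0) \<partial>K)"
      proof (rule nn_integral_mono)
        fix l
        have "cmod (?c (k - l)) \<le> max B 0" using B[of "k - l"] by simp
        then show "ecmod (fourier_coeff (u j) l * ?c (k - l)) \<le> ecmod (fourier_coeff (u j) l) * ennreal (max B 0)"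
          by (simp add: norm_mult ennreal_mult[symmetric] ennreal_leI mult_left_mono)
      qed
      also have "\<dots> = ennreal (Q * max B 0)" using Q by (simp add: nn_integral_multc ennreal_mult)
      finally show ?thesis using Q by (simp add: ennreal_le_iff)
    qed
    then show ?thesis by blast
  qed
  have ip: "integrable K (\<lambda>k. fourier_coeff (\<lambda>x. grad \<phi> x $ j) (- k) * P j k)" for j
    using Pb[of j] by (auto intro!: absum_integrable(1) absum_mult_bounded absum_grad[OF \<phi>])
  have trm: "complex_of_real (LINT x|torus. f x * u j x * (grad \<phi> x $ j))
      = of_real vol * (LINT k|K. fourier_coeff (\<lambda>x. grad \<phi> x $ j) (- k) * P j k)" for j
    unfolding Pc[symmetric]
    by (rule pairing[OF uf test_functions_integrable[OF test_functions_grad[OF \<phi>]] test_functions_absum[OF test_functions_grad[OF \<phi>]]])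
  have "(\<lambda>x. f x * (mg_velocity \<Omega> \<beta> \<eta> f x \<bullet> grad \<phi> x)) = (\<lambda>x. \<Sum>j\<in>UNIV. f x * u j x * (grad \<phi> x $ j))"
    by (simp add: fun_eq_iff inner_vec_def vel(4) sum_distrib_left mult.assoc)
  then have "complex_of_real (LINT x|torus. f x * (mg_velocity \<Omega> \<beta> \<eta> f x \<bullet> grad \<phi> x))
     = (\<Sum>j\<in>UNIV. complex_of_real (LINT x|torus. f x * u j x * (grad \<phi> x $ j)))"
    using integrable_L2_mult[OF fi vel(1) vel(3) test_functions_grad[OF \<phi>]]
    by (simp only:) (subst Bochner_Integration.integral_sum, auto)
  also have "\<dots> = (\<Sum>j\<in>UNIV. of_real vol * (LINT k|K. fourier_coeff (\<lambda>x. grad \<phi> x $ j) (- k) * P j k))"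
    by (simp only: trm)
  also have "\<dots> = of_real vol * (LINT k|K. (\<Sum>j\<in>UNIV. fourier_coeff (\<lambda>x. grad \<phi> x $ j) (- k) * P j k))"
    using ip by (subst Bochner_Integration.integral_sum) (auto simp: sum_distrib_left)
  also have "(\<lambda>k. \<Sum>j\<in>UNIV. fourier_coeff (\<lambda>x. grad \<phi> x $ j) (- k) * P j k)
     = (\<lambda>k. - (fourier_coeff \<phi> (- k) * (LINT l|K. \<i> * of_real (msym k l) * ?c l * ?c (k - l))))"
  proof
    fix k
    have "(\<Sum>j\<in>UNIV. fourier_coeff (\<lambda>x. grad \<phi> x $ j) (- k) * P j k)
      = (\<Sum>j\<in>UNIV. (LINT l|K. (- \<i> * of_int (k $ j) * fourier_coeff \<phi> (- k)) * (fourier_coeff (u j) l * ?c (k - l))))"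
      by (simp add: test_functions_coeff_grad[OF \<phi>] P_def)
    also have "\<dots> = (LINT l|K. (\<Sum>j\<in>UNIV. (- \<i> * of_int (k $ j) * fourier_coeff \<phi> (- k)) * (fourier_coeff (u j) l * ?c (k - l))))"
      by (rule Bochner_Integration.integral_sum[symmetric]) (intro integrable_mult_right iu)
    also have "\<dots> = (LINT l|K. (- fourier_coeff \<phi> (- k)) * (\<i> * of_real (msym k l) * ?c l * ?c (k - l)))"
    proof (rule Bochner_Integration.integral_cong[OF refl])
      fix l
      have "complex_of_real (msym k l) = (\<Sum>j\<in>UNIV. of_int (k $ j) * of_real (mgs l $ j))"
        by (simp add: msym_def inner_vec_def)
      then show "(\<Sum>j\<in>UNIV. (- \<i> * of_int (k $ j) * fourier_coeff \<phi> (- k)) * (fourier_coeff (u j) l * ?c (k - l)))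
        = (- fourier_coeff \<phi> (- k)) * (\<i> * of_real (msym k l) * ?c l * ?c (k - l))"
        by (simp add: vel(2) sum_distrib_left sum_distrib_right sum_negf mult_ac)
    qed
    also have "\<dots> = - (fourier_coeff \<phi> (- k) * (LINT l|K. \<i> * of_real (msym k l) * ?c l * ?c (k - l)))"
      by (subst integral_mult_right_zero) simp
    finally show "(\<Sum>j\<in>UNIV. fourier_coeff (\<lambda>x. grad \<phi> x $ j) (- k) * P j k)
      = - (fourier_coeff \<phi> (- k) * (LINT l|K. \<i> * of_real (msym k l) * ?c l * ?c (k - l)))" .
  qed
  finally show ?thesis by simp
qed

lemma velocity_div_free:
  assumes f: "AN (fourier_coeff f) < \<infinity>"
  shows "div_free (mg_velocity \<Omega> \<beta> \<eta> f)"
  unfolding div_free_def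
proof
  fix \<phi> assume \<phi>: "\<phi> \<in> test_functions"
  let ?c = "fourier_coeff f"
  define u where "u j = multiplier_op (\<lambda>k. mgs k $ j) f" for j
  note vel = velocity[OF f, folded u_def]
  note g = test_functions_integrable[OF test_functions_grad[OF \<phi>]] test_functions_absum[OF test_functions_grad[OF \<phi>]]
  have trm: "complex_of_real (LINT x|torus. u j x * (grad \<phi> x $ j))
      = of_real vol * (LINT k|K. fourier_coeff (\<lambda>x. grad \<phi> x $ j) (- k) * fourier_coeff (u j) k)" for j
    by (rule pairing[OF L2_integrable[OF vel(1)] g])
  have ip: "integrable K (\<lambda>k. fourier_coeff (\<lambda>x. grad \<phi> x $ j) (- k) * fourier_coeff (u j) k)" for j
    using absum_bounded[OF vel(3)[of j]] by (auto intro!: absum_integrable(1) absum_mult_bounded absum_grad[OF \<phi>])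
  have "(\<lambda>x. mg_velocity \<Omega> \<beta> \<eta> f x \<bullet> grad \<phi> x) = (\<lambda>x. \<Sum>j\<in>UNIV. u j x * (grad \<phi> x $ j))"
    by (simp add: fun_eq_iff inner_vec_def vel(4))
  then have "complex_of_real (LINT x|torus. mg_velocity \<Omega> \<beta> \<eta> f x \<bullet> grad \<phi> x)
     = (\<Sum>j\<in>UNIV. complex_of_real (LINT x|torus. u j x * (grad \<phi> x $ j)))"
    using integrable_real_mult_absum[OF L2_integrable[OF vel(1)] g]
    by (simp only:) (subst Bochner_Integration.integral_sum, auto)
  also have "\<dots> = (\<Sum>j\<in>UNIV. of_real vol * (LINT k|K. fourier_coeff (\<lambda>x. grad \<phi> x $ j) (- k) * fourier_coeff (u j) k))"
    by (simp only: trm)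
  also have "\<dots> = of_real vol * (LINT k|K. (\<Sum>j\<in>UNIV. fourier_coeff (\<lambda>x. grad \<phi> x $ j) (- k) * fourier_coeff (u j) k))"
    using ip by (subst Bochner_Integration.integral_sum) (auto simp: sum_distrib_left)
  also have "(\<lambda>k. \<Sum>j\<in>UNIV. fourier_coeff (\<lambda>x. grad \<phi> x $ j) (- k) * fourier_coeff (u j) k) = (\<lambda>k. 0)"
  proof
    fix k
    have "(\<Sum>j\<in>UNIV. fourier_coeff (\<lambda>x. grad \<phi> x $ j) (- k) * fourier_coeff (u j) k)
      = - \<i> * fourier_coeff \<phi> (- k) * ?c k * of_real (wavevec k \<bullet> mgs k)"
      by (simp add: test_functions_coeff_grad[OF \<phi>] vel(2) inner_vec_def sum_distrib_left sum_negf mult_ac)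
    then show "(\<Sum>j\<in>UNIV. fourier_coeff (\<lambda>x. grad \<phi> x $ j) (- k) * fourier_coeff (u j) k) = 0"
      by (simp add: symbol_orth)
  qed
  finally show "(LINT x|torus. mg_velocity \<Omega> \<beta> \<eta> f x \<bullet> grad \<phi> x) = 0" by simp
qed

end

section \<open>Bochner spaces\<close>

text \<open>True even for infinite \<open>SN\<close>, because two defaults agree: the unordered sum
  of a non-summable family and \<open>enn2real top\<close> are both 0.\<close>

lemma Sobolev_norm_eq: "Sobolev_norm r f = sqrt (vol * enn2real (SN r (fourier_coeff f)))"
proof (cases "SN r (fourier_coeff f) < \<infinity>")
  case True
  then obtain x where x: "SN r (fourier_coeff f) = ennreal x" "x \<ge> 0" by (cases "SN r (fourier_coeff f)") auto
  have "ennreal ((Sobolev_norm r f)\<^sup>2) = ennreal (vol * x)"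
    using Sobolev_norm_SN[OF True] x by (simp add: ennreal_mult less_imp_le)
  then have "(Sobolev_norm r f)\<^sup>2 = vol * x" using x by (simp add: less_imp_le)
  then have "Sobolev_norm r f = sqrt (vol * x)" using Sobolev_norm_nonneg[of r f] by (metis real_sqrt_unique)
  then show ?thesis using x by simp
next
  case False
  let ?f = "\<lambda>k. (1 + (norm (wavevec k))\<^sup>2) powr r * (cmod (fourier_coeff f k))\<^sup>2"
  have "\<not> ?f summable_on UNIV"
    using False unfolding SN_def by (subst summable_on_iff_nn_integral_K(1)) (auto simp: ennreal_weight)
  then have "Sobolev_norm r f = 0" by (simp add: Sobolev_norm_def infsum_not_exists)
  moreover have "SN r (fourier_coeff f) = top" using False top.not_eq_extremum by fastforce
  ultimately show ?thesis by simp
qed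

lemma SN_measurable [measurable]:
  assumes [measurable]: "\<And>k. (\<lambda>t. c t k) \<in> borel_measurable M"
  shows "(\<lambda>t. SN r (c t)) \<in> borel_measurable M"
  unfolding SN_def by measurable

lemma SN_finite_support:
  assumes "finite A" "\<And>k. k \<notin> A \<Longrightarrow> c k = 0"
  shows "SN r c < \<infinity>" "absum c"
proof -
  have "SN r c = (\<Sum>k\<in>A. ennreal ((1 + (kn k)\<^sup>2) powr r) * (ecmod (c k))\<^sup>2)"
    unfolding SN_def using assms by (intro nn_integral_count_space') auto
  also have "\<dots> < \<infinity>" using assms(1) by (simp add: ennreal_mult_less_top power_less_top_ennreal)
  finally show "SN r c < \<infinity>" .
  have "(\<integral>\<^sup>+k. ecmod (c k) \<partial>K) = (\<Sum>k\<in>A. ecmod (c k))"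
    using assms by (intro nn_integral_count_space') auto
  also have "\<dots> < \<infinity>" using assms(1) by simp
  finally show "absum c" by (simp add: absum_def)
qed

lemma uniform_modes:
  fixes c :: "real \<Rightarrow> int^3 \<Rightarrow> complex"
  assumes cont: "\<And>k. continuous_on {0..T} (\<lambda>t. c t k)" and A: "finite A" and e: "e > 0"
  shows "\<exists>d>0. \<forall>t\<in>{0..T}. \<forall>u\<in>{0..T}. \<bar>t - u\<bar> < d \<longrightarrow> (\<forall>k\<in>A. cmod (c t k - c u k) < e)"
  using A
proof (induction A rule: finite_induct)
  case empty
  show ?case by (intro exI[of _ 1]) simp
next
  case (insert k A)
  then obtain d1 where d1: "d1 > 0" "\<forall>t\<in>{0..T}. \<forall>u\<in>{0..T}. \<bar>t - u\<bar> < d1 \<longrightarrow> (\<forall>k\<in>A. cmod (c t k - c u k) < e)" by blast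
  have "uniformly_continuous_on {0..T} (\<lambda>t. c t k)" by (rule compact_uniformly_continuous[OF cont]) simp
  then obtain d2 where d2: "d2 > 0" "\<forall>t\<in>{0..T}. \<forall>u\<in>{0..T}. dist u t < d2 \<longrightarrow> dist (c u k) (c t k) < e"
    using e unfolding uniformly_continuous_on_def by blast
  show ?case
  proof (intro exI[of _ "min d1 d2"] conjI ballI impI)
    show "min d1 d2 > 0" using d1 d2 by simp
    fix t u k' assume "t \<in> {0..T}" "u \<in> {0..T}" "\<bar>t - u\<bar> < min d1 d2" "k' \<in> insert k A"
    then show "cmod (c t k' - c u k') < e" using d1(2) d2(2) by (auto simp: dist_norm abs_minus_commute)
  qed
qed

text \<open>The simple functions truncate to finitely many modes and freeze these on a time grid, fine
  enough (by uniform continuity of the modes) to make the error in those modes negligible.\<close>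

lemma strongly_measurable_fser:
  fixes c :: "real \<Rightarrow> int^3 \<Rightarrow> complex"
  assumes T: "T > 0" and cont: "\<And>k. continuous_on {0..T} (\<lambda>t. c t k)"
    and ab: "\<And>t. t \<in> {0..T} \<Longrightarrow> absum (c t)" and he: "\<And>t. t \<in> {0..T} \<Longrightarrow> herm (c t)"
    and fin: "AE t in lebesgue_on {0<..<T}. SN r (c t) < \<infinity>"
  shows "strongly_measurable r {0<..<T} (\<lambda>t. fser (c t))"
proof -
  define B where "B n = {k. kn k \<le> real (Suc n)}" for n
  have fB: "finite (B n)" for n unfolding B_def by (rule card_lattice_ball(1)) simp
  define w where "w k = (1 + (kn k)\<^sup>2) powr r" for k
  have w0: "w k \<ge> 0" for k by (simp add: w_def)
  define W where "W n = (\<Sum>k\<in>B n. w k)" for n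
  have W0: "W n \<ge> 0" for n unfolding W_def by (intro sum_nonneg w0)
  \<comment> \<open>Chosen such that an error \<open>e n\<close> in the square of each mode of
    \<open>B n\<close> adds up to at most \<open>1 / (n + 1)\<close> in the weighted sum.\<close>
  define e where "e n = 1 / ((W n + 1) * real (Suc n))" for n
  have e0: "e n > 0" for n using W0[of n] by (simp add: e_def add_nonneg_pos)
  have "\<exists>d>0. \<forall>t\<in>{0..T}. \<forall>u\<in>{0..T}. \<bar>t - u\<bar> < d \<longrightarrow> (\<forall>k\<in>B n. cmod (c t k - c u k) < sqrt (e n))" for n
    by (rule uniform_modes[OF cont fB]) (use e0 in simp)
  then obtain d where d: "\<And>n. d n > 0"
    "\<And>n t u k. t \<in> {0..T} \<Longrightarrow> u \<in> {0..T} \<Longrightarrow> \<bar>t - u\<bar> < d n \<Longrightarrow> k \<in> B n \<Longrightarrow> cmod (c t k - c u k) < sqrt (e n)"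
    by metis
  define h where "h n = d n / 2" for n
  have h: "h n > 0" "h n < d n" for n using d(1)[of n] by (auto simp: h_def)
  \<comment> \<open>Rounding down to a grid of mesh below \<open>d n\<close> takes finitely many
    values on the interval and stays inside \<open>{0..T}\<close>.\<close>
  define q where "q n t = h n * of_int \<lfloor>t / h n\<rfloor>" for n t
  have q: "q n t \<in> {0..T}" "\<bar>t - q n t\<bar> < d n" if "t \<in> {0<..<T}" for n t
  proof -
    have a: "of_int \<lfloor>t / h n\<rfloor> \<le> t / h n" "t / h n < of_int \<lfloor>t / h n\<rfloor> + 1" by linarith+
    have "h n * of_int \<lfloor>t / h n\<rfloor> \<le> h n * (t / h n)" by (rule mult_left_mono[OF a(1)]) (use h(1)[of n] in simp)
    moreover have "h n * (t / h n) < h n * (of_int \<lfloor>t / h n\<rfloor> + 1)" by (rule mult_strict_left_mono[OF a(2)]) (use h(1)[of n] in simp)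
    moreover have "h n * (t / h n) = t" using h(1)[of n] by simp
    ultimately have b: "q n t \<le> t" "t < q n t + h n" unfolding q_def distrib_left by linarith+
    have "0 \<le> \<lfloor>t / h n\<rfloor>" using that h(1)[of n] by simp
    then have "0 \<le> q n t" using h(1)[of n] by (simp add: q_def)
    then show "q n t \<in> {0..T}" "\<bar>t - q n t\<bar> < d n" using b that h(2)[of n] by auto
  qed
  define cc where "cc n t k = (if k \<in> B n then c (q n t) k else 0)" for n t k
  define F where "F n t = fser (cc n t)" for n t
  have ccab: "absum (cc n t)" "SN r (cc n t) < \<infinity>" for n t
    using SN_finite_support(1)[OF fB[of n], of "cc n t" r] SN_finite_support(2)[OF fB[of n], of "cc n t"] by (auto simp: cc_def)
  have cche: "herm (cc n t)" if "t \<in> {0<..<T}" for n t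
    using he[OF q(1)[OF that]] by (auto simp: herm_def cc_def B_def)
  have ccF: "fourier_coeff (F n t) = cc n t" if "t \<in> {0<..<T}" for n t
    unfolding F_def using fourier_coeff_fser[OF ccab(1) cche[OF that]] by auto
  have sub: "t \<in> {0..T}" if "t \<in> {0<..<T}" for t using that by auto
  have cF: "fourier_coeff (fser (c t)) = c t" if "t \<in> {0<..<T}" for t
    using fourier_coeff_fser[OF ab he] sub[OF that] by auto
  show ?thesis
    unfolding strongly_measurable_def
  proof (intro exI[of _ F] conjI allI ballI)
    fix n
    show "simple_function (lebesgue_on {0<..<T}) (F n)"
    proof -
      have "simple_function (lebesgue_on {0<..<T}) (q n)"
      proof (rule simple_function_borel_measurable)
        have "q n \<in> borel_measurable borel" unfolding q_def[abs_def] by measurable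
        then have "q n \<in> borel_measurable lebesgue" by (simp add: measurable_completion)
        then show "q n \<in> borel_measurable (lebesgue_on {0<..<T})" by (rule measurable_restrict_space1)
        have "q n ` {0<..<T} \<subseteq> (\<lambda>i. h n * of_int i) ` {0..\<lfloor>T / h n\<rfloor>}"
        proof
          fix y assume "y \<in> q n ` {0<..<T}"
          then obtain t where t: "t \<in> {0<..<T}" "y = q n t" by blast
          have "t / h n \<le> T / h n" "0 \<le> t / h n" using t h(1)[of n] by (auto intro: divide_right_mono)
          then have "\<lfloor>t / h n\<rfloor> \<in> {0..\<lfloor>T / h n\<rfloor>}" by (auto intro: floor_mono)
          then show "y \<in> (\<lambda>i. h n * of_int i) ` {0..\<lfloor>T / h n\<rfloor>}" using t by (auto simp: q_def)
        qed
        then show "finite (q n ` space (lebesgue_on {0<..<T}))" by (simp add: finite_subset)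
      qed
      then have "simple_function (lebesgue_on {0<..<T}) (\<lambda>t. (\<lambda>u. fser (\<lambda>k. if k \<in> B n then c u k else 0)) (q n t))"
        by (rule simple_function_compose1)
      then show ?thesis by (simp add: F_def[abs_def] cc_def[abs_def])
    qed
    fix t assume t: "t \<in> {0<..<T}"
    show "F n t \<in> Sobolev r"
      using ccF[OF t] ccab fser_L2[OF ccab(1)] by (simp add: Sobolev_iff F_def)
  next
    show "AE t in lebesgue_on {0<..<T}. fser (c t) \<in> Sobolev r \<and> (\<lambda>n. Sobolev_norm r (\<lambda>x. F n t x - fser (c t) x)) \<longlonglongrightarrow> 0"
      using fin AE_space
    proof eventually_elim
      case (elim t)
      then have t: "t \<in> {0<..<T}" by simp
      have S: "fser (c t) \<in> Sobolev r"
        using elim(1) cF[OF t] fser_L2[OF ab[OF sub[OF t]]] by (simp add: Sobolev_iff)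
      have FS: "F n t \<in> Sobolev r" for n
        using ccF[OF t] ccab fser_L2[OF ccab(1)] by (simp add: Sobolev_iff F_def)
      define dd where "dd n k = cc n t k - c t k" for n k
      have ddF: "fourier_coeff (\<lambda>x. F n t x - fser (c t) x) = dd n" for n
        using Sobolev_diff(2)[OF FS S, of n] ccF[OF t] cF[OF t] by (simp add: dd_def fun_eq_iff)
      define tl where "tl n = (\<integral>\<^sup>+k. indicator (- B n) k * (ennreal (w k) * (ecmod (c t k))\<^sup>2) \<partial>K)" for n
      have tl0: "tl \<longlonglongrightarrow> 0"
      proof -
        have "(\<lambda>n. \<integral>\<^sup>+k. indicator (- B n) k * (ennreal (w k) * (ecmod (c t k))\<^sup>2) \<partial>K) \<longlonglongrightarrow> (\<integral>\<^sup>+k. 0 \<partial>K)"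
        proof (rule nn_integral_dominated_convergence[where w = "\<lambda>k. ennreal (w k) * (ecmod (c t k))\<^sup>2"])
          show "(\<integral>\<^sup>+k. ennreal (w k) * (ecmod (c t k))\<^sup>2 \<partial>K) < \<infinity>"
            using elim(1) by (simp add: SN_def w_def)
          show "AE k in K. (\<lambda>n. indicator (- B n) k * (ennreal (w k) * (ecmod (c t k))\<^sup>2)) \<longlonglongrightarrow> 0"
          proof (rule AE_I2)
            fix k
            obtain N where N: "kn k \<le> real N" using real_arch_simple by blast
            have "eventually (\<lambda>n. indicator (- B n) k * (ennreal (w k) * (ecmod (c t k))\<^sup>2) = 0) sequentially"
              unfolding eventually_sequentially
            proof (intro exI allI impI)
              fix n assume "N \<le> n"
              then have "k \<in> B n" using N by (simp add: B_def)
              then show "indicator (- B n) k * (ennreal (w k) * (ecmod (c t k))\<^sup>2) = 0" by simp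
            qed
            then show "(\<lambda>n. indicator (- B n) k * (ennreal (w k) * (ecmod (c t k))\<^sup>2)) \<longlonglongrightarrow> 0"
              by (rule tendsto_eventually)
          qed
        qed (auto simp: indicator_def intro!: AE_I2)
        then show ?thesis by (simp add: tl_def[abs_def])
      qed
      have le: "SN r (dd n) \<le> ennreal (1 / real (Suc n)) + tl n" for n
      proof -
        have "SN r (dd n) \<le> (\<integral>\<^sup>+k. indicator (B n) k * (ennreal (w k) * ennreal (e n)) + indicator (- B n) k * (ennreal (w k) * (ecmod (c t k))\<^sup>2) \<partial>K)"
          unfolding SN_def w_def[symmetric]
        proof (rule nn_integral_mono)
          fix k
          show "ennreal (w k) * (ecmod (dd n k))\<^sup>2 \<le> indicator (B n) k * (ennreal (w k) * ennreal (e n)) + indicator (- B n) k * (ennreal (w k) * (ecmod (c t k))\<^sup>2)"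
          proof (cases "k \<in> B n")
            case True
            have "cmod (dd n k) < sqrt (e n)"
              using d(2)[OF sub[OF t] q(1)[OF t] q(2)[OF t] True] True by (simp add: dd_def cc_def norm_minus_commute)
            then have "(cmod (dd n k))\<^sup>2 \<le> (sqrt (e n))\<^sup>2" by (intro power_mono) auto
            then have "(cmod (dd n k))\<^sup>2 \<le> e n" using e0[of n] by simp
            then have "(ecmod (dd n k))\<^sup>2 \<le> ennreal (e n)" by (simp add: ennreal_power ennreal_leI)
            then show ?thesis using True by (simp add: mult_left_mono)
          next
            case False
            then show ?thesis by (simp add: dd_def cc_def)
          qed
        qed
        also have "\<dots> = (\<integral>\<^sup>+k. indicator (B n) k * (ennreal (w k) * ennreal (e n)) \<partial>K) + tl n"
          unfolding tl_def by (rule nn_integral_add) auto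
        also have "(\<integral>\<^sup>+k. indicator (B n) k * (ennreal (w k) * ennreal (e n)) \<partial>K) = (\<Sum>k\<in>B n. ennreal (w k) * ennreal (e n))"
          using fB by (subst nn_integral_count_space'[where A = "B n"]) auto
        also have "\<dots> = (\<Sum>k\<in>B n. ennreal (w k * e n))" using w0 e0[of n] by (simp add: ennreal_mult less_imp_le)
        also have "\<dots> = ennreal (\<Sum>k\<in>B n. w k * e n)" using w0 e0[of n] by (intro sum_ennreal) (auto simp: less_imp_le)
        also have "(\<Sum>k\<in>B n. w k * e n) = W n * e n" by (simp add: W_def sum_distrib_right)
        also have "ennreal (W n * e n) \<le> ennreal (1 / real (Suc n))"
        proof (rule ennreal_leI)
          have "W n * e n = (W n / (W n + 1)) * (1 / real (Suc n))" by (simp add: e_def)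
          also have "\<dots> \<le> 1 * (1 / real (Suc n))" using W0[of n] by (intro mult_right_mono) auto
          finally show "W n * e n \<le> 1 / real (Suc n)" by simp
        qed
        finally show ?thesis by (simp add: add_right_mono)
      qed
      have "(\<lambda>n. ennreal (1 / real (Suc n)) + tl n) \<longlonglongrightarrow> ennreal 0 + 0"
        by (intro tendsto_add tl0 tendsto_ennrealI LIMSEQ_Suc[OF lim_1_over_n])
      then have up: "(\<lambda>n. ennreal (1 / real (Suc n)) + tl n) \<longlonglongrightarrow> 0" by simp
      have "(\<lambda>n. SN r (dd n)) \<longlonglongrightarrow> 0"
      proof (rule tendsto_sandwich[OF _ _ tendsto_const up])
        show "\<forall>\<^sub>F n in sequentially. 0 \<le> SN r (dd n)" by (intro always_eventually allI zero_le)
        show "\<forall>\<^sub>F n in sequentially. SN r (dd n) \<le> ennreal (1 / real (Suc n)) + tl n"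
          by (intro always_eventually allI le)
      qed
      then have "(\<lambda>n. SN r (dd n)) \<longlonglongrightarrow> ennreal 0" by simp
      then have "(\<lambda>n. enn2real (SN r (dd n))) \<longlonglongrightarrow> 0" by (rule tendsto_enn2real) simp
      then have "(\<lambda>n. sqrt (vol * enn2real (SN r (dd n)))) \<longlonglongrightarrow> sqrt (vol * 0)" by (intro tendsto_real_sqrt tendsto_mult tendsto_const)
      then have "(\<lambda>n. Sobolev_norm r (\<lambda>x. F n t x - fser (c t) x)) \<longlonglongrightarrow> 0"
        by (simp add: Sobolev_norm_eq ddF)
      then show ?case using S by simp
    qed
  qed
qed

lemma Linf_Sobolev_fser:
  fixes c :: "real \<Rightarrow> int^3 \<Rightarrow> complex"
  assumes T: "T > 0" and cont: "\<And>k. continuous_on {0..T} (\<lambda>t. c t k)" and [measurable]: "\<And>k. (\<lambda>t. c t k) \<in> borel_measurable borel"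
    and ab: "\<And>t. t \<in> {0..T} \<Longrightarrow> absum (c t)" and he: "\<And>t. t \<in> {0..T} \<Longrightarrow> herm (c t)"
    and bd: "\<And>t. t \<in> {0..T} \<Longrightarrow> SN r (c t) \<le> ennreal M"
  shows "(\<lambda>t. fser (c t)) \<in> Linf_Sobolev r {0<..<T}"
proof -
  have sub: "t \<in> {0..T}" if "t \<in> {0<..<T}" for t using that by auto
  have fin: "SN r (c t) < \<infinity>" if "t \<in> {0..T}" for t using le_less_trans[OF bd[OF that]] by simp
  have sm: "strongly_measurable r {0<..<T} (\<lambda>t. fser (c t))"
    by (rule strongly_measurable_fser[OF T cont ab he AE_I2]) (use fin in auto)
  have eq: "Sobolev_norm r (fser (c t)) = sqrt (vol * enn2real (SN r (c t)))" if "t \<in> {0..T}" for t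
  proof -
    have "fourier_coeff (fser (c t)) = c t" using fourier_coeff_fser[OF ab[OF that] he[OF that]] by auto
    then show ?thesis by (simp add: Sobolev_norm_eq)
  qed
  have le: "Sobolev_norm r (fser (c t)) \<le> sqrt (vol * max M 0)" if "t \<in> {0..T}" for t
  proof -
    have "SN r (c t) \<le> ennreal (max M 0)" by (rule order_trans[OF bd[OF that] ennreal_leI]) simp
    then have "enn2real (SN r (c t)) \<le> max M 0" by (intro enn2real_leI) auto
    then show ?thesis unfolding eq[OF that] by (simp add: less_imp_le)
  qed
  have "(\<lambda>t. ereal (sqrt (vol * enn2real (SN r (c t))))) \<in> borel_measurable borel" by measurable
  then have "(\<lambda>t. ereal (sqrt (vol * enn2real (SN r (c t))))) \<in> borel_measurable lebesgue" by (simp add: measurable_completion)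
  then have "(\<lambda>t. ereal (sqrt (vol * enn2real (SN r (c t))))) \<in> borel_measurable (lebesgue_on {0<..<T})" by (rule measurable_restrict_space1)
  then have m: "(\<lambda>t. ereal (Sobolev_norm r (fser (c t)))) \<in> borel_measurable (lebesgue_on {0<..<T})"
    by (rule measurable_cong[THEN iffD1, rotated]) (use eq in auto)
  have "Linf_norm r {0<..<T} (\<lambda>t. fser (c t)) \<le> ereal (sqrt (vol * max M 0))"
    unfolding Linf_norm_def by (rule esssup_I[OF m AE_I2]) (use le in auto)
  also have "\<dots> < \<infinity>" by simp
  finally show ?thesis using sm by (simp add: Linf_Sobolev_def)
qed

lemma nn_integral_lebesgue_on:
  assumes A: "A \<in> sets borel"
  shows "(\<integral>\<^sup>+t. f t \<partial>lebesgue_on A) = (\<integral>\<^sup>+t. indicator A t * f t \<partial>lborel)"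
  using A by (subst nn_integral_restrict_space) (auto simp: nn_integral_completion mult.commute)

lemma AE_lebesgue_on: "A \<in> sets borel \<Longrightarrow> (AE t in lebesgue_on A. P t) \<longleftrightarrow> (AE t in lborel. t \<in> A \<longrightarrow> P t)"
  by (subst AE_restrict_space_iff) (auto simp: AE_completion_iff)

lemma L2_Sobolev_fser:
  fixes c :: "real \<Rightarrow> int^3 \<Rightarrow> complex"
  assumes T: "T > 0" and cont: "\<And>k. continuous_on {0..T} (\<lambda>t. c t k)" and [measurable]: "\<And>k. (\<lambda>t. c t k) \<in> borel_measurable borel"
    and ab: "\<And>t. t \<in> {0..T} \<Longrightarrow> absum (c t)" and he: "\<And>t. t \<in> {0..T} \<Longrightarrow> herm (c t)"
    and fin: "(\<integral>\<^sup>+t. indicator {0<..<T} t * SN r (c t) \<partial>lborel) < \<infinity>"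
  shows "(\<lambda>t. fser (c t)) \<in> L2_Sobolev r {0<..<T}"
proof -
  have sub: "t \<in> {0..T}" if "t \<in> {0<..<T}" for t using that by auto
  have "AE t in lborel. indicator {0<..<T} t * SN r (c t) \<noteq> \<infinity>"
    by (rule nn_integral_PInf_AE) (use fin in auto)
  then have "AE t in lborel. t \<in> {0<..<T} \<longrightarrow> SN r (c t) < \<infinity>" by eventually_elim (auto simp: less_top)
  then have f: "AE t in lebesgue_on {0<..<T}. SN r (c t) < \<infinity>" by (subst AE_lebesgue_on) auto
  have sm: "strongly_measurable r {0<..<T} (\<lambda>t. fser (c t))"
    by (rule strongly_measurable_fser[OF T cont ab he f])
  have eq: "Sobolev_norm r (fser (c t)) = sqrt (vol * enn2real (SN r (c t)))" if "t \<in> {0..T}" for t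
  proof -
    have "fourier_coeff (fser (c t)) = c t" using fourier_coeff_fser[OF ab[OF that] he[OF that]] by auto
    then show ?thesis by (simp add: Sobolev_norm_eq)
  qed
  have "(\<lambda>t. (sqrt (vol * enn2real (SN r (c t))))\<^sup>2) \<in> borel_measurable borel" by measurable
  then have "(\<lambda>t. (sqrt (vol * enn2real (SN r (c t))))\<^sup>2) \<in> borel_measurable lebesgue" by (simp add: measurable_completion)
  then have "(\<lambda>t. (sqrt (vol * enn2real (SN r (c t))))\<^sup>2) \<in> borel_measurable (lebesgue_on {0<..<T})" by (rule measurable_restrict_space1)
  then have m: "(\<lambda>t. (Sobolev_norm r (fser (c t)))\<^sup>2) \<in> borel_measurable (lebesgue_on {0<..<T})"
    by (rule measurable_cong[THEN iffD1, rotated]) (use eq in auto)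
  have "integrable (lebesgue_on {0<..<T}) (\<lambda>t. (Sobolev_norm r (fser (c t)))\<^sup>2)"
  proof (rule integrableI_bounded[OF m])
    have "(\<integral>\<^sup>+t. ennreal (norm ((Sobolev_norm r (fser (c t)))\<^sup>2)) \<partial>lebesgue_on {0<..<T})
      = (\<integral>\<^sup>+t. indicator {0<..<T} t * ennreal (norm ((Sobolev_norm r (fser (c t)))\<^sup>2)) \<partial>lborel)"
      by (rule nn_integral_lebesgue_on) simp
    also have "\<dots> \<le> (\<integral>\<^sup>+t. ennreal vol * (indicator {0<..<T} t * SN r (c t)) \<partial>lborel)"
    proof (rule nn_integral_mono)
      fix t
      show "indicator {0<..<T} t * ennreal (norm ((Sobolev_norm r (fser (c t)))\<^sup>2)) \<le> ennreal vol * (indicator {0<..<T} t * SN r (c t))"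
      proof (cases "t \<in> {0<..<T}")
        case True
        have "norm ((Sobolev_norm r (fser (c t)))\<^sup>2) = vol * enn2real (SN r (c t))"
          unfolding eq[OF sub[OF True]] by (simp add: less_imp_le)
        then have "ennreal (norm ((Sobolev_norm r (fser (c t)))\<^sup>2)) = ennreal vol * ennreal (enn2real (SN r (c t)))"
          by (simp add: ennreal_mult less_imp_le)
        also have "\<dots> \<le> ennreal vol * SN r (c t)" by (intro mult_left_mono) (auto simp: ennreal_enn2real_if)
        finally show ?thesis using True by simp
      qed simp
    qed
    also have "\<dots> = ennreal vol * (\<integral>\<^sup>+t. indicator {0<..<T} t * SN r (c t) \<partial>lborel)" by (rule nn_integral_cmult) measurable
    also have "\<dots> < \<infinity>" using fin by (simp add: ennreal_mult_less_top)
    finally show "(\<integral>\<^sup>+t. ennreal (norm ((Sobolev_norm r (fser (c t)))\<^sup>2)) \<partial>lebesgue_on {0<..<T}) < \<infinity>" .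
  qed
  then show ?thesis using sm by (simp add: L2_Sobolev_def)
qed

section \<open>From the weak formulation to the modes\<close>

lemma integral_lebesgue_on:
  fixes h :: "real \<Rightarrow> complex"
  assumes "A \<in> sets borel" "h \<in> borel_measurable borel"
  shows "(LINT \<tau>|lebesgue_on A. h \<tau>) = (LINT \<tau>:A|lborel. h \<tau>)"
  using assms unfolding set_lebesgue_integral_def
  by (subst integral_restrict_space) (auto simp: integral_completion)

lemma borel_measurable_lebesgue_on: "h \<in> borel_measurable borel \<Longrightarrow> h \<in> borel_measurable (lebesgue_on A)"
  by (intro measurable_restrict_space1 measurable_completion) simp

lemma sigma_finite_lebesgue_on_interval: "sigma_finite_measure (lebesgue_on {0<..<t :: real})"
  by (intro finite_measure.axioms(1)[OF finite_measure_lebesgue_on]) simp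

lemma cmod_fourier_coeff_le:
  "cmod (fourier_coeff f k) \<le> (LINT x|torus. \<bar>f x\<bar>) / vol"
proof -
  have "cmod (LINT x|torus. of_real (f x) * cis (- (wavevec k \<bullet> x))) \<le> (LINT x|torus. cmod (of_real (f x) * cis (- (wavevec k \<bullet> x))))"
    by (rule integral_norm_bound)
  also have "\<dots> = (LINT x|torus. \<bar>f x\<bar>)" by (simp add: norm_mult)
  finally show ?thesis
    unfolding fourier_coeff_def vol_def by (simp add: norm_divide norm_power divide_right_mono)
qed

lemma integrable_absum_mult:
  assumes "absum c" "\<And>k. cmod (b k) \<le> B"
  shows "integrable K (\<lambda>k. c k * b k)"
  using absum_mult_bounded[OF assms] by (rule absum_integrable(1))

text \<open>The time integrals of the modes are bounded uniformly in \<open>k\<close> and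
  \<open>c\<close> is absolutely summable, which provides the majorant for exchanging time and
  modes. \<open>F\<close> is given by the series almost everywhere, and its measurability is
  inferred from this.\<close>

lemma time_pairing:
  fixes h :: "real \<Rightarrow> int^3 \<Rightarrow> complex" and F :: "real \<Rightarrow> real"
  assumes c: "absum c" and h [measurable]: "\<And>k. (\<lambda>\<tau>. h \<tau> k) \<in> borel_measurable borel"
    and B: "\<And>k. (\<integral>\<^sup>+\<tau>. indicator {0<..<t} \<tau> * ecmod (h \<tau> k) \<partial>lborel) \<le> ennreal B"
    and F: "AE \<tau> in lebesgue_on {0<..<t}. complex_of_real (F \<tau>) = of_real vol * (LINT k|K. c k * h \<tau> k)"
  shows "complex_of_real (LINT \<tau>|lebesgue_on {0<..<t}. F \<tau>) = of_real vol * (LINT k|K. c k * (LINT \<tau>:{0<..<t}|lborel. h \<tau> k))"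
    and "integrable K (\<lambda>k. c k * (LINT \<tau>:{0<..<t}|lborel. h \<tau> k))"
proof -
  let ?L = "lebesgue_on {0<..<t}"
  have m: "(\<lambda>\<tau>. of_real vol * (LINT k|K. c k * h \<tau> k)) \<in> borel_measurable ?L"
    by (rule borel_measurable_lebesgue_on) measurable
  have "complex_of_real (LINT \<tau>|?L. F \<tau>) = (LINT \<tau>|?L. complex_of_real (F \<tau>))" by simp
  also have "\<dots> = (LINT \<tau>|?L. of_real vol * (LINT k|K. c k * h \<tau> k))"
    by (intro integral_cong_AE m F measurable_lebesgue_on_AE[OF _ m F]) simp
  also have "\<dots> = of_real vol * (LINT \<tau>|?L. LINT k|K. c k * h \<tau> k)" by simp
  also have "(LINT \<tau>|?L. LINT k|K. c k * h \<tau> k) = (LINT k|K. LINT \<tau>|?L. c k * h \<tau> k)"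
  proof (rule integral_K_swap[OF sigma_finite_lebesgue_on_interval])
    show "(\<lambda>\<tau>. c k * h \<tau> k) \<in> borel_measurable ?L" for k by (rule borel_measurable_lebesgue_on) measurable
    have "(\<integral>\<^sup>+\<tau>. ecmod (c k * h \<tau> k) \<partial>?L) \<le> ecmod (c k) * ennreal B" for k
    proof -
      have "(\<integral>\<^sup>+\<tau>. ecmod (c k * h \<tau> k) \<partial>?L) = (\<integral>\<^sup>+\<tau>. indicator {0<..<t} \<tau> * ecmod (c k * h \<tau> k) \<partial>lborel)"
        by (rule nn_integral_lebesgue_on) simp
      also have "\<dots> = (\<integral>\<^sup>+\<tau>. ecmod (c k) * (indicator {0<..<t} \<tau> * ecmod (h \<tau> k)) \<partial>lborel)"
        by (intro nn_integral_cong) (simp add: norm_mult ennreal_mult mult.left_commute)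
      also have "\<dots> = ecmod (c k) * (\<integral>\<^sup>+\<tau>. indicator {0<..<t} \<tau> * ecmod (h \<tau> k) \<partial>lborel)"
        by (rule nn_integral_cmult) measurable
      also have "\<dots> \<le> ecmod (c k) * ennreal B" by (intro mult_left_mono B) simp
      finally show ?thesis .
    qed
    then have "(\<integral>\<^sup>+k. \<integral>\<^sup>+\<tau>. ecmod (c k * h \<tau> k) \<partial>?L \<partial>K) \<le> (\<integral>\<^sup>+k. ecmod (c k) * ennreal B \<partial>K)"
      by (rule nn_integral_mono)
    also have "\<dots> = (\<integral>\<^sup>+k. ecmod (c k) \<partial>K) * ennreal B" by (rule nn_integral_multc) simp
    also have "\<dots> < \<infinity>" using c by (simp add: absum_def ennreal_mult_less_top)
    finally show "(\<integral>\<^sup>+k. \<integral>\<^sup>+\<tau>. ennreal (norm (c k * h \<tau> k)) \<partial>?L \<partial>K) < \<infinity>" .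
  qed
  also have "\<dots> = (LINT k|K. c k * (LINT \<tau>:{0<..<t}|lborel. h \<tau> k))"
    by (intro Bochner_Integration.integral_cong) (simp_all add: integral_lebesgue_on)
  finally show "complex_of_real (LINT \<tau>|?L. F \<tau>) = of_real vol * (LINT k|K. c k * (LINT \<tau>:{0<..<t}|lborel. h \<tau> k))" .
  have "cmod (LINT \<tau>:{0<..<t}|lborel. h \<tau> k) \<le> max B 0" for k
  proof -
    have "ecmod (LINT \<tau>:{0<..<t}|lborel. h \<tau> k) \<le> ennreal (max B 0)"
      by (rule order_trans[OF norm_set_integral_le order_trans[OF B]]) (simp add: ennreal_leI)
    then show ?thesis by simp
  qed
  then show "integrable K (\<lambda>k. c k * (LINT \<tau>:{0<..<t}|lborel. h \<tau> k))" by (rule integrable_absum_mult[OF c])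
qed

locale mg_problem =
  fixes \<Omega> \<beta> \<eta> \<kappa> s :: real
  assumes par: "\<Omega> > 0" "\<beta> > 0" "\<eta> > 0" and kap: "\<kappa> > 0" and s52: "s > 5 / 2"

sublocale mg_problem \<subseteq> mg_fourier \<kappa> s "3 / \<Omega>" "msym \<Omega> \<beta> \<eta>"
  by (rule mg_fourier_msym[OF par kap s52])

context mg_problem
begin

text \<open>Residual of mode \<open>k\<close> in the time-integrated equation. The function
  \<open>f\<close> at the end time is kept apart from the modes \<open>p\<close> under the
  integrals, since the latter represent the solution only at almost every time.\<close>

definition defect ::
  "(real^3 \<Rightarrow> real) \<Rightarrow> (real^3 \<Rightarrow> real) \<Rightarrow> (real \<Rightarrow> int^3 \<Rightarrow> complex) \<Rightarrow> (real \<Rightarrow> int^3 \<Rightarrow> complex) \<Rightarrow> real \<Rightarrow> int^3 \<Rightarrow> complex"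
  where "defect f f0 p sg t k = fourier_coeff f k - fourier_coeff f0 k
     + of_real \<kappa> * (LINT \<tau>:{0<..<t}|lborel. of_real (kn k) * p \<tau> k)
     + (LINT \<tau>:{0<..<t}|lborel. Bl (p \<tau>) (p \<tau>) k) - (LINT \<tau>:{0<..<t}|lborel. sg \<tau> k)"

lemma nn_integral_interval_le:
  assumes "\<And>\<tau>. \<tau> \<in> {0<..<t} \<Longrightarrow> f \<tau> \<le> ennreal B" "t > 0"
  shows "(\<integral>\<^sup>+\<tau>. indicator {0<..<t} \<tau> * f \<tau> \<partial>lborel) \<le> ennreal (B * t)"
proof (cases "B \<ge> 0")
  case True
  have "(\<integral>\<^sup>+\<tau>. indicator {0<..<t} \<tau> * f \<tau> \<partial>lborel) \<le> (\<integral>\<^sup>+\<tau>. ennreal B * indicator {0<..<t} \<tau> \<partial>lborel)"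
    using assms by (intro nn_integral_mono) (auto simp: indicator_def)
  also have "\<dots> = ennreal B * ennreal t" using assms by (simp add: nn_integral_cmult_indicator)
  also have "\<dots> = ennreal (B * t)" using assms True by (simp add: ennreal_mult)
  finally show ?thesis .
next
  case False
  then have "ennreal B = 0" by (simp add: ennreal_neg)
  then have "(\<integral>\<^sup>+\<tau>. indicator {0<..<t} \<tau> * f \<tau> \<partial>lborel) = (\<integral>\<^sup>+\<tau>. 0 \<partial>(lborel :: real measure))"
    using assms by (intro nn_integral_cong) (auto simp: indicator_def)
  then show ?thesis by simp
qed

text \<open>The weak identity becomes a pairing of the coefficients of \<open>\<phi>\<close> with
  the residuals. It serves both directions: vanishing residuals give a solution, and testing a
  solution makes the residuals vanish.\<close>

lemma weak_modes:
  assumes t: "t > 0" and ft: "f \<in> L2_space" and f0: "f0 \<in> L2_space"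
    and p [measurable]: "\<And>k. (\<lambda>\<tau>. p \<tau> k) \<in> borel_measurable borel"
    and ae1: "AE \<tau> in lebesgue_on {0<..<t}. \<Theta> \<tau> \<in> L2_space \<and> fourier_coeff (\<Theta> \<tau>) = p \<tau>"
    and pAN: "\<And>\<tau>. \<tau> \<in> {0<..<t} \<Longrightarrow> AN (p \<tau>) \<le> ennreal B" and B: "B \<ge> 0"
    and sg [measurable]: "\<And>k. (\<lambda>\<tau>. sg \<tau> k) \<in> borel_measurable borel"
    and ae2: "AE \<tau> in lebesgue_on {0<..<t}. S \<tau> \<in> L2_space \<and> fourier_coeff (S \<tau>) = sg \<tau>"
    and sgb: "\<And>k. (\<integral>\<^sup>+\<tau>. indicator {0<..<t} \<tau> * ecmod (sg \<tau> k) \<partial>lborel) \<le> ennreal B'"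
    and \<phi>: "\<phi> \<in> test_functions"
  shows "complex_of_real ((LINT x|torus. (f x - f0 x) * \<phi> x)
        + \<kappa> * (LINT \<tau>|lebesgue_on {0<..<t}. LINT x|torus. \<Theta> \<tau> x * frac_laplacian (1/2) \<phi> x)
        - (LINT \<tau>|lebesgue_on {0<..<t}. LINT x|torus.
             \<Theta> \<tau> x * (mg_velocity \<Omega> \<beta> \<eta> (\<Theta> \<tau>) x \<bullet> grad \<phi> x))
        - (LINT \<tau>|lebesgue_on {0<..<t}. LINT x|torus. S \<tau> x * \<phi> x))
     = of_real vol * (LINT k|K. fourier_coeff \<phi> (- k) * defect f f0 p sg t k)"
proof -
  let ?L = "lebesgue_on {0<..<t}"
  define c where "c k = fourier_coeff \<phi> (- k)" for k
  have cab: "absum c" unfolding c_def[abs_def] by (rule absum_reflect[OF test_functions_absum[OF \<phi>]])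
  have i1: "integrable torus \<phi>" by (rule test_functions_integrable[OF \<phi>])
  let ?T1 = "LINT x|torus. (f x - f0 x) * \<phi> x"
  let ?T2 = "LINT \<tau>|?L. LINT x|torus. \<Theta> \<tau> x * frac_laplacian (1/2) \<phi> x"
  let ?T3 = "LINT \<tau>|?L. LINT x|torus. \<Theta> \<tau> x * (mg_velocity \<Omega> \<beta> \<eta> (\<Theta> \<tau>) x \<bullet> grad \<phi> x)"
  let ?T4 = "LINT \<tau>|?L. LINT x|torus. S \<tau> x * \<phi> x"
  define D where "D k = fourier_coeff f k - fourier_coeff f0 k" for k
  define P where "P k = (LINT \<tau>:{0<..<t}|lborel. of_real (kn k) * p \<tau> k)" for k
  define N where "N k = (LINT \<tau>:{0<..<t}|lborel. Bl (p \<tau>) (p \<tau>) k)" for k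
  define G where "G k = (LINT \<tau>:{0<..<t}|lborel. sg \<tau> k)" for k
  have a1: "complex_of_real ?T1 = of_real vol * (LINT k|K. c k * D k)"
    using pairing[OF L2_integrable[OF L2_space_diff[OF ft f0]] i1 test_functions_absum[OF \<phi>]]
      fourier_coeff_diff[OF L2_integrable[OF ft] L2_integrable[OF f0]]
    by (simp add: c_def D_def)
  have b1: "integrable K (\<lambda>k. c k * D k)"
  proof (rule integrable_absum_mult[OF cab])
    fix k
    show "cmod (D k) \<le> (LINT x|torus. \<bar>f x\<bar>) / vol + (LINT x|torus. \<bar>f0 x\<bar>) / vol"
      unfolding D_def by (rule order_trans[OF norm_triangle_ineq4 add_mono[OF cmod_fourier_coeff_le cmod_fourier_coeff_le]])
  qed
  have aw: "ecmod (of_real (kn k) * p \<tau> k) \<le> ennreal B" if "\<tau> \<in> {0<..<t}" for \<tau> k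
    using order_trans[OF aw_le_AN pAN[OF that]] by (simp add: aw_def norm_mult)
  have e2: "AE \<tau> in ?L. complex_of_real (LINT x|torus. \<Theta> \<tau> x * frac_laplacian (1/2) \<phi> x)
      = of_real vol * (LINT k|K. c k * (of_real (kn k) * p \<tau> k))"
    using ae1
  proof eventually_elim
    case (elim \<tau>)
    have "kn (- k) = kn k" for k by simp
    then show ?case
      using pairing[OF L2_integrable L2_integrable[OF frac_laplacian_test(1)[OF \<phi>]] frac_laplacian_test(3)[OF \<phi>], of "\<Theta> \<tau>"] elim
      by (simp add: frac_laplacian_test(2)[OF \<phi>] c_def mult_ac)
  qed
  have m2: "(\<lambda>\<tau>. complex_of_real (kn k) * p \<tau> k) \<in> borel_measurable borel" for k by measurable
  note t2 = time_pairing[OF cab m2 nn_integral_interval_le[OF aw t] e2, folded P_def]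
  have blb: "ecmod (Bl (p \<tau>) (p \<tau>) k) \<le> ennreal (3 / \<Omega> * (B * B))" if "\<tau> \<in> {0<..<t}" for \<tau> k
  proof -
    have "ecmod (Bl (p \<tau>) (p \<tau>) k) \<le> ennreal (3 / \<Omega>) * (AN (p \<tau>) * AN (p \<tau>))" by (rule Bl_le_AN)
    also have "\<dots> \<le> ennreal (3 / \<Omega>) * (ennreal B * ennreal B)" by (intro mult_left_mono mult_mono pAN that) auto
    also have "\<dots> = ennreal (3 / \<Omega> * (B * B))" using B par by (intro ennreal_mult3) auto
    finally show ?thesis .
  qed
  have e3: "AE \<tau> in ?L. complex_of_real (- (LINT x|torus. \<Theta> \<tau> x * (mg_velocity \<Omega> \<beta> \<eta> (\<Theta> \<tau>) x \<bullet> grad \<phi> x)))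
      = of_real vol * (LINT k|K. c k * Bl (p \<tau>) (p \<tau>) k)"
    using ae1 AE_space
  proof eventually_elim
    case (elim \<tau>)
    have "AN (p \<tau>) < \<infinity>" using le_less_trans[OF pAN] elim(2) by simp
    then have "AN (fourier_coeff (\<Theta> \<tau>)) < \<infinity>" using elim by simp
    from weak_nonlinear[OF par _ this \<phi>] elim show ?case by (simp add: c_def Bl_def)
  qed
  have m3: "(\<lambda>\<tau>. Bl (p \<tau>) (p \<tau>) k) \<in> borel_measurable borel" for k by measurable
  note t3 = time_pairing[OF cab m3 nn_integral_interval_le[OF blb t] e3, folded N_def]
  have e4: "AE \<tau> in ?L. complex_of_real (LINT x|torus. S \<tau> x * \<phi> x) = of_real vol * (LINT k|K. c k * sg \<tau> k)"
    using ae2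
  proof eventually_elim
    case (elim \<tau>)
    then show ?case
      using pairing[OF L2_integrable i1 test_functions_absum[OF \<phi>], of "S \<tau>"] by (simp add: c_def)
  qed
  note t4 = time_pairing[OF cab sg sgb e4, folded G_def]
  have "c k * defect f f0 p sg t k = c k * D k + of_real \<kappa> * (c k * P k) + c k * N k - c k * G k" for k
    by (simp add: defect_def D_def P_def N_def G_def algebra_simps)
  then have "(LINT k|K. c k * defect f f0 p sg t k)
     = (LINT k|K. c k * D k) + of_real \<kappa> * (LINT k|K. c k * P k) + (LINT k|K. c k * N k) - (LINT k|K. c k * G k)"
    using b1 t2(2) t3(2) t4(2) by simp
  moreover have "complex_of_real ?T3 = - (of_real vol * (LINT k|K. c k * N k))" using t3(1) by (simp add: minus_equation_iff)
  ultimately have "of_real vol * (LINT k|K. c k * defect f f0 p sg t k)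
     = complex_of_real ?T1 + of_real \<kappa> * complex_of_real ?T2 - complex_of_real ?T3 - complex_of_real ?T4"
    by (simp only: a1 t2(1) t4(1)) (simp add: ring_distribs)
  then show ?thesis by (simp add: c_def)
qed

end

section \<open>Borel modes of the data\<close>

lemma nn_integral_weighted_swap:
  fixes c :: "real \<Rightarrow> int^3 \<Rightarrow> complex"
  assumes [measurable]: "\<And>k. (\<lambda>t. c t k) \<in> borel_measurable borel" "A \<in> sets borel"
  shows "(\<integral>\<^sup>+k. ennreal (w k) * (\<integral>\<^sup>+\<tau>. indicator A \<tau> * (ecmod (c \<tau> k))\<^sup>2 \<partial>lborel) \<partial>K)
     = (\<integral>\<^sup>+\<tau>. indicator A \<tau> * (\<integral>\<^sup>+k. ennreal (w k) * (ecmod (c \<tau> k))\<^sup>2 \<partial>K) \<partial>lborel)"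
proof -
  have "(\<integral>\<^sup>+\<tau>. indicator A \<tau> * (\<integral>\<^sup>+k. ennreal (w k) * (ecmod (c \<tau> k))\<^sup>2 \<partial>K) \<partial>lborel)
     = (\<integral>\<^sup>+\<tau>. (\<integral>\<^sup>+k. ennreal (w k) * (indicator A \<tau> * (ecmod (c \<tau> k))\<^sup>2) \<partial>K) \<partial>lborel)"
    by (intro nn_integral_cong) (simp add: nn_integral_cmult[symmetric] mult.left_commute)
  also have "\<dots> = (\<integral>\<^sup>+k. \<integral>\<^sup>+\<tau>. ennreal (w k) * (indicator A \<tau> * (ecmod (c \<tau> k))\<^sup>2) \<partial>lborel \<partial>K)"
    by (rule nn_integral_K_swap[OF lborel.sigma_finite_measure_axioms]) measurable
  also have "\<dots> = (\<integral>\<^sup>+k. ennreal (w k) * (\<integral>\<^sup>+\<tau>. indicator A \<tau> * (ecmod (c \<tau> k))\<^sup>2 \<partial>lborel) \<partial>K)"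
    by (intro nn_integral_cong nn_integral_cmult) measurable
  finally show ?thesis by simp
qed

lemma HsN_measurable [measurable]:
  assumes [measurable]: "\<And>k. (\<lambda>t. c t k) \<in> borel_measurable M"
  shows "(\<lambda>t. HsN r (c t)) \<in> borel_measurable M"
  unfolding HsN_def by measurable

lemma fourier_coeff_zero_mean: "zero_mean f \<Longrightarrow> fourier_coeff f 0 = 0"
  by (simp add: zero_mean_def fourier_coeff_def)

lemma nn_integral_K_eq_0: "(\<integral>\<^sup>+k. f k \<partial>K) = 0 \<longleftrightarrow> (\<forall>k. f k = 0)"
proof
  assume "(\<integral>\<^sup>+k. f k \<partial>K) = 0"
  then show "\<forall>k. f k = 0" using nn_integral_K_member[of f] by (metis le_zero_eq)
next
  assume "\<forall>k. f k = 0"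
  then show "(\<integral>\<^sup>+k. f k \<partial>K) = 0" by simp
qed

text \<open>There are countably many modes, so a single null set of times serves for all of
  them.\<close>

lemma borel_modes:
  assumes f: "strongly_measurable r I f" and I: "I \<in> sets borel" and r: "r \<ge> 0"
  obtains c where "\<And>k. (\<lambda>t. c t k) \<in> borel_measurable borel"
    "AE t in lebesgue_on I. f t \<in> Sobolev r \<and> fourier_coeff (f t) = c t"
proof -
  have S: "I \<in> sets lebesgue" using I by (simp add: sets_completionI_sets)
  have "\<exists>g. g \<in> borel_measurable borel \<and> (AE t in lebesgue_on I. fourier_coeff (f t) k = g t)" for k
    using borel_version[OF fourier_coeff_strongly_measurable(1)[OF f S r] S] by metis
  then obtain g where g: "\<And>k. g k \<in> borel_measurable borel" "\<And>k. AE t in lebesgue_on I. fourier_coeff (f t) k = g k t"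
    by metis
  have "AE t in lebesgue_on I. \<forall>k\<in>UNIV. fourier_coeff (f t) k = g k t"
    using g(2) by (subst AE_ball_countable[OF countable_int3]) simp
  with fourier_coeff_strongly_measurable(2)[OF f S r]
  have "AE t in lebesgue_on I. f t \<in> Sobolev r \<and> fourier_coeff (f t) = (\<lambda>k. g k t)"
    by eventually_elim auto
  then show ?thesis using that[of "\<lambda>t k. g k t"] g(1) by blast
qed

text \<open>Setting the modes to zero at exceptional times makes vanishing mean, reality and the
  norm bound hold at every time. The bound \<open>e^2 / vol\<close> is the square of the essential
  supremum in the normalisation of \<open>SN\<close>, integrated over a window of length 1.\<close>

lemma (in mg_problem) source_modes:
  assumes S: "S \<in> L2_Sobolev (s - 1/2) {0<..}" and zm: "AE t in lebesgue_on {0<..}. zero_mean (S t)"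
    and bd: "Linf_norm (s - 1/2) {0<..} S \<le> ereal e"
  obtains sg where "\<And>k. (\<lambda>t. sg t k) \<in> borel_measurable borel" "\<And>t. sg t 0 = 0" "\<And>t. herm (sg t)"
    "AE t in lebesgue_on {0<..}. S t \<in> L2_space \<and> fourier_coeff (S t) = sg t"
    "(\<integral>\<^sup>+k. ennreal (kn k powr (2 * s - 1)) * (\<integral>\<^sup>+\<tau>. indicator {0<..} \<tau> * (ecmod (sg \<tau> k))\<^sup>2 \<partial>lborel) \<partial>K) < \<infinity>"
    "\<And>j :: nat. (\<integral>\<^sup>+k. ennreal (kn k powr (2 * s - 1)) *
        (\<integral>\<^sup>+\<tau>. indicator {real j<..<real j + 1} \<tau> * (ecmod (sg \<tau> k))\<^sup>2 \<partial>lborel) \<partial>K) \<le> ennreal (e\<^sup>2 / vol)"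
proof -
  let ?L = "lebesgue_on {0 :: real<..}"
  define r where "r = s - 1/2"
  have r: "r \<ge> 0" "2 * s - 1 = 2 * r" using s52 by (simp_all add: r_def)
  have sm: "strongly_measurable r {0<..} S" and int: "integrable ?L (\<lambda>t. (Sobolev_norm r (S t))\<^sup>2)"
    using S by (auto simp: L2_Sobolev_def r_def)
  obtain c where c [measurable]: "\<And>k. (\<lambda>t. c t k) \<in> borel_measurable borel"
    and cS: "AE t in ?L. S t \<in> Sobolev r \<and> fourier_coeff (S t) = c t"
    by (rule borel_modes[OF sm borel_open[OF open_greaterThan] r(1)]) blast
  \<comment> \<open>Vanishing mean and reality are phrased as inequalities between measurable
    functions, the latter with one sum over all modes, so that the good times form a Borel
    set.\<close>
  define good where "good t \<longleftrightarrow> cmod (c t 0) \<le> 0 \<and> (\<integral>\<^sup>+k. ecmod (c t (- k) - cnj (c t k)) \<partial>K) \<le> 0 \<and> SN r (c t) \<le> ennreal (e\<^sup>2 / vol)" for t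
  define sg where "sg t k = (if good t then c t k else 0)" for t k
  have [measurable]: "cnj \<in> borel_measurable borel" by (intro borel_measurable_continuous_onI continuous_intros)
  have good_meas [measurable]: "Measurable.pred borel good"
    unfolding good_def[abs_def] by measurable
  have m [measurable]: "(\<lambda>t. sg t k) \<in> borel_measurable borel" for k unfolding sg_def by measurable
  have sg0: "sg t 0 = 0" for t by (simp add: sg_def good_def)
  have he: "herm (sg t)" for t
    by (auto simp: herm_def sg_def good_def nn_integral_K_eq_0)
  have SNle: "SN r (sg t) \<le> ennreal (e\<^sup>2 / vol)" for t
    by (cases "good t") (simp_all add: sg_def[abs_def] SN_def[of r "\<lambda>k. 0"], simp add: good_def)
  have "AE t in ?L. ereal (Sobolev_norm r (S t)) \<le> Linf_norm r {0<..} S"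
    unfolding Linf_norm_def by (rule esssup_AE)
  with zm cS have "AE t in ?L. S t \<in> Sobolev r \<and> fourier_coeff (S t) = sg t"
  proof eventually_elim
    case (elim t)
    have n: "Sobolev_norm r (S t) \<le> e" using order_trans[OF elim(3) bd[folded r_def]] by simp
    have "SN r (c t) = ennreal ((Sobolev_norm r (S t))\<^sup>2 / vol)" using SN_eq elim(2) by metis
    also have "\<dots> \<le> ennreal (e\<^sup>2 / vol)"
      by (intro ennreal_leI divide_right_mono power_mono n Sobolev_norm_nonneg) (simp add: less_imp_le)
    finally have "good t"
      using elim herm_fourier_coeff[of "S t"] fourier_coeff_zero_mean[of "S t"] by (simp add: good_def herm_def nn_integral_K_eq_0)
    then show ?case using elim by (simp add: sg_def fun_eq_iff)
  qed
  then have ae: "AE t in ?L. S t \<in> Sobolev r \<and> fourier_coeff (S t) = sg t" .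
  have Hle: "HsN r (sg t) \<le> SN r (sg t)" for t by (rule HsN_le_SN[OF r(1)])
  show ?thesis
  proof (rule that[OF m sg0 he])
    show "AE t in ?L. S t \<in> L2_space \<and> fourier_coeff (S t) = sg t"
      using ae by eventually_elim (auto simp: Sobolev_def)
    have "(\<integral>\<^sup>+\<tau>. indicator {0<..} \<tau> * HsN r (sg \<tau>) \<partial>lborel) \<le> (\<integral>\<^sup>+\<tau>. indicator {0<..} \<tau> * SN r (sg \<tau>) \<partial>lborel)"
      by (intro nn_integral_mono mult_left_mono Hle) simp
    also have "\<dots> = (\<integral>\<^sup>+\<tau>. SN r (sg \<tau>) \<partial>?L)" by (rule nn_integral_lebesgue_on[symmetric]) simp
    also have "\<dots> = (\<integral>\<^sup>+\<tau>. ennreal (norm ((Sobolev_norm r (S \<tau>))\<^sup>2)) * ennreal (1 / vol) \<partial>?L)"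
    proof (rule nn_integral_cong_AE)
      show "AE \<tau> in ?L. SN r (sg \<tau>) = ennreal (norm ((Sobolev_norm r (S \<tau>))\<^sup>2)) * ennreal (1 / vol)"
        using ae
      proof eventually_elim
        case (elim \<tau>)
        then have "SN r (sg \<tau>) = ennreal ((Sobolev_norm r (S \<tau>))\<^sup>2 / vol)" using SN_eq by metis
        also have "\<dots> = ennreal ((Sobolev_norm r (S \<tau>))\<^sup>2 * (1 / vol))" by simp
        also have "\<dots> = ennreal (norm ((Sobolev_norm r (S \<tau>))\<^sup>2)) * ennreal (1 / vol)"
          by (subst ennreal_mult) (auto simp: less_imp_le)
        finally show ?case .
      qed
    qed
    also have "\<dots> = (\<integral>\<^sup>+\<tau>. ennreal (norm ((Sobolev_norm r (S \<tau>))\<^sup>2)) \<partial>?L) * ennreal (1 / vol)"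
      by (rule nn_integral_multc[OF measurable_compose[OF borel_measurable_integrable[OF integrable_norm[OF int]] measurable_ennreal]])
    also have "\<dots> < \<infinity>" using int by (simp add: integrable_iff_bounded ennreal_mult_less_top)
    finally show "(\<integral>\<^sup>+k. ennreal (kn k powr (2 * s - 1)) * (\<integral>\<^sup>+\<tau>. indicator {0<..} \<tau> * (ecmod (sg \<tau> k))\<^sup>2 \<partial>lborel) \<partial>K) < \<infinity>"
      unfolding r(2) by (subst nn_integral_weighted_swap[OF m]) (simp_all add: HsN_def)
    fix j :: nat
    have "(\<integral>\<^sup>+\<tau>. indicator {real j<..<real j + 1} \<tau> * HsN r (sg \<tau>) \<partial>lborel)
        \<le> (\<integral>\<^sup>+\<tau>. ennreal (e\<^sup>2 / vol) * indicator {real j<..<real j + 1} \<tau> \<partial>lborel)"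
      using order_trans[OF Hle SNle] by (intro nn_integral_mono) (auto simp: indicator_def)
    also have "\<dots> = ennreal (e\<^sup>2 / vol)" by (simp add: nn_integral_cmult_indicator)
    finally show "(\<integral>\<^sup>+k. ennreal (kn k powr (2 * s - 1)) *
        (\<integral>\<^sup>+\<tau>. indicator {real j<..<real j + 1} \<tau> * (ecmod (sg \<tau> k))\<^sup>2 \<partial>lborel) \<partial>K) \<le> ennreal (e\<^sup>2 / vol)"
      unfolding r(2) by (subst nn_integral_weighted_swap[OF m]) (simp_all add: HsN_def)
  qed
qed

section \<open>Global well-posedness\<close>

locale mg_small = mg_problem \<Omega> \<beta> \<eta> \<kappa> s + mg_data \<kappa> s "3 / \<Omega>" "msym \<Omega> \<beta> \<eta>" y0 sg d a0 dl
  for \<Omega> \<beta> \<eta> \<kappa> s y0 sg d a0 dl +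
  fixes \<Theta>\<^sub>0 :: "real^3 \<Rightarrow> real" and S :: "real \<Rightarrow> real^3 \<Rightarrow> real"
  assumes Theta0: "\<Theta>\<^sub>0 \<in> L2_space" "y0 = fourier_coeff \<Theta>\<^sub>0"
    and sg_herm: "\<And>t. herm (sg t)"
    and S_modes: "AE t in lebesgue_on {0<..}. S t \<in> L2_space \<and> fourier_coeff (S t) = sg t"
    and small4: "10 * (3 / \<Omega>)\<^sup>2 * dl\<^sup>2 < \<kappa>\<^sup>2"
begin

definition sol :: "real \<Rightarrow> real^3 \<Rightarrow> real" where "sol t = fser (th t)"

lemma th_zero_mode: "t \<ge> 0 \<Longrightarrow> th t 0 = 0"
  using th_fixed Phi_0 by simp

lemma th_absum: "t \<ge> 0 \<Longrightarrow> absum (th t)"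
  by (rule absum_AN, rule le_less_trans[OF ok_AN[OF th_ok]]) auto

lemma th_herm': "t \<ge> 0 \<Longrightarrow> herm (th t)"
  by (rule th_herm) (auto simp: Theta0(2) herm_fourier_coeff sg_herm)

lemma sol_modes: "t \<ge> 0 \<Longrightarrow> fourier_coeff (sol t) = th t"
  unfolding sol_def using fourier_coeff_fser[OF th_absum th_herm'] by auto

lemma sol_L2_space: "t \<ge> 0 \<Longrightarrow> sol t \<in> L2_space"
  unfolding sol_def by (rule fser_L2[OF th_absum])

lemma th_continuous: "continuous_on {0..T} (\<lambda>t. th t k)"
proof -
  have "continuous_on {0..T} (duhamel (\<kappa> * kn k) (y0 k) (src th k))"
    by (rule continuous_duhamel[OF src_set_integrable(1)[OF th_ok]]) (use kap in simp)
  then show ?thesis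
    by (rule continuous_on_cong[THEN iffD1, rotated -1]) (use th_fixed in \<open>auto simp: Phi_def\<close>)
qed

lemma th_set_integrable: "set_integrable lborel {0<..<T} (\<lambda>t. th t k)"
  by (rule set_integrable_subset[OF borel_integrable_atLeastAtMost'[OF th_continuous[of T k]]]) auto

lemma sg_L1:
  assumes t: "t > 0"
  obtains B where "\<And>k. (\<integral>\<^sup>+\<tau>. indicator {0<..<t} \<tau> * ecmod (sg \<tau> k) \<partial>lborel) \<le> ennreal B"
proof -
  define X where "X = (\<integral>\<^sup>+k. ennreal (kn k powr (2 * s - 1)) * (\<integral>\<^sup>+\<tau>. indicator {0<..} \<tau> * (ecmod (sg \<tau> k))\<^sup>2 \<partial>lborel) \<partial>K)"
  obtain x where x: "X = ennreal x" "x \<ge> 0" using sg_tot by (cases X) (auto simp: X_def)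
  have "(\<integral>\<^sup>+\<tau>. indicator {0<..<t} \<tau> * ecmod (sg \<tau> k) \<partial>lborel) \<le> ennreal (t + x)" for k
  proof -
    have a: "(\<integral>\<^sup>+\<tau>. indicator {0<..} \<tau> * (ecmod (sg \<tau> k))\<^sup>2 \<partial>lborel) \<le> X"
    proof (cases "k = 0")
      case False
      have "1 \<le> kn k powr (2 * s - 1)" using kn_ge_1[OF False] s52 by (intro ge_one_powr_ge_zero) auto
      then have "(\<integral>\<^sup>+\<tau>. indicator {0<..} \<tau> * (ecmod (sg \<tau> k))\<^sup>2 \<partial>lborel)
        \<le> ennreal (kn k powr (2 * s - 1)) * (\<integral>\<^sup>+\<tau>. indicator {0<..} \<tau> * (ecmod (sg \<tau> k))\<^sup>2 \<partial>lborel)"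
        using mult_right_mono[of 1 "ennreal (kn k powr (2 * s - 1))"] by simp
      also have "\<dots> \<le> X" unfolding X_def by (rule nn_integral_K_member)
      finally show ?thesis .
    qed (simp add: sg_0)
    have "indicator {0<..<t} \<tau> * ecmod (sg \<tau> k) \<le> indicator {0<..<t} \<tau> + indicator {0<..} \<tau> * (ecmod (sg \<tau> k))\<^sup>2" for \<tau>
    proof -
      have "0 \<le> (2 * cmod (sg \<tau> k) - 1)\<^sup>2" by simp
      then have "cmod (sg \<tau> k) \<le> 1 + (cmod (sg \<tau> k))\<^sup>2" by (simp add: power2_diff algebra_simps)
      then have "ecmod (sg \<tau> k) \<le> ennreal (1 + (cmod (sg \<tau> k))\<^sup>2)" by (rule ennreal_leI)
      also have "\<dots> = 1 + (ecmod (sg \<tau> k))\<^sup>2" by (simp add: ennreal_power)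
      finally show ?thesis by (auto simp: indicator_def)
    qed
    then have "(\<integral>\<^sup>+\<tau>. indicator {0<..<t} \<tau> * ecmod (sg \<tau> k) \<partial>lborel)
       \<le> (\<integral>\<^sup>+\<tau>. indicator {0<..<t} \<tau> + indicator {0<..} \<tau> * (ecmod (sg \<tau> k))\<^sup>2 \<partial>lborel)"
      by (rule nn_integral_mono)
    also have "\<dots> = (\<integral>\<^sup>+\<tau>. indicator {0<..<t} \<tau> \<partial>lborel) + (\<integral>\<^sup>+\<tau>. indicator {0<..} \<tau> * (ecmod (sg \<tau> k))\<^sup>2 \<partial>lborel)"
      by (rule nn_integral_add) measurable
    also have "\<dots> \<le> ennreal t + ennreal x" using a x t by (intro add_mono) auto
    also have "\<dots> = ennreal (t + x)" using t x(2) by (subst ennreal_plus) auto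
    finally show ?thesis .
  qed
  then show ?thesis by (rule that)
qed

lemma S_modes_on: "AE t in lebesgue_on {0<..<T}. S t \<in> L2_space \<and> fourier_coeff (S t) = sg t"
proof -
  have "AE t in lborel. t \<in> {0<..} \<longrightarrow> S t \<in> L2_space \<and> fourier_coeff (S t) = sg t"
    using S_modes by (subst (asm) AE_lebesgue_on) auto
  then have "AE t in lborel. t \<in> {0<..<T} \<longrightarrow> S t \<in> L2_space \<and> fourier_coeff (S t) = sg t"
    by eventually_elim auto
  then show ?thesis by (subst AE_lebesgue_on) auto
qed

text \<open>The fixed point equation, brought into integrated form by
  \<open>duhamel_ode\<close>.\<close>

lemma sol_defect:
  assumes t: "t > 0"
  shows "defect (sol t) \<Theta>\<^sub>0 th sg t k = 0"
proof -
  let ?mu = "\<kappa> * kn k"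
  have B: "set_integrable lborel {0<..<t} (\<lambda>\<tau>. Bl (th \<tau>) (th \<tau>) k)" by (rule src_set_integrable(2)[OF th_ok])
  have G: "set_integrable lborel {0<..<t} (\<lambda>\<tau>. sg \<tau> k)" by (rule sg_set_integrable)
  have P: "set_integrable lborel {0<..<t} (\<lambda>\<tau>. complex_of_real (kn k) * th \<tau> k)"
    using th_set_integrable[of t k] by (rule set_integrable_mult_right)
  have "th t k = y0 k + (LINT \<tau>:{0<..<t}|lborel. src th k \<tau> - ?mu *\<^sub>R duhamel ?mu (y0 k) (src th k) \<tau>)"
    using th_fixed[of t k] duhamel_ode[OF src_set_integrable(3)[OF th_ok] src_set_integrable(1)[OF th_ok], of ?mu t "y0 k"] t kap
    by (simp add: Phi_def)
  also have "(LINT \<tau>:{0<..<t}|lborel. src th k \<tau> - ?mu *\<^sub>R duhamel ?mu (y0 k) (src th k) \<tau>)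
     = (LINT \<tau>:{0<..<t}|lborel. sg \<tau> k - Bl (th \<tau>) (th \<tau>) k - of_real \<kappa> * (of_real (kn k) * th \<tau> k))"
  proof (rule set_lebesgue_integral_cong)
    show "\<forall>\<tau>. \<tau> \<in> {0<..<t} \<longrightarrow> src th k \<tau> - ?mu *\<^sub>R duhamel ?mu (y0 k) (src th k) \<tau>
       = sg \<tau> k - Bl (th \<tau>) (th \<tau>) k - of_real \<kappa> * (of_real (kn k) * th \<tau> k)"
      using th_fixed[of _ k] by (simp add: Phi_def src_def scaleR_conv_of_real mult.assoc)
  qed simp
  also have "\<dots> = (LINT \<tau>:{0<..<t}|lborel. sg \<tau> k) - (LINT \<tau>:{0<..<t}|lborel. Bl (th \<tau>) (th \<tau>) k)
     - of_real \<kappa> * (LINT \<tau>:{0<..<t}|lborel. of_real (kn k) * th \<tau> k)"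
    using B G P by (simp add: set_integral_diff set_integral_mult_right)
  finally show ?thesis
    using sol_modes[of t] t by (simp add: defect_def Theta0(2))
qed

lemma sol_Linf:
  assumes T: "T > 0"
  shows "sol \<in> Linf_Sobolev s {0<..<T}"
proof -
  obtain M where M: "\<And>t. t \<ge> 0 \<Longrightarrow> HsN s (th t) \<le> M" "M < \<infinity>"
    using th_Hs unfolding HsN_def by blast
  obtain x where x: "M = ennreal x" "x \<ge> 0" using M(2) by (cases M) auto
  have "SN s (th t) \<le> ennreal (2 powr s * x)" if "t \<ge> 0" for t
  proof -
    have "SN s (th t) \<le> ennreal (2 powr s) * HsN s (th t)"
      using s52 by (intro SN_le_HsN th_zero_mode that) auto
    also have "\<dots> \<le> ennreal (2 powr s) * ennreal x" using M(1)[OF that] x by (intro mult_left_mono) auto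
    also have "\<dots> = ennreal (2 powr s * x)" using x by (simp add: ennreal_mult)
    finally show ?thesis .
  qed
  then show ?thesis
    unfolding sol_def[abs_def]
    by (intro Linf_Sobolev_fser[OF T th_continuous th_measurable th_absum th_herm']) auto
qed

lemma sol_L2:
  assumes T: "T > 0"
  shows "sol \<in> L2_Sobolev (s + 1/2) {0<..<T}"
proof -
  have "(\<integral>\<^sup>+t. indicator {0<..<T} t * SN (s + 1/2) (th t) \<partial>lborel)
      \<le> (\<integral>\<^sup>+t. ennreal (2 powr (s + 1/2)) * (indicator {0<..} t * HsN (s + 1/2) (th t)) \<partial>lborel)"
  proof (rule nn_integral_mono)
    fix t
    show "indicator {0<..<T} t * SN (s + 1/2) (th t) \<le> ennreal (2 powr (s + 1/2)) * (indicator {0<..} t * HsN (s + 1/2) (th t))"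
      using SN_le_HsN[of "s + 1/2" "th t"] th_zero_mode[of t] s52 by (auto simp: indicator_def)
  qed
  also have "\<dots> = ennreal (2 powr (s + 1/2)) * (\<integral>\<^sup>+t. indicator {0<..} t * HsN (s + 1/2) (th t) \<partial>lborel)"
    by (rule nn_integral_cmult) measurable
  also have "(\<integral>\<^sup>+t. indicator {0<..} t * HsN (s + 1/2) (th t) \<partial>lborel) = Y1 s th"
  proof -
    have "2 * (s + 1/2) = 2 * s + 1" by simp
    then show ?thesis unfolding Y1_def HsN_def by (subst nn_integral_weighted_swap[OF th_measurable]) simp_all
  qed
  also have "ennreal (2 powr (s + 1/2)) * Y1 s th < \<infinity>" using Y1_th by (simp add: ennreal_mult_less_top)
  finally have fin: "(\<integral>\<^sup>+t. indicator {0<..<T} t * SN (s + 1/2) (th t) \<partial>lborel) < \<infinity>" .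
  show ?thesis
    unfolding sol_def[abs_def]
    by (rule L2_Sobolev_fser[OF T th_continuous th_measurable th_absum th_herm' fin]) auto
qed

theorem sol_solution:
  assumes T: "T > 0"
  shows "mg_solution \<Omega> \<beta> \<eta> \<kappa> (1/2) s S \<Theta>\<^sub>0 T sol"
  unfolding mg_solution_def
proof (intro conjI ballI)
  show "sol \<in> Linf_Sobolev s {0<..<T}" by (rule sol_Linf[OF T])
  show "sol \<in> L2_Sobolev (s + 1/2) {0<..<T}" by (rule sol_L2[OF T])
  show "sol t \<in> L2_space" if "t \<in> {0<..<T}" for t using that by (intro sol_L2_space) auto
  show "AE t in lebesgue_on {0<..<T}. div_free (mg_velocity \<Omega> \<beta> \<eta> (sol t))"
  proof (rule AE_I2)
    fix t assume "t \<in> space (lebesgue_on {0<..<T})"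
    then have t: "t \<ge> 0" by simp
    have "AN (fourier_coeff (sol t)) < \<infinity>"
      unfolding sol_modes[OF t] by (rule le_less_trans[OF ok_AN[OF th_ok t]]) simp
    then show "div_free (mg_velocity \<Omega> \<beta> \<eta> (sol t))" by (rule velocity_div_free[OF par])
  qed
  fix \<phi> t assume \<phi>: "\<phi> \<in> test_functions" and "t \<in> {0<..<T}"
  then have t: "t > 0" by simp
  obtain B' where B': "\<And>k. (\<integral>\<^sup>+\<tau>. indicator {0<..<t} \<tau> * ecmod (sg \<tau> k) \<partial>lborel) \<le> ennreal B'"
    using sg_L1[OF t] by blast
  have ae1: "AE \<tau> in lebesgue_on {0<..<t}. sol \<tau> \<in> L2_space \<and> fourier_coeff (sol \<tau>) = th \<tau>"
    using sol_L2_space sol_modes by (intro AE_I2) auto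
  have AN: "AN (th \<tau>) \<le> ennreal dl" if "\<tau> \<in> {0<..<t}" for \<tau> using that by (intro ok_AN[OF th_ok]) auto
  show "(LINT x|torus. (sol t x - \<Theta>\<^sub>0 x) * \<phi> x)
        + \<kappa> * (LINT \<tau>|lebesgue_on {0<..<t}. LINT x|torus. sol \<tau> x * frac_laplacian (1/2) \<phi> x)
        - (LINT \<tau>|lebesgue_on {0<..<t}. LINT x|torus. sol \<tau> x * (mg_velocity \<Omega> \<beta> \<eta> (sol \<tau>) x \<bullet> grad \<phi> x))
        = (LINT \<tau>|lebesgue_on {0<..<t}. LINT x|torus. S \<tau> x * \<phi> x)" (is "?l = ?r")
  proof -
    have "complex_of_real (?l - ?r) = of_real vol * (LINT k|K. fourier_coeff \<phi> (- k) * defect (sol t) \<Theta>\<^sub>0 th sg t k)"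
      by (rule weak_modes[OF t sol_L2_space Theta0(1) th_measurable ae1 AN _ sg_meas S_modes_on B' \<phi>])
        (use t dl in auto)
    also have "\<dots> = 0" by (simp add: sol_defect[OF t])
    finally show ?thesis by (simp only: of_real_eq_0_iff right_minus_eq)
  qed
qed

end

text \<open>Two summands instead of a case distinction: for \<open>k = 0\<close> both apply and add
  up to \<open>a\<close>.\<close>

lemma fourier_coeff_trig:
  "fourier_coeff (trig k a b) l
     = (if l = k then Complex a (- b) / 2 else 0) + (if l = - k then Complex a b / 2 else 0)"
proof -
  have e: "complex_of_real (trig k a b x) * ek (- l) x = Complex a (- b) / 2 * ek (k - l) x + Complex a b / 2 * ek (- k - l) x" for x
  proof -
    have "complex_of_real (trig k a b x) = Complex a (- b) / 2 * ek k x + Complex a b / 2 * ek (- k) x"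
      by (simp add: trig_def ek_def complex_eq_iff wavevec_minus diff_divide_distrib)
    then show ?thesis using ek_add[of k "- l" x] ek_add[of "- k" "- l" x] by (simp add: algebra_simps)
  qed
  have "(LINT x|torus. complex_of_real (trig k a b x) * ek (- l) x)
     = Complex a (- b) / 2 * (LINT x|torus. ek (k - l) x) + Complex a b / 2 * (LINT x|torus. ek (- k - l) x)"
    unfolding e by (simp add: integrable_torus_continuous[OF continuous_ek])
  moreover have "- k - l = 0 \<longleftrightarrow> l = - k" by (metis eq_iff_diff_eq_0 minus_diff_commute)
  ultimately show ?thesis
    unfolding fourier_coeff_ek by (auto simp: integral_ek vol_def add_divide_distrib)
qed

lemma trig_pairing:
  "(LINT l|K. fourier_coeff (trig k a b) (- l) * E l) = Complex a (- b) / 2 * E (- k) + Complex a b / 2 * E k"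
proof -
  let ?f = "\<lambda>l. (if l = - k then Complex a (- b) / 2 else 0) * E l"
  let ?g = "\<lambda>l. (if l = k then Complex a b / 2 else 0) * E l"
  have i: "integrable K ?f" "integrable K ?g"
    unfolding integrable_K_iff
    by (subst nn_integral_K_point[where k = "- k"]; simp) (subst nn_integral_K_point[where k = k]; simp)
  have "(LINT l|K. fourier_coeff (trig k a b) (- l) * E l) = (LINT l|K. ?f l + ?g l)"
  proof (rule Bochner_Integration.integral_cong)
    fix l
    have "- l = k \<longleftrightarrow> l = - k" by auto
    then show "fourier_coeff (trig k a b) (- l) * E l = ?f l + ?g l"
      by (simp only: fourier_coeff_trig neg_equal_iff_equal distrib_right)
  qed simp
  also have "\<dots> = (LINT l|K. ?f l) + (LINT l|K. ?g l)" by (rule Bochner_Integration.integral_add[OF i])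
  also have "(LINT l|K. ?f l) = ?f (- k)" by (rule integral_K_point) simp
  also have "(LINT l|K. ?g l) = ?g k" by (rule integral_K_point) simp
  finally show ?thesis by simp
qed

text \<open>Supplies times arbitrarily close to a given one at which an almost everywhere identity
  holds.\<close>

lemma AE_lborel_interval:
  assumes "AE t in lborel. P t" "a < b"
  shows "\<exists>t\<in>{a<..<b}. P (t :: real)"
proof (rule ccontr)
  assume "\<not> ?thesis"
  then have "AE t in lborel. t \<notin> {a<..<b}" using assms(1) by (auto elim: eventually_mono)
  then have "{a<..<b} \<in> null_sets lborel" by (subst AE_iff_null_sets) auto
  then show False using assms(2) by (simp add: null_sets_def)
qed

lemma duhamel_rate_0: "duhamel 0 y g t = y + (LINT \<tau>:{0<..<t}|lborel. g \<tau>)"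
  by (simp add: duhamel_def)

lemma set_integral_cong_AE_on:
  fixes g h :: "real \<Rightarrow> complex"
  assumes "AE t in lborel. t \<in> {0<..<T} \<longrightarrow> g t = h t" "t \<le> T" "g \<in> borel_measurable borel" "h \<in> borel_measurable borel"
  shows "(LINT \<tau>:{0<..<t}|lborel. g \<tau>) = (LINT \<tau>:{0<..<t}|lborel. h \<tau>)"
proof -
  have "AE \<tau> in lborel. indicator {0<..<t} \<tau> *\<^sub>R g \<tau> = indicator {0<..<t} \<tau> *\<^sub>R h \<tau>"
    using assms(1) by eventually_elim (use assms(2) in \<open>auto simp: indicator_def\<close>)
  then show ?thesis unfolding set_lebesgue_integral_def
    using assms(3,4) by (intro integral_cong_AE) simp_all
qed

lemma HsN_closed:
  assumes lim: "\<And>k. (\<lambda>n. u n k) \<longlonglongrightarrow> v k" and le: "\<And>n :: nat. HsN r (u n) \<le> c"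
  shows "HsN r v \<le> c"
  unfolding HsN_def
proof (rule nn_integral_liminf_le)
  show "(\<integral>\<^sup>+k. ennreal (kn k powr (2 * r)) * (ecmod (u n k))\<^sup>2 \<partial>K) \<le> c" for n
    using le by (simp add: HsN_def)
  fix k
  have "(\<lambda>n. ennreal (kn k powr (2 * r) * (cmod (u n k))\<^sup>2)) \<longlonglongrightarrow> ennreal (kn k powr (2 * r) * (cmod (v k))\<^sup>2)"
    by (intro tendsto_ennrealI tendsto_intros lim)
  then have "(\<lambda>n. ennreal (kn k powr (2 * r)) * (ecmod (u n k))\<^sup>2) \<longlonglongrightarrow> ennreal (kn k powr (2 * r)) * (ecmod (v k))\<^sup>2"
    by (simp add: ennreal_weight)
  then show "ennreal (kn k powr (2 * r)) * (ecmod (v k))\<^sup>2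
      \<le> liminf (\<lambda>n. ennreal (kn k powr (2 * r)) * (ecmod (u n k))\<^sup>2)"
    using lim_imp_Liminf[OF sequentially_bot] by fastforce
qed simp

context mg_problem
begin

text \<open>As for the source, the modes are set to zero where the \<open>H^s\<close> bound fails,
  which concerns a null set inside the interval. \<open>M\<close> is the squared essential bound
  divided by \<open>vol\<close>, plus 1 for positivity.\<close>

lemma solution_modes:
  assumes "\<Theta> \<in> Linf_Sobolev s {0<..<T}"
  obtains p M where "\<And>k. (\<lambda>t. p t k) \<in> borel_measurable borel" "M > 0" "\<And>t. HsN s (p t) \<le> ennreal M"
    "AE t in lebesgue_on {0<..<T}. \<Theta> t \<in> L2_space \<and> fourier_coeff (\<Theta> t) = p t"
proof -
  have sm: "strongly_measurable s {0<..<T} \<Theta>" and "Linf_norm s {0<..<T} \<Theta> < \<infinity>"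
    using assms by (auto simp: Linf_Sobolev_def)
  then obtain x where x: "Linf_norm s {0<..<T} \<Theta> \<le> ereal x"
    by (cases "Linf_norm s {0<..<T} \<Theta>") auto
  define M where "M = x\<^sup>2 / vol + 1"
  have M: "M > 0" "x\<^sup>2 / vol \<le> M" by (auto simp: M_def intro!: add_nonneg_pos divide_nonneg_pos)
  have s0: "s \<ge> 0" using s52 by simp
  obtain c where c [measurable]: "\<And>k. (\<lambda>t. c t k) \<in> borel_measurable borel"
    and cT: "AE t in lebesgue_on {0<..<T}. \<Theta> t \<in> Sobolev s \<and> fourier_coeff (\<Theta> t) = c t"
    by (rule borel_modes[OF sm borel_open[OF open_greaterThanLessThan] s0]) blast
  define p where "p t k = (if HsN s (c t) \<le> ennreal M then c t k else 0)" for t k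
  have p [measurable]: "(\<lambda>t. p t k) \<in> borel_measurable borel" for k unfolding p_def by measurable
  have "HsN s (\<lambda>k. 0) = 0" by (simp add: HsN_def)
  then have pM: "HsN s (p t) \<le> ennreal M" for t
    by (cases "HsN s (c t) \<le> ennreal M") (simp_all add: p_def[abs_def])
  have "AE t in lebesgue_on {0<..<T}. ereal (Sobolev_norm s (\<Theta> t)) \<le> Linf_norm s {0<..<T} \<Theta>"
    unfolding Linf_norm_def by (rule esssup_AE)
  with cT have "AE t in lebesgue_on {0<..<T}. \<Theta> t \<in> L2_space \<and> fourier_coeff (\<Theta> t) = p t"
  proof eventually_elim
    case (elim t)
    have n: "Sobolev_norm s (\<Theta> t) \<le> x" using order_trans[OF elim(2) x] by simp
    have "HsN s (c t) \<le> SN s (c t)" by (rule HsN_le_SN[OF s0])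
    also have "\<dots> = ennreal ((Sobolev_norm s (\<Theta> t))\<^sup>2 / vol)" using SN_eq elim(1) by metis
    also have "\<dots> \<le> ennreal (x\<^sup>2 / vol)"
      by (intro ennreal_leI divide_right_mono power_mono n Sobolev_norm_nonneg) (simp add: less_imp_le)
    also have "\<dots> \<le> ennreal M" by (rule ennreal_leI[OF M(2)])
    finally show ?case using elim(1) by (auto simp: p_def Sobolev_def)
  qed
  then show ?thesis using that[OF p M(1) pM] by blast
qed

end

context mg_small
begin

text \<open>The bounds on the competitor hold almost everywhere in time. Its integrated equation
  provides modes \<open>y\<close> that are continuous in time and agree with it at every time of the
  interval; \<open>y\<close> obeys the Duhamel formula and the \<open>H^s\<close> bound throughout,
  as \<open>mg_pair\<close> demands.\<close>

theorem sol_unique: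
  assumes T: "T > 0" and \<Theta>: "mg_solution \<Omega> \<beta> \<eta> \<kappa> (1/2) s S \<Theta>\<^sub>0 T \<Theta>" and Th0: "HsN s y0 < \<infinity>"
    and t0: "t0 \<in> {0<..<T}"
  shows "AE x in torus. \<Theta> t0 x = sol t0 x"
proof -
  have Linf: "\<Theta> \<in> Linf_Sobolev s {0<..<T}" and TL2: "\<And>t. t \<in> {0<..<T} \<Longrightarrow> \<Theta> t \<in> L2_space"
    and weak: "\<And>\<phi> t. \<phi> \<in> test_functions \<Longrightarrow> t \<in> {0<..<T} \<Longrightarrow>
        (LINT x|torus. (\<Theta> t x - \<Theta>\<^sub>0 x) * \<phi> x)
        + \<kappa> * (LINT \<tau>|lebesgue_on {0<..<t}. LINT x|torus. \<Theta> \<tau> x * frac_laplacian (1/2) \<phi> x)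
        - (LINT \<tau>|lebesgue_on {0<..<t}. LINT x|torus. \<Theta> \<tau> x * (mg_velocity \<Omega> \<beta> \<eta> (\<Theta> \<tau>) x \<bullet> grad \<phi> x))
        = (LINT \<tau>|lebesgue_on {0<..<t}. LINT x|torus. S \<tau> x * \<phi> x)"
    using \<Theta> unfolding mg_solution_def by auto
  obtain p M where p [measurable]: "\<And>k. (\<lambda>t. p t k) \<in> borel_measurable borel" and M: "M > 0"
    and pM: "\<And>t. HsN s (p t) \<le> ennreal M"
    and ae: "AE t in lebesgue_on {0<..<T}. \<Theta> t \<in> L2_space \<and> fourier_coeff (\<Theta> t) = p t"
    using solution_modes[OF Linf] by blast
  have ae': "AE t in lborel. t \<in> {0<..<T} \<longrightarrow> \<Theta> t \<in> L2_space \<and> fourier_coeff (\<Theta> t) = p t"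
    using ae by (subst (asm) AE_lebesgue_on) auto
  define B where "B = 1 / 2 * (Cz + M)"
  have B: "B \<ge> 0" using Cz(2) M by (simp add: B_def)
  have HB: "AN v \<le> ennreal B" if "HsN s v \<le> ennreal M" for v
  proof -
    have "AN v \<le> ennreal (1 / 2) * (ennreal Cz + HsN s v)" by (rule AN_le_HsN)
    also have "\<dots> \<le> ennreal (1 / 2) * (ennreal Cz + ennreal M)" by (intro mult_left_mono add_left_mono that) simp
    also have "ennreal Cz + ennreal M = ennreal (Cz + M)" using Cz(2) M by (intro ennreal_plus[symmetric]) auto
    also have "ennreal (1 / 2) * \<dots> = ennreal B" unfolding B_def using Cz(2) M by (intro ennreal_mult[symmetric]) auto
    finally show ?thesis .
  qed
  have pAN: "AN (p t) \<le> ennreal B" for t by (rule HB[OF pM])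
  have defect0: "defect (\<Theta> t) \<Theta>\<^sub>0 p sg t k = 0" if t: "t \<in> {0<..<T}" for t k
  proof -
    have t0: "t > 0" using t by simp
    obtain B' where B': "\<And>k. (\<integral>\<^sup>+\<tau>. indicator {0<..<t} \<tau> * ecmod (sg \<tau> k) \<partial>lborel) \<le> ennreal B'"
      using sg_L1[OF t0] by blast
    have "AE \<tau> in lborel. \<tau> \<in> {0<..<t} \<longrightarrow> \<Theta> \<tau> \<in> L2_space \<and> fourier_coeff (\<Theta> \<tau>) = p \<tau>"
      using ae' by eventually_elim (use t in auto)
    then have ae1: "AE \<tau> in lebesgue_on {0<..<t}. \<Theta> \<tau> \<in> L2_space \<and> fourier_coeff (\<Theta> \<tau>) = p \<tau>"
      by (subst AE_lebesgue_on) auto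
    have z: "(LINT l|K. fourier_coeff (trig k a b) (- l) * defect (\<Theta> t) \<Theta>\<^sub>0 p sg t l) = 0" for a b
    proof -
      have tr: "trig k a b \<in> test_functions" by (rule trig_test_function)
      have "of_real vol * (LINT l|K. fourier_coeff (trig k a b) (- l) * defect (\<Theta> t) \<Theta>\<^sub>0 p sg t l) = complex_of_real 0"
        unfolding weak_modes[OF t0 TL2[OF t] Theta0(1) p ae1 pAN B sg_meas S_modes_on B' tr, symmetric]
        using weak[OF tr t] by simp
      then show ?thesis by simp
    qed
    \<comment> \<open>The cosine and the sine as test functions give the sum and the difference of
      the residuals at \<open>k\<close> and \<open>- k\<close>.\<close>
    have "Complex 1 0 / 2 * defect (\<Theta> t) \<Theta>\<^sub>0 p sg t (- k) + Complex 1 0 / 2 * defect (\<Theta> t) \<Theta>\<^sub>0 p sg t k = 0"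
      "Complex 0 (- 1) / 2 * defect (\<Theta> t) \<Theta>\<^sub>0 p sg t (- k) + Complex 0 1 / 2 * defect (\<Theta> t) \<Theta>\<^sub>0 p sg t k = 0"
      using z[of 1 0] z[of 0 1] by (simp_all only: trig_pairing minus_zero)
    then show ?thesis by (simp add: complex_eq_iff)
  qed
  \<comment> \<open>Dissipation is counted as part of the source here, which makes \<open>y\<close>
    a plain indefinite integral, a Duhamel formula with rate 0. \<open>duhamel_unique\<close> later
    restores the rate \<open>\<kappa> |k|\<close>.\<close>
  define h where "h k \<tau> = sg \<tau> k - Bl (p \<tau>) (p \<tau>) k - of_real \<kappa> * (of_real (kn k) * p \<tau> k)" for k \<tau>
  have h_meas [measurable]: "h k \<in> borel_measurable borel" for k unfolding h_def[abs_def] by measurable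
  have iB: "set_integrable lborel {0<..<t} (\<lambda>\<tau>. Bl (p \<tau>) (p \<tau>) k)" for t k
    by (rule Bl_set_integrable[OF p pAN])
  have iP: "set_integrable lborel {0<..<t} (\<lambda>\<tau>. complex_of_real (kn k) * p \<tau> k)" for t k
  \<comment> \<open>\<open>max t 1\<close> appears because \<open>nn_integral_interval_le\<close>
    asks for a positive length while \<open>t\<close> is arbitrary.\<close>
  proof (rule set_integrable_of_L2)
    have "(\<integral>\<^sup>+\<tau>. indicator {0<..<max t 1} \<tau> * (ecmod (complex_of_real (kn k) * p \<tau> k))\<^sup>2 \<partial>lborel) \<le> ennreal (B\<^sup>2 * max t 1)"
    proof (rule nn_integral_interval_le)
      fix \<tau>
      have "ecmod (complex_of_real (kn k) * p \<tau> k) \<le> ennreal B"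
        using order_trans[OF aw_le_AN pAN[of \<tau>]] by (simp add: aw_def norm_mult)
      then have "(ecmod (complex_of_real (kn k) * p \<tau> k))\<^sup>2 \<le> (ennreal B)\<^sup>2" by (rule power_mono) simp
      then show "(ecmod (complex_of_real (kn k) * p \<tau> k))\<^sup>2 \<le> ennreal (B\<^sup>2)" using B by (simp add: ennreal_power)
    qed simp
    then have "(\<integral>\<^sup>+\<tau>. indicator {0<..<max t 1} \<tau> * (ecmod (complex_of_real (kn k) * p \<tau> k))\<^sup>2 \<partial>lborel) < \<infinity>"
      by (rule le_less_trans) simp
    moreover have "(\<integral>\<^sup>+\<tau>. indicator {0<..<t} \<tau> * (ecmod (complex_of_real (kn k) * p \<tau> k))\<^sup>2 \<partial>lborel)
       \<le> (\<integral>\<^sup>+\<tau>. indicator {0<..<max t 1} \<tau> * (ecmod (complex_of_real (kn k) * p \<tau> k))\<^sup>2 \<partial>lborel)"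
      by (intro nn_integral_mono) (auto simp: indicator_def)
    ultimately show "(\<integral>\<^sup>+\<tau>. indicator {0<..<t} \<tau> * (ecmod (complex_of_real (kn k) * p \<tau> k))\<^sup>2 \<partial>lborel) < \<infinity>"
      by (rule le_less_trans[rotated])
  qed measurable
  have ih: "set_integrable lborel {0<..<t} (h k)" for t k
    unfolding h_def[abs_def] by (intro set_integral_diff(1) sg_set_integrable iB set_integrable_mult_right iP)
  define y where "y t k = duhamel 0 (y0 k) (h k) t" for t k
  have y_eq: "fourier_coeff (\<Theta> t) k = y t k" if t: "t \<in> {0<..<T}" for t k
  proof -
    have "(LINT \<tau>:{0<..<t}|lborel. h k \<tau>) = (LINT \<tau>:{0<..<t}|lborel. sg \<tau> k) - (LINT \<tau>:{0<..<t}|lborel. Bl (p \<tau>) (p \<tau>) k)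
       - of_real \<kappa> * (LINT \<tau>:{0<..<t}|lborel. of_real (kn k) * p \<tau> k)"
      unfolding h_def[abs_def] using iB[of t k] iP[of t k] sg_set_integrable[of t k]
      by (simp add: set_integral_diff set_integral_mult_right)
    then have "fourier_coeff (\<Theta> t) k - y t k = defect (\<Theta> t) \<Theta>\<^sub>0 p sg t k"
      by (simp only: defect_def y_def duhamel_rate_0 Theta0(2)) (simp only: algebra_simps)
    then show ?thesis using defect0[OF t, of k] by simp
  qed
  have y_cont: "continuous_on {0..T} (\<lambda>t. y t k)" for k
    unfolding y_def by (rule continuous_duhamel[OF ih]) simp
  have y_meas [measurable]: "(\<lambda>t. y t k) \<in> borel_measurable borel" for k unfolding y_def by measurable
  have ae_y: "AE t in lborel. t \<in> {0<..<T} \<longrightarrow> p t = y t"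
    using ae'
  proof eventually_elim
    case (elim t)
    show ?case
    proof
      assume t: "t \<in> {0<..<T}"
      then have "fourier_coeff (\<Theta> t) = p t" using elim by simp
      then show "p t = y t" using y_eq[OF t] by (simp add: fun_eq_iff)
    qed
  qed
  \<comment> \<open>The bound is known at almost every time. Such times converge to \<open>t\<close>
    from the right, and continuity of the modes with lower semicontinuity of the norm carries the
    bound to \<open>t\<close>.\<close>
  have yM: "HsN s (y t) \<le> ennreal M" if t: "t \<in> {0<..<T}" for t
  proof -
    have "\<exists>u\<in>{t<..<min T (t + 1 / real (Suc n))}. u \<in> {0<..<T} \<longrightarrow> p u = y u" for n
      by (rule AE_lborel_interval[OF ae_y]) (use t in auto)
    then obtain u where u: "\<And>n. t < u n" "\<And>n. u n < min T (t + 1 / real (Suc n))" "\<And>n. u n \<in> {0<..<T} \<longrightarrow> p (u n) = y (u n)"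
      by (metis greaterThanLessThan_iff)
    have uT: "u n \<in> {0<..<T}" for n using u(1,2)[of n] t by auto
    have "(\<lambda>n. t + 1 / real (Suc n)) \<longlonglongrightarrow> t + 0" by (intro tendsto_add tendsto_const LIMSEQ_Suc[OF lim_1_over_n])
    then have up: "(\<lambda>n. t + 1 / real (Suc n)) \<longlonglongrightarrow> t" by simp
    have ut: "u \<longlonglongrightarrow> t"
      by (rule tendsto_sandwich[OF _ _ tendsto_const up])
        (use u(1,2) in \<open>auto intro!: always_eventually less_imp_le\<close>)
    show ?thesis
    proof (rule HsN_closed)
      show "(\<lambda>n. y (u n) k) \<longlonglongrightarrow> y t k" for k
        by (rule continuous_on_tendsto_compose[OF y_cont ut]) (use t uT in \<open>auto intro!: always_eventually less_imp_le\<close>)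
      show "HsN s (y (u n)) \<le> ennreal M" for n using pM[of "u n"] u(3)[of n] uT[of n] by simp
    qed
  qed
  have yAN: "AN (y t) \<le> ennreal B" if "0 < t" "t < T" for t using HB[OF yM] that by simp
  have iBy: "set_integrable lborel {0<..<T} (\<lambda>\<tau>. Bl (y \<tau>) (y \<tau>) k)" for k
    by (rule Bl_set_integrable[OF y_meas yAN])
  have iy: "set_integrable lborel {0<..<T} (\<lambda>\<tau>. y \<tau> k)" for k
    by (rule set_integrable_subset[OF borel_integrable_atLeastAtMost'[OF y_cont[of k]]]) auto
  have y_duh: "y t k = duhamel (\<kappa> * kn k) (y0 k) (\<lambda>\<tau>. sg \<tau> k - Bl (y \<tau>) (y \<tau>) k) t" if t: "t \<in> {0<..<T}" for t k
  proof (rule duhamel_unique[OF _ _ _ iy _ t])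
    show "0 \<le> \<kappa> * kn k" using kap by simp
    show "(\<lambda>\<tau>. sg \<tau> k - Bl (y \<tau>) (y \<tau>) k) \<in> borel_measurable borel" by measurable
    show "set_integrable lborel {0<..<T} (\<lambda>\<tau>. sg \<tau> k - Bl (y \<tau>) (y \<tau>) k)"
      by (intro set_integral_diff(1) sg_set_integrable iBy)
    fix t assume t: "t \<in> {0<..<T}"
    have "AE \<tau> in lborel. \<tau> \<in> {0<..<T} \<longrightarrow> h k \<tau> = sg \<tau> k - Bl (y \<tau>) (y \<tau>) k - (\<kappa> * kn k) *\<^sub>R y \<tau> k"
      using ae_y by eventually_elim (simp add: h_def scaleR_conv_of_real mult.assoc)
    then have "(LINT \<tau>:{0<..<t}|lborel. h k \<tau>) = (LINT \<tau>:{0<..<t}|lborel. sg \<tau> k - Bl (y \<tau>) (y \<tau>) k - (\<kappa> * kn k) *\<^sub>R y \<tau> k)"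
      by (rule set_integral_cong_AE_on) (use t in auto)
    then show "y t k = y0 k + (LINT \<tau>:{0<..<t}|lborel. sg \<tau> k - Bl (y \<tau>) (y \<tau>) k - (\<kappa> * kn k) *\<^sub>R y \<tau> k)"
      by (simp add: y_def duhamel_rate_0)
  qed
  obtain M1 where M1: "\<And>t. t \<ge> 0 \<Longrightarrow> HsN s (th t) \<le> M1" "M1 < \<infinity>"
    using th_Hs unfolding HsN_def by blast
  obtain m1 where m1: "M1 = ennreal m1" "m1 \<ge> 0" using M1(2) by (cases M1) auto
  obtain m0 where m0: "HsN s y0 = ennreal m0" "m0 \<ge> 0" using Th0 by (cases "HsN s y0") auto
  define M' where "M' = M + m1 + m0"
  have M': "M \<le> M'" "m1 \<le> M'" "m0 \<le> M'" "M' > 0" using M m1 m0 by (auto simp: M'_def)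
  \<comment> \<open>By \<open>small3\<close> the datum takes up at most half of the radius, so it
    meets the smallness that \<open>mg_pair\<close> asks of the initial value.\<close>
  have a0dl: "a0 \<le> dl"
  proof -
    have "0 \<le> H * (d / 2 * Cz + d / (4 * \<kappa>))" using H_pos(1) Cz(2) d kap by simp
    then show ?thesis using small3 dl by simp
  qed
  interpret P: mg_pair \<kappa> s "3 / \<Omega>" "msym \<Omega> \<beta> \<eta>" T dl M' y0 sg th y
  proof unfold_locales
    show "th t k = duhamel (\<kappa> * kn k) (y0 k) (\<lambda>\<tau>. sg \<tau> k - Bl (th \<tau>) (th \<tau>) k) t" if "t \<in> {0<..<T}" for t k
      using th_fixed[of t k] that by (simp add: Phi_def src_def[abs_def])
    show "AN (th t) \<le> ennreal dl" if "t \<in> {0<..<T}" for t using that by (intro ok_AN[OF th_ok]) auto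
    show "AN y0 \<le> ennreal dl" by (rule order_trans[OF y0_AN ennreal_leI[OF a0dl]])
    show "HsN s (th t) \<le> ennreal M'" if "t \<in> {0<..<T}" for t
      using order_trans[OF M1(1)[of t, unfolded m1(1)] ennreal_leI[OF M'(2)]] that by simp
    show "HsN s (y t) \<le> ennreal M'" if "t \<in> {0<..<T}" for t
      by (rule order_trans[OF yM[OF that] ennreal_leI[OF M'(1)]])
    show "HsN s y0 \<le> ennreal M'" unfolding m0(1) by (rule ennreal_leI[OF M'(3)])
  qed (use T dl M' sg_set_integrable y_duh small4 in \<open>auto simp: power_divide\<close>)
  have eq: "fourier_coeff (\<Theta> t0) k = fourier_coeff (sol t0) k" for k
  proof (cases "k = 0")
    \<comment> \<open>The critical norm does not see the zero mode, so it is treated directly: datum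
      and source vanish there, hence so does the solution.\<close>
    case True
    have "h 0 = (\<lambda>\<tau>. 0)" by (simp add: h_def fun_eq_iff sg_0)
    then show ?thesis using True t0 y_eq[OF t0, of 0] th_zero_mode[of t0] sol_modes[of t0] by (simp add: y_def duhamel_rate_0 y0_0)
  next
    case False
    then show ?thesis using P.fourier_uniqueness[OF t0 False] t0 y_eq[OF t0, of k] sol_modes[of t0] by simp
  qed
  show ?thesis
    by (rule fourier_unique[OF L2_integrable[OF TL2[OF t0]] L2_integrable[OF sol_L2_space] eq]) (use t0 in simp)
qed

end

lemma eventually_at_right_0_less:
  fixes f :: "real \<Rightarrow> real"
  assumes "isCont f 0" "f 0 < c"
  shows "\<forall>\<^sub>F x in at_right 0. f x < c"
  using order_tendstoD(2)[OF isContD[OF assms(1)] assms(2)]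
  by (rule filter_leD[OF at_le, rotated]) simp

text \<open>Allows the smallness condition, a sum of extended reals, to be read as a bound on each
  summand. The essential supremum of the zero function is 0 because the half line has positive
  measure.\<close>

lemma Linf_norm_nonneg: "0 \<le> Linf_norm r {0<..} f"
proof -
  have "emeasure lborel {0 :: real<..<1} \<le> emeasure lborel {0 :: real<..}" by (rule emeasure_mono) auto
  then have pos: "emeasure lborel {0 :: real<..} \<noteq> 0" by auto
  have "(0 :: ereal) = esssup (lebesgue_on {0 :: real<..}) (\<lambda>t. 0)"
    by (rule esssup_const[symmetric]) (use pos in \<open>simp add: emeasure_restrict_space\<close>)
  also have "\<dots> \<le> Linf_norm r {0<..} f"
    unfolding Linf_norm_def by (rule esssup_mono) (simp_all add: Sobolev_norm_nonneg)
  finally show ?thesis .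
qed

text \<open>The radius \<open>dl\<close> is fixed first, by strict conditions on the parameters that
  hold at 0 and hence for small positive radii. Then \<open>e\<close> is chosen so small that datum
  and source take up less than half of this radius. Both choices precede the data.\<close>

theorem theorem5p3:
  fixes \<Omega> \<beta> \<eta> \<kappa> \<gamma> s \<alpha> :: real
  assumes "\<Omega> > 0" and "\<beta> > 0" and "\<eta> > 0" and "\<kappa> > 0"
    and "\<gamma> = 1 / 2" and "s > 5 / 2" and "\<alpha> = 1 - (5 / 2) / s"
  shows "\<exists>\<epsilon>>0. \<forall>(\<Theta>\<^sub>0 :: real^3 \<Rightarrow> real) (S :: real \<Rightarrow> real^3 \<Rightarrow> real).
     \<Theta>\<^sub>0 \<in> Sobolev s \<longrightarrow> zero_mean \<Theta>\<^sub>0 \<longrightarrow>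
     S \<in> L2_Sobolev (s - \<gamma>) {0<..} \<longrightarrow> (AE t in lebesgue_on {0<..}. zero_mean (S t)) \<longrightarrow>
     ereal (L2_norm \<Theta>\<^sub>0 powr \<alpha> * Sobolev_norm s \<Theta>\<^sub>0 powr (1 - \<alpha>))
       + Linf_norm (s - \<gamma>) {0<..} S \<le> ereal \<epsilon> \<longrightarrow>
     (\<exists>\<Theta>. \<forall>T>0. mg_solution \<Omega> \<beta> \<eta> \<kappa> \<gamma> s S \<Theta>\<^sub>0 T \<Theta> \<and>
        (\<forall>\<Theta>'. mg_solution \<Omega> \<beta> \<eta> \<kappa> \<gamma> s S \<Theta>\<^sub>0 T \<Theta>' \<longrightarrow>
           (\<forall>t\<in>{0<..<T}. AE x in torus. \<Theta>' t x = \<Theta> t x)))"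
proof -
  interpret G: mg_problem \<Omega> \<beta> \<eta> \<kappa> s using assms by unfold_locales auto
  have al: "1 - \<alpha> = (5/2) / s" using assms by simp
  obtain C1 where C1: "C1 > 0" "\<And>f. f \<in> Sobolev s \<Longrightarrow>
      AN (fourier_coeff f) \<le> ennreal (C1 * (L2_norm f powr \<alpha> * Sobolev_norm s f powr (1 - \<alpha>)))"
    using G.interpolation unfolding assms(7) by auto
  have "\<forall>\<^sub>F x in at_right 0. 4 * (G.H * (3 / \<Omega>) * x) / \<kappa> < 1"
    "\<forall>\<^sub>F x in at_right 0. 6 * G.CY * x\<^sup>2 / \<kappa>\<^sup>2 < 1"
    "\<forall>\<^sub>F x in at_right 0. 10 * (3 / \<Omega>)\<^sup>2 * x\<^sup>2 < \<kappa>\<^sup>2"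
    using assms(1,4) by (intro eventually_at_right_0_less; simp)+
  then have "\<forall>\<^sub>F x in at_right (0::real). 0 < x \<and> 4 * (G.H * (3 / \<Omega>) * x) / \<kappa> < 1
      \<and> 6 * G.CY * x\<^sup>2 / \<kappa>\<^sup>2 < 1 \<and> 10 * (3 / \<Omega>)\<^sup>2 * x\<^sup>2 < \<kappa>\<^sup>2"
    using eventually_at_right_less[of 0] by eventually_elim simp
  then obtain dl where dl: "dl > 0" "4 * (G.H * (3 / \<Omega>) * dl) / \<kappa> < 1"
      "6 * G.CY * dl\<^sup>2 / \<kappa>\<^sup>2 < 1" "10 * (3 / \<Omega>)\<^sup>2 * dl\<^sup>2 < \<kappa>\<^sup>2"
    using eventually_happens'[OF trivial_limit_at_right_real] by blast
  have "\<forall>\<^sub>F x in at_right 0. C1 * x + G.H * (x / sqrt vol / 2 * G.Cz + x / sqrt vol / (4 * \<kappa>)) < dl / 2"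
    using assms(4) dl(1) by (intro eventually_at_right_0_less) simp_all
  then have "\<forall>\<^sub>F x in at_right (0::real). 0 < x \<and> C1 * x + G.H * (x / sqrt vol / 2 * G.Cz + x / sqrt vol / (4 * \<kappa>)) < dl / 2"
    using eventually_at_right_less[of 0] by eventually_elim simp
  then obtain e where e: "e > 0" "C1 * e + G.H * (e / sqrt vol / 2 * G.Cz + e / sqrt vol / (4 * \<kappa>)) < dl / 2"
    using eventually_happens'[OF trivial_limit_at_right_real] by blast
  show ?thesis
  proof (intro exI[of _ e] conjI allI impI)
    show "e > 0" by (rule e(1))
    fix \<Theta>\<^sub>0 :: "real^3 \<Rightarrow> real" and S :: "real \<Rightarrow> real^3 \<Rightarrow> real"
    assume T0: "\<Theta>\<^sub>0 \<in> Sobolev s" "zero_mean \<Theta>\<^sub>0"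
      and S: "S \<in> L2_Sobolev (s - \<gamma>) {0<..}" "AE t in lebesgue_on {0<..}. zero_mean (S t)"
      and small: "ereal (L2_norm \<Theta>\<^sub>0 powr \<alpha> * Sobolev_norm s \<Theta>\<^sub>0 powr (1 - \<alpha>)) + Linf_norm (s - \<gamma>) {0<..} S \<le> ereal e"
    define A where "A = L2_norm \<Theta>\<^sub>0 powr \<alpha> * Sobolev_norm s \<Theta>\<^sub>0 powr (1 - \<alpha>)"
    have A0: "A \<ge> 0" by (simp add: A_def)
    have "ereal A + 0 \<le> ereal e"
      by (rule order_trans[OF add_left_mono[OF Linf_norm_nonneg] small[folded A_def]])
    then have Ae: "A \<le> e" by simp
    have "0 + Linf_norm (s - \<gamma>) {0<..} S \<le> ereal e"
      by (rule order_trans[OF add_right_mono small[folded A_def]]) (use A0 in simp)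
    then have Se: "Linf_norm (s - 1/2) {0<..} S \<le> ereal e" using assms(5) by simp
    obtain sg where sg: "\<And>k. (\<lambda>t. sg t k) \<in> borel_measurable borel" "\<And>t. sg t 0 = 0" "\<And>t. herm (sg t)"
      "AE t in lebesgue_on {0<..}. S t \<in> L2_space \<and> fourier_coeff (S t) = sg t"
      "(\<integral>\<^sup>+k. ennreal (kn k powr (2 * s - 1)) * (\<integral>\<^sup>+\<tau>. indicator {0<..} \<tau> * (ecmod (sg \<tau> k))\<^sup>2 \<partial>lborel) \<partial>K) < \<infinity>"
      "\<And>j :: nat. (\<integral>\<^sup>+k. ennreal (kn k powr (2 * s - 1)) *
        (\<integral>\<^sup>+\<tau>. indicator {real j<..<real j + 1} \<tau> * (ecmod (sg \<tau> k))\<^sup>2 \<partial>lborel) \<partial>K) \<le> ennreal (e\<^sup>2 / vol)"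
      using G.source_modes[OF S(1)[unfolded assms(5)] S(2) Se] by blast
    have Hs: "HsN s (fourier_coeff \<Theta>\<^sub>0) < \<infinity>"
      using HsN_le_SN[of s "fourier_coeff \<Theta>\<^sub>0"] T0(1) assms(6) by (auto simp: Sobolev_iff intro: le_less_trans)
    have AN0: "AN (fourier_coeff \<Theta>\<^sub>0) \<le> ennreal (C1 * e)"
      by (rule order_trans[OF C1(2)[OF T0(1), folded A_def] ennreal_leI]) (use Ae C1(1) in simp)
    \<comment> \<open>\<open>source_modes\<close> bounds the squared source on a window by
      \<open>e^2 / vol\<close>, hence the parameter \<open>d = e / sqrt vol\<close>; the datum
      contributes \<open>C1 * e\<close> by interpolation.\<close>
    have d2: "(e / sqrt vol)\<^sup>2 = e\<^sup>2 / vol" by (simp add: power_divide less_imp_le)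
    interpret Q: mg_small \<Omega> \<beta> \<eta> \<kappa> s "fourier_coeff \<Theta>\<^sub>0" sg "e / sqrt vol" "C1 * e" dl \<Theta>\<^sub>0 S
    proof unfold_locales
      show "(\<integral>\<^sup>+k. ennreal (kn k powr (2 * s)) * (ecmod (fourier_coeff \<Theta>\<^sub>0 k))\<^sup>2 \<partial>K) < \<infinity>"
        using Hs by (simp add: HsN_def)
      show "C1 * e + G.H * (e / sqrt vol / 2 * G.Cz + e / sqrt vol / (4 * \<kappa>)) \<le> dl / 2" using e(2) by simp
      show "4 * (G.H * (3 / \<Omega>) * dl) / \<kappa> \<le> 1" "6 * G.CY * dl\<^sup>2 / \<kappa>\<^sup>2 \<le> 1" using dl by simp_all
      show "\<Theta>\<^sub>0 \<in> L2_space" using T0(1) by (simp add: Sobolev_def)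
      show "(\<integral>\<^sup>+k. ennreal (kn k powr (2 * s - 1)) *
        (\<integral>\<^sup>+\<tau>. indicator {real j<..<real j + 1} \<tau> * (ecmod (sg \<tau> k))\<^sup>2 \<partial>lborel) \<partial>K) \<le> ennreal ((e / sqrt vol)\<^sup>2)" for j :: nat
        unfolding d2 by (rule sg(6))
    qed (fact sg AN0 dl(1,4) fourier_coeff_zero_mean[OF T0(2)] refl | use e(1) C1(1) in simp)+
    show "\<exists>\<Theta>. \<forall>T>0. mg_solution \<Omega> \<beta> \<eta> \<kappa> \<gamma> s S \<Theta>\<^sub>0 T \<Theta> \<and>
        (\<forall>\<Theta>'. mg_solution \<Omega> \<beta> \<eta> \<kappa> \<gamma> s S \<Theta>\<^sub>0 T \<Theta>' \<longrightarrow>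
           (\<forall>t\<in>{0<..<T}. AE x in torus. \<Theta>' t x = \<Theta> t x))"
      unfolding assms(5) using Q.sol_solution Q.sol_unique Hs by blast
  qed
qed

end
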